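(* Let $n\ge 3$. The Hilbert–Poincaré polynomial of $R/\mathcal I_{K_n}$ is \[ P_{R/\mathcal I_{K_n}}(t)=2(1-t)^n+\Big[-1+3t+\tfrac{n^2+n-6}{2}\,t^2+\tfrac{n^2-3n+2}{2}\,t^3\Big](1-t)^{2n-3}. \] In particular, $\operatorname{depth}(R/\mathcal I_{K_n})\ge 3$ and $\operatorname{reg}(R/\mathcal I_{K_n})\le 3$.
   Context: Let $\Bbbk$ be a field and $R=\Bbbk[x_1,\dots,x_n,y_1,\dots,y_n]$ the standard graded polynomial ring. The parity binomial edge ideal of the complete graph $K_n$ is $\mathcal I_{K_n}=(x_ix_j-y_iy_j\mid 1\le i<j\le n)$. For a finitely generated graded $R$-module $M$, the Hilbert–Poincaré polynomial $P_M(t)$ is the polynomial with $\sum_{i\ge0}\dim_\Bbbk M_i\,t^i=P_M(t)/(1-t)^{2n}$ (equivalently $P_M(t)=\sum_{i,j}(-1)^i\beta_{i,j}(M)t^j$ with $\beta_{i,j}$ the graded Betti numbers); $\operatorname{reg}$ denotes Castelnuovo–Mumford regularity. *)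

theory Defs
  imports Complex_Main "HOL-Library.Poly_Mapping" "HOL-Library.Extended_Real"
    "HOL-Library.Extended_Nat" "HOL-Computational_Algebra.Formal_Power_Series"
begin

text \<open>Polynomials over a field k in the variables indexed by nat:
  monomials are exponent vectors (nat =>0 nat), polynomials are finitely supported
  coefficient functions on monomials.  The ring R = k[x_1..x_n,y_1..y_n] is the set of
  polynomials involving only the variables 0..2n-1; x_i is variable i-1, y_i is variable n+i-1.\<close>

type_synonym 'k mpoly = "(nat \<Rightarrow>\<^sub>0 nat) \<Rightarrow>\<^sub>0 'k"

definition pvar :: "nat \<Rightarrow> 'k::comm_ring_1 mpoly" where
  "pvar i = Poly_Mapping.single (Poly_Mapping.single i 1) 1"

definition mdeg :: "(nat \<Rightarrow>\<^sub>0 nat) \<Rightarrow> nat" where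
  "mdeg m = (\<Sum>i\<in>Poly_Mapping.keys m. Poly_Mapping.lookup m i)"

definition polyring :: "nat \<Rightarrow> 'k::comm_ring_1 mpoly set" where
  "polyring N = {p. \<forall>m\<in>Poly_Mapping.keys p. Poly_Mapping.keys m \<subseteq> {..<N}}"

text \<open>Homogeneous polynomials of degree e (including 0); empty apart from 0 if e < 0.\<close>
definition homog :: "nat \<Rightarrow> int \<Rightarrow> 'k::comm_ring_1 mpoly set" where
  "homog N e = {p \<in> polyring N. \<forall>m\<in>Poly_Mapping.keys p. int (mdeg m) = e}"

definition ideal_gen :: "nat \<Rightarrow> 'k::comm_ring_1 mpoly set \<Rightarrow> 'k mpoly set" where
  "ideal_gen N G = {(\<Sum>g\<in>F. c g * g) | F c. finite F \<and> F \<subseteq> G \<and> (\<forall>g\<in>F. c g \<in> polyring N)}"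

definition maxideal :: "nat \<Rightarrow> 'k::comm_ring_1 mpoly set" where
  "maxideal N = {p \<in> polyring N. Poly_Mapping.lookup p 0 = 0}"

definition pscale :: "'k::field \<Rightarrow> 'k mpoly \<Rightarrow> 'k mpoly" where
  "pscale c p = Poly_Mapping.map (\<lambda>a. c * a) p"

definition vdim :: "'k::field mpoly set \<Rightarrow> nat" where
  "vdim S = vector_space.dim pscale S"

text \<open>Hilbert function of R/I (I generated by G): dim_k (R/I)_d = dim_k R_d - dim_k I_d,
  where I_d = I \<inter> R_d.\<close>
definition hilbert_fun :: "nat \<Rightarrow> 'k::field mpoly set \<Rightarrow> nat \<Rightarrow> nat" where
  "hilbert_fun N G d = vdim (homog N (int d) :: 'k mpoly set)
     - vdim (ideal_gen N G \<inter> homog N (int d))"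

definition hilbert_series :: "nat \<Rightarrow> 'k::field mpoly set \<Rightarrow> rat fps" where
  "hilbert_series N G = Abs_fps (\<lambda>d. of_nat (hilbert_fun N G d))"

text \<open>Generators of the parity binomial edge ideal of K_n: x_i x_j - y_i y_j, i<j.\<close>
definition parity_KN :: "nat \<Rightarrow> 'k::comm_ring_1 mpoly set" where
  "parity_KN n = {pvar i * pvar j - pvar (n + i) * pvar (n + j) | i j. i < j \<and> j < n}"

text \<open>f_1..f_r in the maximal ideal is an M-regular sequence for M = R/I:
  each f_i is a nonzerodivisor on M/(f_1..f_{i-1})M = R/(I+(f_1..f_{i-1})),
  and M/(f_1..f_r)M \<noteq> 0.\<close>
definition regular_seq :: "nat \<Rightarrow> 'k::comm_ring_1 mpoly set \<Rightarrow> 'k mpoly list \<Rightarrow> bool" where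
  "regular_seq N G fs \<longleftrightarrow>
     (\<forall>i<length fs. fs ! i \<in> maxideal N \<and>
        (\<forall>g\<in>polyring N. fs ! i * g \<in> ideal_gen N (G \<union> set (take i fs))
            \<longrightarrow> g \<in> ideal_gen N (G \<union> set (take i fs))))
     \<and> 1 \<notin> ideal_gen N (G \<union> set fs)"

definition depth :: "nat \<Rightarrow> 'k::comm_ring_1 mpoly set \<Rightarrow> enat" where
  "depth N G = Sup {enat (length fs) | fs. regular_seq N G fs}"

definition fmod :: "nat \<Rightarrow> nat \<Rightarrow> (nat \<Rightarrow> 'k::comm_ring_1 mpoly) set" where
  "fmod N b = {u. (\<forall>k<b. u k \<in> polyring N) \<and> (\<forall>k\<ge>b. u k = 0)}"

text \<open>Differential F_i -> F_{i-1}: basis vector e_{i,k} maps to (d i k l)_l.\<close>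
definition dmap :: "(nat \<Rightarrow> nat \<Rightarrow> nat \<Rightarrow> 'k::comm_ring_1 mpoly) \<Rightarrow> (nat \<Rightarrow> nat) \<Rightarrow> nat
    \<Rightarrow> (nat \<Rightarrow> 'k mpoly) \<Rightarrow> (nat \<Rightarrow> 'k mpoly)" where
  "dmap d b i v = (\<lambda>l. if l < b (i - 1) then (\<Sum>k<b i. v k * d i k l) else 0)"

text \<open>Minimal graded free resolution ... -> F_1 -> F_0 -> R/I -> 0, with
  F_i = \<Oplus>_{k<b i} R(-a i k); the augmentation sends e_{0,k} to the class of eps k.
  Minimality: all differentials have entries in the maximal ideal.\<close>
definition min_graded_free_res ::
  "nat \<Rightarrow> 'k::comm_ring_1 mpoly set \<Rightarrow> (nat \<Rightarrow> nat) \<Rightarrow> (nat \<Rightarrow> nat \<Rightarrow> int)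
     \<Rightarrow> (nat \<Rightarrow> nat \<Rightarrow> nat \<Rightarrow> 'k mpoly) \<Rightarrow> (nat \<Rightarrow> 'k mpoly) \<Rightarrow> bool" where
  "min_graded_free_res N G b a d eps \<longleftrightarrow>
     (\<forall>k<b 0. eps k \<in> homog N (a 0 k)) \<and>
     (\<forall>i\<ge>1. \<forall>k<b i. \<forall>l<b (i - 1). d i k l \<in> homog N (a i k - a (i - 1) l) \<inter> maxideal N) \<and>
     (\<forall>p\<in>polyring N. \<exists>u\<in>fmod N (b 0). p - (\<Sum>k<b 0. u k * eps k) \<in> ideal_gen N G) \<and>
     (\<forall>u\<in>fmod N (b 0). (\<Sum>k<b 0. u k * eps k) \<in> ideal_gen N G
          \<longleftrightarrow> (\<exists>v\<in>fmod N (b 1). u = dmap d b 1 v)) \<and>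
     (\<forall>i\<ge>1. \<forall>u\<in>fmod N (b i). (\<forall>l. dmap d b i u l = 0)
          \<longleftrightarrow> (\<exists>v\<in>fmod N (b (Suc i)). u = dmap d b (Suc i) v))"

definition graded_betti :: "nat \<Rightarrow> 'k::comm_ring_1 mpoly set \<Rightarrow> nat \<Rightarrow> int \<Rightarrow> nat" where
  "graded_betti N G i j =
     (case (SOME r. case r of (b, a, d, eps) \<Rightarrow> min_graded_free_res N G b a d eps) of
        (b, a, d, eps) \<Rightarrow> card {k. k < b i \<and> a i k = j})"

definition cm_reg :: "nat \<Rightarrow> 'k::comm_ring_1 mpoly set \<Rightarrow> ereal" where
  "cm_reg N G = Sup {ereal (of_int (j - int i)) | i j. graded_betti N G i j \<noteq> 0}"

end

theory Submission
  imports Defs "HOL-Library.Function_Algebras"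
begin

text \<open>
  Write \<open>q_ij = x_i x_j - y_i y_j\<close>, \<open>g_ij = x_i y_j - x_j y_i\<close>, \<open>h_i = x_i^2 - y_i^2\<close>, and let \<open>P_ij\<close> be
  the ideal generated by \<open>q_ij\<close> and all variables of index other than \<open>i, j\<close>. Everything is read off a
  chain of ideals from \<open>I\<close> to the ring. Adjoining the \<open>g_ij\<close> with \<open>i < j < n\<close> to \<open>I\<close> one at a time gives
  quotients \<open>R / P_ij\<close>, shifted by 2. Adjoining then \<open>g_in\<close> and \<open>h_i\<close> together, for one vertex
  \<open>i < n - 1\<close> at a time, gives shifts by 1 of \<open>(x_n, y_i, P_in) / P_in\<close>. This reaches the intersection of
  \<open>P = P_(n-1)n\<close> with the ideal of polynomials vanishing on both linear components \<open>x = y\<close> and \<open>x = -y\<close>.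
  The two remaining steps, up to \<open>P\<close>, have quotients \<open>(P + L) / L\<close> with \<open>L = (x_i - y_i)_i\<close> and
  \<open>L = (x_i + y_i)_i\<close>. All pieces are complete intersections or kernels of maps between such, hence their
  Hilbert series and a bound for the degrees of their Koszul homology are known, and one sequence of
  three elements is regular on all of them. The three properties pass to \<open>R / I\<close> along the chain, and
  Koszul homology bounds the shifts in a minimal resolution.
\<close>

text \<open>The field is arbitrary. It may be finite, so generic linear forms need not exist and the
  regular sequence is written down explicitly; in characteristic 2 the two linear components
  coincide, so the ideal of both is described by a grading instead of an intersection. All modules
  are subquotients \<open>A / B\<close> of the ring given by pairs of ideals, and the degree bound
  is carried by Koszul homology, which follows a short exact sequence without any resolution being
  chosen. The bound 3 is 1 + 2: a quadric such as \<open>R / P_ij\<close> has bound 1, and the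
  largest shift is 2. The length 3 is the dimension of \<open>R / P_ij\<close>. The quotients by
  \<open>(x_n, y_i, P_in)\<close> and by \<open>P + L\<close> have dimension 2; they occur only as
  targets of maps from quotients on which all three elements are regular, and the kernels of these
  maps still have depth 3. All pairs among the first n - 1 vertices precede the vertex steps because
  the relations that carry the multiples of \<open>h_i\<close> by the variables of a vertex k into
  the ideal use \<open>g_ik\<close>.\<close>

abbreviation coef :: "('a \<Rightarrow>\<^sub>0 'b::zero) \<Rightarrow> 'a \<Rightarrow> 'b" where "coef \<equiv> Poly_Mapping.lookup"
abbreviation mons :: "('a \<Rightarrow>\<^sub>0 'b::zero) \<Rightarrow> 'a set" where "mons \<equiv> Poly_Mapping.keys"
abbreviation mterm :: "'a \<Rightarrow> 'b::zero \<Rightarrow> 'a \<Rightarrow>\<^sub>0 'b" where "mterm \<equiv> Poly_Mapping.single"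

subsection \<open>Polynomials and monomials\<close>

lemma poly_eq_sum_terms: "p = (\<Sum>m\<in>mons p. mterm m (coef p m))"
  by (rule poly_mapping_eqI)
     (simp add: lookup_sum lookup_single when_def in_keys_iff)

lemma poly_induct [case_names zero mterm add]:
  fixes p :: "'a \<Rightarrow>\<^sub>0 'b::comm_monoid_add"
  assumes "P 0" "\<And>m c. P (mterm m c)" "\<And>p q. P p \<Longrightarrow> P q \<Longrightarrow> P (p + q)"
  shows "P p"
proof -
  have "P (\<Sum>m\<in>A. mterm m (coef p m))" if "finite A" for A
    using that by induction (use assms in auto)
  from this[of "mons p"] show ?thesis using poly_eq_sum_terms[of p] by simp
qed

lemma poly_induct_mons [case_names zero mterm add]:
  fixes p :: "'a \<Rightarrow>\<^sub>0 'b::comm_monoid_add"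
  assumes "P 0" "\<And>m. m \<in> mons p \<Longrightarrow> P (mterm m (coef p m))" "\<And>p q. P p \<Longrightarrow> P q \<Longrightarrow> P (p + q)"
  shows "P p"
proof -
  have "A \<subseteq> mons p \<Longrightarrow> P (\<Sum>m\<in>A. mterm m (coef p m))" if "finite A" for A
    using that by induction (use assms in auto)
  from this[of "mons p"] show ?thesis using poly_eq_sum_terms[of p] by simp
qed

lemma coef_term_mult:
  fixes p :: "'k::comm_ring_1 mpoly"
  shows "coef (mterm m c * p) (m + k) = c * coef p k"
proof (induction p rule: poly_induct)
  case (mterm m' d)
  show ?case by (auto simp: mult_single lookup_single when_def)
qed (auto simp: lookup_add algebra_simps)

lemma mons_term_mult:
  fixes p :: "'k::comm_ring_1 mpoly"
  shows "mons (mterm m c * p) \<subseteq> (\<lambda>k. m + k) ` mons p"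
  using keys_mult[of "mterm m c" p] by (auto split: if_splits)

lemma mons_diff_subset: "mons (p - q) \<subseteq> mons p \<union> mons (q :: 'a \<Rightarrow>\<^sub>0 'b::ab_group_add)"
  by (auto simp: in_keys_iff lookup_minus)

lemma mons_sum_subset:
  fixes f :: "'i \<Rightarrow> 'a \<Rightarrow>\<^sub>0 'b::comm_monoid_add"
  shows "mons (sum f I) \<subseteq> (\<Union>i\<in>I. mons (f i))"
proof (induction I rule: infinite_finite_induct)
  case (insert x F)
  then show ?case using keys_add[of "f x" "sum f F"] by auto
qed auto

text \<open>Weights take the place of a monomial order. A weight only has to single out the leading
  monomial of each of the finitely many generators at hand; ties elsewhere do no harm, and each
  application may choose its own weight.\<close>

definition wt :: "(nat \<Rightarrow> nat) \<Rightarrow> (nat \<Rightarrow>\<^sub>0 nat) \<Rightarrow> nat" where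
  "wt w m = (\<Sum>i\<in>mons m. w i * coef m i)"

lemma wt_superset: "finite A \<Longrightarrow> mons m \<subseteq> A \<Longrightarrow> wt w m = (\<Sum>i\<in>A. w i * coef m i)"
  unfolding wt_def by (rule sum.mono_neutral_left) (auto simp: in_keys_iff)

lemma wt_add [simp]: "wt w (m + m') = wt w m + wt w m'"
proof -
  let ?A = "mons m \<union> mons m'"
  have "wt w (m + m') = (\<Sum>i\<in>?A. w i * coef (m + m') i)"
    by (rule wt_superset) (use keys_add[of m m'] in auto)
  then show ?thesis
    by (simp add: wt_superset[of ?A] lookup_add algebra_simps sum.distrib)
qed

lemma wt_zero [simp]: "wt w 0 = 0"
  by (simp add: wt_def)

lemma wt_term [simp]: "wt w (mterm i k) = w i * k"
  by (cases "k = 0") (auto simp: wt_def)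

lemma mdeg_eq_wt: "mdeg m = wt (\<lambda>_. 1) m"
  by (simp add: mdeg_def wt_def)

lemma mdeg_add [simp]: "mdeg (m + m') = mdeg m + mdeg m'"
  and mdeg_zero [simp]: "mdeg 0 = 0" and mdeg_term [simp]: "mdeg (mterm i k) = k"
  by (simp_all add: mdeg_eq_wt)

lemma mdeg_eq_0_iff: "mdeg m = 0 \<longleftrightarrow> m = 0"
  by (auto simp: mdeg_def in_keys_iff) (metis in_keys_iff poly_mapping_eqI lookup_zero)

lemma mons_add_nat: "mons (m + m' :: nat \<Rightarrow>\<^sub>0 nat) = mons m \<union> mons m'"
  by (auto simp: in_keys_iff lookup_add)

lemma monomial_splitE:
  assumes "i \<in> mons (m :: nat \<Rightarrow>\<^sub>0 nat)"
  obtains m' where "m = mterm i 1 + m'"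
proof
  show "m = mterm i 1 + (m - mterm i 1)"
    using assms by (intro poly_mapping_eqI)
      (auto simp: lookup_add lookup_minus lookup_single when_def in_keys_iff)
qed

lemma monomial_induct [case_names zero add]:
  assumes "P 0" "\<And>i m. P m \<Longrightarrow> P (mterm i 1 + m)"
  shows "P (m :: nat \<Rightarrow>\<^sub>0 nat)"
proof (induction "mdeg m" arbitrary: m rule: less_induct)
  case less
  show ?case
  proof (cases "m = 0")
    case False
    then obtain i where "i \<in> mons m" by (metis keys_eq_empty ex_in_conv)
    then obtain m' where "m = mterm i 1 + m'" by (rule monomial_splitE)
    with less assms(2) show ?thesis by auto
  qed (use assms in auto)
qed

lemma term_add_eq_pvar_mult: "mterm (mterm i 1 + m) c = pvar i * (mterm m c :: 'k::comm_ring_1 mpoly)"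
  by (simp add: pvar_def mult_single)

lemma mons_pvar [simp]: "mons (pvar i :: 'k::comm_ring_1 mpoly) = {mterm i 1}"
  by (simp add: pvar_def)

lemma coef_pvar: "coef (pvar i :: 'k::comm_ring_1 mpoly) m = (if m = mterm i 1 then 1 else 0)"
  by (auto simp: pvar_def lookup_single when_def)

subsection \<open>The polynomial ring in the first variables\<close>

lemma polyring_0 [simp]: "0 \<in> polyring N"
  and polyring_1 [simp]: "1 \<in> polyring N"
  by (auto simp: polyring_def)

lemma polyring_add [intro]: "p \<in> polyring N \<Longrightarrow> q \<in> polyring N \<Longrightarrow> p + q \<in> polyring N"
  using keys_add[of p q] by (force simp: polyring_def)

lemma polyring_diff [intro]: "p \<in> polyring N \<Longrightarrow> q \<in> polyring N \<Longrightarrow> p - q \<in> polyring N"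
  using mons_diff_subset[of p q] by (force simp: polyring_def)

lemma polyring_uminus [simp]: "- p \<in> polyring N \<longleftrightarrow> p \<in> polyring N"
  by (simp add: polyring_def)

lemma polyring_mult [intro]: "p \<in> polyring N \<Longrightarrow> q \<in> polyring N \<Longrightarrow> p * q \<in> polyring N"
  using keys_mult[of p q] by (fastforce simp: polyring_def mons_add_nat)

lemma polyring_sum [intro]: "(\<And>i. i \<in> I \<Longrightarrow> f i \<in> polyring N) \<Longrightarrow> sum f I \<in> polyring N"
  by (induction I rule: infinite_finite_induct) auto

lemma polyring_pvar [simp]: "pvar i \<in> polyring N \<longleftrightarrow> i < N"
  by (auto simp: polyring_def)

lemma polyring_term: "mons m \<subseteq> {..<N} \<Longrightarrow> mterm m c \<in> polyring N"
  by (auto simp: polyring_def)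

lemma polyring_termD: "p \<in> polyring N \<Longrightarrow> m \<in> mons p \<Longrightarrow> mons m \<subseteq> {..<N}"
  by (auto simp: polyring_def)

lemma homog_polyring: "p \<in> homog N e \<Longrightarrow> p \<in> polyring N"
  by (simp add: homog_def)

lemma homog_0 [simp]: "0 \<in> homog N e"
  by (auto simp: homog_def)

lemma homog_1 [simp]: "1 \<in> homog N 0"
  by (auto simp: homog_def)

lemma homog_add [intro]: "p \<in> homog N e \<Longrightarrow> q \<in> homog N e \<Longrightarrow> p + q \<in> homog N e"
  using keys_add[of p q] by (force simp: homog_def)

lemma homog_diff [intro]: "p \<in> homog N e \<Longrightarrow> q \<in> homog N e \<Longrightarrow> p - q \<in> homog N e"
  using mons_diff_subset[of p q] by (force simp: homog_def)

lemma homog_uminus [simp]: "- p \<in> homog N e \<longleftrightarrow> p \<in> homog N e"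
  by (simp add: homog_def)

lemma homog_mult: "p \<in> homog N e \<Longrightarrow> q \<in> homog N f \<Longrightarrow> p * q \<in> homog N (e + f)"
  using keys_mult[of p q] by (fastforce simp: homog_def)

lemma homog_sum [intro]: "(\<And>i. i \<in> I \<Longrightarrow> f i \<in> homog N e) \<Longrightarrow> sum f I \<in> homog N e"
  by (induction I rule: infinite_finite_induct) auto

lemma homog_pvar [simp]: "i < N \<Longrightarrow> pvar i \<in> homog N 1"
  by (auto simp: homog_def)

lemma homog_neg: "e < 0 \<Longrightarrow> p \<in> homog N e \<Longrightarrow> p = 0"
  unfolding homog_def using keys_eq_empty by fastforce

definition pfilter :: "('a \<Rightarrow> bool) \<Rightarrow> ('a \<Rightarrow>\<^sub>0 'b::zero) \<Rightarrow> 'a \<Rightarrow>\<^sub>0 'b" where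
  "pfilter P p = Poly_Mapping.mapp (\<lambda>m c. c when P m) p"

lemma coef_pfilter [simp]: "coef (pfilter P p) m = (if P m then coef p m else 0)"
  by (auto simp: pfilter_def lookup_mapp when_def in_keys_iff)

lemma mons_pfilter [simp]: "mons (pfilter P p) = {m \<in> mons p. P m}"
  by (auto simp: in_keys_iff split: if_splits)

lemma pfilter_add [simp]: "pfilter P (p + q) = pfilter P p + pfilter P q"
  for p q :: "'a \<Rightarrow>\<^sub>0 'b::monoid_add"
  by (rule poly_mapping_eqI) (simp add: lookup_add)

lemma pfilter_0 [simp]: "pfilter P 0 = 0"
  by (rule poly_mapping_eqI) simp

definition hcomp :: "int \<Rightarrow> 'k::comm_ring_1 mpoly \<Rightarrow> 'k mpoly" where
  "hcomp e = pfilter (\<lambda>m. int (mdeg m) = e)"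

lemma hcomp_homog: "p \<in> polyring N \<Longrightarrow> hcomp e p \<in> homog N e"
  by (auto simp: hcomp_def homog_def polyring_def)

lemma hcomp_polyring: "p \<in> polyring N \<Longrightarrow> hcomp e p \<in> polyring N"
  by (auto simp: hcomp_def polyring_def)

lemma hcomp_add [simp]: "hcomp e (p + q) = hcomp e p + hcomp e q"
  by (simp add: hcomp_def)

lemma hcomp_sum [simp]: "hcomp e (sum f I) = (\<Sum>i\<in>I. hcomp e (f i))"
  by (induction I rule: infinite_finite_induct) (auto simp: hcomp_def)

lemma hcomp_homog_eq: "p \<in> homog N e \<Longrightarrow> hcomp e p = p"
  by (rule poly_mapping_eqI) (auto simp: hcomp_def homog_def in_keys_iff)

lemma hcomp_term: "hcomp e (mterm m c) = (if int (mdeg m) = e then mterm m c else 0)"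
  by (rule poly_mapping_eqI) (auto simp: hcomp_def lookup_single when_def)

lemma hcomp_mult_homog: "c \<in> homog N g \<Longrightarrow> hcomp (e + g) (c * p) = c * hcomp e p"
proof (induction p rule: poly_induct)
  case (mterm m d)
  have "hcomp (e + g) (mterm m' (coef c m') * mterm m d) = mterm m' (coef c m') * hcomp e (mterm m d)"
    if "m' \<in> mons c" for m'
    using that mterm by (auto simp: hcomp_term mult_single homog_def)
  then have "hcomp (e + g) ((\<Sum>m'\<in>mons c. mterm m' (coef c m')) * mterm m d)
      = (\<Sum>m'\<in>mons c. mterm m' (coef c m')) * hcomp e (mterm m d)"
    by (simp add: sum_distrib_right)
  then show ?case by (simp flip: poly_eq_sum_terms)
qed (auto simp: hcomp_def algebra_simps)

lemma poly_sum_hcomp: 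
  assumes "\<And>m. m \<in> mons p \<Longrightarrow> mdeg m < D"
  shows "p = (\<Sum>e<D. hcomp (int e) p)"
  by (rule poly_mapping_eqI)
     (use assms in \<open>auto simp: lookup_sum hcomp_def in_keys_iff\<close>)

lemma homog_induct [consumes 1, case_names homog add]:
  assumes "p \<in> polyring N" "\<And>e p. p \<in> homog N e \<Longrightarrow> P p" "\<And>p q. P p \<Longrightarrow> P q \<Longrightarrow> P (p + q)"
  shows "P p"
proof -
  have "P (\<Sum>e<D. hcomp (int e) p)" for D
  proof (induction D)
    case 0
    show ?case using assms(2)[of 0] by simp
  next
    case (Suc D)
    then show ?case using assms(2)[OF hcomp_homog[OF assms(1)]] assms(3) by simp
  qed
  moreover have "p = (\<Sum>e<Suc (Max (insert 0 (mdeg ` mons p))). hcomp (int e) p)"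
    by (rule poly_sum_hcomp) (simp add: less_Suc_eq_le)
  ultimately show ?thesis by metis
qed

subsection \<open>Homogeneous ideals\<close>

definition rideal :: "nat \<Rightarrow> 'k::comm_ring_1 mpoly set \<Rightarrow> bool" where
  "rideal N A \<longleftrightarrow> A \<subseteq> polyring N \<and> 0 \<in> A \<and> (\<forall>a\<in>A. \<forall>b\<in>A. a + b \<in> A) \<and>
     (\<forall>r\<in>polyring N. \<forall>a\<in>A. r * a \<in> A)"

definition gideal :: "nat \<Rightarrow> 'k::comm_ring_1 mpoly set \<Rightarrow> bool" where
  "gideal N A \<longleftrightarrow> rideal N A \<and> (\<forall>a\<in>A. \<forall>e. hcomp e a \<in> A)"

lemma gideal_rideal: "gideal N A \<Longrightarrow> rideal N A"
  by (simp add: gideal_def)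

lemma rideal_polyring: "rideal N A \<Longrightarrow> a \<in> A \<Longrightarrow> a \<in> polyring N"
  and rideal_0: "rideal N A \<Longrightarrow> 0 \<in> A"
  and rideal_add: "rideal N A \<Longrightarrow> a \<in> A \<Longrightarrow> b \<in> A \<Longrightarrow> a + b \<in> A"
  and rideal_mult: "rideal N A \<Longrightarrow> r \<in> polyring N \<Longrightarrow> a \<in> A \<Longrightarrow> r * a \<in> A"
  by (auto simp: rideal_def)

lemma rideal_mult_right: "rideal N A \<Longrightarrow> r \<in> polyring N \<Longrightarrow> a \<in> A \<Longrightarrow> a * r \<in> A"
  by (metis mult.commute rideal_mult)

lemma rideal_uminus: "rideal N A \<Longrightarrow> a \<in> A \<Longrightarrow> - a \<in> A"
  using rideal_mult[of N A "- 1" a] by simp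

lemma rideal_diff: "rideal N A \<Longrightarrow> a \<in> A \<Longrightarrow> b \<in> A \<Longrightarrow> a - b \<in> A"
  using rideal_add[of N A a "- b"] rideal_uminus[of N A b] by simp

lemma rideal_sum: "rideal N A \<Longrightarrow> (\<And>i. i \<in> I \<Longrightarrow> f i \<in> A) \<Longrightarrow> sum f I \<in> A"
  by (induction I rule: infinite_finite_induct) (auto simp: rideal_0 rideal_add)

lemma rideal_cong: "rideal N A \<Longrightarrow> a - b \<in> A \<Longrightarrow> a \<in> A \<longleftrightarrow> b \<in> A"
  using rideal_add[of N A "a - b" b] rideal_diff[of N A a "a - b"] by auto

lemma rideal_Int: "rideal N A \<Longrightarrow> rideal N B \<Longrightarrow> rideal N (A \<inter> B)"
  unfolding rideal_def by blast

lemma gideal_Int: "gideal N A \<Longrightarrow> gideal N B \<Longrightarrow> gideal N (A \<inter> B)"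
  unfolding gideal_def by (auto simp: rideal_Int)

lemma rideal_ring: "rideal N (polyring N)"
  by (auto simp: rideal_def)

lemma gideal_ring: "gideal N (polyring N)"
  by (auto simp: gideal_def rideal_ring hcomp_polyring)

lemma rideal_colon: "rideal N A \<Longrightarrow> g \<in> polyring N \<Longrightarrow> rideal N {f \<in> polyring N. f * g \<in> A}"
  unfolding rideal_def by (auto simp: algebra_simps)

lemma rideal_ideal_gen:
  fixes G :: "'k::comm_ring_1 mpoly set"
  assumes "G \<subseteq> polyring N"
  shows "rideal N (ideal_gen N G)"
  unfolding rideal_def
proof (intro conjI ballI)
  show "ideal_gen N G \<subseteq> polyring N" using assms by (auto simp: ideal_gen_def intro!: polyring_sum)
  show "0 \<in> ideal_gen N G"
    unfolding ideal_gen_def by (rule CollectI, rule exI[of _ "{}"]) auto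
next
  fix a b assume "a \<in> ideal_gen N G" "b \<in> ideal_gen N G"
  then obtain F c F' c' where *: "a = (\<Sum>g\<in>F. c g * g)" "b = (\<Sum>g\<in>F'. c' g * g)"
    "finite F" "finite F'" "F \<subseteq> G" "F' \<subseteq> G" "\<forall>g\<in>F. c g \<in> polyring N" "\<forall>g\<in>F'. c' g \<in> polyring N"
    by (auto simp: ideal_gen_def)
  let ?c = "\<lambda>g. (if g \<in> F then c g else 0)" and ?c' = "\<lambda>g. (if g \<in> F' then c' g else 0)"
  have "a = (\<Sum>g\<in>F \<union> F'. ?c g * g)" "b = (\<Sum>g\<in>F \<union> F'. ?c' g * g)"
    using * by (auto intro!: sum.mono_neutral_cong_left)
  then have "a + b = (\<Sum>g\<in>F \<union> F'. (?c g + ?c' g) * g)"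
    by (simp add: algebra_simps sum.distrib)
  with * show "a + b \<in> ideal_gen N G"
    unfolding ideal_gen_def
    by (intro CollectI exI[of _ "F \<union> F'"] exI[of _ "\<lambda>g. ?c g + ?c' g"]) auto
next
  fix r a :: "'k mpoly" assume r: "r \<in> polyring N" and "a \<in> ideal_gen N G"
  then obtain F c where *: "a = (\<Sum>g\<in>F. c g * g)" "finite F" "F \<subseteq> G" "\<forall>g\<in>F. c g \<in> polyring N"
    by (auto simp: ideal_gen_def)
  then show "r * a \<in> ideal_gen N G" using r
    unfolding ideal_gen_def
    by (intro CollectI exI[of _ F] exI[of _ "\<lambda>g. r * c g"]) (auto simp: sum_distrib_left mult.assoc)
qed

lemma ideal_gen_superset: "g \<in> G \<Longrightarrow> g \<in> ideal_gen N G"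
  unfolding ideal_gen_def by (intro CollectI exI[of _ "{g}"] exI[of _ "\<lambda>_. 1"]) auto

lemma ideal_gen_least:
  assumes "rideal N A" "G \<subseteq> A"
  shows "ideal_gen N G \<subseteq> A"
  using assms by (auto simp: ideal_gen_def intro!: rideal_sum rideal_mult)

lemma ideal_gen_leastI:
  assumes "rideal N A" "p \<in> ideal_gen N G" "\<And>g. g \<in> G \<Longrightarrow> g \<in> A"
  shows "p \<in> A"
  using ideal_gen_least[of N A G] assms by auto

lemma ideal_gen_mono: "G \<subseteq> G' \<Longrightarrow> ideal_gen N G \<subseteq> ideal_gen N G'"
  unfolding ideal_gen_def by blast

lemma gideal_ideal_gen:
  assumes G: "\<And>g. g \<in> G \<Longrightarrow> \<exists>e. g \<in> homog N e"
  shows "gideal N (ideal_gen N G)"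
proof -
  have sub: "G \<subseteq> polyring N" using G homog_polyring by blast
  define A where "A = {p \<in> polyring N. \<forall>e. hcomp e p \<in> ideal_gen N G}"
  note I = rideal_ideal_gen[OF sub]
  have hg: "hcomp e g \<in> ideal_gen N G" if g: "g \<in> G" for g e
  proof -
    obtain f where f: "g \<in> homog N f" using G g by blast
    then have "hcomp e g = (if e = f then g else 0)"
      by (intro poly_mapping_eqI) (auto simp: hcomp_def homog_def in_keys_iff)
    then show ?thesis using ideal_gen_superset[OF g] rideal_0[OF I] by auto
  qed
  show ?thesis unfolding gideal_def
  proof (intro conjI I ballI allI)
    fix a e assume "a \<in> ideal_gen N G"
    then obtain F c where *: "a = (\<Sum>g\<in>F. c g * g)" "finite F" "F \<subseteq> G" "\<forall>g\<in>F. c g \<in> polyring N"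
      by (auto simp: ideal_gen_def)
    \<comment> \<open>Splitting the coefficient \<open>r\<close> into homogeneous parts reduces the
      claim to multiplication by a homogeneous element, which merely shifts the components of
      \<open>g\<close>.\<close>
    have "hcomp e (r * g) \<in> ideal_gen N G" if "g \<in> G" "r \<in> polyring N" for r g e
      using that(2)
    proof (induction arbitrary: e rule: homog_induct)
      case (homog f r)
      have "hcomp (e - f + f) (r * g) = r * hcomp (e - f) g" by (rule hcomp_mult_homog) fact
      moreover have "r * hcomp (e - f) g \<in> ideal_gen N G"
        using homog by (intro rideal_mult[OF I] hg that) (auto simp: homog_polyring)
      ultimately show ?case by simp
    next
      case (add p q)
      then show ?case by (simp add: ring_distribs rideal_add[OF I])
    qed
    then show "hcomp e a \<in> ideal_gen N G" using * by (auto intro!: rideal_sum[OF I])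
  qed
qed

section \<open>Sums and multiples of ideals\<close>

definition iplus :: "'k::comm_ring_1 mpoly set \<Rightarrow> 'k mpoly set \<Rightarrow> 'k mpoly set" where
  "iplus A B = {a + b | a b. a \<in> A \<and> b \<in> B}"

definition imul :: "'k::comm_ring_1 mpoly \<Rightarrow> 'k mpoly set \<Rightarrow> 'k mpoly set" where
  "imul c A = (\<lambda>a. c * a) ` A"

lemma iplus_memI: "a \<in> A \<Longrightarrow> b \<in> B \<Longrightarrow> a + b \<in> iplus A B"
  by (auto simp: iplus_def)

lemma iplus_memE:
  assumes "p \<in> iplus A B"
  obtains a b where "a \<in> A" "b \<in> B" "p = a + b"
  using assms by (auto simp: iplus_def)

lemma rideal_iplus:
  fixes A :: "'k::comm_ring_1 mpoly set"
  assumes A: "rideal N A" and B: "rideal N B"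
  shows "rideal N (iplus A B)"
  unfolding rideal_def
proof (intro conjI ballI subsetI)
  show "0 \<in> iplus A B" using iplus_memI[OF rideal_0[OF A] rideal_0[OF B]] by simp
next
  fix p assume "p \<in> iplus A B"
  then show "p \<in> polyring N"
    using rideal_polyring[OF A] rideal_polyring[OF B] by (auto elim: iplus_memE)
next
  fix p q assume "p \<in> iplus A B" "q \<in> iplus A B"
  then obtain a b a' b' where *: "a \<in> A" "b \<in> B" "p = a + b" "a' \<in> A" "b' \<in> B" "q = a' + b'"
    by (auto elim!: iplus_memE)
  then have "(a + a') + (b + b') \<in> iplus A B"
    by (intro iplus_memI rideal_add[OF A] rideal_add[OF B])
  then show "p + q \<in> iplus A B" using * by (simp add: algebra_simps)
next
  fix r p :: "'k mpoly" assume "r \<in> polyring N" "p \<in> iplus A B"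
  then show "r * p \<in> iplus A B"
    by (auto elim!: iplus_memE simp: distrib_left intro!: iplus_memI rideal_mult[OF A] rideal_mult[OF B])
qed

lemma rideal_imul: "rideal N A \<Longrightarrow> c \<in> polyring N \<Longrightarrow> rideal N (imul c A)"
  unfolding rideal_def imul_def
  by (auto simp flip: distrib_left simp: image_iff mult.left_commute[of _ c] intro: bexI[of _ 0])

lemma gideal_iplus: "gideal N A \<Longrightarrow> gideal N B \<Longrightarrow> gideal N (iplus A B)"
  unfolding gideal_def by (auto simp: rideal_iplus elim!: iplus_memE intro!: iplus_memI)

lemma gideal_imul:
  assumes "gideal N A" "c \<in> homog N g"
  shows "gideal N (imul c A)"
proof -
  have "hcomp e (c * a) \<in> imul c A" if "a \<in> A" for a e
    using hcomp_mult_homog[OF assms(2), of "e - g" a] assms(1) that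
    by (auto simp: imul_def gideal_def)
  then show ?thesis
    using assms by (auto simp: gideal_def rideal_imul homog_polyring) (auto simp: imul_def)
qed

lemma iplus_sup1: "rideal N B \<Longrightarrow> A \<subseteq> iplus A B"
  using iplus_memI[of _ A 0 B] rideal_0[of N B] by auto

lemma iplus_sup2: "rideal N A \<Longrightarrow> B \<subseteq> iplus A B"
  using iplus_memI[of 0 A _ B] rideal_0[of N A] by auto

lemma iplus_least: "rideal N C \<Longrightarrow> A \<subseteq> C \<Longrightarrow> B \<subseteq> C \<Longrightarrow> iplus A B \<subseteq> C"
  by (auto simp: iplus_def intro: rideal_add)

lemma imul_subset: "rideal N A \<Longrightarrow> c \<in> polyring N \<Longrightarrow> imul c A \<subseteq> A"
  by (auto simp: imul_def rideal_mult)

lemma ideal_gen_Un: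
  assumes "G \<subseteq> polyring N" "H \<subseteq> polyring N"
  shows "ideal_gen N (G \<union> H) = iplus (ideal_gen N G) (ideal_gen N H)"
proof
  note I = rideal_ideal_gen[OF assms(1)] rideal_ideal_gen[OF assms(2)]
  show "ideal_gen N (G \<union> H) \<subseteq> iplus (ideal_gen N G) (ideal_gen N H)"
    using iplus_sup1[OF I(2)] iplus_sup2[OF I(1)]
    by (intro ideal_gen_least rideal_iplus I) (auto simp: ideal_gen_superset subset_iff)
  show "iplus (ideal_gen N G) (ideal_gen N H) \<subseteq> ideal_gen N (G \<union> H)"
    using assms by (intro iplus_least[OF rideal_ideal_gen] ideal_gen_mono) auto
qed

lemma ideal_gen_single: "g \<in> polyring N \<Longrightarrow> ideal_gen N {g} = imul g (polyring N)"
proof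
  assume g: "g \<in> polyring N"
  show "ideal_gen N {g} \<subseteq> imul g (polyring N)"
    using g by (intro ideal_gen_least rideal_imul rideal_ring) (auto simp: imul_def image_iff intro!: bexI[of _ 1])
  show "imul g (polyring N) \<subseteq> ideal_gen N {g}"
    using g rideal_mult_right[OF rideal_ideal_gen[of "{g}"] _ ideal_gen_superset[of g "{g}"]]
    by (auto simp: imul_def)
qed

lemma ideal_gen_insert:
  assumes "G \<subseteq> polyring N" "g \<in> polyring N"
  shows "ideal_gen N (insert g G) = iplus (imul g (polyring N)) (ideal_gen N G)"
  using ideal_gen_Un[of "{g}" N G] assms by (simp add: ideal_gen_single)

lemma ideal_gen_insert_memE:
  assumes "p \<in> ideal_gen N (insert g G)" "G \<subseteq> polyring N" "g \<in> polyring N"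
  obtains r q where "r \<in> polyring N" "q \<in> ideal_gen N G" "p = g * r + q"
  using assms by (auto simp: ideal_gen_insert iplus_def imul_def)

lemma ideal_gen_insert_cong:
  assumes "G \<subseteq> polyring N" "g \<in> polyring N" "h \<in> polyring N" "g - h \<in> ideal_gen N G"
  shows "ideal_gen N (insert g G) = ideal_gen N (insert h G)"
proof -
  have "ideal_gen N (insert g G) \<subseteq> ideal_gen N (insert h G)"
    if "g - h \<in> ideal_gen N G" "g \<in> polyring N" "h \<in> polyring N" for g h
  proof (rule ideal_gen_least)
    show *: "rideal N (ideal_gen N (insert h G))" using assms that by (intro rideal_ideal_gen) auto
    have "g - h \<in> ideal_gen N (insert h G)" using that ideal_gen_mono[of G "insert h G"] by auto
    then show "insert g G \<subseteq> ideal_gen N (insert h G)"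
      using rideal_cong[OF *] by (auto intro: ideal_gen_superset)
  qed
  moreover have "h - g \<in> ideal_gen N G"
    using rideal_uminus[OF rideal_ideal_gen[OF assms(1)] assms(4)] by simp
  ultimately show ?thesis using assms by blast
qed

subsection \<open>Koszul complexes and regularity\<close>

text \<open>The sign (-1)^n, for a module type that is only an additive group and has no scalar
  -1.\<close>

definition sgnp :: "nat \<Rightarrow> 'm::ab_group_add \<Rightarrow> 'm" where
  "sgnp n y = (if even n then y else - y)"

definition ksign :: "nat set \<Rightarrow> nat \<Rightarrow> nat" where
  "ksign S t = card {l\<in>S. l < t}"

text \<open>The Koszul boundary read off by coefficients: a chain is the sum of \<open>u S\<close>
  times the exterior basis element e_S, and e_S receives a contribution from every e_T with
  \<open>T = insert t S\<close>, signed by the position of \<open>t\<close>.\<close>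

definition kdiff :: "nat \<Rightarrow> (nat \<Rightarrow> 'm \<Rightarrow> 'm) \<Rightarrow> (nat set \<Rightarrow> 'm) \<Rightarrow> nat set \<Rightarrow> 'm::ab_group_add" where
  "kdiff N X u S = (\<Sum>t\<in>{..<N} - S. sgnp (ksign S t) (X t (u (insert t S))))"

text \<open>Exterior multiplication by the basis element e_t, the homotopy for multiplication by the
  variable \<open>t\<close>.\<close>

definition khom :: "nat \<Rightarrow> (nat set \<Rightarrow> 'm) \<Rightarrow> nat set \<Rightarrow> 'm::ab_group_add" where
  "khom t u S = (if t \<in> S then sgnp (ksign S t) (u (S - {t})) else 0)"

text \<open>Each e_t has internal degree 1, so in internal degree \<open>j\<close> the coefficients
  of an \<open>i\<close>-fold product have degree \<open>j - i\<close>. Coefficients elsewhere are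
  forced to 0, so that chains can be compared as functions.\<close>

definition kchain :: "nat \<Rightarrow> (int \<Rightarrow> 'm::ab_group_add set) \<Rightarrow> nat \<Rightarrow> int \<Rightarrow> 'm set \<Rightarrow> (nat set \<Rightarrow> 'm) set" where
  "kchain N H i j A =
     {u. \<forall>S. u S \<in> (if S \<subseteq> {..<N} \<and> card S = i then A \<inter> H (j - int i) else {0})}"

text \<open>The Koszul homology of \<open>A / B\<close> with respect to the variables vanishes in homological
  degree \<open>i\<close> and internal degree \<open>j > i + r\<close>.\<close>

definition kreg :: "nat \<Rightarrow> (nat \<Rightarrow> 'm \<Rightarrow> 'm) \<Rightarrow> (int \<Rightarrow> 'm::ab_group_add set) \<Rightarrow> int \<Rightarrow> 'm set \<Rightarrow> 'm set \<Rightarrow> bool" where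
  "kreg N X H r A B \<longleftrightarrow> (\<forall>i j u. j > int i + r \<longrightarrow> u \<in> kchain N H i j A \<longrightarrow> (\<forall>S. kdiff N X u S \<in> B) \<longrightarrow>
     (\<exists>v\<in>kchain N H (Suc i) j A. \<forall>S. u S - kdiff N X v S \<in> B))"

lemma sgnp_simps [simp]: "sgnp n 0 = 0" "sgnp m (sgnp n y) = sgnp (m + n) y"
  "- sgnp n y = sgnp (Suc n) y" "sgnp 0 y = y"
  by (auto simp: sgnp_def)

lemma sgnp_even: "even n \<Longrightarrow> sgnp n y = y"
  by (auto simp: sgnp_def)

lemma sgnp_cancel: "odd (m + n) \<Longrightarrow> sgnp m y + sgnp n y = 0"
  by (auto simp: sgnp_def)

lemma sgnp_add: "sgnp n (a + b) = sgnp n a + sgnp n b"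
  by (auto simp: sgnp_def)

lemma sgnp_sum: "sgnp n (sum f I) = (\<Sum>i\<in>I. sgnp n (f i))"
  by (simp add: sgnp_def sum_negf)

lemma ksign_insert: 
  assumes "t \<notin> S"
  shows "ksign (insert t S) s = ksign S s + (if t < s then 1 else 0)"
proof -
  have "{l \<in> insert t S. l < s} = (if t < s then insert t {l\<in>S. l < s} else {l\<in>S. l < s})" by auto
  moreover have "finite {l\<in>S. l < s}" by (rule finite_subset[of _ "{..<s}"]) auto
  ultimately show ?thesis using assms by (simp add: ksign_def)
qed

lemma kchainD: "u \<in> kchain N H i j A \<Longrightarrow> S \<subseteq> {..<N} \<Longrightarrow> card S = i \<Longrightarrow> u S \<in> A \<and> u S \<in> H (j - int i)"
  and kchain_zero: "u \<in> kchain N H i j A \<Longrightarrow> \<not> (S \<subseteq> {..<N} \<and> card S = i) \<Longrightarrow> u S = 0"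
  by (auto simp: kchain_def dest!: spec[of _ S] split: if_splits)

lemma kchainI:
  assumes "\<And>S. S \<subseteq> {..<N} \<Longrightarrow> card S = i \<Longrightarrow> u S \<in> A \<and> u S \<in> H (j - int i)"
    "\<And>S. \<not> (S \<subseteq> {..<N} \<and> card S = i) \<Longrightarrow> u S = 0"
  shows "u \<in> kchain N H i j A"
  using assms by (auto simp: kchain_def)

text \<open>Only the commuting action of the variables and the grading matter for the Koszul
  complex. The abstraction serves both the ring, with its ideals as submodules, and graded free
  modules.\<close>

locale graded_action =
  fixes N :: nat and X :: "nat \<Rightarrow> 'm::ab_group_add \<Rightarrow> 'm" and H :: "int \<Rightarrow> 'm set"
  assumes X_add: "X i (a + b) = X i a + X i b"
    and X_comm: "X i (X j a) = X j (X i a)"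
    and H_0: "0 \<in> H e"
    and H_add: "a \<in> H e \<Longrightarrow> b \<in> H e \<Longrightarrow> a + b \<in> H e"
    and H_uminus: "a \<in> H e \<Longrightarrow> - a \<in> H e"
    and X_H: "i < N \<Longrightarrow> a \<in> H e \<Longrightarrow> X i a \<in> H (e + 1)"
begin

abbreviation "D \<equiv> kdiff N X"
abbreviation "C \<equiv> kchain N H"

definition submod :: "'m set \<Rightarrow> bool" where
  "submod A \<longleftrightarrow> 0 \<in> A \<and> (\<forall>a\<in>A. \<forall>b\<in>A. a + b \<in> A) \<and> (\<forall>a\<in>A. - a \<in> A) \<and> (\<forall>i<N. \<forall>a\<in>A. X i a \<in> A)"

lemma submod_0: "submod A \<Longrightarrow> 0 \<in> A"
  and submod_add: "submod A \<Longrightarrow> a \<in> A \<Longrightarrow> b \<in> A \<Longrightarrow> a + b \<in> A"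
  and submod_uminus: "submod A \<Longrightarrow> a \<in> A \<Longrightarrow> - a \<in> A"
  and submod_X: "submod A \<Longrightarrow> i < N \<Longrightarrow> a \<in> A \<Longrightarrow> X i a \<in> A"
  by (auto simp: submod_def)

lemma submod_diff: "submod A \<Longrightarrow> a \<in> A \<Longrightarrow> b \<in> A \<Longrightarrow> a - b \<in> A"
  using submod_add[of A a "- b"] submod_uminus[of A b] by simp

lemma submod_sgnp: "submod A \<Longrightarrow> a \<in> A \<Longrightarrow> sgnp n a \<in> A"
  by (auto simp: sgnp_def submod_uminus)

lemma submod_sum: "submod A \<Longrightarrow> (\<And>i. i \<in> I \<Longrightarrow> f i \<in> A) \<Longrightarrow> sum f I \<in> A"
  by (induction I rule: infinite_finite_induct) (auto simp: submod_0 submod_add)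

lemma H_diff: "a \<in> H e \<Longrightarrow> b \<in> H e \<Longrightarrow> a - b \<in> H e"
  using H_add[of a e "- b"] H_uminus[of b e] by simp

lemma H_sgnp: "a \<in> H e \<Longrightarrow> sgnp n a \<in> H e"
  by (auto simp: sgnp_def H_uminus)

lemma H_sum: "(\<And>i. i \<in> I \<Longrightarrow> f i \<in> H e) \<Longrightarrow> sum f I \<in> H e"
  by (induction I rule: infinite_finite_induct) (auto simp: H_0 H_add)

lemma X_0 [simp]: "X i 0 = 0"
  using X_add[of i 0 0] by simp

lemma X_uminus: "X i (- a) = - X i a"
  using X_add[of i a "- a"] by (simp add: eq_neg_iff_add_eq_0 add.commute)

lemma X_sgnp: "X i (sgnp n a) = sgnp n (X i a)"
  by (auto simp: sgnp_def X_uminus)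

lemma X_sum: "X i (sum f I) = (\<Sum>k\<in>I. X i (f k))"
  by (induction I rule: infinite_finite_induct) (auto simp: X_add)

lemma kdiff_add: "D (\<lambda>S. u S + v S) S = D u S + D v S"
  by (simp add: kdiff_def X_add sgnp_add sum.distrib)

lemma kdiff_uminus: "D (\<lambda>S. - u S) S = - D u S"
  by (simp add: kdiff_def X_uminus sgnp_def sum_negf[symmetric]) (rule sum.cong, auto)

lemma kdiff_diff: "D (\<lambda>S. u S - v S) S = D u S - D v S"
  using kdiff_add[of u "\<lambda>S. - v S" S] by (simp add: kdiff_uminus)

lemma kdiff_X: "D (\<lambda>S. X t (u S)) S = X t (D u S)"
  by (simp add: kdiff_def X_sum X_sgnp X_comm[of t])

lemma kdiff_in: "submod A \<Longrightarrow> (\<And>S. u S \<in> A) \<Longrightarrow> D u S \<in> A"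
  by (auto simp: kdiff_def intro!: submod_sum submod_sgnp submod_X)

lemma khom_in: "submod A \<Longrightarrow> (\<And>S. u S \<in> A) \<Longrightarrow> khom t u S \<in> A"
  by (auto simp: khom_def intro: submod_sgnp submod_0)

lemma kchain_in: "submod A \<Longrightarrow> u \<in> C i j A \<Longrightarrow> u S \<in> A"
  using kchainD[of u N H i j A S] kchain_zero[of u N H i j A S] by (cases "S \<subseteq> {..<N} \<and> card S = i") (auto simp: submod_0)

lemma kchain_0: "submod A \<Longrightarrow> (\<lambda>S. 0) \<in> C i j A"
  by (rule kchainI) (auto simp: submod_0 H_0)

lemma kchain_add: "submod A \<Longrightarrow> u \<in> C i j A \<Longrightarrow> v \<in> C i j A \<Longrightarrow> (\<lambda>S. u S + v S) \<in> C i j A"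
  by (rule kchainI) (auto simp: kchainD kchain_zero submod_add H_add)

lemma kchain_diff: "submod A \<Longrightarrow> u \<in> C i j A \<Longrightarrow> v \<in> C i j A \<Longrightarrow> (\<lambda>S. u S - v S) \<in> C i j A"
  by (rule kchainI) (auto simp: kchainD kchain_zero submod_diff H_diff)

lemma kchain_subset: "u \<in> C i j A \<Longrightarrow> (\<And>S. u S \<in> B) \<Longrightarrow> u \<in> C i j B"
  by (rule kchainI) (auto simp: kchainD kchain_zero)

lemma kchain_mono: "u \<in> C i j A \<Longrightarrow> A \<subseteq> B \<Longrightarrow> u \<in> C i j B"
  by (rule kchainI) (auto simp: kchainD kchain_zero)

lemma kdiff_chain:
  assumes "submod A" "u \<in> C (Suc i) j A"
  shows "D u \<in> C i j A"
proof (rule kchainI)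
  fix S assume S: "S \<subseteq> {..<N}" "card S = i"
  have "u (insert t S) \<in> A \<and> u (insert t S) \<in> H (j - int (Suc i))" if "t \<in> {..<N} - S" for t
    using that S finite_subset[OF S(1)] by (intro kchainD[OF assms(2)]) auto
  then show "D u S \<in> A \<and> D u S \<in> H (j - int i)"
    unfolding kdiff_def
    by (intro conjI submod_sum[OF assms(1)] H_sum submod_sgnp[OF assms(1)] H_sgnp submod_X[OF assms(1)])
       (use X_H[of _ _ "j - int (Suc i)"] in auto)
next
  fix S assume S: "\<not> (S \<subseteq> {..<N} \<and> card S = i)"
  have "u (insert t S) = 0" if "t \<in> {..<N} - S" for t
    using that S kchain_zero[OF assms(2), of "insert t S"] finite_subset[of S "{..<N}"]
    by (cases "S \<subseteq> {..<N}") auto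
  then show "D u S = 0" by (simp add: kdiff_def)
qed

lemma kdiff_chain0: "u \<in> C 0 j A \<Longrightarrow> D u S = 0"
proof -
  assume u: "u \<in> C 0 j A"
  have "u (insert t S) = 0" if "t \<in> {..<N} - S" for t
    using kchain_zero[OF u, of "insert t S"] finite_subset[of "insert t S" "{..<N}"] by fastforce
  then show ?thesis by (simp add: kdiff_def)
qed

text \<open>The terms for \<open>(t, t')\<close> and for \<open>(t', t)\<close> carry the same
  value. Having the smaller index in the set moves the larger one by one position, so the two signs
  are opposite.\<close>

lemma kdiff_kdiff: "D (D u) S = 0"
proof -
  let ?f = "\<lambda>t t'. sgnp (ksign S t + ksign (insert t S) t') (X t (X t' (u (insert t' (insert t S)))))"
  let ?T = "{..<N} - S"
  have "D (D u) S = (\<Sum>t\<in>?T. \<Sum>t'\<in>?T - {t}. ?f t t')"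
    unfolding kdiff_def by (auto simp: X_sum sgnp_sum X_sgnp intro!: sum.cong)
  also have "\<dots> = (\<Sum>t\<in>?T. \<Sum>t'\<in>{t'\<in>?T. t < t'}. ?f t t') + (\<Sum>t\<in>?T. \<Sum>t'\<in>{t'\<in>?T. t' < t}. ?f t t')"
    unfolding sum.distrib[symmetric]
  proof (rule sum.cong)
    fix t
    have "(\<Sum>t'\<in>?T - {t}. ?f t t') = (\<Sum>t'\<in>{t'\<in>?T. t < t'} \<union> {t'\<in>?T. t' < t}. ?f t t')"
      by (rule sum.cong) auto
    then show "(\<Sum>t'\<in>?T - {t}. ?f t t') = (\<Sum>t'\<in>{t'\<in>?T. t < t'}. ?f t t') + (\<Sum>t'\<in>{t'\<in>?T. t' < t}. ?f t t')"
      by (subst (asm) sum.union_disjoint) auto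
  qed auto
  also have "(\<Sum>t\<in>?T. \<Sum>t'\<in>{t'\<in>?T. t' < t}. ?f t t') = (\<Sum>t\<in>?T. \<Sum>t'\<in>{t'\<in>?T. t < t'}. ?f t' t)"
    by (rule sum.swap_restrict) auto
  also have "(\<Sum>t\<in>?T. \<Sum>t'\<in>{t'\<in>?T. t < t'}. ?f t t') + \<dots> =
      (\<Sum>t\<in>?T. \<Sum>t'\<in>{t'\<in>?T. t < t'}. ?f t t' + ?f t' t)"
    by (simp add: sum.distrib)
  also have "\<dots> = 0"
  proof (rule sum.neutral, rule ballI, rule sum.neutral, rule ballI)
    fix t t' assume "t \<in> ?T" "t' \<in> {t'\<in>?T. t < t'}"
    then have "odd ((ksign S t + ksign (insert t S) t') + (ksign S t' + ksign (insert t' S) t))"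
      by (auto simp: ksign_insert)
    from sgnp_cancel[OF this, of "X t (X t' (u (insert t' (insert t S))))"]
    show "?f t t' + ?f t' t = 0" by (simp add: X_comm[of t'] insert_commute)
  qed
  finally show ?thesis .
qed

text \<open>If \<open>t\<close> is not in \<open>S\<close>, only the term for \<open>t\<close> of
  the first boundary survives. If it is, the term for \<open>t\<close> in the second summand gives
  \<open>X t (u S)\<close>, and the remaining terms of the two sums cancel in pairs by their
  signs.\<close>

lemma khom_homotopy:
  assumes t: "t < N"
  shows "D (khom t u) S + khom t (D u) S = X t (u S)"
proof (cases "t \<in> S")
  case True
  define S0 where "S0 = S - {t}"
  have S: "S = insert t S0" "t \<notin> S0" using True by (auto simp: S0_def)
  let ?T = "{..<N} - S"
  have T: "{..<N} - S0 = insert t ?T" using S t by auto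
  have "khom t (D u) S = sgnp (ksign S t) (D u S0)"
    using True by (simp add: khom_def S0_def)
  also have "\<dots> = X t (u S) + (\<Sum>t'\<in>?T. sgnp (ksign S t + ksign S0 t') (X t' (u (insert t' S0))))"
    unfolding kdiff_def T using S
    by (subst sum.insert) (auto simp: sgnp_add sgnp_sum ksign_insert sgnp_even)
  finally have 1: "khom t (D u) S = \<dots>" .
  have "D (khom t u) S = (\<Sum>t'\<in>?T. sgnp (ksign S t' + ksign (insert t' S) t) (X t' (u (insert t' S0))))"
    unfolding kdiff_def
  proof (rule sum.cong)
    fix t' assume "t' \<in> ?T"
    then have "insert t' S - {t} = insert t' S0" using S by auto
    then show "sgnp (ksign S t') (X t' (khom t u (insert t' S))) =
      sgnp (ksign S t' + ksign (insert t' S) t) (X t' (u (insert t' S0)))"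
      using True by (simp add: khom_def X_sgnp)
  qed simp
  with 1 have "D (khom t u) S + khom t (D u) S = X t (u S) +
    (\<Sum>t'\<in>?T. sgnp (ksign S t' + ksign (insert t' S) t) (X t' (u (insert t' S0))) +
       sgnp (ksign S t + ksign S0 t') (X t' (u (insert t' S0))))"
    by (simp add: sum.distrib)
  also have "(\<Sum>t'\<in>?T. sgnp (ksign S t' + ksign (insert t' S) t) (X t' (u (insert t' S0))) +
       sgnp (ksign S t + ksign S0 t') (X t' (u (insert t' S0)))) = 0"
  proof (rule sum.neutral, rule ballI, rule sgnp_cancel)
    fix t' assume t': "t' \<in> ?T"
    then have "ksign S t' = ksign S0 t' + (if t < t' then 1 else 0)" 
      "ksign (insert t' S) t = ksign S t + (if t' < t then 1 else 0)" "t \<noteq> t'"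
      using S by (auto simp: ksign_insert)
    then show "odd (ksign S t' + ksign (insert t' S) t + (ksign S t + ksign S0 t'))"
      by auto
  qed
  finally show ?thesis by simp
next
  case False
  have "D (khom t u) S = (\<Sum>t'\<in>{t}. sgnp (ksign S t') (X t' (khom t u (insert t' S))))"
    unfolding kdiff_def by (rule sum.mono_neutral_right) (use False t in \<open>auto simp: khom_def\<close>)
  also have "\<dots> = X t (u S)"
    using False by (simp add: khom_def X_sgnp ksign_insert sgnp_even)
  finally show ?thesis using False by (simp add: khom_def)
qed

lemma khom_chain:
  assumes "submod A" "u \<in> C i j A" "t < N"
  shows "khom t u \<in> C (Suc i) (j + 1) A"
proof (rule kchainI)
  fix S assume S: "S \<subseteq> {..<N}" "card S = Suc i"
  show "khom t u S \<in> A \<and> khom t u S \<in> H (j + 1 - int (Suc i))"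
  proof (cases "t \<in> S")
    case True
    have "u (S - {t}) \<in> A \<and> u (S - {t}) \<in> H (j - int i)"
      using S True finite_subset[OF S(1)] by (intro kchainD[OF assms(2)]) auto
    then show ?thesis using True by (auto simp: khom_def submod_sgnp[OF assms(1)] H_sgnp)
  qed (auto simp: khom_def submod_0[OF assms(1)] H_0)
next
  fix S assume S: "\<not> (S \<subseteq> {..<N} \<and> card S = Suc i)"
  then have "u (S - {t}) = 0" if "t \<in> S"
    using that assms(3) card_Suc_Diff1[of S t] card.infinite[of "S - {t}"]
      finite_subset[of "S - {t}" "{..<N}"]
    by (intro kchain_zero[OF assms(2)]) (auto dest: finite_subset)
  then show "khom t u S = 0" by (auto simp: khom_def)
qed

lemma kregD:
  assumes "kreg N X H r A B" "j > int i + r" "u \<in> C i j A" "\<And>S. D u S \<in> B"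
  obtains v where "v \<in> C (Suc i) j A" "\<And>S. u S - D v S \<in> B"
  using assms unfolding kreg_def by blast

lemma kreg_mono: "kreg N X H r A B \<Longrightarrow> r \<le> r' \<Longrightarrow> kreg N X H r' A B"
  unfolding kreg_def by fastforce

text \<open>The middle term of the long exact homology sequence of \<open>0 \<rightarrow> B/E
  \<rightarrow> A/E \<rightarrow> A/B \<rightarrow> 0\<close>, carried out on chains: a cycle is
  first corrected to lie in \<open>B\<close> and then bounded there.\<close>

lemma kreg_ext:
  assumes "submod A" "submod B" "submod E" "E \<subseteq> B" "B \<subseteq> A"
    and AB: "kreg N X H r A B" and BE: "kreg N X H r B E"
  shows "kreg N X H r A E"
  unfolding kreg_def
proof (intro allI impI)
  fix i j u assume *: "j > int i + r" "u \<in> C i j A" "\<forall>S. D u S \<in> E"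
  then obtain v where v: "v \<in> C (Suc i) j A" "\<And>S. u S - D v S \<in> B"
    using kregD[OF AB *(1,2)] *(3) assms(4) by blast
  have "(\<lambda>S. u S - D v S) \<in> C i j A" using * v assms by (intro kchain_diff kdiff_chain) auto
  then have "(\<lambda>S. u S - D v S) \<in> C i j B" using v(2) by (rule kchain_subset)
  moreover have "D (\<lambda>S. u S - D v S) S \<in> E" for S using * by (simp add: kdiff_diff kdiff_kdiff)
  ultimately obtain w where w: "w \<in> C (Suc i) j B" "\<And>S. u S - D v S - D w S \<in> E"
    by (rule kregD[OF BE *(1)]) blast
  show "\<exists>v\<in>C (Suc i) j A. \<forall>S. u S - D v S \<in> E"
  proof (rule bexI[of _ "\<lambda>S. v S + w S"])
    show "(\<lambda>S. v S + w S) \<in> C (Suc i) j A"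
      using kchain_mono[OF w(1) assms(5)] by (intro kchain_add assms v)
  qed (use w in \<open>simp add: kdiff_add diff_diff_eq\<close>)
qed

text \<open>A cycle of \<open>B/E\<close> that bounds in \<open>A/E\<close> comes through the
  connecting map from a cycle of \<open>A/B\<close> in homological degree \<open>i + 1\<close> and
  the same internal degree; this is why the bound for \<open>A/B\<close> must be smaller by
  one.\<close>

lemma kreg_ker:
  assumes "submod A" "submod B" "submod E" "E \<subseteq> B" "B \<subseteq> A"
    and AE: "kreg N X H r A E" and AB: "kreg N X H r' A B" and r: "r' + 1 \<le> r"
  shows "kreg N X H r B E"
  unfolding kreg_def
proof (intro allI impI)
  fix i j u assume *: "j > int i + r" "u \<in> C i j B" "\<forall>S. D u S \<in> E"
  then obtain v where v: "v \<in> C (Suc i) j A" "\<And>S. u S - D v S \<in> E"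
    using kregD[OF AE *(1) kchain_mono[OF *(2) assms(5)]] *(3) by blast
  have "D v S \<in> B" for S
    using submod_diff[OF assms(2) kchain_in[OF assms(2) *(2), of S], of "u S - D v S"] v(2) assms(4) by auto
  moreover have "j > int (Suc i) + r'" using * r by simp
  ultimately obtain w where w: "w \<in> C (Suc (Suc i)) j A" "\<And>S. v S - D w S \<in> B"
    using kregD[OF AB _ v(1)] by blast
  show "\<exists>v\<in>C (Suc i) j B. \<forall>S. u S - D v S \<in> E"
  proof (rule bexI[of _ "\<lambda>S. v S - D w S"])
    have "(\<lambda>S. v S - D w S) \<in> C (Suc i) j A" using v w assms by (intro kchain_diff kdiff_chain) auto
    then show "(\<lambda>S. v S - D w S) \<in> C (Suc i) j B" using w(2) by (rule kchain_subset)
  qed (use v in \<open>simp add: kdiff_diff kdiff_kdiff\<close>)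
qed

text \<open>The connecting map sends a cycle of \<open>A/B\<close> to its boundary in
  \<open>B/E\<close>, one homological degree lower at the same internal degree, so the bound for
  \<open>B/E\<close> may be larger by one.\<close>

lemma kreg_coker:
  assumes "submod A" "submod B" "submod E" "E \<subseteq> B" "B \<subseteq> A"
    and BE: "kreg N X H r' B E" and AE: "kreg N X H r A E" and r: "r' \<le> r + 1"
  shows "kreg N X H r A B"
  unfolding kreg_def
proof (intro allI impI)
  fix i j u assume *: "j > int i + r" "u \<in> C i j A" "\<forall>S. D u S \<in> B"
  have "\<exists>w\<in>C i j B. \<forall>S. D u S - D w S \<in> E"
  proof (cases i)
    case 0
    then show ?thesis using * kchain_0[OF assms(2)] kdiff_chain0[of u j A] submod_0[OF assms(3)]
      by (intro bexI[of _ "\<lambda>_. 0"]) (auto simp: kdiff_def)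
  next
    case (Suc k)
    have "D u \<in> C k j B"
      by (rule kchain_subset[of _ _ _ A]) (use * assms(1) Suc in \<open>auto intro: kdiff_chain\<close>)
    moreover have "D (D u) S \<in> E" for S by (simp add: kdiff_kdiff submod_0[OF assms(3)])
    moreover have "j > int k + r'" using * r Suc by simp
    ultimately obtain w where "w \<in> C (Suc k) j B" "\<And>S. D u S - D w S \<in> E"
      using kregD[OF BE] by blast
    then show ?thesis using Suc by blast
  qed
  then obtain w where w: "w \<in> C i j B" "\<And>S. D u S - D w S \<in> E" by blast
  have "(\<lambda>S. u S - w S) \<in> C i j A" by (intro kchain_diff assms * kchain_mono[OF w(1)])
  moreover have "D (\<lambda>S. u S - w S) S \<in> E" for S using w by (simp add: kdiff_diff)
  ultimately obtain v where v: "v \<in> C (Suc i) j A" "\<And>S. u S - w S - D v S \<in> E"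
    by (rule kregD[OF AE *(1)]) blast
  show "\<exists>v\<in>C (Suc i) j A. \<forall>S. u S - D v S \<in> B"
  proof (intro bexI[OF _ v(1)] allI)
    fix S
    have "u S - w S - D v S + w S \<in> B"
      by (rule submod_add[OF assms(2)]) (use v(2) assms(4) kchain_in[OF assms(2) w(1)] in auto)
    then show "u S - D v S \<in> B" by (simp add: algebra_simps)
  qed
qed

text \<open>Multiplication by a variable is null-homotopic on the Koszul complex.\<close>

lemma kreg_lift:
  assumes "submod A" "submod P" "t < N" "P \<subseteq> Q"
    and nzd: "\<And>a. a \<in> A \<Longrightarrow> X t a \<in> P \<Longrightarrow> a \<in> P"
    and Q: "\<And>e q. q \<in> Q \<Longrightarrow> q \<in> A \<Longrightarrow> q \<in> H e \<Longrightarrow> \<exists>w. w \<in> A \<and> w \<in> H (e - 1) \<and> q - X t w \<in> P"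
    and AQ: "kreg N X H r A Q"
  shows "kreg N X H r A P"
  unfolding kreg_def
proof (intro allI impI)
  fix i j u assume *: "j > int i + r" "u \<in> C i j A" "\<forall>S. D u S \<in> P"
  then obtain v where v: "v \<in> C (Suc i) j A" "\<And>S. u S - D v S \<in> Q"
    using kregD[OF AQ *(1,2)] *(3) assms(4) by blast
  define u' where "u' = (\<lambda>S. u S - D v S)"
  have u': "u' \<in> C i j A" unfolding u'_def by (intro kchain_diff kdiff_chain assms(1) v *)
  have "\<forall>S. \<exists>w. S \<subseteq> {..<N} \<and> card S = i \<longrightarrow> w \<in> A \<and> w \<in> H (j - int i - 1) \<and> u' S - X t w \<in> P"
    using Q v(2) kchainD[OF u'] by (fastforce simp: u'_def)
  then obtain w0 where w0: "\<And>S. S \<subseteq> {..<N} \<Longrightarrow> card S = i \<Longrightarrow> 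
      w0 S \<in> A \<and> w0 S \<in> H (j - int i - 1) \<and> u' S - X t (w0 S) \<in> P" by metis
  define w where "w = (\<lambda>S. if S \<subseteq> {..<N} \<and> card S = i then w0 S else 0)"
  have w: "w \<in> C i (j - 1) A"
    using w0 by (intro kchainI) (auto simp: w_def algebra_simps)
  have uw: "u' S - X t (w S) \<in> P" for S
    using w0[of S] kchain_zero[OF u', of S] submod_0[OF assms(2)] by (auto simp: w_def)
  \<comment> \<open>Since \<open>X t\<close> is regular modulo \<open>P\<close>, the cycle condition
    on \<open>X t w\<close> becomes one on \<open>w\<close>; the homotopy then exhibits
    \<open>X t w\<close> as a boundary modulo \<open>P\<close>.\<close>
  have "D w S \<in> P" for S
  proof (rule nzd)
    show "D w S \<in> A" by (rule kdiff_in[OF assms(1)]) (rule kchain_in[OF assms(1) w])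
    have "D u' S - X t (D w S) \<in> P"
      using kdiff_in[OF assms(2), of "\<lambda>S. u' S - X t (w S)" S] uw by (simp add: kdiff_diff kdiff_X)
    moreover have "D u' S \<in> P" using * by (simp add: u'_def kdiff_diff kdiff_kdiff)
    ultimately have "D u' S - (D u' S - X t (D w S)) \<in> P" by (rule submod_diff[OF assms(2), rotated])
    then show "X t (D w S) \<in> P" by simp
  qed
  then have h: "khom t (D w) S \<in> P" for S by (rule khom_in[OF assms(2)])
  show "\<exists>v\<in>C (Suc i) j A. \<forall>S. u S - D v S \<in> P"
  proof (intro bexI[of _ "\<lambda>S. v S + khom t w S"] allI)
    show "(\<lambda>S. v S + khom t w S) \<in> C (Suc i) j A"
      using khom_chain[OF assms(1) w assms(3)] by (intro kchain_add assms(1) v) simp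
    fix S
    have "u S - D (\<lambda>S. v S + khom t w S) S = u' S - X t (w S) + khom t (D w) S"
      unfolding khom_homotopy[OF assms(3), of w S, symmetric] by (simp add: u'_def kdiff_add)
    then show "u S - D (\<lambda>S. v S + khom t w S) S \<in> P"
      using submod_add[OF assms(2) uw h] by simp
  qed
qed

text \<open>An element is a 0-chain, supported on the empty set, and every 0-chain is a cycle; to
  bound modulo \<open>B\<close> means to be a combination of the variables modulo
  \<open>B\<close>.\<close>

lemma kreg_generated:
  assumes "submod A" "submod B" "kreg N X H r A B" "a \<in> A" "a \<in> H e" "e > r"
  obtains v where "\<And>t. t < N \<Longrightarrow> v t \<in> A \<and> v t \<in> H (e - 1)" "a - (\<Sum>t<N. X t (v t)) \<in> B"
proof -
  define u where "u = (\<lambda>S::nat set. if S = {} then a else 0)"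
  have u: "u \<in> C 0 e A"
    using assms by (intro kchainI) (auto simp: u_def finite_subset card_eq_0_iff dest: finite_subset)
  have "D u S \<in> B" for S using submod_0[OF assms(2)] by (auto simp: kdiff_def u_def)
  then obtain v where v: "v \<in> C (Suc 0) e A" "\<And>S. u S - D v S \<in> B"
    using kregD[OF assms(3) _ u] assms(6) by auto
  show ?thesis
  proof (rule that[of "\<lambda>t. v {t}"])
    show "v {t} \<in> A \<and> v {t} \<in> H (e - 1)" if "t < N" for t
      using kchainD[OF v(1), of "{t}"] that by simp
    show "a - (\<Sum>t<N. X t (v {t})) \<in> B"
      using v(2)[of "{}"] by (simp add: u_def kdiff_def ksign_def)
  qed
qed

end

text \<open>The map only has to induce an isomorphism of \<open>A/B\<close> with
  \<open>A'/B'\<close> degree by degree, up to the shift \<open>c\<close>. Preimages are chosen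
  coefficient by coefficient, so no inverse map on the modules themselves is involved.\<close>

lemma kreg_iso:
  assumes "graded_action N X H" "graded_action N X' H'"
    and A: "graded_action.submod N X A" and B: "graded_action.submod N X B"
    and A': "graded_action.submod N X' A'" and B': "graded_action.submod N X' B'"
    and f_add: "\<And>a b. f (a + b) = f a + f b"
    and f_X: "\<And>i a. i < N \<Longrightarrow> f (X i a) = X' i (f a)"
    and f_H: "\<And>a e. a \<in> A \<Longrightarrow> a \<in> H e \<Longrightarrow> f a \<in> A' \<and> f a \<in> H' (e + c)"
    and surj: "\<And>y e. y \<in> A' \<Longrightarrow> y \<in> H' (e + c) \<Longrightarrow> \<exists>x. x \<in> A \<and> x \<in> H e \<and> y - f x \<in> B'"
    and inj: "\<And>x. x \<in> A \<Longrightarrow> f x \<in> B' \<longleftrightarrow> x \<in> B"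
  shows "kreg N X H r A B \<longleftrightarrow> kreg N X' H' (r + c) A' B'"
proof -
  interpret M: graded_action N X H by fact
  interpret M': graded_action N X' H' by fact
  have f0: "f 0 = 0" using f_add[of 0 0] by simp
  have fm: "f (- a) = - f a" for a
    using f_add[of a "- a"] f0 by (simp add: eq_neg_iff_add_eq_0 add.commute)
  have fd: "f (a - b) = f a - f b" for a b using f_add[of a "- b"] fm[of b] by simp
  have fs: "f (sum g I) = (\<Sum>i\<in>I. f (g i))" for g :: "nat \<Rightarrow> _" and I
    by (induction I rule: infinite_finite_induct) (auto simp: f0 f_add)
  have fD: "M'.D (\<lambda>S. f (u S)) S = f (M.D u S)" for u S
    unfolding kdiff_def fs by (rule sum.cong) (auto simp: sgnp_def fm f_X)
  have fC: "(\<lambda>S. f (u S)) \<in> M'.C i (j + c) A'" if u: "u \<in> M.C i j A" for u i j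
  proof (rule kchainI)
    fix S assume "S \<subseteq> {..<N}" "card S = i"
    then show "f (u S) \<in> A' \<and> f (u S) \<in> H' (j + c - int i)"
      using f_H[of "u S" "j - int i"] kchainD[OF u] by (simp add: algebra_simps)
  qed (use kchain_zero[OF u] f0 in auto)
  have lift: "\<exists>u\<in>M.C i j A. \<forall>S. u' S - f (u S) \<in> B'" if u': "u' \<in> M'.C i (j + c) A'" for u' i j
  proof -
    have "\<forall>S. \<exists>x. S \<subseteq> {..<N} \<and> card S = i \<longrightarrow> x \<in> A \<and> x \<in> H (j - int i) \<and> u' S - f x \<in> B'"
      using surj[of _ "j - int i"] kchainD[OF u'] by (auto simp: algebra_simps)
    then obtain x where x: "\<And>S. S \<subseteq> {..<N} \<Longrightarrow> card S = i \<Longrightarrow> x S \<in> A \<and> x S \<in> H (j - int i) \<and> u' S - f (x S) \<in> B'"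
      by metis
    show ?thesis
    proof (intro bexI[of _ "\<lambda>S. if S \<subseteq> {..<N} \<and> card S = i then x S else 0"] allI)
      show "u' S - f (if S \<subseteq> {..<N} \<and> card S = i then x S else 0) \<in> B'" for S
        using x[of S] kchain_zero[OF u', of S] M'.submod_0[OF B'] f0 by auto
    qed (use x in \<open>auto intro!: kchainI split: if_splits\<close>)
  qed
  show ?thesis
  proof
    assume *: "kreg N X H r A B"
    show "kreg N X' H' (r + c) A' B'"
      unfolding kreg_def
    proof (intro allI impI)
      fix i j u' assume 1: "j > int i + (r + c)" "u' \<in> M'.C i j A'" "\<forall>S. M'.D u' S \<in> B'"
      have "u' \<in> M'.C i (j - c + c) A'" using 1(2) by simp
      from lift[OF this] obtain u where u: "u \<in> M.C i (j - c) A" "\<And>S. u' S - f (u S) \<in> B'"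
        by blast
      have DuA: "M.D u S \<in> A" for S
        by (rule M.kdiff_in[OF A]) (rule M.kchain_in[OF A u(1)])
      have Du: "M.D u S \<in> B" for S
      proof -
        have "M'.D u' S - f (M.D u S) \<in> B'"
          using M'.kdiff_in[OF B', of "\<lambda>S. u' S - f (u S)" S] u(2) by (simp add: M'.kdiff_diff fD)
        then have "M'.D u' S - (M'.D u' S - f (M.D u S)) \<in> B'"
          by (rule M'.submod_diff[OF B' 1(3)[rule_format]])
        then show ?thesis using inj[OF DuA] by simp
      qed
      have "int i + r < j - c" using 1(1) by simp
      from M.kregD[OF * this u(1) Du]
      obtain v where v: "v \<in> M.C (Suc i) (j - c) A" "\<And>S. u S - M.D v S \<in> B"
        by blast
      show "\<exists>v\<in>M'.C (Suc i) j A'. \<forall>S. u' S - M'.D v S \<in> B'"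
      proof (intro bexI[of _ "\<lambda>S. f (v S)"] allI)
        show "(\<lambda>S. f (v S)) \<in> M'.C (Suc i) j A'" using fC[OF v(1)] by simp
        fix S
        have "u S - M.D v S \<in> A"
          by (intro M.submod_diff[OF A] M.kdiff_in[OF A] M.kchain_in[OF A u(1)] M.kchain_in[OF A v(1)])
        then have "f (u S - M.D v S) \<in> B'"
          using inj v(2) by blast
        then have "u' S - f (u S) + f (u S - M.D v S) \<in> B'" by (intro M'.submod_add[OF B'] u)
        then show "u' S - M'.D (\<lambda>S. f (v S)) S \<in> B'" by (simp add: fD fd)
      qed
    qed
  next
    assume *: "kreg N X' H' (r + c) A' B'"
    show "kreg N X H r A B"
      unfolding kreg_def
    proof (intro allI impI)
      fix i j u assume 1: "j > int i + r" "u \<in> M.C i j A" "\<forall>S. M.D u S \<in> B"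
      have "M.D u S \<in> A" for S
        by (rule M.kdiff_in[OF A]) (rule M.kchain_in[OF A 1(2)])
      then have Du: "M'.D (\<lambda>S. f (u S)) S \<in> B'" for S
        using inj 1(3) by (simp add: fD)
      have "int i + (r + c) < j + c" using 1(1) by simp
      from M'.kregD[OF * this fC[OF 1(2)] Du]
      obtain v' where v': "v' \<in> M'.C (Suc i) (j + c) A'" "\<And>S. f (u S) - M'.D v' S \<in> B'"
        by blast
      obtain v where v: "v \<in> M.C (Suc i) j A" "\<And>S. v' S - f (v S) \<in> B'"
        using lift[OF v'(1)] by blast
      show "\<exists>v\<in>M.C (Suc i) j A. \<forall>S. u S - M.D v S \<in> B"
      proof (intro bexI[OF _ v(1)] allI)
        fix S
        have "M'.D v' S - f (M.D v S) \<in> B'"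
          using M'.kdiff_in[OF B', of "\<lambda>S. v' S - f (v S)" S] v(2) by (simp add: M'.kdiff_diff fD)
        then have "(f (u S) - M'.D v' S) + (M'.D v' S - f (M.D v S)) \<in> B'"
          by (intro M'.submod_add[OF B'] v')
        moreover have "u S - M.D v S \<in> A"
          by (intro M.submod_diff[OF A] M.kdiff_in[OF A] M.kchain_in[OF A 1(2)] M.kchain_in[OF A v(1)])
        ultimately show "u S - M.D v S \<in> B"
          using inj[of "u S - M.D v S"] by (simp add: fd)
      qed
    qed
  qed
qed

subsection \<open>Coprime leading monomials\<close>

definition lead :: "(nat \<Rightarrow> nat) \<Rightarrow> (nat \<Rightarrow>\<^sub>0 nat) \<Rightarrow> 'k::comm_ring_1 mpoly \<Rightarrow> bool" where
  "lead w l f \<longleftrightarrow> coef f l \<noteq> 0 \<and> (\<forall>m\<in>mons f. m \<noteq> l \<longrightarrow> wt w m < wt w l)"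

definition mdvd :: "(nat \<Rightarrow>\<^sub>0 nat) \<Rightarrow> (nat \<Rightarrow>\<^sub>0 nat) \<Rightarrow> bool" where
  "mdvd l m \<longleftrightarrow> (\<exists>k. m = l + k)"

definition reduced :: "(nat \<Rightarrow>\<^sub>0 nat) set \<Rightarrow> 'k::comm_ring_1 mpoly \<Rightarrow> bool" where
  "reduced L p \<longleftrightarrow> (\<forall>m\<in>mons p. \<forall>l\<in>L. \<not> mdvd l m)"

lemma mdvd_iff: "mdvd l m \<longleftrightarrow> (\<forall>i. coef l i \<le> coef m i)"
proof
  assume "\<forall>i. coef l i \<le> coef m i"
  then have "m = l + (m - l)" by (intro poly_mapping_eqI) (simp add: lookup_add lookup_minus)
  then show "mdvd l m" by (auto simp: mdvd_def)
qed (auto simp: mdvd_def lookup_add)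

lemma mdvd_coprime: "mdvd l (a + m) \<Longrightarrow> mons l \<inter> mons a = {} \<Longrightarrow> mdvd l m"
  unfolding mdvd_iff by (auto simp: lookup_add in_keys_iff) (metis IntI add_0 empty_iff in_keys_iff le0)

lemma reduced_0 [simp]: "reduced L 0"
  by (simp add: reduced_def)

lemma reduced_add: "reduced L p \<Longrightarrow> reduced L q \<Longrightarrow> reduced L (p + q)"
  using keys_add[of p q] by (auto simp: reduced_def)

lemma reduced_diff: "reduced L p \<Longrightarrow> reduced L q \<Longrightarrow> reduced L (p - q)"
  using mons_diff_subset[of p q] by (auto simp: reduced_def)

text \<open>Division with remainder, by induction on the weight bound: cancelling a monomial against
  a leading term leaves only monomials of strictly smaller weight. Terms are treated one at a time,
  since many monomials may share a weight. The bound on the remainder serves to compare top parts in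
  \<open>lead_mult_normal_form\<close>.\<close>

lemma normal_form:
  fixes F :: "'k::field mpoly set"
  assumes F: "F \<subseteq> polyring N" and lead: "\<And>f. f \<in> F \<Longrightarrow> lead w (lm f) f"
    and p: "p \<in> polyring N" "\<And>m. m \<in> mons p \<Longrightarrow> wt w m < c"
  obtains r where "r \<in> polyring N" "reduced (lm ` F) r" "p - r \<in> ideal_gen N F"
    "\<And>m. m \<in> mons r \<Longrightarrow> wt w m < c"
proof -
  note I = rideal_ideal_gen[OF F]
  define Q where "Q c p \<longleftrightarrow> (\<exists>r. r \<in> polyring N \<and> reduced (lm ` F) r \<and> p - r \<in> ideal_gen N F \<and>
    (\<forall>m\<in>mons r. wt w m < c))" for c and p :: "'k mpoly"
  have Q_add: "Q c (p + q)" if "Q c p" "Q c q" for c p q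
  proof -
    from that obtain r s where "r \<in> polyring N" "reduced (lm ` F) r" "p - r \<in> ideal_gen N F"
      "\<forall>m\<in>mons r. wt w m < c" "s \<in> polyring N" "reduced (lm ` F) s" "q - s \<in> ideal_gen N F"
      "\<forall>m\<in>mons s. wt w m < c" by (auto simp: Q_def)
    then show ?thesis
      unfolding Q_def using keys_add[of r s] rideal_add[OF I, of "p - r" "q - s"]
      by (intro exI[of _ "r + s"]) (auto simp: reduced_add algebra_simps)
  qed
  have Q_0: "Q c 0" for c
    unfolding Q_def by (rule exI[of _ 0]) (simp add: rideal_0[OF I])
  have "Q c p" if "p \<in> polyring N" "\<forall>m\<in>mons p. wt w m < c" for p c
    using that
  proof (induction c arbitrary: p rule: less_induct)
    case (less c)
    have "Q c (mterm m a)" if m: "mons m \<subseteq> {..<N}" "wt w m < c" for m a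
    proof (cases "\<exists>f\<in>F. mdvd (lm f) m")
      case False
      then show ?thesis unfolding Q_def using m
        by (intro exI[of _ "mterm m a"]) (auto simp: reduced_def polyring_term rideal_0[OF I])
    next
      case True
      then obtain f k where f: "f \<in> F" "m = lm f + k" by (auto simp: mdvd_def)
      define l where "l = lm f"
      have l: "coef f l \<noteq> 0" "\<And>m. m \<in> mons f \<Longrightarrow> m \<noteq> l \<Longrightarrow> wt w m < wt w l"
        using lead[OF f(1)] by (auto simp: lead_def l_def)
      define t where "t = mterm k (a / coef f l) * f"
      have k: "mterm k b \<in> polyring N" for b :: 'k
        using m f by (intro polyring_term) (auto simp: mons_add_nat)
      have t: "t \<in> ideal_gen N F" unfolding t_def by (intro rideal_mult[OF I] k ideal_gen_superset f)
      have "coef t m = a" using coef_term_mult[of k "a / coef f l" f l] l f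
        by (simp add: t_def l_def add.commute)
      then have "wt w m' < wt w m" if "m' \<in> mons (mterm m a - t)" for m'
      proof -
        have "m' \<noteq> m" using that \<open>coef t m = a\<close> by (auto simp: in_keys_iff lookup_minus)
        with that have "m' \<in> mons t" using mons_diff_subset[of "mterm m a" t] by (auto split: if_splits)
        then obtain m'' where "m'' \<in> mons f" "m' = k + m''" using mons_term_mult[of k "a / coef f l" f] by (auto simp: t_def)
        then show ?thesis using l(2)[of m''] \<open>m' \<noteq> m\<close> f by (auto simp: l_def add.commute)
      qed
      moreover have "mterm m a - t \<in> polyring N"
        using polyring_term[OF m(1)] rideal_polyring[OF I t] by auto
      ultimately have "Q (wt w m) (mterm m a - t)" using less.IH m by auto
      then obtain r where "r \<in> polyring N" "reduced (lm ` F) r" "mterm m a - t - r \<in> ideal_gen N F"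
        "\<forall>m'\<in>mons r. wt w m' < wt w m" by (auto simp: Q_def)
      moreover from rideal_add[OF I this(3) t] have "mterm m a - r \<in> ideal_gen N F" by (simp add: algebra_simps)
      ultimately show ?thesis unfolding Q_def using m by (intro exI[of _ r]) auto
    qed
    then have "Q c (mterm m (coef p m))" if "m \<in> mons p" for m
      using that less.prems polyring_termD by blast
    then show ?case
      by (intro poly_induct_mons[of "Q c" p] Q_0 Q_add)
  qed
  from this[of p c] p have "Q c p" by blast
  then show ?thesis unfolding Q_def by (elim exE conjE) (rule that, auto)
qed

text \<open>Because \<open>l\<close> is coprime to the leading monomials of \<open>F\<close>, the
  part of \<open>a\<close> of top weight times the leading term of \<open>g\<close> is already
  reduced. Everything else in \<open>g * a\<close> has smaller weight and cannot cancel it during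
  reduction.\<close>

lemma lead_mult_normal_form:
  fixes F :: "'k::field mpoly set"
  assumes F: "F \<subseteq> polyring N" and lead: "\<And>f. f \<in> F \<Longrightarrow> lead w (lm f) f"
    and g: "g \<in> polyring N" "lead w l g" "\<And>f. f \<in> F \<Longrightarrow> mons (lm f) \<inter> mons l = {}"
    and a: "a \<in> polyring N" "a \<noteq> 0" "reduced (lm ` F) a"
  obtains s m where "s \<in> polyring N" "reduced (lm ` F) s" "g * a - s \<in> ideal_gen N F" "m \<in> mons s" "mdvd l m"
proof -
  note I = rideal_ideal_gen[OF F]
  define c where "c = Max (wt w ` mons a)"
  have c: "wt w m \<le> c" if "m \<in> mons a" for m using that by (simp add: c_def)
  have "mons a \<noteq> {}" using a by simp
  then have "c \<in> wt w ` mons a" unfolding c_def by (intro Max_in) auto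
  then obtain m0 where m0: "m0 \<in> mons a" "wt w m0 = c" by auto
  define top where "top = pfilter (\<lambda>m. wt w m = c) a"
  define s1 where "s1 = mterm l (coef g l) * top"
  have "mons l \<subseteq> {..<N}" using polyring_termD[OF g(1), of l] g(2) by (auto simp: lead_def in_keys_iff)
  have gl: "coef g l \<noteq> 0" "\<And>m. m \<in> mons g \<Longrightarrow> m \<noteq> l \<Longrightarrow> wt w m < wt w l"
    using g(2) by (auto simp: lead_def)
  have top: "top \<in> polyring N" using a(1) by (auto simp: top_def polyring_def)
  have s1: "s1 \<in> polyring N" unfolding s1_def
    by (intro polyring_mult polyring_term top) fact
  have s1m: "\<exists>m\<in>mons a. m' = l + m" if "m' \<in> mons s1" for m'
    using mons_term_mult[of l "coef g l" top] that by (auto simp: s1_def top_def)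
  have s1_red: "reduced (lm ` F) s1"
    unfolding reduced_def
  proof safe
    fix m' f assume "m' \<in> mons s1" "f \<in> F" "mdvd (lm f) m'"
    then obtain m where "m \<in> mons a" "mdvd (lm f) (l + m)" using s1m by blast
    then show False using mdvd_coprime[of "lm f" l m] g(3)[OF \<open>f \<in> F\<close>] a(3) \<open>f \<in> F\<close> by (auto simp: reduced_def)
  qed
  have "wt w m < wt w l + c" if m: "m \<in> mons (g * a - s1)" for m
  proof (rule ccontr)
    assume neg: "\<not> wt w m < wt w l + c"
    define g' where "g' = pfilter (\<lambda>m. m \<noteq> l) g"
    define a' where "a' = pfilter (\<lambda>m. wt w m \<noteq> c) a"
    have "g - mterm l (coef g l) = g'"
      by (rule poly_mapping_eqI) (auto simp: g'_def lookup_minus lookup_single when_def)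
    moreover have "a - top = a'"
      by (rule poly_mapping_eqI) (auto simp: top_def a'_def lookup_minus)
    moreover have "g * a - s1 = mterm l (coef g l) * (a - top) + (g - mterm l (coef g l)) * a"
      by (simp add: s1_def algebra_simps)
    ultimately have "g * a - s1 = mterm l (coef g l) * a' + g' * a" by simp
    then have "m \<in> mons (mterm l (coef g l) * a') \<or> m \<in> mons (g' * a)" using m keys_add by fastforce
    then show False
    proof
      assume "m \<in> mons (mterm l (coef g l) * a')"
      then obtain k where "k \<in> mons a'" "m = l + k" using mons_term_mult by blast
      then show False using c[of k] neg by (auto simp: a'_def)
    next
      assume "m \<in> mons (g' * a)"
      then obtain x y where "x \<in> mons g'" "y \<in> mons a" "m = x + y" using keys_mult by blast
      then show False using gl(2)[of x] c[of y] neg by (auto simp: g'_def)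
    qed
  qed
  moreover have "g * a - s1 \<in> polyring N" using g a s1 by auto
  ultimately obtain r where r: "r \<in> polyring N" "reduced (lm ` F) r" "g * a - s1 - r \<in> ideal_gen N F"
    "\<And>m. m \<in> mons r \<Longrightarrow> wt w m < wt w l + c"
    using normal_form[OF F lead, of "g * a - s1" "wt w l + c"] by metis
  have "coef r (l + m0) = 0" using r(4)[of "l + m0"] m0 by (auto simp: in_keys_iff)
  moreover have "coef s1 (l + m0) \<noteq> 0"
    using gl m0 by (simp add: s1_def coef_term_mult top_def in_keys_iff)
  ultimately have "l + m0 \<in> mons (s1 + r)" by (simp add: in_keys_iff lookup_add)
  then show ?thesis
    using that[of "s1 + r" "l + m0"] s1 r s1_red by (auto simp: reduced_add diff_diff_eq mdvd_def)
qed

text \<open>Polynomials with pairwise coprime leading monomials form a Groebner basis. In the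
  induction the coefficient of the new \<open>g\<close> may be reduced modulo the rest; if it were
  nonzero, \<open>p\<close> would contain a multiple of the leading monomial of
  \<open>g\<close>.\<close>

lemma reduced_ideal_gen_eq_0:
  fixes F :: "'k::field mpoly set"
  assumes "finite F" "F \<subseteq> polyring N" "\<And>f. f \<in> F \<Longrightarrow> lead w (lm f) f"
    "\<And>f g. f \<in> F \<Longrightarrow> g \<in> F \<Longrightarrow> f \<noteq> g \<Longrightarrow> mons (lm f) \<inter> mons (lm g) = {}"
    "p \<in> ideal_gen N F" "reduced (lm ` F) p"
  shows "p = 0"
  using assms
proof (induction F arbitrary: p)
  case empty
  then show ?case by (auto simp: ideal_gen_def)
next
  case (insert g F)
  have F: "F \<subseteq> polyring N" and g: "g \<in> polyring N" and lead: "\<And>f. f \<in> F \<Longrightarrow> lead w (lm f) f"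
    using insert.prems by auto
  have cop: "\<And>f g. f \<in> F \<Longrightarrow> g \<in> F \<Longrightarrow> f \<noteq> g \<Longrightarrow> mons (lm f) \<inter> mons (lm g) = {}"
    using insert.prems(3) by blast
  have copg: "mons (lm f) \<inter> mons (lm g) = {}" if "f \<in> F" for f
    using insert.prems(3)[of f g] insert.hyps that by blast
  note I = rideal_ideal_gen[OF F]
  have IH: "\<And>p. p \<in> ideal_gen N F \<Longrightarrow> reduced (lm ` F) p \<Longrightarrow> p = 0"
    by (rule insert.IH[OF F lead cop])
  have pF: "reduced (lm ` F) p" using insert.prems by (auto simp: reduced_def)
  obtain a q where a: "a \<in> polyring N" "q \<in> ideal_gen N F" "p = g * a + q"
    using ideal_gen_insert_memE[OF insert.prems(4) F g] by metis
  obtain a0 where a0: "a0 \<in> polyring N" "reduced (lm ` F) a0" "a - a0 \<in> ideal_gen N F"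
    using normal_form[OF F lead a(1), of "Suc (Max (wt w ` mons a))"] by (metis Max_ge finite_imageI finite_keys image_eqI le_imp_less_Suc)
  have "p - g * a0 = g * (a - a0) + q" using a by (simp add: algebra_simps)
  then have p: "p - g * a0 \<in> ideal_gen N F" using rideal_add[OF I rideal_mult[OF I g a0(3)] a(2)] by simp
  show ?case
  proof (cases "a0 = 0")
    case True
    then show ?thesis using IH p pF by simp
  next
    case False
    obtain s m where s: "s \<in> polyring N" "reduced (lm ` F) s" "g * a0 - s \<in> ideal_gen N F" "m \<in> mons s" "mdvd (lm g) m"
      by (rule lead_mult_normal_form[OF F lead g insert.prems(2)[OF insertI1] copg a0(1) False a0(2)])
    have "p - s \<in> ideal_gen N F" using rideal_add[OF I p s(3)] by simp
    then have "p = s" using IH reduced_diff[OF pF s(2)] by fastforce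
    then show ?thesis using s(4,5) insert.prems(5) by (auto simp: reduced_def)
  qed
qed

text \<open>If the normal form of \<open>p\<close> were nonzero, its product with \<open>g\<close>
  would have a nonzero reduced representative although it lies in the ideal. This is the source of
  all complete intersections used here.\<close>

lemma lead_coprime_nzd:
  fixes F :: "'k::field mpoly set"
  assumes "finite F" "F \<subseteq> polyring N" "g \<in> polyring N" "\<And>f. f \<in> F \<Longrightarrow> lead w (lm f) f" "lead w l g"
    "\<And>f f'. f \<in> F \<Longrightarrow> f' \<in> F \<Longrightarrow> f \<noteq> f' \<Longrightarrow> mons (lm f) \<inter> mons (lm f') = {}"
    "\<And>f. f \<in> F \<Longrightarrow> mons (lm f) \<inter> mons l = {}"
    and p: "p \<in> polyring N" "g * p \<in> ideal_gen N F"
  shows "p \<in> ideal_gen N F"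
proof -
  note F = assms(2) and lead = assms(4)
  note I = rideal_ideal_gen[OF F]
  obtain a where a: "a \<in> polyring N" "reduced (lm ` F) a" "p - a \<in> ideal_gen N F"
    using normal_form[OF F lead p(1), of "Suc (Max (wt w ` mons p))"] by (metis Max_ge finite_imageI finite_keys image_eqI le_imp_less_Suc)
  have "a = 0"
  proof (rule ccontr)
    assume "a \<noteq> 0"
    obtain s m where s: "s \<in> polyring N" "reduced (lm ` F) s" "g * a - s \<in> ideal_gen N F" "m \<in> mons s" "mdvd l m"
      by (rule lead_mult_normal_form[OF F lead assms(3,5,7) a(1) \<open>a \<noteq> 0\<close> a(2)])
    have "g * p - g * (p - a) - (g * a - s) \<in> ideal_gen N F"
      by (intro rideal_diff[OF I] p s rideal_mult[OF I] a assms)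
    then have "s \<in> ideal_gen N F" by (simp add: algebra_simps)
    then have "s = 0" using reduced_ideal_gen_eq_0[OF assms(1) F lead assms(6) _ s(2)] by blast
    then show False using s by simp
  qed
  then show ?thesis using a by simp
qed

subsection \<open>Regular sequences on subquotients\<close>

lemma iplus_mono: "A \<subseteq> A' \<Longrightarrow> B \<subseteq> B' \<Longrightarrow> iplus A B \<subseteq> iplus A' B'"
  by (auto simp: iplus_def)

lemma mult_mem_iplus_imul: "rideal N B \<Longrightarrow> a \<in> A \<Longrightarrow> c * a \<in> iplus (imul c A) B"
  using iplus_memI[of "c * a" "imul c A" 0 B] rideal_0[of N B] by (simp add: imul_def)

text \<open>\<open>rreg ts A B\<close>: the sequence \<open>ts\<close> is (weakly) regular on the module \<open>A / B\<close>.\<close>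

primrec rreg :: "'k::comm_ring_1 mpoly list \<Rightarrow> 'k mpoly set \<Rightarrow> 'k mpoly set \<Rightarrow> bool" where
  "rreg [] A B \<longleftrightarrow> True"
| "rreg (t # ts) A B \<longleftrightarrow> (\<forall>g\<in>A. t * g \<in> B \<longrightarrow> g \<in> B) \<and> rreg ts A (iplus B (imul t A))"

text \<open>Multiplication by \<open>c\<close> identifies \<open>A / B\<close> with
  \<open>A' / B'\<close>. Both hypotheses on \<open>c\<close> persist when \<open>t A\<close> is
  added to \<open>B\<close> and \<open>t A'\<close> to \<open>B'\<close>, which is the induction
  step.\<close>

lemma rreg_iso:
  assumes "rideal N A" "rideal N B" "rideal N A'" "rideal N B'" "c \<in> polyring N" "set ts \<subseteq> polyring N"
    "A' = iplus (imul c A) B'" "\<And>a. a \<in> A \<Longrightarrow> c * a \<in> B' \<longleftrightarrow> a \<in> B"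
  shows "rreg ts A B \<longleftrightarrow> rreg ts A' B'"
  using assms
proof (induction ts arbitrary: B B')
  case (Cons t ts)
  note A = Cons.prems(1) and B = Cons.prems(2) and A' = Cons.prems(3) and B' = Cons.prems(4)
    and c = Cons.prems(5) and A'_eq = Cons.prems(7) and inj = Cons.prems(8)
  have t: "t \<in> polyring N" using Cons.prems(6) by simp
  have cA: "c * a \<in> A'" if "a \<in> A" for a
    using that mult_mem_iplus_imul[OF B'] A'_eq by simp
  have B'A: "B' \<subseteq> A'" using iplus_sup2[OF rideal_imul[OF A c]] A'_eq by simp
  have "(\<forall>g\<in>A. t * g \<in> B \<longrightarrow> g \<in> B) \<longleftrightarrow> (\<forall>g\<in>A'. t * g \<in> B' \<longrightarrow> g \<in> B')"
  proof (intro iffI ballI impI)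
    fix g assume *: "\<forall>g\<in>A. t * g \<in> B \<longrightarrow> g \<in> B" and g: "g \<in> A'" "t * g \<in> B'"
    obtain a b where ab: "a \<in> A" "b \<in> B'" "g = c * a + b"
      using g(1) unfolding A'_eq by (auto elim!: iplus_memE simp: imul_def)
    have "t * g - t * b \<in> B'" by (intro rideal_diff[OF B'] g rideal_mult[OF B' t] ab)
    then have "c * (t * a) \<in> B'" using ab by (simp add: algebra_simps)
    then have "a \<in> B" using inj rideal_mult[OF A t] * ab by blast
    then show "g \<in> B'" using ab inj rideal_add[OF B'] by simp
  next
    fix g assume *: "\<forall>g\<in>A'. t * g \<in> B' \<longrightarrow> g \<in> B'" and g: "g \<in> A" "t * g \<in> B"
    have "c * (t * g) \<in> B'" using inj rideal_mult[OF A t g(1)] g by blast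
    then have "t * (c * g) \<in> B'" by (simp add: algebra_simps)
    then show "g \<in> B" using * cA inj g by blast
  qed
  moreover have "rreg ts A (iplus B (imul t A)) \<longleftrightarrow> rreg ts A' (iplus B' (imul t A'))"
  proof (rule Cons.IH)
    note BA = rideal_iplus[OF B rideal_imul[OF A t]] and BA' = rideal_iplus[OF B' rideal_imul[OF A' t]]
    show "rideal N (iplus B (imul t A))" "rideal N (iplus B' (imul t A'))" by fact+
    have "iplus B' (imul t A') \<subseteq> A'" by (intro iplus_least[OF A'] B'A imul_subset[OF A' t])
    moreover have "imul c A \<subseteq> A'" using cA by (auto simp: imul_def)
    ultimately have "iplus (imul c A) (iplus B' (imul t A')) \<subseteq> A'"
      by (rule_tac iplus_least[OF A'])
    moreover have "iplus (imul c A) B' \<subseteq> iplus (imul c A) (iplus B' (imul t A'))"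
      by (intro iplus_mono order.refl iplus_sup1[OF rideal_imul[OF A' t]])
    ultimately show "A' = iplus (imul c A) (iplus B' (imul t A'))" using A'_eq by blast
    fix a assume a: "a \<in> A"
    show "c * a \<in> iplus B' (imul t A') \<longleftrightarrow> a \<in> iplus B (imul t A)"
    proof
      assume "c * a \<in> iplus B' (imul t A')"
      then obtain b' a' where "b' \<in> B'" "a' \<in> A'" "c * a = b' + t * a'"
        by (auto elim!: iplus_memE simp: imul_def)
      moreover obtain a1 b1 where "a1 \<in> A" "b1 \<in> B'" "a' = c * a1 + b1"
        using \<open>a' \<in> A'\<close> unfolding A'_eq by (auto elim!: iplus_memE simp: imul_def)
      ultimately have *: "c * (a - t * a1) = b' + t * b1" "a1 \<in> A" "b1 \<in> B'" "b' \<in> B'"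
        by (auto simp: algebra_simps)
      have "c * (a - t * a1) \<in> B'" unfolding * by (intro rideal_add[OF B'] rideal_mult[OF B' t] *)
      then have "a - t * a1 \<in> B" using inj a rideal_diff[OF A a rideal_mult[OF A t *(2)]] by blast
      then have "(a - t * a1) + t * a1 \<in> iplus B (imul t A)"
        using * by (intro iplus_memI) (auto simp: imul_def)
      then show "a \<in> iplus B (imul t A)" by simp
    next
      assume "a \<in> iplus B (imul t A)"
      then obtain b a1 where *: "b \<in> B" "a1 \<in> A" "a = b + t * a1" by (auto elim!: iplus_memE simp: imul_def)
      then have "b = a - t * a1" by simp
      then have "b \<in> A" using rideal_diff[OF A a rideal_mult[OF A t *(2)]] by simp
      then have "c * b \<in> B'" using inj * by blast
      then have "c * b + t * (c * a1) \<in> iplus B' (imul t A')"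
        using cA[OF *(2)] by (intro iplus_memI) (auto simp: imul_def)
      then show "c * a \<in> iplus B' (imul t A')" using * by (simp add: algebra_simps)
    qed
  qed (use Cons.prems in auto)
  ultimately show ?case by simp
qed simp

text \<open>Regularity of \<open>t\<close> on \<open>A / B\<close> gives
  \<open>B \<inter> (E + t A) = E + t B\<close>, so that \<open>B / E\<close> reduced modulo
  \<open>t\<close> embeds into \<open>A / E\<close> reduced modulo \<open>t\<close>.\<close>

lemma rreg_second_iso:
  assumes "rideal N A" "rideal N B" "rideal N E" "E \<subseteq> B" "B \<subseteq> A" "t \<in> polyring N" "set ts \<subseteq> polyring N"
    and nzd: "\<And>g. g \<in> A \<Longrightarrow> t * g \<in> B \<Longrightarrow> g \<in> B"
  shows "rreg ts B (iplus E (imul t B)) \<longleftrightarrow> rreg ts (iplus B (imul t A)) (iplus E (imul t A))"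
proof (rule rreg_iso[where c = 1])
  note A = assms(1) and B = assms(2) and E = assms(3) and t = assms(6)
  note tA = rideal_imul[OF A t]
  show "rideal N B" "rideal N (iplus E (imul t B))" "rideal N (iplus B (imul t A))" "rideal N (iplus E (imul t A))"
    using A B E t by (auto intro!: rideal_iplus rideal_imul)
  have "iplus B (imul t A) \<subseteq> iplus B (iplus E (imul t A))"
    using iplus_sup1[OF rideal_iplus[OF E tA], of B] iplus_sup2[OF B, of "iplus E (imul t A)"]
      iplus_sup2[OF E, of "imul t A"]
    by (intro iplus_least[OF rideal_iplus[OF B rideal_iplus[OF E tA]]]) auto
  moreover have "iplus B (iplus E (imul t A)) \<subseteq> iplus B (imul t A)"
    using iplus_sup1[OF tA, of B] iplus_sup2[OF B, of "imul t A"] assms(4)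
    by (intro iplus_least[OF rideal_iplus[OF B tA]] iplus_mono order.refl) auto
  ultimately show "iplus B (imul t A) = iplus (imul 1 B) (iplus E (imul t A))"
    by (simp add: imul_def)
  fix b assume b: "b \<in> B"
  show "1 * b \<in> iplus E (imul t A) \<longleftrightarrow> b \<in> iplus E (imul t B)"
  proof
    assume "1 * b \<in> iplus E (imul t A)"
    then obtain e a where *: "e \<in> E" "a \<in> A" "b = e + t * a" by (auto elim!: iplus_memE simp: imul_def)
    then have "t * a = b - e" by simp
    then have "t * a \<in> B" using rideal_diff[OF B b, of e] * assms(4) by auto
    then have "a \<in> B" using nzd * by blast
    then show "b \<in> iplus E (imul t B)" using * by (auto simp: imul_def intro!: iplus_memI)
  next
    assume "b \<in> iplus E (imul t B)"
    then obtain e a where "e \<in> E" "a \<in> B" "b = e + t * a" by (auto elim!: iplus_memE simp: imul_def)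
    then show "1 * b \<in> iplus E (imul t A)" using assms(5) by (auto simp: imul_def intro!: iplus_memI)
  qed
qed (use assms in auto)

lemma rreg_ext:
  assumes "rideal N A" "rideal N B" "rideal N E" "E \<subseteq> B" "B \<subseteq> A" "set ts \<subseteq> polyring N"
    "rreg ts A B" "rreg ts B E"
  shows "rreg ts A E"
  using assms
proof (induction ts arbitrary: B E)
  case (Cons t ts)
  have t: "t \<in> polyring N" and ts: "set ts \<subseteq> polyring N" using Cons.prems by auto
  note tA = rideal_imul[OF Cons.prems(1) t]
  have "rreg ts (iplus B (imul t A)) (iplus E (imul t A))"
    using rreg_second_iso[OF Cons.prems(1-5) t ts] Cons.prems by auto
  moreover have "iplus B (imul t A) \<subseteq> A"
    by (intro iplus_least[OF Cons.prems(1)] Cons.prems imul_subset[OF _ t])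
  ultimately have "rreg ts A (iplus E (imul t A))"
    using Cons.prems t ts tA
    by (rule_tac Cons.IH[of "iplus B (imul t A)"]) (auto intro: rideal_iplus simp: iplus_mono)
  moreover have "\<forall>g\<in>A. t * g \<in> E \<longrightarrow> g \<in> E" using Cons.prems by auto
  ultimately show ?case by simp
qed simp

text \<open>The depth lemma for a kernel: a submodule inherits regularity of a single element
  directly, and \<open>A / B\<close> is needed only to pass on to the next element. The last element
  has no successor, hence \<open>butlast\<close>.\<close>

lemma rreg_ker:
  assumes "rideal N A" "rideal N B" "rideal N E" "E \<subseteq> B" "B \<subseteq> A" "set ts \<subseteq> polyring N"
    "rreg ts A E" "rreg (butlast ts) A B"
  shows "rreg ts B E"
  using assms
proof (induction ts arbitrary: B E)
  case (Cons t ts)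
  have t: "t \<in> polyring N" and ts: "set ts \<subseteq> polyring N" using Cons.prems by auto
  have nzd: "\<forall>g\<in>B. t * g \<in> E \<longrightarrow> g \<in> E" using Cons.prems by auto
  show ?case
  proof (cases "ts = []")
    case False
    note tA = rideal_imul[OF Cons.prems(1) t]
    have "iplus B (imul t A) \<subseteq> A"
      by (intro iplus_least[OF Cons.prems(1)] Cons.prems imul_subset[OF _ t])
    then have "rreg ts (iplus B (imul t A)) (iplus E (imul t A))"
      using Cons.prems t ts tA False
      by (rule_tac Cons.IH) (auto intro: rideal_iplus simp: iplus_mono)
    then have "rreg ts B (iplus E (imul t B))"
      using rreg_second_iso[OF Cons.prems(1-5) t ts] Cons.prems False by auto
    then show ?thesis using nzd by simp
  qed (use nzd in simp)
qed simp

subsection \<open>Hilbert series of subquotients\<close>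

lemma pscale_eq: "pscale c p = mterm 0 c * p"
  by (simp add: pscale_def mult_map_scale_conv_mult)

lemma coef_pscale [simp]: "coef (pscale c p) m = c * coef p m"
  using coef_term_mult[of 0 c p m] by (simp add: pscale_eq)

interpretation pv: vector_space "pscale :: 'k::field \<Rightarrow> 'k mpoly \<Rightarrow> 'k mpoly"
  by unfold_locales (rule poly_mapping_eqI, simp add: lookup_add algebra_simps)+

context vector_space
begin

lemma span_Un_memE:
  assumes "x \<in> span (S \<union> T)" obtains a b where "a \<in> span S" "b \<in> span T" "x = a + b"
  using assms by (auto simp: span_Un)

text \<open>The difference of dimensions stands for the dimension of the quotient. A basis of
  \<open>W\<close> is extended to one of \<open>V\<close>, and \<open>f\<close> maps the added
  vectors \<open>C\<close> to a basis of a complement of \<open>W'\<close> in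
  \<open>V'\<close>.\<close>

lemma dim_quotient_iso:
  assumes lin: "Vector_Spaces.linear scale scale f"
    and sub: "subspace V" "subspace W" "subspace V'" "subspace W'" "W \<subseteq> V" "W' \<subseteq> V'"
    and fin: "finite T" "V \<subseteq> span T" "V' \<subseteq> span T"
    and f: "\<And>x. x \<in> V \<Longrightarrow> f x \<in> V'" "\<And>y. y \<in> V' \<Longrightarrow> \<exists>x\<in>V. y - f x \<in> W'"
      "\<And>x. x \<in> V \<Longrightarrow> f x \<in> W' \<longleftrightarrow> x \<in> W"
  shows "int (dim V') - int (dim W') = int (dim V) - int (dim W)"
proof -
  interpret f: Vector_Spaces.linear scale scale f by fact
  obtain BW where BW: "BW \<subseteq> W" "independent BW" "W \<subseteq> span BW" "card BW = dim W"
    using basis_exists by blast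
  obtain BV where BV: "BW \<subseteq> BV" "BV \<subseteq> V" "independent BV" "V \<subseteq> span BV"
    using maximal_independent_subset_extend[of BW V] BW sub by blast
  obtain BW' where BW': "BW' \<subseteq> W'" "independent BW'" "W' \<subseteq> span BW'" "card BW' = dim W'"
    using basis_exists by blast
  have "finite BV" using independent_span_bound[OF fin(1) BV(3)] BV(2) fin(2) by blast
  have "finite BW'" using independent_span_bound[OF fin(1) BW'(2)] BW'(1) fin(3) sub(6) by blast
  have sW: "span BW = W" and sW': "span BW' = W'" and sV: "span BV = V"
    by (rule span_subspace, fact+)+
  define C where "C = BV - BW"
  have CV: "C \<subseteq> V" using BV by (auto simp: C_def)
  have indep: "independent (BW' \<union> f ` C0) \<and> card (BW' \<union> f ` C0) = card BW' + card C0"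
    if "finite C0" "C0 \<subseteq> C" for C0
    using that
  proof (induction C0)
    case (insert c C0)
    have "f c \<notin> span (BW' \<union> f ` C0)"
    proof
      assume "f c \<in> span (BW' \<union> f ` C0)"
      then obtain a b where ab: "a \<in> W'" "b \<in> span (f ` C0)" "f c = a + b"
        by (auto elim!: span_Un_memE simp: sW')
      then obtain u where u: "u \<in> span C0" "b = f u" by (auto simp: f.span_image)
      have uV: "u \<in> V" using u span_mono[of C0 BV] insert.prems sV by (auto simp: C_def)
      have cV: "c \<in> V" using insert.prems CV by auto
      have "f (c - u) = a" using ab u by (simp add: f.diff)
      then have "c - u \<in> W" using f(3)[of "c - u"] ab subspace_diff[OF sub(1) cV uV] by simp
      then have "(c - u) + u \<in> span (BW \<union> C0)"
        using u(1) sW span_mono[of BW "BW \<union> C0"] span_mono[of C0 "BW \<union> C0"] by (intro span_add) auto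
      then have "c \<in> span (BV - {c})"
        using span_mono[of "BW \<union> C0" "BV - {c}"] insert BV(1) by (auto simp: C_def)
      then show False using BV(3) insert.prems by (auto simp: dependent_def C_def)
    qed
    note nin = this
    have IH: "independent (BW' \<union> f ` C0)" "card (BW' \<union> f ` C0) = card BW' + card C0"
      using insert by auto
    have "independent (insert (f c) (BW' \<union> f ` C0))" by (rule independent_insertI[OF nin IH(1)])
    moreover have "f c \<notin> BW' \<union> f ` C0" using nin by (metis span_base)
    ultimately show ?case using IH(2) insert.hyps \<open>finite BW'\<close> by simp
  qed (use BW' in auto)
  have "finite C" using \<open>finite BV\<close> by (simp add: C_def)
  have sub': "BW' \<union> f ` C \<subseteq> V'" using BW' sub f(1) CV by auto
  have "V' \<subseteq> span (BW' \<union> f ` C)"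
  proof
    fix y assume "y \<in> V'"
    then obtain x where x: "x \<in> V" "y - f x \<in> W'" using f(2) by blast
    have "BV = BW \<union> C" using BV(1) by (auto simp: C_def)
    then have "x \<in> span (BW \<union> C)" using x sV by simp
    then obtain a b where ab: "a \<in> W" "b \<in> span C" "x = a + b" by (auto elim!: span_Un_memE simp: sW)
    have "f a \<in> W'" using ab f(3)[of a] sub(5) by auto
    then have "y - f x + f a \<in> W'" using x sub(4) by (intro subspace_add)
    then have "y - f b \<in> span BW'" using ab sW' by (simp add: f.add)
    then have "y - f b \<in> span (BW' \<union> f ` C)" using span_mono[of BW' "BW' \<union> f ` C"] by auto
    moreover have "f b \<in> span (BW' \<union> f ` C)" using ab span_mono[of "f ` C" "BW' \<union> f ` C"] by (auto simp: f.span_image)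
    ultimately show "y \<in> span (BW' \<union> f ` C)" using span_add by fastforce
  qed
  then have "dim V' = card BW' + card C"
    using dim_unique[OF sub'] indep[OF \<open>finite C\<close>] by simp
  moreover have "dim V = card BV" using BV basis_card_eq_dim by metis
  moreover have "card BV = card BW + card C"
    using BV(1) \<open>finite BV\<close> by (simp add: C_def card_Diff_subset finite_subset card_mono)
  ultimately show ?thesis using BW BW' by simp
qed

end

lemma finite_monomials: "finite {m. mons m \<subseteq> {..<N} \<and> mdeg m \<le> d}"
proof (rule finite_imageD)
  have "coef m i \<le> d" if "mdeg m \<le> d" for m i
    using that member_le_sum[of i "mons m" "coef m"] by (cases "i \<in> mons m") (auto simp: mdeg_def in_keys_iff)
  then show "finite (coef ` {m. mons m \<subseteq> {..<N} \<and> mdeg m \<le> d})"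
    by (intro finite_subset[OF _ finite_set_of_finite_funs[of "{..<N}" "{..d}" 0]])
       (auto simp: in_keys_iff)
  show "inj_on coef {m. mons m \<subseteq> {..<N} \<and> mdeg m \<le> d}"
    by (auto intro!: inj_onI poly_mapping_eqI)
qed

lemma homog_span:
  obtains T where "finite T" "homog N (int d) \<subseteq> pv.span (T :: 'k::field mpoly set)"
proof
  define T where "T = (\<lambda>m. mterm m (1::'k)) ` {m. mons m \<subseteq> {..<N} \<and> mdeg m \<le> d}"
  show "finite T" unfolding T_def by (intro finite_imageI finite_monomials)
  show "homog N (int d) \<subseteq> pv.span T"
  proof
    fix p :: "'k mpoly" assume p: "p \<in> homog N (int d)"
    have "mterm m (coef p m) \<in> pv.span T" if "m \<in> mons p" for m
    proof -
      have "mterm m (coef p m) = pscale (coef p m) (mterm m 1)" by (simp add: pscale_eq mult_single)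
      moreover have "mterm m 1 \<in> T" using p that by (auto simp: T_def homog_def polyring_def)
      ultimately show ?thesis by (simp add: pv.span_scale pv.span_base)
    qed
    then show "p \<in> pv.span T" by (subst poly_eq_sum_terms) (rule pv.span_sum)
  qed
qed

text \<open>A difference of integers, so that additivity along a chain of ideals is plain
  cancellation; for \<open>B \<subseteq> A\<close> it is the Hilbert series of
  \<open>A / B\<close>.\<close>

definition hilb :: "nat \<Rightarrow> 'k::field mpoly set \<Rightarrow> 'k mpoly set \<Rightarrow> rat fps" where
  "hilb N A B = Abs_fps (\<lambda>d. of_int (int (vdim (A \<inter> homog N (int d))) - int (vdim (B \<inter> homog N (int d)))))"

lemma hilb_ext: "hilb N A E = hilb N A B + hilb N B E"
  by (rule fps_ext) (simp add: hilb_def)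

lemma subspace_homog: "rideal N A \<Longrightarrow> pv.subspace (A \<inter> homog N e)"
proof (rule pv.subspaceI)
  assume A: "rideal N A"
  show "0 \<in> A \<inter> homog N e" using rideal_0[OF A] by simp
  show "x + y \<in> A \<inter> homog N e" if "x \<in> A \<inter> homog N e" "y \<in> A \<inter> homog N e" for x y
    using that rideal_add[OF A] by auto
  fix c x assume x: "x \<in> A \<inter> homog N e"
  have "mterm 0 c * x \<in> A" using x by (intro rideal_mult[OF A] polyring_term) auto
  moreover have "mterm 0 c \<in> homog N 0" by (auto simp: homog_def polyring_term)
  then have "mterm 0 c * x \<in> homog N (0 + e)" using x by (intro homog_mult) auto
  ultimately show "pscale c x \<in> A \<inter> homog N e" by (simp add: pscale_eq)
qed

text \<open>A preimage of mixed degree may be cut down to its component of degree \<open>e\<close>,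
  because multiplication by the homogeneous \<open>c\<close> shifts components.\<close>

lemma homog_iso_lift:
  assumes "gideal N A" "gideal N B'" "c \<in> homog N g" "A' = iplus (imul c A) B'" "y \<in> A'" "y \<in> homog N (e + g)"
  shows "\<exists>x. x \<in> A \<and> x \<in> homog N e \<and> y - c * x \<in> B'"
proof -
  obtain a b where ab: "a \<in> A" "b \<in> B'" "y = c * a + b" using assms by (auto elim!: iplus_memE simp: imul_def)
  have "y = hcomp (e + g) y" using hcomp_homog_eq[OF assms(6)] by simp
  also have "\<dots> = c * hcomp e a + hcomp (e + g) b" using ab hcomp_mult_homog[OF assms(3), of e a] by simp
  finally have "y - c * hcomp e a = hcomp (e + g) b" by (simp add: algebra_simps)
  then show ?thesis using assms ab by (intro exI[of _ "hcomp e a"])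
    (auto simp: gideal_def hcomp_homog rideal_polyring)
qed

lemma hilb_iso:
  fixes A :: "'k::field mpoly set"
  assumes gi: "gideal N A" "gideal N B" "gideal N A'" "gideal N B'" and "B \<subseteq> A" and c: "c \<in> homog N (int g)"
    and A': "A' = iplus (imul c A) B'" and inj: "\<And>a. a \<in> A \<Longrightarrow> c * a \<in> B' \<longleftrightarrow> a \<in> B"
  shows "hilb N A' B' = fps_X ^ g * hilb N A B"
proof (rule fps_ext)
  fix d
  note ri = gi[THEN gideal_rideal]
  have cp: "c \<in> polyring N" using c by (rule homog_polyring)
  have cA: "c * a \<in> A'" if "a \<in> A" for a
    using that mult_mem_iplus_imul[OF ri(4)] A' by simp
  have B'A: "B' \<subseteq> A'" using iplus_sup2[OF rideal_imul[OF ri(1) cp]] A' by simp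
  show "fps_nth (hilb N A' B') d = fps_nth (fps_X ^ g * hilb N A B) d"
  proof (cases "d < g")
    case True
    \<comment> \<open>Below degree \<open>g\<close> the homogeneous preimage would have negative
      degree and is therefore 0.\<close>
    have "y \<in> B'" if "y \<in> A'" "y \<in> homog N (int d)" for y
    proof -
      have "y \<in> homog N (int d - int g + int g)" using that by simp
      from homog_iso_lift[OF gi(1,4) c A' that(1) this]
      obtain x where "x \<in> A" "x \<in> homog N (int d - int g)" "y - c * x \<in> B'" by blast
      moreover from this have "x = 0" using homog_neg[of "int d - int g" x N] True by simp
      ultimately show ?thesis by simp
    qed
    then have "A' \<inter> homog N (int d) = B' \<inter> homog N (int d)" using B'A by auto
    then show ?thesis using True by (simp add: hilb_def fps_X_power_mult_nth)
  next
    case False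
    define e where "e = d - g"
    have d: "int d = int e + int g" using False by (simp add: e_def)
    obtain T1 where T1: "finite T1" "homog N (int e) \<subseteq> pv.span (T1 :: 'k mpoly set)" by (rule homog_span)
    obtain T2 where T2: "finite T2" "homog N (int d) \<subseteq> pv.span (T2 :: 'k mpoly set)" by (rule homog_span)
    have "int (pv.dim (A' \<inter> homog N (int d))) - int (pv.dim (B' \<inter> homog N (int d)))
      = int (pv.dim (A \<inter> homog N (int e))) - int (pv.dim (B \<inter> homog N (int e)))"
    proof (rule pv.dim_quotient_iso[where f = "\<lambda>x. c * x" and T = "T1 \<union> T2"])
      show "Vector_Spaces.linear pscale pscale (\<lambda>x. c * x)"
        by unfold_locales (auto simp: pscale_eq algebra_simps)
      show "A \<inter> homog N (int e) \<subseteq> pv.span (T1 \<union> T2)" "A' \<inter> homog N (int d) \<subseteq> pv.span (T1 \<union> T2)"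
        using T1 T2 pv.span_mono[of T1 "T1 \<union> T2"] pv.span_mono[of T2 "T1 \<union> T2"] by auto
      show "c * x \<in> A' \<inter> homog N (int d)" if "x \<in> A \<inter> homog N (int e)" for x
        using that cA homog_mult[OF c, of x "int e"] d by (auto simp: add.commute)
      show "\<exists>x\<in>A \<inter> homog N (int e). y - c * x \<in> B' \<inter> homog N (int d)" if y: "y \<in> A' \<inter> homog N (int d)" for y
      proof -
        have "y \<in> homog N (int e + int g)" "y \<in> A'" using y d by auto
        from homog_iso_lift[OF gi(1,4) c A' this(2,1)]
        obtain x where x: "x \<in> A" "x \<in> homog N (int e)" "y - c * x \<in> B'" by blast
        moreover have "c * x \<in> homog N (int d)" using homog_mult[OF c x(2)] d by (simp add: add.commute)
        ultimately show ?thesis using y by blast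
      qed
      show "c * x \<in> B' \<inter> homog N (int d) \<longleftrightarrow> x \<in> B \<inter> homog N (int e)" if "x \<in> A \<inter> homog N (int e)" for x
        using that inj homog_mult[OF c, of x "int e"] d by (auto simp: add.commute)
    qed (use T1 T2 assms(5) B'A ri in \<open>auto intro: subspace_homog\<close>)
    then show ?thesis using False by (simp add: hilb_def fps_X_power_mult_nth vdim_def e_def)
  qed
qed

section \<open>Exponent vectors of single variables\<close>

definition vmon :: "nat \<Rightarrow> nat \<Rightarrow>\<^sub>0 nat" where
  "vmon i = mterm i 1"

lemma mons_vmon [simp]: "mons (vmon i) = {i}" and wt_vmon [simp]: "wt w (vmon i) = w i"
  and mdeg_vmon [simp]: "mdeg (vmon i) = 1"
  by (simp_all add: vmon_def)

lemma vmon_eq_iff [simp]: "vmon i = vmon j \<longleftrightarrow> i = j"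
  by (metis mons_vmon singleton_inject)

lemma vmon_neq_0 [simp]: "vmon i \<noteq> 0" "0 \<noteq> vmon i"
  by (metis keys_zero insert_not_empty mons_vmon)+

declare mons_pvar [simp del]

lemma mons_pvar_vmon [simp]: "mons (pvar i :: 'k::comm_ring_1 mpoly) = {vmon i}"
  by (simp add: vmon_def mons_pvar)

lemma coef_pvar_vmon: "coef (pvar i :: 'k::comm_ring_1 mpoly) m = (if m = vmon i then 1 else 0)"
  by (simp add: vmon_def coef_pvar)

subsection \<open>Triangular systems\<close>

text \<open>Pairs of a leading monomial and its polynomial, with pairwise coprime leading monomials:
  such a system generates a complete intersection. Regularity, Hilbert series and degree bounds are
  all obtained by adding one pair at a time.\<close>

definition lsys :: "nat \<Rightarrow> (nat \<Rightarrow> nat) \<Rightarrow> ((nat \<Rightarrow>\<^sub>0 nat) \<times> 'k::field mpoly) set \<Rightarrow> bool" where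
  "lsys N w P \<longleftrightarrow> finite P \<and> (\<forall>(l, f)\<in>P. f \<in> polyring N \<and> lead w l f) \<and>
     (\<forall>x\<in>P. \<forall>y\<in>P. x \<noteq> y \<longrightarrow> mons (fst x) \<inter> mons (fst y) = {})"

lemma lsys_insert:
  assumes "lsys N w P" "f \<in> polyring N" "lead w l f" "\<And>x. x \<in> P \<Longrightarrow> mons l \<inter> mons (fst x) = {}"
  shows "lsys N w (insert (l, f) P)"
  using assms unfolding lsys_def by (fastforce simp: Int_commute)

lemma lsys_subset: "lsys N w P \<Longrightarrow> Q \<subseteq> P \<Longrightarrow> lsys N w Q"
  unfolding lsys_def by (meson finite_subset subsetD)

lemma lsysD: "lsys N w P \<Longrightarrow> (l, f) \<in> P \<Longrightarrow> f \<in> polyring N \<and> lead w l f"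
  unfolding lsys_def by blast

lemma lsys_disjoint: "lsys N w P \<Longrightarrow> (l, f) \<in> P \<Longrightarrow> (l', f') \<in> P \<Longrightarrow> f \<noteq> f' \<Longrightarrow> mons l \<inter> mons l' = {}"
  unfolding lsys_def by fastforce

lemma lsys_finite: "lsys N w P \<Longrightarrow> finite P"
  unfolding lsys_def by blast

lemma lsys_polyring: "lsys N w P \<Longrightarrow> snd ` P \<subseteq> polyring N"
  using lsysD by fastforce

lemma lsys_nzd:
  assumes P: "lsys N w P" and g: "g \<in> polyring N" "lead w l g" "\<And>x. x \<in> P \<Longrightarrow> mons l \<inter> mons (fst x) = {}"
    and p: "p \<in> polyring N" "g * p \<in> ideal_gen N (snd ` P)"
  shows "p \<in> ideal_gen N (snd ` P)"
proof -
  \<comment> \<open>The division lemmas expect a function from polynomials to leading monomials; any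
    choice among the pairs of the system will do.\<close>
  define lm where "lm f = (SOME l. (l, f) \<in> P)" for f
  have lm: "(lm f, f) \<in> P" if "f \<in> snd ` P" for f
  proof -
    from that obtain l where "(l, f) \<in> P" by force
    then show ?thesis unfolding lm_def by (rule someI)
  qed
  show ?thesis
  proof (rule lead_coprime_nzd[where lm = lm])
    show "finite (snd ` P)" "snd ` P \<subseteq> polyring N" using lsys_finite[OF P] lsys_polyring[OF P] by auto
    show "lead w (lm f) f" if "f \<in> snd ` P" for f using lsysD[OF P lm[OF that]] by simp
    show "mons (lm f) \<inter> mons (lm f') = {}" if "f \<in> snd ` P" "f' \<in> snd ` P" "f \<noteq> f'" for f f'
      by (rule lsys_disjoint[OF P lm[OF that(1)] lm[OF that(2)] that(3)])
    show "mons (lm f) \<inter> mons l = {}" if "f \<in> snd ` P" for f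
      using g(3)[OF lm[OF that]] by auto
  qed fact+
qed

subsection \<open>Filtration pieces\<close>

interpretation pk: graded_action N "\<lambda>i p. pvar i * p :: 'k::comm_ring_1 mpoly" "homog N" for N
proof unfold_locales
  show "pvar i * a \<in> homog N (e + 1)" if "i < N" "a \<in> homog N e" for i e and a :: "'k mpoly"
    using homog_mult[OF homog_pvar[OF that(1)] that(2)] by (simp add: add.commute)
qed (auto simp: algebra_simps)

abbreviation pkreg :: "nat \<Rightarrow> int \<Rightarrow> 'k::comm_ring_1 mpoly set \<Rightarrow> 'k mpoly set \<Rightarrow> bool" where
  "pkreg N \<equiv> kreg N (\<lambda>i p. pvar i * p) (homog N)"

lemma rideal_submod: "rideal N A \<Longrightarrow> pk.submod N A"
  unfolding pk.submod_def by (auto simp: rideal_0 rideal_add rideal_uminus rideal_mult)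

lemma gideal_submod: "gideal N A \<Longrightarrow> pk.submod N A"
  by (simp add: gideal_rideal rideal_submod)

text \<open>The three invariants travel together, since each step of the chain is one exact sequence
  or one shift that controls all of them.\<close>

definition good :: "nat \<Rightarrow> 'k::field mpoly list \<Rightarrow> rat fps \<Rightarrow> int \<Rightarrow> 'k mpoly set \<Rightarrow> 'k mpoly set \<Rightarrow> bool" where
  "good N ts h r A B \<longleftrightarrow> hilb N A B = h \<and> pkreg N r A B \<and> rreg ts A B"

lemma good_mono: "good N ts h r A B \<Longrightarrow> r \<le> r' \<Longrightarrow> good N ts h r' A B"
  unfolding good_def using pk.kreg_mono by blast

lemma good_ext:
  assumes gi: "gideal N A" "gideal N B" "gideal N E" and sub: "E \<subseteq> B" "B \<subseteq> A" "set ts \<subseteq> polyring N"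
    and "good N ts h r A B" "good N ts h' r B E"
  shows "good N ts (h + h') r A E"
  using assms pk.kreg_ext[OF gi[THEN gideal_submod] sub(1,2)]
    rreg_ext[OF gi[THEN gideal_rideal] sub] hilb_ext[of N A E B]
  by (auto simp: good_def)

text \<open>Applied to the kernel of \<open>A / E \<rightarrow> A / B\<close>: relative to the
  target, one element of the sequence is gained and one degree is lost.\<close>

lemma good_ker:
  assumes gi: "gideal N A" "gideal N B" "gideal N E" and sub: "E \<subseteq> B" "B \<subseteq> A" "set ts \<subseteq> polyring N"
    and "good N ts h r A E" "good N (butlast ts) h' r' A B" "r' + 1 \<le> r"
  shows "good N ts (h - h') r B E"
  using assms pk.kreg_ker[OF gi[THEN gideal_submod] sub(1,2)]
    rreg_ker[OF gi[THEN gideal_rideal] sub] hilb_ext[of N A E B]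
  by (auto simp: good_def algebra_simps)

lemma good_iso:
  assumes gi: "gideal N A" "gideal N B" "gideal N A'" "gideal N B'" and "B \<subseteq> A" "set ts \<subseteq> polyring N"
    and c: "c \<in> homog N (int g)" and A': "A' = iplus (imul c A) B'"
    and inj: "\<And>a. a \<in> A \<Longrightarrow> c * a \<in> B' \<longleftrightarrow> a \<in> B"
  shows "good N ts h r A B \<longleftrightarrow> good N ts (fps_X ^ g * h) (r + int g) A' B'"
proof -
  have cp: "c \<in> polyring N" using c by (rule homog_polyring)
  have "pkreg N r A B \<longleftrightarrow> pkreg N (r + int g) A' B'"
  proof (rule kreg_iso[where f = "\<lambda>p. c * p"])
    show "c * a \<in> A' \<and> c * a \<in> homog N (e + int g)" if "a \<in> A" "a \<in> homog N e" for a e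
      using that mult_mem_iplus_imul[OF gideal_rideal[OF gi(4)]] A' homog_mult[OF c that(2)]
      by (simp add: add.commute)
    show "\<exists>x. x \<in> A \<and> x \<in> homog N e \<and> y - c * x \<in> B'" if "y \<in> A'" "y \<in> homog N (e + int g)" for y e
      using homog_iso_lift[OF gi(1,4) c A' that] .
  qed (use gi inj in \<open>auto intro: gideal_submod pk.graded_action_axioms simp: distrib_left mult.left_commute\<close>)
  moreover have "rreg ts A B \<longleftrightarrow> rreg ts A' B'"
    by (rule rreg_iso[OF gi[THEN gideal_rideal] cp assms(6) A' inj])
  moreover have "hilb N A' B' = fps_X ^ g * hilb N A B"
    by (rule hilb_iso[OF gi assms(5) c A' inj])
  ultimately show ?thesis by (auto simp: good_def)
qed

lemma gideal_iplus_imul: "gideal N P \<Longrightarrow> f \<in> homog N e \<Longrightarrow> gideal N (iplus (imul f (polyring N)) P)"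
  by (intro gideal_iplus gideal_imul gideal_ring)

text \<open>Multiplication by \<open>f\<close> identifies \<open>R / P\<close>, shifted by
  \<open>e\<close>, with \<open>(f R + P) / P\<close>; in the cokernel the bound grows by
  \<open>e - 1\<close> and the series acquires the factor \<open>1 - t^e\<close>. Regular sequences
  are left out here and treated separately.\<close>

lemma good_hypersurface:
  assumes P: "gideal N P" and f: "f \<in> homog N (int e)" "e \<ge> 1"
    and nzd: "\<And>p. p \<in> polyring N \<Longrightarrow> f * p \<in> P \<Longrightarrow> p \<in> P"
    and "good N [] h r (polyring N) P"
  shows "good N [] ((1 - fps_X ^ e) * h) (r + int e - 1) (polyring N) (iplus (imul f (polyring N)) P)"
proof -
  let ?R = "polyring N :: 'a mpoly set" and ?Q = "iplus (imul f (polyring N)) P"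
  note R = gideal_ring[of N] and Q = gideal_iplus_imul[OF P f(1)]
  have fp: "f \<in> ?R" using f by (simp add: homog_polyring)
  have sub: "P \<subseteq> ?Q" "?Q \<subseteq> ?R"
    using iplus_sup2[OF rideal_imul[OF rideal_ring fp]] rideal_polyring[OF gideal_rideal[OF Q]] by auto
  have "f * p \<in> P \<longleftrightarrow> p \<in> P" if "p \<in> ?R" for p
    using nzd[OF that] rideal_mult[OF gideal_rideal[OF P] fp] by blast
  then have "good N [] (fps_X ^ e * h) (r + int e) ?Q P"
    using good_iso[OF R P Q P _ _ f(1) refl, of "[]" h r] sub assms(5) by auto
  then have 1: "hilb N ?Q P = fps_X ^ e * h" "pkreg N (r + int e) ?Q P" by (auto simp: good_def)
  moreover have 2: "hilb N ?R P = h" "pkreg N (r + int e - 1) ?R P"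
    using assms(5) f(2) pk.kreg_mono[of N r _ _ "r + int e - 1"] by (auto simp: good_def)
  moreover have "pkreg N (r + int e - 1) ?R ?Q"
    using pk.kreg_coker[OF R[THEN gideal_submod] Q[THEN gideal_submod] P[THEN gideal_submod] sub 1(2) 2(2)] by simp
  moreover have "hilb N ?R ?Q = (1 - fps_X ^ e) * h" using hilb_ext[of N ?R P ?Q] 1 2 by (simp add: algebra_simps)
  ultimately show ?thesis by (simp add: good_def)
qed

subsection \<open>The polynomial ring and linear quotients\<close>

lemma maxideal_eq: "maxideal N = ideal_gen N (pvar ` {..<N})"
proof
  have *: "pvar ` {..<N} \<subseteq> (polyring N :: 'a mpoly set)" by auto
  note I = rideal_ideal_gen[OF *]
  show "maxideal N \<subseteq> (ideal_gen N (pvar ` {..<N}) :: 'a mpoly set)"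
  proof
    fix p :: "'a mpoly" assume p: "p \<in> maxideal N"
    have "mterm m (coef p m) \<in> ideal_gen N (pvar ` {..<N})" if m: "m \<in> mons p" for m
    proof -
      have "m \<noteq> 0" using p m by (auto simp: maxideal_def)
      then obtain i where i: "i \<in> mons m" by (metis keys_eq_empty ex_in_conv)
      have mN: "mons m \<subseteq> {..<N}" using p m by (auto simp: maxideal_def dest: polyring_termD)
      obtain m' where m': "m = mterm i 1 + m'" using monomial_splitE[OF i] by metis
      then have "mterm m (coef p m) = pvar i * mterm m' (coef p m)" using term_add_eq_pvar_mult by blast
      moreover have "mterm m' (coef p m) \<in> polyring N" using mN m' by (intro polyring_term) (auto simp: mons_add_nat)
      moreover have "pvar i \<in> ideal_gen N (pvar ` {..<N})" using i mN by (intro ideal_gen_superset) auto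
      ultimately show ?thesis using rideal_mult_right[OF I] by metis
    qed
    then show "p \<in> ideal_gen N (pvar ` {..<N})" by (subst poly_eq_sum_terms) (rule rideal_sum[OF I])
  qed
  have "coef (r * a) 0 = 0" if "coef a 0 = 0" for r a :: "'a mpoly"
  proof -
    have "0 \<notin> mons (r * a)"
    proof
      assume "0 \<in> mons (r * a)"
      then obtain x y where "x \<in> mons r" "y \<in> mons a" "x + y = 0" using keys_mult by fastforce
      then have "mdeg y = 0" by (metis add_is_0 mdeg_add mdeg_zero)
      with that \<open>y \<in> mons a\<close> show False by (simp add: mdeg_eq_0_iff in_keys_iff)
    qed
    then show ?thesis by (simp add: in_keys_iff)
  qed
  then have "rideal N (maxideal N :: 'a mpoly set)"
    by (auto simp: rideal_def maxideal_def lookup_add)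
  then show "ideal_gen N (pvar ` {..<N}) \<subseteq> (maxideal N :: 'a mpoly set)"
    by (rule ideal_gen_least) (auto simp: maxideal_def coef_pvar_vmon)
qed

lemma rideal_maxideal: "rideal N (maxideal N)"
  unfolding maxideal_eq by (rule rideal_ideal_gen) auto

lemma homog_pos_maxideal: "p \<in> homog N e \<Longrightarrow> e > 0 \<Longrightarrow> p \<in> maxideal N"
  by (force simp: homog_def maxideal_def in_keys_iff)

lemma gideal_pvars: "V \<subseteq> {..<N} \<Longrightarrow> gideal N (ideal_gen N (pvar ` V))"
  by (intro gideal_ideal_gen) (auto intro!: homog_pvar)

lemma lead_pvar: "lead w (vmon i) (pvar i :: 'k::field mpoly)"
  by (simp add: lead_def coef_pvar_vmon)

lemma lsys_pvars: "finite V \<Longrightarrow> V \<subseteq> {..<N} \<Longrightarrow> lsys N w ((\<lambda>i. (vmon i, pvar i :: 'k::field mpoly)) ` V)"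
  unfolding lsys_def by (auto simp: lead_pvar)

lemma pvar_nzd:
  fixes p :: "'k::field mpoly"
  assumes "V \<subseteq> {..<N}" "k < N" "k \<notin> V" "p \<in> polyring N" "pvar k * p \<in> ideal_gen N (pvar ` V)"
  shows "p \<in> ideal_gen N (pvar ` V)"
proof -
  have "finite V" using assms finite_subset by blast
  have "p \<in> ideal_gen N (snd ` (\<lambda>i. (vmon i, pvar i :: 'k mpoly)) ` V)"
    by (rule lsys_nzd[OF lsys_pvars[OF \<open>finite V\<close> assms(1)] _ lead_pvar])
       (use assms in \<open>auto simp: image_image\<close>)
  then show ?thesis by (simp add: image_image)
qed

lemma hilb_residue_field: "hilb N (polyring N) (maxideal N :: 'k::field mpoly set) = 1"
proof (rule fps_ext)
  fix d
  have R: "polyring N \<inter> homog N (int d) = (homog N (int d) :: 'k mpoly set)" for d by (auto simp: homog_polyring)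
  show "fps_nth (hilb N (polyring N) (maxideal N :: 'k mpoly set)) d = fps_nth 1 d"
  proof (cases "d = 0")
    case True
    have hom0: "p = mterm 0 (coef p 0)" if "p \<in> homog N 0" for p :: "'k mpoly"
      using that by (intro poly_mapping_eqI)
        (auto simp: homog_def lookup_single when_def mdeg_eq_0_iff in_keys_iff)
    have "pv.dim (homog N 0 :: 'k mpoly set) = 1"
    proof (rule pv.dim_unique)
      show "{1} \<subseteq> (homog N 0 :: 'k mpoly set)" by simp
      show "homog N 0 \<subseteq> pv.span {1 :: 'k mpoly}"
      proof
        fix p :: "'k mpoly" assume "p \<in> homog N 0"
        then have "p = pscale (coef p 0) 1" using hom0 by (simp add: pscale_eq)
        then show "p \<in> pv.span {1}" by (metis pv.span_base pv.span_scale singletonI)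
      qed
    qed auto
    moreover have "maxideal N \<inter> homog N 0 = {0 :: 'k mpoly}"
      using hom0 rideal_0[OF rideal_maxideal] by (fastforce simp: maxideal_def)
    moreover have "pv.dim {0 :: 'k mpoly} = 0" using pv.dim_le_card[of "{0}" "{}"] by simp
    ultimately show ?thesis using True R[of 0] by (simp add: hilb_def vdim_def del: mult_eq_0_iff)
  next
    case False
    have "maxideal N \<inter> homog N (int d) = (homog N (int d) :: 'k mpoly set)"
      using False homog_pos_maxideal[of _ N "int d"] by auto
    then show ?thesis using False R[of d] by (simp add: hilb_def)
  qed
qed

text \<open>In internal degree above \<open>i\<close> the coefficients of an \<open>i\<close>-chain
  have positive degree, so the chain is already 0 in the residue field.\<close>

lemma pkreg_residue_field: "pkreg N 0 (polyring N) (maxideal N :: 'k::field mpoly set)"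
  unfolding kreg_def
proof (intro allI impI)
  fix i j and u :: "nat set \<Rightarrow> 'k mpoly" assume *: "j > int i + 0" "u \<in> kchain N (homog N) i j (polyring N)"
  have u: "u S \<in> maxideal N" for S
  proof (cases "S \<subseteq> {..<N} \<and> card S = i")
    case True
    then show ?thesis using kchainD[OF *(2)] *(1) homog_pos_maxideal[of "u S" N "j - int i"] by auto
  qed (use kchain_zero[OF *(2)] rideal_0[OF rideal_maxideal] in auto)
  show "\<exists>v\<in>kchain N (homog N) (Suc i) j (polyring N). \<forall>S. u S - kdiff N (\<lambda>i p. pvar i * p) v S \<in> maxideal N"
    using u by (intro bexI[OF _ pk.kchain_0[OF rideal_submod[OF rideal_ring]]]) (simp add: kdiff_def)
qed

lemma pvars_Suc:
  assumes "k < N"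
  shows "ideal_gen N (pvar ` {..<Suc k}) =
    iplus (imul (pvar k) (polyring N)) (ideal_gen N (pvar ` {..<k}) :: 'k::field mpoly set)"
proof -
  have "pvar ` {..<k} \<subseteq> (polyring N :: 'k mpoly set)" using assms by auto
  from ideal_gen_insert[OF this, of "pvar k"] show ?thesis using assms by (simp add: lessThan_Suc)
qed

lemma ideal_gen_empty: "ideal_gen N {} = {0}"
  by (auto simp: ideal_gen_def)

text \<open>The bound for the ring is lifted from the residue field: the variables are removed from
  the ideal one at a time by \<open>kreg_lift\<close>. The Hilbert series runs the other way, each
  variable that is added to the ideal contributing a factor \<open>1 - t\<close>.\<close>

lemma good_ring: "good N [] (inverse ((1 - fps_X) ^ N)) 0 (polyring N) {0 :: 'k::field mpoly}"
proof -
  let ?R = "polyring N :: 'k mpoly set"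
  let ?P = "\<lambda>k. ideal_gen N (pvar ` {..<k}) :: 'k mpoly set"
  have P: "gideal N (?P k)" if "k \<le> N" for k using that by (intro gideal_pvars) auto
  have nzd: "p \<in> ?P k" if "k < N" "p \<in> ?R" "pvar k * p \<in> ?P k" for p k
    by (rule pvar_nzd[OF _ that(1) _ that(2,3)]) (use that in auto)
  have "pkreg N 0 ?R (?P (N - d))" if "d \<le> N" for d
    using that
  proof (induction d)
    case 0
    show ?case using pkreg_residue_field[of N] by (simp add: maxideal_eq)
  next
    case (Suc d)
    define k where "k = N - Suc d"
    have k: "k < N" "N - d = Suc k" using Suc.prems by (auto simp: k_def)
    show ?case unfolding k_def[symmetric]
    proof (rule pk.kreg_lift[where t = k and Q = "?P (Suc k)"])
      show "\<exists>w. w \<in> ?R \<and> w \<in> homog N (e - 1) \<and> q - pvar k * w \<in> ?P k"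
        if "q \<in> ?P (Suc k)" "q \<in> homog N e" for e q
        using homog_iso_lift[OF gideal_ring P homog_pvar pvars_Suc that(1), of "e - 1"] that k by auto
      show "pk.submod N ?R" "pk.submod N (?P k)"
        using gideal_submod[OF gideal_ring] gideal_submod[OF P[of k]] k by auto
      show "?P k \<subseteq> ?P (Suc k)" by (rule ideal_gen_mono) auto
      show "p \<in> ?P k" if "p \<in> ?R" "pvar k * p \<in> ?P k" for p using nzd[OF k(1)] that by blast
      show "pkreg N 0 ?R (?P (Suc k))" using Suc k by simp
    qed (rule k)
  qed
  from this[of N] have kr: "pkreg N 0 ?R {0}" by (simp add: ideal_gen_empty)
  have "hilb N ?R (?P k) = (1 - fps_X) ^ k * hilb N ?R {0}" if "k \<le> N" for k
    using that
  proof (induction k)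
    case 0
    show ?case by (simp add: ideal_gen_empty)
  next
    case (Suc k)
    note R = gideal_ring[of N] and Pk = P[of k] and Q = P[OF Suc.prems]
    have k: "k < N" using Suc by simp
    have "hilb N (?P (Suc k)) (?P k) = fps_X ^ 1 * hilb N ?R (?P k)"
    proof (rule hilb_iso)
      show "pvar k * a \<in> ?P k \<longleftrightarrow> a \<in> ?P k" if "a \<in> ?R" for a
        using that nzd[OF k] k rideal_mult[OF gideal_rideal[OF Pk]] by auto
    qed (use k R Pk Q pvars_Suc[OF k] rideal_polyring[OF gideal_rideal[OF Pk]] in auto)
    then have "hilb N ?R (?P (Suc k)) = hilb N ?R (?P k) - fps_X * hilb N ?R (?P k)"
      using hilb_ext[of N ?R "?P k" "?P (Suc k)"] by simp
    also have "hilb N ?R (?P k) = (1 - fps_X) ^ k * hilb N ?R {0}" using Suc by simp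
    finally show ?case by (simp only: power_Suc left_diff_distrib mult_1 mult.assoc)
  qed
  from this[of N] have "(1 - fps_X) ^ N * hilb N ?R {0} = hilb N ?R (?P N)" by simp
  also have "\<dots> = 1" using hilb_residue_field[of N] by (simp add: maxideal_eq)
  finally have "hilb N ?R {0} = inverse ((1 - fps_X) ^ N)"
    by (metis fps_inverse_unique mult.commute)
  then show ?thesis using kr by (simp add: good_def)
qed

lemma good_linear:
  fixes P :: "((nat \<Rightarrow>\<^sub>0 nat) \<times> 'k::field mpoly) set"
  assumes "lsys N w P" "\<And>x. x \<in> P \<Longrightarrow> snd x \<in> homog N 1"
  shows "good N [] ((1 - fps_X) ^ card P * inverse ((1 - fps_X) ^ N)) 0 (polyring N) (ideal_gen N (snd ` P))"
proof -
  have "finite P" using assms by (simp add: lsys_def)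
  then show ?thesis using assms
  proof (induction P)
    case empty
    show ?case using good_ring[of N] by (simp add: ideal_gen_empty)
  next
    case (insert x P)
    obtain l f where x: "x = (l, f)" by force
    have P: "lsys N w P" using lsys_subset[OF insert.prems(1)] by auto
    have f: "f \<in> polyring N" "lead w l f" using insert.prems(1) by (auto simp: lsys_def x)
    have cop: "mons l \<inter> mons (fst y) = {}" if "y \<in> P" for y
      using insert.prems(1) insert.hyps that by (fastforce simp: lsys_def x)
    have f1: "f \<in> homog N (int 1)" using insert.prems(2)[of x] by (simp add: x)
    have IH: "good N [] ((1 - fps_X) ^ card P * inverse ((1 - fps_X) ^ N)) 0 (polyring N) (ideal_gen N (snd ` P))"
      using insert by (auto simp: P)
    have "gideal N (ideal_gen N (snd ` P))" using insert.prems(2) by (intro gideal_ideal_gen) blast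
    from good_hypersurface[OF this f1 _ lsys_nzd[OF P f cop] IH]
    show ?case using insert.hyps lsys_polyring[OF P] f
      by (simp add: x ideal_gen_insert mult.assoc)
  qed
qed

subsection \<open>Graded free modules\<close>

definition fX :: "nat \<Rightarrow> (nat \<Rightarrow> 'k::comm_ring_1 mpoly) \<Rightarrow> nat \<Rightarrow> 'k mpoly" where
  "fX i u = (\<lambda>k. pvar i * u k)"

text \<open>The piece of degree \<open>e\<close> in the direct sum of the \<open>R(-a k)\<close>:
  the basis vector \<open>k\<close> sits in degree \<open>a k\<close>.\<close>

definition fH :: "nat \<Rightarrow> nat \<Rightarrow> (nat \<Rightarrow> int) \<Rightarrow> int \<Rightarrow> (nat \<Rightarrow> 'k::comm_ring_1 mpoly) set" where
  "fH N b a e = {u \<in> fmod N b. \<forall>k<b. u k \<in> homog N (e - a k)}"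

definition fpart :: "(nat \<Rightarrow> int) \<Rightarrow> int \<Rightarrow> (nat \<Rightarrow> 'k::comm_ring_1 mpoly) \<Rightarrow> nat \<Rightarrow> 'k mpoly" where
  "fpart a e u = (\<lambda>k. hcomp (e - a k) (u k))"

definition lcomb :: "nat \<Rightarrow> (nat \<Rightarrow> nat \<Rightarrow> 'k::comm_ring_1 mpoly) \<Rightarrow> (nat \<Rightarrow> 'k mpoly) \<Rightarrow> nat \<Rightarrow> 'k mpoly" where
  "lcomb b g v = (\<lambda>l. \<Sum>k<b. v k * g k l)"

definition fgsub :: "nat \<Rightarrow> nat \<Rightarrow> (nat \<Rightarrow> int) \<Rightarrow> (nat \<Rightarrow> 'k::comm_ring_1 mpoly) set \<Rightarrow> bool" where
  "fgsub N b a Z \<longleftrightarrow> Z \<subseteq> fmod N b \<and> 0 \<in> Z \<and> (\<forall>u\<in>Z. \<forall>v\<in>Z. u + v \<in> Z) \<and>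
     (\<forall>r\<in>polyring N. \<forall>u\<in>Z. (\<lambda>k. r * u k) \<in> Z) \<and> (\<forall>u\<in>Z. \<forall>e. fpart a e u \<in> Z)"

definition fker :: "nat \<Rightarrow> nat \<Rightarrow> (nat \<Rightarrow> nat \<Rightarrow> 'k::comm_ring_1 mpoly) \<Rightarrow> (nat \<Rightarrow> 'k mpoly) set" where
  "fker N b g = {v \<in> fmod N b. lcomb b g v = 0}"

lemma sum_fun_apply: "(sum f I) x = (\<Sum>i\<in>I. f i x)"
  for f :: "'i \<Rightarrow> 'a \<Rightarrow> 'b::comm_monoid_add"
  by (induction I rule: infinite_finite_induct) auto

lemma hcomp_0 [simp]: "hcomp e 0 = 0"
  by (simp add: hcomp_def)

lemma fgsubD:
  assumes "fgsub N b a Z"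
  shows "Z \<subseteq> fmod N b" "0 \<in> Z" "\<And>u v. u \<in> Z \<Longrightarrow> v \<in> Z \<Longrightarrow> u + v \<in> Z"
    "\<And>r u. r \<in> polyring N \<Longrightarrow> u \<in> Z \<Longrightarrow> (\<lambda>k. r * u k) \<in> Z" "\<And>u e. u \<in> Z \<Longrightarrow> fpart a e u \<in> Z"
  using assms unfolding fgsub_def by blast+

interpretation fk: graded_action N fX "fH N b a :: int \<Rightarrow> (nat \<Rightarrow> 'k::comm_ring_1 mpoly) set" for N b a
proof unfold_locales
  show "fX i u \<in> fH N b a (e + 1)" if "i < N" "u \<in> fH N b a e" for i e and u :: "nat \<Rightarrow> 'k mpoly"
  proof -
    have "pvar i * u k \<in> homog N (1 + (e - a k))" if "k < b" for k
      using that \<open>u \<in> fH N b a e\<close> \<open>i < N\<close> by (intro homog_mult homog_pvar) (auto simp: fH_def)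
    then show ?thesis using that by (auto simp: fX_def fH_def fmod_def algebra_simps)
  qed
qed (auto simp: fX_def fH_def fmod_def algebra_simps fun_eq_iff)

lemma fgsub_submod: "fgsub N b a Z \<Longrightarrow> fk.submod N Z"
proof -
  assume Z: "fgsub N b a Z"
  have "- u \<in> Z" if "u \<in> Z" for u
    using fgsubD(4)[OF Z _ that, of "- 1"] by (simp add: fun_Compl_def)
  then show ?thesis unfolding fk.submod_def fX_def using fgsubD[OF Z] by auto
qed

lemma fgsub_sum: "fgsub N b a Z \<Longrightarrow> (\<And>i. i \<in> I \<Longrightarrow> f i \<in> Z) \<Longrightarrow> sum f I \<in> Z"
  using fk.submod_sum[OF fgsub_submod] by blast

lemma fgsub_fmod: "fgsub N b a (fmod N b)"
  by (auto simp: fgsub_def fmod_def fpart_def hcomp_polyring)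

lemma fgsub_0: "fgsub N b a {0}"
  by (auto simp: fgsub_def fmod_def fpart_def hcomp_def fun_eq_iff)

lemma fpart_fH: "u \<in> fmod N b \<Longrightarrow> fpart a e u \<in> fH N b a e"
  by (auto simp: fH_def fmod_def fpart_def hcomp_homog hcomp_polyring)

lemma fpart_eq: "u \<in> fH N b a e \<Longrightarrow> fpart a e u = u"
proof
  fix k assume u: "u \<in> fH N b a e"
  show "fpart a e u k = u k"
    using u hcomp_homog_eq[of "u k" N "e - a k"]
    by (cases "k < b") (simp_all add: fH_def fmod_def fpart_def)
qed

lemma fpart_sum: "fpart a e (sum f I) = (\<Sum>i\<in>I. fpart a e (f i))"
  by (simp add: fpart_def fun_eq_iff sum_fun_apply)

lemma fpart_smult:
  assumes "t \<in> fH N b a f"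
  shows "fpart a e (\<lambda>k. c * t k) = (\<lambda>k. hcomp (e - f) c * t k)"
proof
  fix k
  show "fpart a e (\<lambda>k. c * t k) k = hcomp (e - f) c * t k"
  proof (cases "k < b")
    case True
    then have "hcomp ((e - f) + (f - a k)) (t k * c) = t k * hcomp (e - f) c"
      using assms by (intro hcomp_mult_homog) (auto simp: fH_def)
    then show ?thesis by (simp add: fpart_def mult.commute)
  next
    case False
    then have "t k = 0" using assms by (auto simp: fH_def fmod_def)
    then show ?thesis by (simp add: fpart_def hcomp_def)
  qed
qed

lemma fpart_lcomb:
  assumes "\<And>k. k < b' \<Longrightarrow> g k \<in> fH N b a (a' k)"
  shows "fpart a e (lcomb b' g v) = lcomb b' g (fpart a' e v)"
proof -
  have "lcomb b' g v = (\<Sum>k<b'. (\<lambda>l. v k * g k l))" for v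
    by (simp add: lcomb_def fun_eq_iff sum_fun_apply)
  then have "fpart a e (lcomb b' g v) = (\<Sum>k<b'. fpart a e (\<lambda>l. v k * g k l))"
    by (simp add: fpart_sum)
  also have "\<dots> = (\<Sum>k<b'. (\<lambda>l. hcomp (e - a' k) (v k) * g k l))"
    by (rule sum.cong) (simp_all add: fpart_smult[OF assms])
  finally show ?thesis by (simp add: lcomb_def fpart_def fun_eq_iff sum_fun_apply)
qed

lemma lcomb_in:
  assumes "fgsub N b a Z" "\<And>k. k < b' \<Longrightarrow> g k \<in> Z" "\<And>k. k < b' \<Longrightarrow> v k \<in> polyring N"
  shows "lcomb b' g v \<in> Z"
proof -
  have "lcomb b' g v = (\<Sum>k<b'. (\<lambda>l. v k * g k l))"
    by (simp add: lcomb_def fun_eq_iff sum_fun_apply)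
  then show ?thesis using fgsubD(4)[OF assms(1)] assms by (auto intro!: fgsub_sum[OF assms(1)])
qed

lemma fgsub_fker:
  assumes "\<And>k. k < b' \<Longrightarrow> g k \<in> fH N b a (a' k)"
  shows "fgsub N b' a' (fker N b' g)"
  unfolding fgsub_def
proof (intro conjI ballI allI)
  note F = fgsub_fmod[of N b' a']
  show "fker N b' g \<subseteq> fmod N b'" "0 \<in> fker N b' g"
    using fgsubD(2)[OF F] by (auto simp: fker_def lcomb_def fun_eq_iff)
  show "u + v \<in> fker N b' g" if "u \<in> fker N b' g" "v \<in> fker N b' g" for u v
    using that fgsubD(3)[OF F]
    by (auto simp: fker_def lcomb_def fun_eq_iff algebra_simps sum.distrib)
  show "(\<lambda>k. r * u k) \<in> fker N b' g" if "r \<in> polyring N" "u \<in> fker N b' g" for r u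
    using that fgsubD(4)[OF F]
    by (auto simp: fker_def lcomb_def fun_eq_iff mult.assoc simp flip: sum_distrib_left)
  show "fpart a' e u \<in> fker N b' g" if "u \<in> fker N b' g" for u e
    using that fgsubD(5)[OF F] fpart_lcomb[of b' g N b a a' e u, OF assms]
    by (auto simp: fker_def fpart_def hcomp_def fun_eq_iff)
qed

text \<open>The Koszul complex of a direct sum splits into components, and the component
  \<open>k\<close> is that of the ring shifted by \<open>a k\<close>.\<close>

lemma kreg_free:
  fixes a :: "nat \<Rightarrow> int"
  assumes a: "\<And>k. k < b \<Longrightarrow> a k \<le> r"
  shows "kreg N fX (fH N b a) r (fmod N b) {0 :: nat \<Rightarrow> 'k::field mpoly}"
  unfolding kreg_def
proof (intro allI impI)
  fix i j and u :: "nat set \<Rightarrow> nat \<Rightarrow> 'k mpoly"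
  assume *: "j > int i + r" "u \<in> fk.C N b a i j (fmod N b)" "\<forall>S. fk.D N u S \<in> {0}"
  have D: "fk.D N w S k = pk.D N (\<lambda>S. w S k) S" for w :: "nat set \<Rightarrow> nat \<Rightarrow> 'k mpoly" and S k
    by (auto simp: kdiff_def sum_fun_apply fX_def sgnp_def intro!: sum.cong)
  have "\<exists>v\<in>pk.C N (Suc i) (j - a k) (polyring N). \<forall>S. u S k - pk.D N v S \<in> {0}" if k: "k < b" for k
  proof -
    have "(\<lambda>S. u S k) \<in> pk.C N i (j - a k) (polyring N)"
    proof (rule kchainI)
      fix S assume "S \<subseteq> {..<N}" "card S = i"
      from kchainD[OF *(2) this] k
      show "u S k \<in> polyring N \<and> u S k \<in> homog N (j - a k - int i)"
        by (auto simp: fmod_def fH_def algebra_simps)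
    next
      fix S assume "\<not> (S \<subseteq> {..<N} \<and> card S = i)"
      then show "u S k = 0" using kchain_zero[OF *(2)] by simp
    qed
    moreover have "pk.D N (\<lambda>S. u S k) S \<in> {0}" for S
      using *(3) D[of u S k] by simp
    moreover have "j - a k > int i + 0" using * a[OF k] by simp
    moreover have "pkreg N 0 (polyring N) {0 :: 'k mpoly}" using good_ring[where N = N and 'k = 'k] by (simp add: good_def)
    ultimately show ?thesis unfolding kreg_def by blast
  qed
  then obtain v where v: "\<And>k. k < b \<Longrightarrow> v k \<in> pk.C N (Suc i) (j - a k) (polyring N)"
    "\<And>k S. k < b \<Longrightarrow> u S k - pk.D N (v k) S \<in> {0}" by metis
  define w where "w = (\<lambda>S k. if k < b then v k S else 0)"
  show "\<exists>v\<in>fk.C N b a (Suc i) j (fmod N b). \<forall>S. u S - fk.D N v S \<in> {0}"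
  proof (intro bexI[of _ w] allI)
    fix S
    have "u S k - pk.D N (\<lambda>S. w S k) S = 0" for k
    proof (cases "k < b")
      case False
      have "u S \<in> fmod N b" using fk.kchain_in[OF fgsub_submod[OF fgsub_fmod] *(2)] .
      then show ?thesis using False by (simp add: w_def kdiff_def fmod_def)
    qed (use v(2)[of k S] in \<open>simp add: w_def\<close>)
    then show "u S - fk.D N w S \<in> {0}" by (auto simp: D)
  next
    show "w \<in> fk.C N b a (Suc i) j (fmod N b)"
    proof (rule kchainI)
      fix S assume S: "S \<subseteq> {..<N}" "card S = Suc i"
      show "w S \<in> fmod N b \<and> w S \<in> fH N b a (j - int (Suc i))"
        using kchainD[OF v(1) S] by (auto simp: w_def fmod_def fH_def algebra_simps)
    next
      fix S assume S: "\<not> (S \<subseteq> {..<N} \<and> card S = Suc i)"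
      show "w S = 0" using kchain_zero[OF v(1) S] by (auto simp: w_def fun_eq_iff)
    qed
  qed
qed

text \<open>\<open>Z\<close> is the kernel of \<open>F \<rightarrow> F / Z\<close>, and passing to a
  kernel costs one degree.\<close>

lemma kreg_syzygies:
  fixes Z :: "(nat \<Rightarrow> 'k::field mpoly) set"
  assumes Z: "fgsub N b a Z" and a: "\<And>k. k < b \<Longrightarrow> a k \<le> r" and "kreg N fX (fH N b a) r (fmod N b) Z"
  shows "kreg N fX (fH N b a) (r + 1) Z {0}"
proof (rule fk.kreg_ker)
  show "kreg N fX (fH N b a) (r + 1) (fmod N b) {0 :: nat \<Rightarrow> 'k mpoly}"
    using fk.kreg_mono[OF kreg_free[where N = N and b = b and a = a and r = r, OF a], of "r + 1"] by simp
  show "{0} \<subseteq> Z" "Z \<subseteq> fmod N b" using fgsubD(1,2)[OF Z] by auto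
  show "kreg N fX (fH N b a) r (fmod N b) Z" by fact
qed (rule fgsub_submod[OF fgsub_fmod] fgsub_submod[OF fgsub_0] fgsub_submod[OF Z] order.refl)+

text \<open>The generators identify the new free module modulo its relations with \<open>Z\<close>.
  Preimages can be taken homogeneous because the generators are.\<close>

lemma kreg_cover:
  fixes Z :: "(nat \<Rightarrow> 'k::field mpoly) set"
  assumes Z: "fgsub N b a Z" and g: "\<And>k. k < b' \<Longrightarrow> g k \<in> Z \<and> g k \<in> fH N b a (a' k)"
    and surj: "\<And>z. z \<in> Z \<Longrightarrow> \<exists>v\<in>fmod N b'. z = lcomb b' g v"
    and "kreg N fX (fH N b a) r Z {0}"
  shows "kreg N fX (fH N b' a') r (fmod N b') (fker N b' g)"
proof -
  have "kreg N fX (fH N b' a') r (fmod N b') (fker N b' g) \<longleftrightarrow> kreg N fX (fH N b a) (r + 0) Z {0}"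
  proof (rule kreg_iso[where f = "lcomb b' g"])
    show "fk.submod N (fker N b' g)" by (rule fgsub_submod[OF fgsub_fker]) (use g in blast)
    show "lcomb b' g (u + v) = lcomb b' g u + lcomb b' g v" for u v
      by (simp add: lcomb_def fun_eq_iff algebra_simps sum.distrib)
    show "lcomb b' g (fX i u) = fX i (lcomb b' g u)" for i u
      by (simp add: lcomb_def fX_def fun_eq_iff sum_distrib_left mult.assoc)
    show "lcomb b' g u \<in> Z \<and> lcomb b' g u \<in> fH N b a (e + 0)" if "u \<in> fmod N b'" "u \<in> fH N b' a' e" for u e
    proof -
      have "lcomb b' g u \<in> Z" using that g by (intro lcomb_in[OF Z]) (auto simp: fmod_def)
      moreover have "fpart a e (lcomb b' g u) = lcomb b' g u"
        using fpart_lcomb[of b' g N b a a' e u] g fpart_eq[OF that(2)] by simp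
      ultimately show ?thesis using fpart_fH[of "lcomb b' g u" N b a e] fgsubD(1)[OF Z] by auto
    qed
    show "\<exists>x. x \<in> fmod N b' \<and> x \<in> fH N b' a' e \<and> z - lcomb b' g x \<in> {0}" if "z \<in> Z" "z \<in> fH N b a (e + 0)" for z e
    proof -
      obtain v where v: "v \<in> fmod N b'" "z = lcomb b' g v" using surj[OF \<open>z \<in> Z\<close>] by blast
      have "z = lcomb b' g (fpart a' e v)"
        using fpart_eq[of z N b a e] that(2) fpart_lcomb[of b' g N b a a' e v] g v by simp
      then show ?thesis using fpart_fH[OF v(1), of a' e] fgsubD(5)[OF fgsub_fmod v(1), of a' e] by auto
    qed
    show "lcomb b' g x \<in> {0} \<longleftrightarrow> x \<in> fker N b' g" if "x \<in> fmod N b'" for x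
      using that by (auto simp: fker_def)
  qed (rule fgsub_submod[OF fgsub_fmod] fgsub_submod[OF fgsub_0] fgsub_submod[OF Z] fk.graded_action_axioms)+
  with assms show ?thesis by simp
qed

text \<open>A basis vector of degree above \<open>r\<close> would be a combination of the variables
  modulo \<open>Z\<close>. As \<open>Z\<close> has its entries in the maximal ideal, so would the
  coefficient 1 of that vector.\<close>

lemma kreg_minimal_bound:
  fixes Z :: "(nat \<Rightarrow> 'k::field mpoly) set"
  assumes Z: "fgsub N b a Z" and kr: "kreg N fX (fH N b a) r (fmod N b) Z"
    and min: "\<And>u k. u \<in> Z \<Longrightarrow> u k \<in> maxideal N" and k: "k < b"
  shows "a k \<le> r"
proof (rule ccontr)
  assume "\<not> a k \<le> r"
  define u where "u = (\<lambda>l. if l = k then 1 else 0 :: 'k mpoly)"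
  have u: "u \<in> fmod N b" "u \<in> fH N b a (a k)" using k by (auto simp: u_def fmod_def fH_def)
  have "a k > r" using \<open>\<not> a k \<le> r\<close> by simp
  from fk.kreg_generated[OF fgsub_submod[OF fgsub_fmod] fgsub_submod[OF Z] kr u this]
  obtain v where v: "\<And>t. t < N \<Longrightarrow> v t \<in> fmod N b \<and> v t \<in> fH N b a (a k - 1)" "u - (\<Sum>t<N. fX t (v t)) \<in> Z"
    by blast
  have "(u - (\<Sum>t<N. fX t (v t))) k \<in> maxideal N" using min[OF v(2)] .
  then have "1 - (\<Sum>t<N. pvar t * v t k) \<in> maxideal N" by (simp add: u_def sum_fun_apply fX_def)
  moreover have "(\<Sum>t<N. pvar t * v t k) \<in> maxideal N"
  proof (intro rideal_sum[OF rideal_maxideal] rideal_mult_right[OF rideal_maxideal])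
    fix t assume "t \<in> {..<N}"
    then show "v t k \<in> polyring N" "pvar t \<in> maxideal N"
      using v(1)[of t] k by (auto simp: fmod_def maxideal_eq intro: ideal_gen_superset)
  qed
  ultimately have "1 - (\<Sum>t<N. pvar t * v t k) + (\<Sum>t<N. pvar t * v t k) \<in> maxideal N"
    by (rule rideal_add[OF rideal_maxideal])
  then show False by (simp add: maxideal_def)
qed

subsection \<open>Minimal generators of graded submodules\<close>

definition fscale :: "'k::field \<Rightarrow> (nat \<Rightarrow> 'k mpoly) \<Rightarrow> nat \<Rightarrow> 'k mpoly" where
  "fscale c u = (\<lambda>k. pscale c (u k))"

interpretation fv: vector_space "fscale :: 'k::field \<Rightarrow> _"
  by unfold_locales (auto simp: fscale_def fun_eq_iff pv.scale_right_distrib pv.scale_left_distrib)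

lemma fH_span:
  obtains T where "finite T" "fH N b a e \<subseteq> fv.span (T :: (nat \<Rightarrow> 'k::field mpoly) set)"
proof
  define s where "s k p = (\<lambda>l. if l = k then p else 0 :: 'k mpoly)" for k :: nat and p
  define T where "T = (\<Union>k<b. (\<lambda>m. s k (mterm m 1)) ` {m. mons m \<subseteq> {..<N} \<and> mdeg m \<le> nat (e - a k)})"
  show "finite T" unfolding T_def by (intro finite_UN_I finite_imageI finite_monomials) auto
  show "fH N b a e \<subseteq> fv.span T"
  proof
    fix u :: "nat \<Rightarrow> 'k mpoly" assume u: "u \<in> fH N b a e"
    have "s k (mterm m (coef (u k) m)) \<in> fv.span T" if "k < b" "m \<in> mons (u k)" for k m
    proof -
      have "u k \<in> homog N (e - a k)" using u that by (auto simp: fH_def)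
      then have "mons m \<subseteq> {..<N}" "mdeg m \<le> nat (e - a k)" using that by (auto simp: homog_def polyring_def)
      then have "s k (mterm m 1) \<in> T" using that by (auto simp: T_def)
      moreover have "s k (mterm m (coef (u k) m)) = fscale (coef (u k) m) (s k (mterm m 1))"
        by (auto simp: s_def fscale_def fun_eq_iff pscale_eq mult_single)
      ultimately show ?thesis by (simp add: fv.span_scale fv.span_base)
    qed
    then have "(\<Sum>k<b. \<Sum>m\<in>mons (u k). s k (mterm m (coef (u k) m))) \<in> fv.span T"
      by (intro fv.span_sum) auto
    also have "(\<Sum>k<b. \<Sum>m\<in>mons (u k). s k (mterm m (coef (u k) m))) = u"
    proof
      fix l
      have "(\<Sum>m\<in>mons (u k). s k (mterm m (coef (u k) m)) l) = (if l = k then u l else 0)" for k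
        by (cases "l = k") (simp_all add: s_def flip: poly_eq_sum_terms)
      then show "(\<Sum>k<b. \<Sum>m\<in>mons (u k). s k (mterm m (coef (u k) m))) l = u l"
        using u by (simp add: sum_fun_apply fH_def fmod_def)
    qed
    finally show "u \<in> fv.span T" .
  qed
qed

inductive_set rspan :: "nat \<Rightarrow> (nat \<Rightarrow> 'k::comm_ring_1 mpoly) set \<Rightarrow> (nat \<Rightarrow> 'k mpoly) set" for N T where
  rspan_0: "0 \<in> rspan N T"
| rspan_base: "r \<in> polyring N \<Longrightarrow> t \<in> T \<Longrightarrow> (\<lambda>k. r * t k) \<in> rspan N T"
| rspan_add: "u \<in> rspan N T \<Longrightarrow> v \<in> rspan N T \<Longrightarrow> u + v \<in> rspan N T"

lemma rspan_superset: "t \<in> T \<Longrightarrow> t \<in> rspan N T"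
  using rspan_base[of 1 N t T] by simp

lemma rspan_smult: "u \<in> rspan N T \<Longrightarrow> r \<in> polyring N \<Longrightarrow> (\<lambda>k. r * u k) \<in> rspan N T"
proof (induction rule: rspan.induct)
  case rspan_0
  then show ?case using rspan.rspan_0[of N T] by (simp add: zero_fun_def)
next
  case (rspan_base r' t)
  then show ?case using rspan.rspan_base[of "r * r'" N t T] by (auto simp: mult.assoc)
next
  case (rspan_add u v)
  then show ?case using rspan.rspan_add[of "\<lambda>k. r * u k" N T "\<lambda>k. r * v k"] by (simp add: plus_fun_def distrib_left)
qed

lemma rspan_sum: "(\<And>i. i \<in> I \<Longrightarrow> f i \<in> rspan N T) \<Longrightarrow> sum f I \<in> rspan N T"
  by (induction I rule: infinite_finite_induct) (auto intro: rspan_0 rspan_add)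

lemma rspan_trans: "u \<in> rspan N T \<Longrightarrow> T \<subseteq> rspan N T' \<Longrightarrow> u \<in> rspan N T'"
  by (induction rule: rspan.induct) (auto intro: rspan_0 rspan_add rspan_smult)

lemma rspan_finite:
  assumes "u \<in> rspan N T" "finite T"
  shows "\<exists>c. (\<forall>t. c t \<in> polyring N) \<and> u = (\<Sum>t\<in>T. (\<lambda>k. c t * t k))"
  using assms(1)
proof (induction rule: rspan.induct)
  case rspan_0
  show ?case by (rule exI[of _ "\<lambda>_. 0"]) (auto simp: fun_eq_iff sum_fun_apply)
next
  case (rspan_base r t)
  have "(\<Sum>s\<in>T. (\<lambda>k. (if s = t then r else 0) * s k)) = (\<Sum>s\<in>T. if s = t then (\<lambda>k. r * t k) else 0)"
    by (rule sum.cong) (auto simp: zero_fun_def)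
  then show ?case using assms(2) rspan_base
    by (intro exI[of _ "\<lambda>s. if s = t then r else 0"]) simp
next
  case (rspan_add u v)
  then obtain c c' where "\<forall>t. c t \<in> polyring N" "u = (\<Sum>t\<in>T. (\<lambda>k. c t * t k))"
    "\<forall>t. c' t \<in> polyring N" "v = (\<Sum>t\<in>T. (\<lambda>k. c' t * t k))" by blast
  then show ?case
    by (intro exI[of _ "\<lambda>t. c t + c' t"]) (auto simp: fun_eq_iff sum_fun_apply distrib_right sum.distrib)
qed

lemma subspace_rspan: "fv.subspace (rspan N T)"
proof (rule fv.subspaceI)
  fix c x assume "x \<in> rspan N T"
  then have "(\<lambda>k. mterm 0 c * x k) \<in> rspan N T" by (rule rspan_smult) (auto intro: polyring_term)
  then show "fscale c x \<in> rspan N T" by (simp add: fscale_def pscale_eq)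
qed (auto intro: rspan_0 rspan_add)

lemma sum_fpart:
  assumes "u \<in> fmod N b"
  obtains E where "finite E" "u = (\<Sum>e\<in>E. fpart a e u)"
proof
  define E where "E = (\<Union>k<b. (\<lambda>m. int (mdeg m) + a k) ` mons (u k))"
  show "finite E" by (simp add: E_def)
  have "coef (u k) m = (\<Sum>e\<in>E. coef (fpart a e u k) m)" for k m
  proof (cases "k < b \<and> m \<in> mons (u k)")
    case True
    then have "int (mdeg m) + a k \<in> E" by (auto simp: E_def)
    moreover have "coef (fpart a e u k) m = (if int (mdeg m) + a k = e then coef (u k) m else 0)" for e
      by (auto simp: fpart_def hcomp_def)
    ultimately show ?thesis using \<open>finite E\<close> by simp
  next
    case False
    then have "coef (u k) m = 0" using assms by (auto simp: fmod_def in_keys_iff)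
    then show ?thesis by (simp add: fpart_def hcomp_def cong: if_cong)
  qed
  then show "u = (\<Sum>e\<in>E. fpart a e u)"
    by (auto simp: fun_eq_iff sum_fun_apply lookup_sum intro!: poly_mapping_eqI)
qed

text \<open>Homological degree 0 expresses an element of degree above \<open>r\<close> through
  elements of one degree less; repetition ends at degree \<open>r\<close>.\<close>

lemma kreg_rspan:
  fixes Z :: "(nat \<Rightarrow> 'k::field mpoly) set"
  assumes Z: "fgsub N b a Z" and kr: "kreg N fX (fH N b a) r Z {0}" and z: "z \<in> Z"
  shows "z \<in> rspan N {t \<in> Z. \<exists>e\<le>r. t \<in> fH N b a e}"
proof -
  let ?T = "{t \<in> Z. \<exists>e\<le>r. t \<in> fH N b a e}"
  have *: "z \<in> rspan N ?T" if "z \<in> Z" "z \<in> fH N b a e" for z e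
    using that
  proof (induction "nat (e - r)" arbitrary: e z rule: less_induct)
    case less
    show ?case
    proof (cases "e \<le> r")
      case True
      then show ?thesis using less by (intro rspan_superset) auto
    next
      case False
      then have "e > r" by simp
      from fk.kreg_generated[OF fgsub_submod[OF Z] fgsub_submod[OF fgsub_0] kr less.prems this]
      obtain v where v: "\<And>t. t < N \<Longrightarrow> v t \<in> Z \<and> v t \<in> fH N b a (e - 1)" "z - (\<Sum>t<N. fX t (v t)) \<in> {0}"
        by blast
      have "fX t (v t) \<in> rspan N ?T" if "t < N" for t
      proof -
        have "v t \<in> rspan N ?T" using v(1)[OF that] False by (intro less.hyps[of "e - 1"]) auto
        then show ?thesis unfolding fX_def by (rule rspan_smult) (use that in simp)
      qed
      then have "(\<Sum>t<N. fX t (v t)) \<in> rspan N ?T" by (intro rspan_sum) auto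
      then show ?thesis using v(2) by simp
    qed
  qed
  obtain E where E: "finite E" "z = (\<Sum>e\<in>E. fpart a e z)"
    using sum_fpart[of z N b a] fgsubD(1)[OF Z] z by blast
  have "fpart a e z \<in> rspan N ?T" for e
    using *[of "fpart a e z" e] fgsubD(5)[OF Z z, of e] fpart_fH[of z N b a e] fgsubD(1)[OF Z] z by blast
  then have "(\<Sum>e\<in>E. fpart a e z) \<in> rspan N ?T" by (intro rspan_sum)
  then show ?thesis using E(2) by simp
qed

text \<open>Finiteness comes from degree bounds instead of a basis theorem: generators are needed
  only up to degree \<open>r\<close>, there is nothing below the smallest shift, and each graded
  piece is finite-dimensional.\<close>

lemma finite_generators:
  fixes Z :: "(nat \<Rightarrow> 'k::field mpoly) set"
  assumes Z: "fgsub N b a Z" and kr: "kreg N fX (fH N b a) r Z {0}"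
  shows "\<exists>T. finite T \<and> T \<subseteq> Z \<and> (\<forall>t\<in>T. \<exists>e. t \<in> fH N b a e) \<and> Z \<subseteq> rspan N T"
proof -
  \<comment> \<open>Any lower bound of the shifts would do; this one also makes sense for
    \<open>b = 0\<close>, where there is no minimum.\<close>
  define L where "L = - (\<Sum>k<b. \<bar>a k\<bar>)"
  have L: "L \<le> a k" if "k < b" for k
    using member_le_sum[of k "{..<b}" "\<lambda>k. \<bar>a k\<bar>"] that by (auto simp: L_def)
  have "\<exists>B. finite B \<and> B \<subseteq> Z \<inter> fH N b a e \<and> Z \<inter> fH N b a e \<subseteq> fv.span B" for e
  proof -
    obtain B where B: "B \<subseteq> Z \<inter> fH N b a e" "fv.independent B" "Z \<inter> fH N b a e \<subseteq> fv.span B"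
      using fv.basis_exists by metis
    obtain S where S: "finite S" "fH N b a e \<subseteq> fv.span (S :: (nat \<Rightarrow> 'k mpoly) set)" by (rule fH_span)
    have "finite B" using fv.independent_span_bound[OF S(1) B(2)] B(1) S(2) by blast
    then show ?thesis using B by blast
  qed
  then obtain B where B: "\<And>e. finite (B e)" "\<And>e. B e \<subseteq> Z \<inter> fH N b a e" "\<And>e. Z \<inter> fH N b a e \<subseteq> fv.span (B e)"
    by metis
  define T where "T = (\<Union>e\<in>{L..r}. B e)"
  have "t \<in> rspan N T" if t: "t \<in> Z" "t \<in> fH N b a e" "e \<le> r" for t e
  proof (cases "e < L")
    case True
    have "t k = 0" for k
    proof (cases "k < b")
      case True
      then show ?thesis using t(2) L[of k] \<open>e < L\<close> homog_neg[of "e - a k" "t k" N] by (auto simp: fH_def)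
    qed (use t(2) in \<open>auto simp: fH_def fmod_def\<close>)
    then have "t = 0" by (simp add: fun_eq_iff)
    then show ?thesis by (simp add: rspan_0)
  next
    case False
    then have "B e \<subseteq> T" unfolding T_def using t(3) by (intro UN_upper) auto
    then have "B e \<subseteq> rspan N T" using rspan_superset[of _ T N] by blast
    then have "fv.span (B e) \<subseteq> rspan N T" by (rule fv.span_minimal[OF _ subspace_rspan])
    then show ?thesis using B(3) t by blast
  qed
  then have "{t \<in> Z. \<exists>e\<le>r. t \<in> fH N b a e} \<subseteq> rspan N T" by blast
  then have "Z \<subseteq> rspan N T" using kreg_rspan[OF Z kr] rspan_trans by blast
  moreover have "finite T" using B(1) by (simp add: T_def)
  moreover have "T \<subseteq> Z" "\<forall>t\<in>T. \<exists>e. t \<in> fH N b a e" using B(2) by (auto simp: T_def)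
  ultimately show ?thesis by blast
qed

text \<open>Taken from a homogeneous generating set of least cardinality: a relation with a
  coefficient outside the maximal ideal could be solved for the corresponding generator.\<close>

lemma minimal_generators:
  fixes Z :: "(nat \<Rightarrow> 'k::field mpoly) set"
  assumes Z: "fgsub N b a Z" and kr: "kreg N fX (fH N b a) r Z {0}"
  shows "\<exists>b' a' g. (\<forall>k<b'. g k \<in> Z \<and> g k \<in> fH N b a (a' k)) \<and> (\<forall>z\<in>Z. \<exists>v\<in>fmod N b'. z = lcomb b' g v) \<and>
    (\<forall>v\<in>fker N b' g. \<forall>k. v k \<in> maxideal N)"
proof -
  define P where "P T \<longleftrightarrow> finite T \<and> T \<subseteq> Z \<and> (\<forall>t\<in>T. \<exists>e. t \<in> fH N b a e) \<and> Z \<subseteq> rspan N T" for T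
  have "\<exists>T. P T" using finite_generators[OF Z kr] by (simp add: P_def)
  then obtain T where T: "P T" "\<And>T'. P T' \<Longrightarrow> card T \<le> card T'"
    by (metis ex_has_least_nat)
  have fin: "finite T" and TZ: "T \<subseteq> Z" and TR: "Z \<subseteq> rspan N T" using T(1) by (auto simp: P_def)
  obtain dg where dg: "\<And>t. t \<in> T \<Longrightarrow> t \<in> fH N b a (dg t)" using T(1) unfolding P_def by metis
  have ker: "c t0 \<in> maxideal N"
    if c: "\<forall>t\<in>T. c t \<in> polyring N" "(\<Sum>t\<in>T. (\<lambda>k. c t * t k)) = 0" and t0: "t0 \<in> T" for c t0
  proof (rule ccontr)
    assume "c t0 \<notin> maxideal N"
    then have \<kappa>: "coef (c t0) 0 \<noteq> 0" using c t0 by (simp add: maxideal_def)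
    define \<kappa> where "\<kappa> = coef (c t0) 0"
    \<comment> \<open>The component of the relation in the degree of \<open>t0\<close>; there the
      coefficient of \<open>t0\<close> is the nonzero constant \<open>\<kappa>\<close>.\<close>
    define c' where "c' t = hcomp (dg t0 - dg t) (c t)" for t
    have "(\<Sum>t\<in>T. (\<lambda>k. c' t * t k)) = (\<Sum>t\<in>T. fpart a (dg t0) (\<lambda>k. c t * t k))"
      by (rule sum.cong) (simp_all add: c'_def fpart_smult[OF dg])
    also have "\<dots> = fpart a (dg t0) (\<Sum>t\<in>T. (\<lambda>k. c t * t k))" by (simp only: fpart_sum)
    also have "\<dots> = 0" unfolding c(2) by (simp add: fpart_def fun_eq_iff)
    finally have 0: "(\<Sum>t\<in>T. (\<lambda>k. c' t * t k)) = 0" .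
    have c't0: "c' t0 = mterm 0 \<kappa>"
      by (rule poly_mapping_eqI) (auto simp: c'_def hcomp_def \<kappa>_def mdeg_eq_0_iff lookup_single when_def)
    have t0_eq: "t0 k = (\<Sum>t\<in>T - {t0}. - mterm 0 (1 / \<kappa>) * c' t * t k)" for k
    proof -
      have "mterm 0 \<kappa> * t0 k + (\<Sum>t\<in>T - {t0}. c' t * t k) = (\<Sum>t\<in>T. c' t * t k)"
        using sum.remove[OF fin t0, of "\<lambda>t. c' t * t k"] c't0 by simp
      also have "\<dots> = 0" using fun_cong[OF 0, of k] by (simp add: sum_fun_apply)
      finally have "mterm 0 \<kappa> * t0 k = - (\<Sum>t\<in>T - {t0}. c' t * t k)" by (simp add: eq_neg_iff_add_eq_0)
      then have "mterm 0 (1 / \<kappa>) * (mterm 0 \<kappa> * t0 k) = (\<Sum>t\<in>T - {t0}. - mterm 0 (1 / \<kappa>) * c' t * t k)"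
        by (simp add: sum_distrib_left sum_negf mult.assoc)
      moreover have "mterm 0 (1 / \<kappa>) * (mterm 0 \<kappa> * t0 k) = t0 k"
        using \<kappa> by (simp add: mult.assoc[symmetric] mult_single \<kappa>_def)
      ultimately show ?thesis by simp
    qed
    have "t0 = (\<Sum>t\<in>T - {t0}. (\<lambda>k. - mterm 0 (1 / \<kappa>) * c' t * t k))"
      by (rule ext) (unfold sum_fun_apply, rule t0_eq)
    also have "\<dots> \<in> rspan N (T - {t0})"
      using c(1) by (intro rspan_sum rspan_base polyring_mult) (auto simp: c'_def hcomp_polyring polyring_term)
    finally have "T \<subseteq> rspan N (T - {t0})" using rspan_superset[of _ "T - {t0}"] by blast
    then have "P (T - {t0})" using T(1) rspan_trans unfolding P_def by blast
    from T(2)[OF this] show False using fin t0 by (metis card_Diff1_less leD)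
  qed
  obtain h where h: "bij_betw h {..<card T} T"
    using ex_bij_betw_nat_finite[OF fin] by (auto simp: atLeast0LessThan)
  have hT: "h k \<in> T" if "k < card T" for k using h that by (auto simp: bij_betw_def)
  have inj: "inj_on h {..<card T}" and img: "h ` {..<card T} = T" using h by (auto simp: bij_betw_def)
  have reidx: "(\<Sum>t\<in>T. (\<lambda>l. c t * t l)) = lcomb (card T) h (\<lambda>k. c (h k))" for c
  proof -
    have "(\<Sum>t\<in>T. (\<lambda>l. c t * t l)) = (\<Sum>k<card T. (\<lambda>l. c (h k) * h k l))"
      using sum.reindex_bij_betw[OF h, of "\<lambda>t. (\<lambda>l. c t * t l)"] by simp
    then show ?thesis by (simp add: lcomb_def fun_eq_iff sum_fun_apply)
  qed
  show ?thesis
  proof (intro exI[of _ "card T"] exI[of _ "\<lambda>k. dg (h k)"] exI[of _ h] conjI allI impI ballI)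
    fix k assume "k < card T"
    then show "h k \<in> Z" "h k \<in> fH N b a (dg (h k))" using hT TZ dg by blast+
  next
    fix z assume "z \<in> Z"
    then obtain c where c: "\<forall>t. c t \<in> polyring N" "z = (\<Sum>t\<in>T. (\<lambda>k. c t * t k))"
      using rspan_finite[OF _ fin] TR by blast
    show "\<exists>v\<in>fmod N (card T). z = lcomb (card T) h v"
      by (rule bexI[of _ "\<lambda>k. if k < card T then c (h k) else 0"])
         (use c in \<open>auto simp: reidx fmod_def lcomb_def intro!: sum.cong\<close>)
  next
    fix v k assume v: "v \<in> fker N (card T) h"
    show "v k \<in> maxideal N"
    proof (cases "k < card T")
      case True
      define c where "c t = v (the_inv_into {..<card T} h t)" for t
      have ch: "c (h k) = v k" if "k < card T" for k
        using that inj by (simp add: c_def the_inv_into_f_f)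
      have "lcomb (card T) h (\<lambda>k. c (h k)) = lcomb (card T) h v" by (simp add: lcomb_def ch fun_eq_iff)
      then have "(\<Sum>t\<in>T. (\<lambda>k. c t * t k)) = 0" using v by (simp add: reidx fker_def)
      moreover have "\<forall>t\<in>h ` {..<card T}. c t \<in> polyring N" using v ch by (auto simp: fker_def fmod_def)
      then have "\<forall>t\<in>T. c t \<in> polyring N" unfolding img .
      ultimately show ?thesis using ker[of c "h k", OF \<open>\<forall>t\<in>T. c t \<in> polyring N\<close>] hT[OF True] ch[OF True] by simp
    next
      case False
      then show ?thesis using v rideal_0[OF rideal_maxideal] by (auto simp: fker_def fmod_def)
    qed
  qed
qed

subsection \<open>Minimal resolutions and regularity\<close>

text \<open>The state while a minimal resolution is built: \<open>F / Z\<close> is the module to be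
  resolved next, with bound \<open>r\<close>, and the condition on the entries of \<open>Z\<close>
  says that the basis of \<open>F\<close> generates it minimally.\<close>

definition stage :: "nat \<Rightarrow> int \<Rightarrow> nat \<Rightarrow> (nat \<Rightarrow> int) \<Rightarrow> (nat \<Rightarrow> 'k::field mpoly) set \<Rightarrow> bool" where
  "stage N r b a Z \<longleftrightarrow> fgsub N b a Z \<and> kreg N fX (fH N b a) r (fmod N b) Z \<and> (\<forall>u\<in>Z. \<forall>k. u k \<in> maxideal N)"

lemma stage_bound: "stage N r b a Z \<Longrightarrow> k < b \<Longrightarrow> a k \<le> r"
  unfolding stage_def using kreg_minimal_bound by blast

text \<open>Passing to syzygies raises the bound by one, so after \<open>i\<close> steps the shifts
  are at most \<open>i + r\<close>; this is the regularity bound.\<close>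

lemma stage_next:
  assumes st: "stage N r b a Z" and g: "\<forall>k<b'. g k \<in> Z \<and> g k \<in> fH N b a (a' k)"
    and surj: "\<forall>z\<in>Z. \<exists>v\<in>fmod N b'. z = lcomb b' g v" and min: "\<forall>v\<in>fker N b' g. \<forall>k. v k \<in> maxideal N"
  shows "stage N (r + 1) b' a' (fker N b' g)"
proof -
  have Z: "fgsub N b a Z" and kr: "kreg N fX (fH N b a) r (fmod N b) Z" using st by (auto simp: stage_def)
  have "kreg N fX (fH N b a) (r + 1) Z {0}" by (rule kreg_syzygies[OF Z stage_bound[OF st] kr])
  then have "kreg N fX (fH N b' a') (r + 1) (fmod N b') (fker N b' g)"
    using kreg_cover[OF Z, of b' g a' "r + 1"] g surj by blast
  moreover have "fgsub N b' a' (fker N b' g)" by (rule fgsub_fker) (use g in blast)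
  ultimately show ?thesis using min by (simp add: stage_def)
qed

text \<open>The augmentation identifies \<open>F / Z\<close> with \<open>R / I\<close>, which
  transfers the bound for \<open>R / I\<close> to the start of a resolution.\<close>

lemma kreg_augmentation:
  fixes I :: "'k::field mpoly set"
  assumes I: "gideal N I" and kr: "pkreg N r (polyring N) I"
    and eps: "\<And>k. k < b \<Longrightarrow> eps k \<in> homog N (a k)"
    and surj: "\<And>p. p \<in> polyring N \<Longrightarrow> \<exists>u\<in>fmod N b. p - (\<Sum>k<b. u k * eps k) \<in> I"
  defines "Z \<equiv> {u \<in> fmod N b. (\<Sum>k<b. u k * eps k) \<in> I}"
  shows "fgsub N b a Z" "kreg N fX (fH N b a) r (fmod N b) Z"
proof -
  note I' = gideal_rideal[OF I]
  have F: "fgsub N b a (fmod N b :: (nat \<Rightarrow> 'k mpoly) set)" by (rule fgsub_fmod)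
  have part: "hcomp e (\<Sum>k<b. u k * eps k) = (\<Sum>k<b. fpart a e u k * eps k)" for e u
  proof -
    have "hcomp e (u k * eps k) = fpart a e u k * eps k" if "k < b" for k
      using hcomp_mult_homog[OF eps[OF that], of "e - a k" "u k"] by (simp add: fpart_def mult.commute)
    then show ?thesis by simp
  qed
  show Z: "fgsub N b a Z"
    unfolding fgsub_def
  proof (intro conjI ballI allI)
    show "Z \<subseteq> fmod N b" "0 \<in> Z" using fgsubD(2)[OF F] rideal_0[OF I'] by (auto simp: Z_def)
    show "u + v \<in> Z" if "u \<in> Z" "v \<in> Z" for u v
      using that fgsubD(3)[OF F] rideal_add[OF I'] by (auto simp: Z_def distrib_right sum.distrib)
    show "(\<lambda>k. r * u k) \<in> Z" if "r \<in> polyring N" "u \<in> Z" for r u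
      using that fgsubD(4)[OF F] rideal_mult[OF I'] by (auto simp: Z_def mult.assoc simp flip: sum_distrib_left)
    show "fpart a e u \<in> Z" if "u \<in> Z" for u e
    proof -
      have "hcomp e (\<Sum>k<b. u k * eps k) \<in> I"
        using that I by (simp add: Z_def gideal_def del: hcomp_sum)
      then show ?thesis using that fgsubD(5)[OF F] by (simp only: part Z_def) simp
    qed
  qed
  have "kreg N fX (fH N b a) r (fmod N b) Z \<longleftrightarrow> pkreg N (r + 0) (polyring N) I"
  proof (rule kreg_iso[where f = "\<lambda>u. \<Sum>k<b. u k * eps k"])
    show "(\<Sum>k<b. (u + v) k * eps k) = (\<Sum>k<b. u k * eps k) + (\<Sum>k<b. v k * eps k)" for u v
      by (simp add: distrib_right sum.distrib)
    show "(\<Sum>k<b. fX i u k * eps k) = pvar i * (\<Sum>k<b. u k * eps k)" for i u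
      by (simp add: fX_def sum_distrib_left mult.assoc)
    show "(\<Sum>k<b. u k * eps k) \<in> polyring N \<and> (\<Sum>k<b. u k * eps k) \<in> homog N (e + 0)"
      if "u \<in> fmod N b" "u \<in> fH N b a e" for u e
    proof -
      have "u k * eps k \<in> homog N ((e - a k) + a k)" if "k < b" for k
        using that \<open>u \<in> fH N b a e\<close> by (intro homog_mult eps) (auto simp: fH_def)
      then have "(\<Sum>k<b. u k * eps k) \<in> homog N e" by (intro homog_sum) auto
      then show ?thesis by (simp add: homog_polyring)
    qed
    show "\<exists>x. x \<in> fmod N b \<and> x \<in> fH N b a e \<and> y - (\<Sum>k<b. x k * eps k) \<in> I"
      if y: "y \<in> polyring N" "y \<in> homog N (e + 0)" for y e
    proof -
      obtain u where u: "u \<in> fmod N b" "y - (\<Sum>k<b. u k * eps k) \<in> I" using surj[OF y(1)] by blast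
      have "hcomp e y = hcomp e (y - (\<Sum>k<b. u k * eps k)) + hcomp e (\<Sum>k<b. u k * eps k)"
        by (simp flip: hcomp_add del: hcomp_sum)
      moreover have "hcomp e y = y" using y by (intro hcomp_homog_eq) simp
      ultimately have "y = hcomp e (y - (\<Sum>k<b. u k * eps k)) + (\<Sum>k<b. fpart a e u k * eps k)"
        unfolding part by simp
      then have "y - (\<Sum>k<b. fpart a e u k * eps k) = hcomp e (y - (\<Sum>k<b. u k * eps k))"
        unfolding diff_eq_eq .
      also have "\<dots> \<in> I" using I u by (auto simp: gideal_def)
      finally show ?thesis using fpart_fH[OF u(1), of a e] fgsubD(5)[OF F u(1), of e] by blast
    qed
    show "(\<Sum>k<b. x k * eps k) \<in> I \<longleftrightarrow> x \<in> Z" if "x \<in> fmod N b" for x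
      using that by (simp add: Z_def)
  qed (rule fgsub_submod[OF F] fgsub_submod[OF Z] fk.graded_action_axioms pk.graded_action_axioms
      gideal_submod[OF I] gideal_submod[OF gideal_ring])+
  then show "kreg N fX (fH N b a) r (fmod N b) Z" using kr by simp
qed

lemma dmap_eq_lcomb: "dmap d b i v = lcomb (b i) (\<lambda>k l. if l < b (i - 1) then d i k l else 0) v"
  by (auto simp: dmap_def lcomb_def fun_eq_iff)

text \<open>Proved for every minimal resolution, because the Betti numbers are read off one about
  which nothing else is known.\<close>

lemma minimal_resolution_bound:
  fixes G :: "'k::field mpoly set"
  assumes I: "gideal N (ideal_gen N G)" and kr: "pkreg N r (polyring N) (ideal_gen N G)"
    and res: "min_graded_free_res N G b a d eps" and k: "k < b i"
  shows "a i k \<le> int i + r"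
proof -
  let ?I = "ideal_gen N G"
  \<comment> \<open>Entries of \<open>d\<close> beyond the rank of the target are unconstrained and
    ignored by \<open>dmap\<close>; cutting them off makes the rows elements of the free
    module.\<close>
  define g where "g i k l = (if l < b (i - 1) then d i k l else 0)" for i k l
  define Z where "Z i = (if i = 0 then {u \<in> fmod N (b 0). (\<Sum>k<b 0. u k * eps k) \<in> ?I} else fker N (b i) (g i))" for i
  have dg: "dmap d b i v = lcomb (b i) (g i) v" for i v
    unfolding dmap_eq_lcomb by (simp add: g_def[abs_def])
  have eps: "\<forall>k<b 0. eps k \<in> homog N (a 0 k)"
    and dh': "\<forall>i\<ge>1. \<forall>k<b i. \<forall>l<b (i - 1). d i k l \<in> homog N (a i k - a (i - 1) l) \<inter> maxideal N"
    and aug: "\<forall>p\<in>polyring N. \<exists>u\<in>fmod N (b 0). p - (\<Sum>k<b 0. u k * eps k) \<in> ?I"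
    and ex0: "\<forall>u\<in>fmod N (b 0). (\<Sum>k<b 0. u k * eps k) \<in> ?I \<longleftrightarrow> (\<exists>v\<in>fmod N (b 1). u = dmap d b 1 v)"
    and ex1: "\<forall>i\<ge>1. \<forall>u\<in>fmod N (b i). (\<forall>l. dmap d b i u l = 0) \<longleftrightarrow>
      (\<exists>v\<in>fmod N (b (Suc i)). u = dmap d b (Suc i) v)"
    using res unfolding min_graded_free_res_def by - (elim conjE, assumption)+
  have dh: "d (Suc i) k l \<in> homog N (a (Suc i) k - a i l) \<inter> maxideal N" if "k < b (Suc i)" "l < b i" for i k l
    using dh'[rule_format, of "Suc i" k l] that by simp
  have ex: "u \<in> Z i \<longleftrightarrow> (\<exists>v\<in>fmod N (b (Suc i)). u = lcomb (b (Suc i)) (g (Suc i)) v)" if "u \<in> fmod N (b i)" for u i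
  proof (cases i)
    case 0
    then show ?thesis using that ex0[rule_format, of u] by (simp add: Z_def dg)
  next
    case (Suc j)
    have "(\<forall>l. dmap d b i u l = 0) \<longleftrightarrow> (\<exists>v\<in>fmod N (b (Suc i)). u = dmap d b (Suc i) v)"
      by (rule ex1[rule_format]) (use that Suc in auto)
    then show ?thesis using that Suc by (simp add: Z_def dg fker_def fun_eq_iff)
  qed
  have gfH: "g (Suc i) k \<in> fH N (b i) (a i) (a (Suc i) k)" if "k < b (Suc i)" for i k
    using dh[OF that] by (auto simp: g_def fH_def fmod_def intro: homog_polyring)
  have gZ: "g (Suc i) k \<in> Z i" if k: "k < b (Suc i)" for i k
  proof -
    define v where "v = (\<lambda>l. if l = k then 1 else 0 :: 'k mpoly)"
    have "(\<Sum>j<b (Suc i). v j * g (Suc i) j l) = (\<Sum>j<b (Suc i). if j = k then g (Suc i) j l else 0)" for l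
      by (rule sum.cong) (auto simp: v_def)
    then have "g (Suc i) k = lcomb (b (Suc i)) (g (Suc i)) v" using k by (simp add: lcomb_def)
    moreover have "v \<in> fmod N (b (Suc i))" using k by (auto simp: v_def fmod_def)
    ultimately show ?thesis using ex[of "g (Suc i) k" i] gfH[OF k] by (auto simp: fH_def)
  qed
  \<comment> \<open>By exactness \<open>Z i\<close> is the image of the next differential, whose
    entries lie in the maximal ideal.\<close>
  have Zmin: "u k \<in> maxideal N" if uZ: "u \<in> Z i" "Z i \<subseteq> fmod N (b i)" for u i k
  proof -
    obtain v where v: "v \<in> fmod N (b (Suc i))" "u = lcomb (b (Suc i)) (g (Suc i)) v"
      using ex[of u i] uZ by blast
    have "v l * g (Suc i) l k \<in> maxideal N" if "l < b (Suc i)" for l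
    proof (rule rideal_mult[OF rideal_maxideal])
      show "v l \<in> polyring N" using v(1) that by (auto simp: fmod_def)
      show "g (Suc i) l k \<in> maxideal N" using dh[OF that, of k] rideal_0[OF rideal_maxideal] by (auto simp: g_def)
    qed
    then show ?thesis unfolding v(2) lcomb_def by (intro rideal_sum[OF rideal_maxideal]) auto
  qed
  have Zsub: "Z i \<subseteq> fmod N (b i)" for i by (auto simp: Z_def fker_def)
  have st: "stage N (int i + r) (b i) (a i) (Z i)" for i
  proof (induction i)
    case 0
    show ?case unfolding stage_def using kreg_augmentation[OF I kr eps[rule_format] aug[rule_format]] Zmin[OF _ Zsub, of _ 0]
      by (simp add: Z_def)
  next
    case (Suc i)
    have Z': "Z (Suc i) = fker N (b (Suc i)) (g (Suc i))" by (simp add: Z_def)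
    have "stage N (int i + r + 1) (b (Suc i)) (a (Suc i)) (fker N (b (Suc i)) (g (Suc i)))"
      by (rule stage_next[OF Suc]) (use gZ gfH ex Zsub Zmin[of _ "Suc i", OF _ Zsub, unfolded Z'] in blast)+
    then show ?case unfolding Z' by (simp add: algebra_simps)
  qed
  show ?thesis by (rule stage_bound[OF st k])
qed

text \<open>Starting from the ring with kernel \<open>I\<close>, minimal generators of the
  successive kernels are chosen; \<open>stage\<close> provides the Koszul bound from which each
  kernel is finitely generated.\<close>

lemma minimal_resolution_exists:
  fixes G :: "'k::field mpoly set"
  assumes I: "gideal N (ideal_gen N G)" and kr: "pkreg N r (polyring N) (ideal_gen N G)"
    and max: "ideal_gen N G \<subseteq> maxideal N"
  shows "\<exists>b a d eps. min_graded_free_res N G b a d eps"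
proof -
  let ?I = "ideal_gen N G"
  define Z0 where "Z0 = {u \<in> fmod N 1. (\<Sum>k<1. u k * 1) \<in> ?I}"
  have aug: "\<exists>u\<in>fmod N 1. p - (\<Sum>k<1. u k * 1) \<in> ?I" if "p \<in> polyring N" for p
    using that rideal_0[OF gideal_rideal[OF I]]
    by (intro bexI[of _ "\<lambda>k. if k = 0 then p else 0"]) (auto simp: fmod_def)
  have "u k \<in> maxideal N" if "u \<in> Z0" for u k
    using that max rideal_0[OF rideal_maxideal] by (cases "k = 0") (auto simp: Z0_def fmod_def)
  moreover have "fgsub N 1 (\<lambda>_. 0) Z0" "kreg N fX (fH N 1 (\<lambda>_. 0)) r (fmod N 1) Z0"
    using kreg_augmentation[OF I kr, of 1 "\<lambda>_. 1" "\<lambda>_. 0"] aug by (auto simp: Z0_def)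
  ultimately have st0: "stage N r 1 (\<lambda>_. 0) Z0" by (simp add: stage_def)
  \<comment> \<open>The clause for \<open>i = 0\<close> pins down the start, since dependent choice
    yields a sequence whose first state is known only through \<open>P 0\<close>.\<close>
  define P where "P i s = (case s of (b, a, g, Z) \<Rightarrow> stage N (r + int i) b a Z \<and>
      (i = 0 \<longrightarrow> b = 1 \<and> a = (\<lambda>_. 0) \<and> Z = Z0))"
    for i :: nat and s :: "nat \<times> (nat \<Rightarrow> int) \<times> (nat \<Rightarrow> nat \<Rightarrow> 'k mpoly) \<times> (nat \<Rightarrow> 'k mpoly) set"
  define Q where "Q i s s' = (case (s, s') of ((b, a, g, Z), (b', a', g', Z')) \<Rightarrow>
      (\<forall>k<b'. g' k \<in> Z \<and> g' k \<in> fH N b a (a' k)) \<and> (\<forall>z\<in>Z. \<exists>v\<in>fmod N b'. z = lcomb b' g' v) \<and> Z' = fker N b' g')"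
    for i :: nat and s s' :: "nat \<times> (nat \<Rightarrow> int) \<times> (nat \<Rightarrow> nat \<Rightarrow> 'k mpoly) \<times> (nat \<Rightarrow> 'k mpoly) set"
  have "\<exists>s. P 0 s" using st0 by (intro exI[of _ "(1, \<lambda>_. 0, \<lambda>_ _. 0, Z0)"]) (simp add: P_def)
  moreover have "\<exists>s'. P (Suc i) s' \<and> Q i s s'" if "P i s" for i s
  proof -
    obtain b a g Z where s: "s = (b, a, g, Z)" by (cases s) auto
    have st: "stage N (r + int i) b a Z" using that by (simp add: P_def s)
    then have Z: "fgsub N b a Z" and kZ: "kreg N fX (fH N b a) (r + int i) (fmod N b) Z" by (auto simp: stage_def)
    have "kreg N fX (fH N b a) (r + int i + 1) Z {0}" by (rule kreg_syzygies[OF Z stage_bound[OF st] kZ])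
    from minimal_generators[OF Z this]
    obtain b' a' g' where *: "\<forall>k<b'. g' k \<in> Z \<and> g' k \<in> fH N b a (a' k)"
      "\<forall>z\<in>Z. \<exists>v\<in>fmod N b'. z = lcomb b' g' v" "\<forall>v\<in>fker N b' g'. \<forall>k. v k \<in> maxideal N" by blast
    then show ?thesis using stage_next[OF st *]
      by (intro exI[of _ "(b', a', g', fker N b' g')"]) (simp add: P_def Q_def s algebra_simps)
  qed
  ultimately obtain S where S: "\<And>i. P i (S i)" "\<And>i. Q i (S i) (S (Suc i))"
    using dependent_nat_choice[of P Q] by blast
  define b a d Z where "b i = fst (S i)" and "a i = fst (snd (S i))" and "d i = fst (snd (snd (S i)))"
    and "Z i = snd (snd (snd (S i)))" for i
  have Si: "S i = (b i, a i, d i, Z i)" for i by (simp add: b_def a_def d_def Z_def)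
  have st: "stage N (r + int i) (b i) (a i) (Z i)" for i using S(1)[of i] by (simp add: P_def Si)
  have init: "b 0 = 1" "a 0 = (\<lambda>_. 0)" "Z 0 = Z0" using S(1)[of 0] by (auto simp: P_def Si)
  have d: "d (Suc i) k \<in> Z i \<and> d (Suc i) k \<in> fH N (b i) (a i) (a (Suc i) k)" if "k < b (Suc i)" for i k
    using S(2)[of i] that by (simp add: Q_def Si)
  have surj: "\<exists>v\<in>fmod N (b (Suc i)). z = lcomb (b (Suc i)) (d (Suc i)) v" if "z \<in> Z i" for i z
    using S(2)[of i] that by (simp add: Q_def Si)
  have Zker: "Z (Suc i) = fker N (b (Suc i)) (d (Suc i))" for i using S(2)[of i] by (simp add: Q_def Si)
  have fg: "fgsub N (b i) (a i) (Z i)" and mn: "\<And>u k. u \<in> Z i \<Longrightarrow> u k \<in> maxideal N" for i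
    using st[of i] by (auto simp: stage_def)
  have dm: "dmap d b (Suc i) v = lcomb (b (Suc i)) (d (Suc i)) v" for i v
  proof
    fix l show "dmap d b (Suc i) v l = lcomb (b (Suc i)) (d (Suc i)) v l"
    proof (cases "l < b i")
      case False
      have "d (Suc i) k l = 0" if "k < b (Suc i)" for k using d[OF that] False by (auto simp: fH_def fmod_def)
      then show ?thesis using False by (simp add: dmap_def lcomb_def)
    qed (simp add: dmap_def lcomb_def)
  qed
  have ex: "u \<in> Z i \<longleftrightarrow> (\<exists>v\<in>fmod N (b (Suc i)). u = dmap d b (Suc i) v)" for u i
  proof
    assume "\<exists>v\<in>fmod N (b (Suc i)). u = dmap d b (Suc i) v"
    then show "u \<in> Z i" using lcomb_in[OF fg[of i], of "b (Suc i)" "d (Suc i)"] d by (auto simp: dm fmod_def)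
  qed (use surj dm in simp)
  have "min_graded_free_res N G b a d (\<lambda>_. 1)"
    unfolding min_graded_free_res_def
  proof (intro conjI allI impI ballI)
    show "(1 :: 'k mpoly) \<in> homog N (a 0 k)" for k by (simp add: init)
    show "d i k l \<in> homog N (a i k - a (i - 1) l) \<inter> maxideal N" if i: "1 \<le> i" "k < b i" "l < b (i - 1)" for i k l
    proof -
      obtain j where "i = Suc j" using i(1) by (cases i) auto
      then show ?thesis using d[of k j] i mn[of "d (Suc j) k" j l] by (auto simp: fH_def)
    qed
    show "\<exists>u\<in>fmod N (b 0). p - (\<Sum>k<b 0. u k * 1) \<in> ?I" if "p \<in> polyring N" for p
      using aug[OF that] by (simp add: init)
    show "(\<Sum>k<b 0. u k * 1) \<in> ?I \<longleftrightarrow> (\<exists>v\<in>fmod N (b 1). u = dmap d b 1 v)" if "u \<in> fmod N (b 0)" for u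
      using that ex[of u 0] by (simp add: init Z0_def)
    show "(\<forall>l. dmap d b i u l = 0) \<longleftrightarrow> (\<exists>v\<in>fmod N (b (Suc i)). u = dmap d b (Suc i) v)"
      if i: "1 \<le> i" "u \<in> fmod N (b i)" for i u
    proof -
      obtain j where j: "i = Suc j" using i(1) by (cases i) auto
      then have "(\<forall>l. dmap d b i u l = 0) \<longleftrightarrow> u \<in> Z i" using i by (simp add: Zker fker_def dm fun_eq_iff)
      then show ?thesis using ex by simp
    qed
  qed
  then show ?thesis by blast
qed

text \<open>The Betti numbers refer to a resolution picked by \<open>SOME\<close>. Existence makes
  the picked one genuine, and the bound valid for all minimal resolutions then applies to
  it.\<close>

theorem cm_reg_le:
  fixes G :: "'k::field mpoly set"
  assumes "gideal N (ideal_gen N G)" "pkreg N r (polyring N) (ideal_gen N G)" "ideal_gen N G \<subseteq> maxideal N"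
  shows "cm_reg N G \<le> ereal (of_int r)"
  unfolding cm_reg_def
proof (rule Sup_least)
  define R where "R = (\<lambda>s. case s of (b, a, d, eps) \<Rightarrow> min_graded_free_res N G b a d eps)"
  have "\<exists>s. R s" using minimal_resolution_exists[OF assms] by (force simp: R_def)
  then have "R (SOME s. R s)" by (rule someI_ex)
  then obtain b a d eps where s: "(SOME s. R s) = (b, a, d, eps)" and res: "min_graded_free_res N G b a d eps"
    by (cases "SOME s. R s") (auto simp: R_def)
  fix x assume "x \<in> {ereal (of_int (j - int i)) |i j. graded_betti N G i j \<noteq> 0}"
  then obtain i j where x: "x = ereal (of_int (j - int i))" and "graded_betti N G i j \<noteq> 0" by blast
  moreover have "graded_betti N G i j = card {k. k < b i \<and> a i k = j}"
    using s by (simp add: graded_betti_def R_def)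
  ultimately have "{k. k < b i \<and> a i k = j} \<noteq> {}" by (metis card.empty)
  then obtain k where "k < b i" "a i k = j" by blast
  then have "j \<le> int i + r" using minimal_resolution_bound[OF assms(1,2) res] by blast
  then show "x \<le> ereal (of_int r)" unfolding x by simp
qed

subsection \<open>Regular sequences from leading monomials\<close>

definition wle :: "(nat \<Rightarrow> nat) \<Rightarrow> nat \<Rightarrow> 'k::comm_ring_1 mpoly \<Rightarrow> bool" where
  "wle w c f \<longleftrightarrow> (\<forall>m\<in>mons f. wt w m \<le> c)"

lemma wle_mono: "wle w c f \<Longrightarrow> c \<le> d \<Longrightarrow> wle w d f"
  by (force simp: wle_def)

lemma wle_add: "wle w c f \<Longrightarrow> wle w c g \<Longrightarrow> wle w c (f + g)"
  using keys_add[of f g] by (auto simp: wle_def)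

lemma wle_uminus [simp]: "wle w c (- f) \<longleftrightarrow> wle w c f"
  by (simp add: wle_def)

lemma wle_diff: "wle w c f \<Longrightarrow> wle w c g \<Longrightarrow> wle w c (f - g)"
  using mons_diff_subset[of f g] by (auto simp: wle_def)

lemma wle_mult: "wle w c f \<Longrightarrow> wle w d g \<Longrightarrow> wle w (c + d) (f * g)"
  using keys_mult[of f g] by (fastforce simp: wle_def intro: add_mono)

lemma wle_sum: "(\<And>i. i \<in> I \<Longrightarrow> wle w c (f i)) \<Longrightarrow> wle w c (sum f I)"
  using mons_sum_subset[of f I] by (auto simp: wle_def)

lemma wle_pvar: "w i \<le> c \<Longrightarrow> wle w c (pvar i)"
  by (simp add: wle_def)

lemma wle_numeral: "wle w c (numeral k :: 'k::comm_ring_1 mpoly)"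
  by (auto simp: wle_def in_keys_iff lookup_numeral when_def split: if_splits)

lemma lead_pvar_mult: "lead w (vmon i + vmon j) (pvar i * pvar j :: 'k::field mpoly)"
  by (simp add: lead_def pvar_def vmon_def mult_single lookup_single when_def)

lemma lead_uminus [simp]: "lead w l (- f) \<longleftrightarrow> lead w l f"
  by (simp add: lead_def)

lemma lead_add:
  assumes "lead w l f" "wle w c g" "c < wt w l"
  shows "lead w l (f + g)"
proof -
  have g: "wt w m < wt w l" if "m \<in> mons g" for m using that assms by (auto simp: wle_def)
  then have "coef g l = 0" by (meson in_keys_iff less_irrefl)
  then have "coef (f + g) l \<noteq> 0" using assms(1) by (simp add: lookup_add lead_def)
  moreover have "wt w m < wt w l" if "m \<in> mons (f + g)" "m \<noteq> l" for m
    using that g[of m] assms(1) keys_add[of f g] by (auto simp: lead_def)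
  ultimately show ?thesis by (simp add: lead_def)
qed

lemma lead_diff: "lead w l f \<Longrightarrow> wle w c g \<Longrightarrow> c < wt w l \<Longrightarrow> lead w l (f - g)"
  using lead_add[of w l f c "- g"] by simp

definition icong :: "'k::comm_ring_1 mpoly set \<Rightarrow> 'k mpoly \<Rightarrow> 'k mpoly \<Rightarrow> bool" where
  "icong I a b \<longleftrightarrow> a - b \<in> I"

lemma icong_refl: "rideal N I \<Longrightarrow> icong I a a"
  by (simp add: icong_def rideal_0)

lemma icong_trans: "rideal N I \<Longrightarrow> icong I a b \<Longrightarrow> icong I b c \<Longrightarrow> icong I a c"
  using rideal_add[of N I "a - b" "b - c"] by (simp add: icong_def)

lemma icong_add: "rideal N I \<Longrightarrow> icong I a b \<Longrightarrow> icong I c d \<Longrightarrow> icong I (a + c) (b + d)"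
  using rideal_add[of N I "a - b" "c - d"] by (simp add: icong_def algebra_simps)

lemma icong_mult:
  assumes "rideal N I" "icong I a b" "icong I c d" "a \<in> polyring N" "d \<in> polyring N"
  shows "icong I (a * c) (b * d)"
proof -
  have "a * (c - d) + (a - b) * d \<in> I"
    using assms by (intro rideal_add[OF assms(1)] rideal_mult[OF assms(1)] rideal_mult_right[OF assms(1)])
      (auto simp: icong_def)
  then show ?thesis by (simp add: icong_def algebra_simps)
qed

lemma icong_sum: "rideal N I \<Longrightarrow> (\<And>i. i \<in> J \<Longrightarrow> icong I (f i) (g i)) \<Longrightarrow> icong I (sum f J) (sum g J)"
  unfolding icong_def sum_subtractf[symmetric] by (rule rideal_sum)

lemma icong_mono: "icong I a b \<Longrightarrow> I \<subseteq> J \<Longrightarrow> icong J a b"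
  by (auto simp: icong_def)

lemma rreg_ring_Cons:
  assumes "F \<subseteq> polyring N" "t \<in> polyring N"
  shows "rreg (t # ts) (polyring N) (ideal_gen N F) \<longleftrightarrow>
    (\<forall>p\<in>polyring N. t * p \<in> ideal_gen N F \<longrightarrow> p \<in> ideal_gen N F) \<and> rreg ts (polyring N) (ideal_gen N (insert t F))"
proof -
  have "iplus A B = iplus B A" for A B :: "'a mpoly set"
    unfolding iplus_def by (metis (no_types, lifting) add.commute)
  then show ?thesis using assms by (simp add: ideal_gen_insert)
qed

text \<open>The element \<open>t\<close> itself need not have a usable leading monomial: modulo the
  ideal it may be exchanged for \<open>t'\<close>, which changes neither its regularity nor the next
  ideal.\<close>

lemma rreg_lsys_Cons:
  fixes P :: "((nat \<Rightarrow>\<^sub>0 nat) \<times> 'k::field mpoly) set"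
  assumes P: "lsys N w P" and t: "t \<in> polyring N" "t' \<in> polyring N" "icong (ideal_gen N (snd ` P)) t t'"
    and lead: "lead w l t'" "\<And>x. x \<in> P \<Longrightarrow> mons l \<inter> mons (fst x) = {}"
    and rest: "rreg ts (polyring N) (ideal_gen N (snd ` insert (l, t') P))"
  shows "rreg (t # ts) (polyring N) (ideal_gen N (snd ` P))"
proof -
  note F = lsys_polyring[OF P]
  note I = rideal_ideal_gen[OF F]
  have "p \<in> ideal_gen N (snd ` P)" if p: "p \<in> polyring N" "t * p \<in> ideal_gen N (snd ` P)" for p
  proof (rule lsys_nzd[OF P t(2) lead p(1)])
    have "(t - t') * p \<in> ideal_gen N (snd ` P)" using t(3) p(1) by (intro rideal_mult_right[OF I]) (auto simp: icong_def)
    from rideal_diff[OF I p(2) this] show "t' * p \<in> ideal_gen N (snd ` P)" by (simp add: algebra_simps)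
  qed
  moreover have "ideal_gen N (insert t (snd ` P)) = ideal_gen N (snd ` insert (l, t') P)"
    using ideal_gen_insert_cong[OF F t(1,2)] t(3) by (simp add: icong_def)
  ultimately show ?thesis unfolding rreg_ring_Cons[OF F t(1)] using rest by auto
qed

subsection \<open>The ideals of the pieces\<close>

definition qq :: "nat \<Rightarrow> nat \<Rightarrow> nat \<Rightarrow> 'k::comm_ring_1 mpoly" where
  "qq n i j = pvar i * pvar j - pvar (n + i) * pvar (n + j)"

definition gg :: "nat \<Rightarrow> nat \<Rightarrow> nat \<Rightarrow> 'k::comm_ring_1 mpoly" where
  "gg n i j = pvar i * pvar (n + j) - pvar j * pvar (n + i)"

definition hh :: "nat \<Rightarrow> nat \<Rightarrow> 'k::comm_ring_1 mpoly" where
  "hh n i = pvar i * pvar i - pvar (n + i) * pvar (n + i)"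

definition others :: "nat \<Rightarrow> nat set \<Rightarrow> nat set" where
  "others n S = ({..<n} - S) \<union> (+) n ` ({..<n} - S)"

abbreviation others_sys :: "nat \<Rightarrow> nat set \<Rightarrow> ((nat \<Rightarrow>\<^sub>0 nat) \<times> 'k::comm_ring_1 mpoly) set" where
  "others_sys n S \<equiv> (\<lambda>i. (vmon i, pvar i)) ` others n S"

definition PP :: "nat \<Rightarrow> nat \<Rightarrow> nat \<Rightarrow> 'k::comm_ring_1 mpoly set" where
  "PP n i j = ideal_gen (2 * n) (insert (qq n i j) (pvar ` others n {i, j}))"

lemma others_subset: "others n S \<subseteq> {..<2 * n}"
  and finite_others [simp]: "finite (others n S)"
  by (auto simp: others_def)

lemma others_iff: "i < n \<Longrightarrow> i \<in> others n S \<longleftrightarrow> i \<notin> S" "i < n \<Longrightarrow> n + i \<in> others n S \<longleftrightarrow> i \<notin> S"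
  by (auto simp: others_def)

lemma card_others: "S \<subseteq> {..<n} \<Longrightarrow> card (others n S) = 2 * (n - card S)"
  unfolding others_def by (subst card_Un_disjoint) (auto simp: card_image card_Diff_subset finite_subset)

lemma lsys_others: "lsys (2 * n) w (others_sys n S :: (_ \<times> 'k::field mpoly) set)"
  by (rule lsys_pvars[OF finite_others others_subset])

lemma homog_pvar_mult: "i < N \<Longrightarrow> j < N \<Longrightarrow> pvar i * pvar j \<in> homog N 2"
  using homog_mult[OF homog_pvar homog_pvar] by fastforce

lemma qq_homog: "i < n \<Longrightarrow> j < n \<Longrightarrow> qq n i j \<in> homog (2 * n) 2"
  and gg_homog: "i < n \<Longrightarrow> j < n \<Longrightarrow> gg n i j \<in> homog (2 * n) 2"
  and hh_homog: "i < n \<Longrightarrow> hh n i \<in> homog (2 * n) 2"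
  unfolding qq_def gg_def hh_def by (auto intro!: homog_diff homog_pvar_mult)

lemma qq_polyring: "i < n \<Longrightarrow> j < n \<Longrightarrow> qq n i j \<in> polyring (2 * n)"
  and gg_polyring: "i < n \<Longrightarrow> j < n \<Longrightarrow> gg n i j \<in> polyring (2 * n)"
  and hh_polyring: "i < n \<Longrightarrow> hh n i \<in> polyring (2 * n)"
  by (rule homog_polyring, rule qq_homog gg_homog hh_homog; assumption)+

lemma others_polyring: "pvar ` others n S \<subseteq> polyring (2 * n)"
  using others_subset[of n S] by auto

lemma gideal_PP: "i < n \<Longrightarrow> j < n \<Longrightarrow> gideal (2 * n) (PP n i j)"
  unfolding PP_def
proof (rule gideal_ideal_gen)
  fix g assume ij: "i < n" "j < n" and "g \<in> insert (qq n i j) (pvar ` others n {i, j})"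
  then consider "g = qq n i j" | t where "g = pvar t" "t < 2 * n" using others_subset[of n "{i, j}"] by auto
  then show "\<exists>e. g \<in> homog (2 * n) e" using qq_homog[OF ij] homog_pvar by cases blast+
qed

lemma lead_qq_x:
  assumes "w (n + i) + w (n + j) < w i + w j"
  shows "lead w (vmon i + vmon j) (qq n i j :: 'k::field mpoly)"
  unfolding qq_def
  by (rule lead_diff[OF lead_pvar_mult wle_mult[OF wle_pvar wle_pvar]]) (use assms in auto)

lemma lead_qq_y:
  assumes "w i + w j < w (n + i) + w (n + j)"
  shows "lead w (vmon (n + i) + vmon (n + j)) (qq n i j :: 'k::field mpoly)"
proof -
  have "lead w (vmon (n + i) + vmon (n + j)) (pvar (n + i) * pvar (n + j) - pvar i * pvar j :: 'k mpoly)"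
    by (rule lead_diff[OF lead_pvar_mult wle_mult[OF wle_pvar wle_pvar]]) (use assms in auto)
  moreover have "qq n i j = - (pvar (n + i) * pvar (n + j) - pvar i * pvar j :: 'k mpoly)"
    by (simp add: qq_def)
  ultimately show ?thesis by (simp only: lead_uminus)
qed

lemma lsys_PP:
  assumes "i < n" "j < n" "lead w l (qq n i j :: 'k::field mpoly)" "mons l \<inter> others n {i, j} = {}"
  shows "lsys (2 * n) w (insert (l, qq n i j) (others_sys n {i, j} :: (_ \<times> 'k mpoly) set))"
  by (rule lsys_insert[OF lsys_others]) (use assms qq_polyring in auto)

lemma PP_nzd:
  fixes p :: "'k::field mpoly"
  assumes ij: "i < n" "j < n" and q: "lead w l (qq n i j :: 'k mpoly)" "mons l \<inter> others n {i, j} = {}"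
    and g: "g \<in> polyring (2 * n)" "lead w l' g" "mons l' \<inter> others n {i, j} = {}" "mons l' \<inter> mons l = {}"
    and p: "p \<in> polyring (2 * n)" "g * p \<in> PP n i j"
  shows "p \<in> PP n i j"
proof -
  have eq: "PP n i j = ideal_gen (2 * n) (snd ` insert (l, qq n i j) (others_sys n {i, j} :: (_ \<times> 'k mpoly) set))"
    by (simp add: PP_def image_image)
  show ?thesis unfolding eq
    by (rule lsys_nzd[OF lsys_PP[OF ij q] g(1,2)]) (use g(3,4) p in \<open>auto simp: eq\<close>)
qed

text \<open>Weight 1 on the x-variables and 0 on the y-variables makes \<open>x_i x_j\<close> lead
  in \<open>qq\<close>, and this is coprime to every y-variable.\<close>

lemma PP_nzd_y:
  fixes p :: "'k::field mpoly"
  assumes "i < n" "j < n" "k = i \<or> k = j" "p \<in> polyring (2 * n)" "pvar (n + k) * p \<in> PP n i j"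
  shows "p \<in> PP n i j"
  by (rule PP_nzd[of i n j "\<lambda>t. if t < n then 1 else 0" "vmon i + vmon j" "pvar (n + k)" "vmon (n + k)"])
     (use assms in \<open>auto intro!: lead_qq_x lead_pvar simp: mons_add_nat others_iff\<close>)

text \<open>Weight 1 on \<open>x_i\<close> and 2 on \<open>y_j\<close> makes \<open>y_i y_j\<close>
  lead in \<open>qq\<close>, so that \<open>x_i^2\<close>, which leads in \<open>hh\<close>, is
  coprime to it.\<close>

lemma PP_nzd_hh:
  fixes p :: "'k::field mpoly"
  assumes ij: "i < n" "j < n" "i \<noteq> j" and p: "p \<in> polyring (2 * n)" "hh n i * p \<in> PP n i j"
  shows "p \<in> PP n i j"
proof (rule PP_nzd[of i n j "\<lambda>t. if t = i then 1 else if t = n + j then 2 else 0" "vmon (n + i) + vmon (n + j)"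
      "hh n i" "vmon i + vmon i"])
  let ?w = "\<lambda>t. if t = i then 1 else if t = n + j then 2 else (0::nat)"
  show "lead ?w (vmon i + vmon i) (hh n i :: 'k mpoly)" unfolding hh_def
    by (rule lead_diff[OF lead_pvar_mult wle_mult[OF wle_pvar wle_pvar, of _ _ 0 _ 0]]) (use ij in auto)
qed (use ij p in \<open>auto intro!: lead_qq_y hh_polyring simp: mons_add_nat others_iff\<close>)

lemma rideal_PP: "i < n \<Longrightarrow> j < n \<Longrightarrow> rideal (2 * n) (PP n i j)"
  by (rule gideal_rideal[OF gideal_PP])

lemma qq_in_PP: "qq n i j \<in> PP n i j"
  unfolding PP_def by (rule ideal_gen_superset) simp

lemma pvar_in_PP: "t \<in> others n {i, j} \<Longrightarrow> pvar t \<in> PP n i j"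
  unfolding PP_def by (rule ideal_gen_superset) simp

text \<open>Either term of \<open>gg\<close> shares a variable with either term of
  \<open>qq\<close>, so leading monomials do not apply directly. The identity
  \<open>x_i g + y_i q = y_j h\<close> reduces the claim to the regular elements \<open>y_j\<close>
  and \<open>h\<close>.\<close>

lemma PP_nzd_gg:
  fixes p :: "'k::field mpoly"
  assumes ij: "i < n" "j < n" "i \<noteq> j" and p: "p \<in> polyring (2 * n)" "gg n i j * p \<in> PP n i j"
  shows "p \<in> PP n i j"
proof -
  note I = rideal_PP[OF ij(1,2)]
  have "pvar i * (gg n i j * p) \<in> PP n i j"
    by (rule rideal_mult[OF I _ p(2)]) (use ij in simp)
  moreover have "qq n i j * (pvar (n + i) * p) \<in> PP n i j"
    by (rule rideal_mult_right[OF I _ qq_in_PP]) (use ij p in auto)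
  ultimately have "pvar i * (gg n i j * p) + qq n i j * (pvar (n + i) * p) \<in> PP n i j"
    by (rule rideal_add[OF I])
  moreover have "pvar i * (gg n i j * p) + qq n i j * (pvar (n + i) * p) = pvar (n + j) * (hh n i * p)"
    by (simp add: gg_def qq_def hh_def algebra_simps)
  ultimately have "pvar (n + j) * (hh n i * p) \<in> PP n i j" by simp
  then have "hh n i * p \<in> PP n i j"
    by (rule PP_nzd_y[OF ij(1,2) disjI2[OF refl], rotated]) (intro polyring_mult hh_polyring ij p)
  then show ?thesis by (rule PP_nzd_hh[OF ij p(1)])
qed

text \<open>The Hilbert series of \<open>R / P_ij\<close>: the quotient by \<open>2 * n - 4\<close>
  variables and one quadric.\<close>

definition hA :: "nat \<Rightarrow> rat fps" where
  "hA n = (1 - fps_X ^ 2) * ((1 - fps_X) ^ (2 * n - 4) * inverse ((1 - fps_X) ^ (2 * n)))"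

lemma good_PP_Nil:
  assumes "i < j" "j < n"
  shows "good (2 * n) [] (hA n) 1 (polyring (2 * n)) (PP n i j :: 'k::field mpoly set)"
proof -
  let ?w = "\<lambda>t. if t < n then 1 else (0::nat)"
  have lin: "good (2 * n) [] ((1 - fps_X) ^ (2 * n - 4) * inverse ((1 - fps_X) ^ (2 * n))) 0 (polyring (2 * n))
      (ideal_gen (2 * n) (pvar ` others n {i, j} :: 'k mpoly set))"
  proof -
    have "card (others_sys n {i, j} :: (_ \<times> 'k mpoly) set) = 2 * n - 4"
      using assms by (subst card_image) (auto simp: inj_on_def card_others)
    moreover have "snd x \<in> homog (2 * n) 1" if "x \<in> others_sys n {i, j}" for x :: "_ \<times> 'k mpoly"
      using that others_subset[of n "{i, j}"] by (auto intro!: homog_pvar)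
    ultimately show ?thesis
      using good_linear[OF lsys_others[where 'k = 'k and n = n and w = ?w and S = "{i, j}"]]
      by (simp add: image_image)
  qed
  have P: "gideal (2 * n) (ideal_gen (2 * n) (pvar ` others n {i, j} :: 'k mpoly set))"
    by (rule gideal_pvars[OF others_subset])
  have nzd: "p \<in> ideal_gen (2 * n) (pvar ` others n {i, j})"
    if "p \<in> polyring (2 * n)" "qq n i j * p \<in> ideal_gen (2 * n) (pvar ` others n {i, j})" for p :: "'k mpoly"
  proof -
    have "p \<in> ideal_gen (2 * n) (snd ` (others_sys n {i, j} :: (_ \<times> 'k mpoly) set))"
      by (rule lsys_nzd[OF lsys_others[where w = ?w] qq_polyring[of i n j] lead_qq_x])
         (use that assms in \<open>auto simp: image_image mons_add_nat others_iff\<close>)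
    then show ?thesis by (simp add: image_image)
  qed
  have "good (2 * n) [] ((1 - fps_X ^ 2) * ((1 - fps_X) ^ (2 * n - 4) * inverse ((1 - fps_X) ^ (2 * n)))) (0 + int 2 - 1)
      (polyring (2 * n)) (iplus (imul (qq n i j) (polyring (2 * n))) (ideal_gen (2 * n) (pvar ` others n {i, j} :: 'k mpoly set)))"
    by (rule good_hypersurface[OF P _ _ nzd lin]) (use assms qq_homog[of i n j] in auto)
  moreover have "PP n i j = iplus (imul (qq n i j) (polyring (2 * n)))
      (ideal_gen (2 * n) (pvar ` others n {i, j} :: 'k mpoly set))"
    unfolding PP_def by (rule ideal_gen_insert[OF others_polyring qq_polyring]) (use assms in auto)
  ultimately show ?thesis by (simp add: hA_def)
qed

subsection \<open>A regular sequence of length three\<close>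

definition e2 :: "nat \<Rightarrow> (nat \<Rightarrow> 'a::comm_ring_1) \<Rightarrow> 'a" where
  "e2 k f = (\<Sum>j<k. \<Sum>i<j. f i * f j)"

definition t1 :: "nat \<Rightarrow> 'k::comm_ring_1 mpoly" where
  "t1 n = (\<Sum>i<n. pvar i)"

text \<open>On the linear components the sum of the y-variables is \<open>t1\<close> up to sign, so
  its square alone would vanish modulo \<open>t1\<close>; the second summand leaves
  \<open>- y_(n-1)^2\<close> there. Modulo \<open>PP n i j\<close> that summand is 0 unless
  \<open>j = n - 1\<close>, where it only changes the coefficient of \<open>y_i y_j\<close> from 2
  to 3.\<close>

definition t2 :: "nat \<Rightarrow> 'k::comm_ring_1 mpoly" where
  "t2 n = (\<Sum>i<n. pvar (n + i)) * (\<Sum>i<n. pvar (n + i)) + pvar (n - 1) * (\<Sum>i<n - 1. pvar i)"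

definition t3 :: "nat \<Rightarrow> 'k::comm_ring_1 mpoly" where
  "t3 n = e2 n (\<lambda>i. pvar (n + i))"

text \<open>Splitting off the first index; two applications isolate \<open>y_0\<close> and
  \<open>y_1\<close> in \<open>t3\<close>.\<close>

lemma e2_Suc: "e2 (Suc k) f = f 0 * (\<Sum>j<k. f (Suc j)) + e2 k (\<lambda>i. f (Suc i))"
proof -
  have "e2 (Suc k) f = (\<Sum>j<k. \<Sum>i<Suc j. f i * f (Suc j))"
    unfolding e2_def by (subst sum.lessThan_Suc_shift) simp
  also have "\<dots> = (\<Sum>j<k. f 0 * f (Suc j) + (\<Sum>i<j. f (Suc i) * f (Suc j)))"
    by (intro sum.cong refl sum.lessThan_Suc_shift)
  finally show ?thesis by (simp add: e2_def sum.distrib sum_distrib_left)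
qed

lemma t1_polyring [simp]: "t1 n \<in> polyring (2 * n)"
  and t2_polyring [simp]: "t2 n \<in> polyring (2 * n)"
  and t3_polyring [simp]: "t3 n \<in> polyring (2 * n)"
  by (cases "n = 0"; auto simp: t1_def t2_def t3_def e2_def intro!: polyring_sum polyring_add polyring_mult)+

text \<open>\<open>zx\<close> and \<open>zy\<close> are representatives of the variables in a
  quotient; the three elements are evaluated by substitution.\<close>

lemma icong_t:
  fixes I :: "'k::comm_ring_1 mpoly set"
  assumes I: "rideal (2 * n) I" and x: "\<And>k. k < n \<Longrightarrow> icong I (pvar k) (zx k)" and y: "\<And>k. k < n \<Longrightarrow> icong I (pvar (n + k)) (zy k)"
    and zx: "\<And>k. k < n \<Longrightarrow> zx k \<in> polyring (2 * n)" and zy: "\<And>k. k < n \<Longrightarrow> zy k \<in> polyring (2 * n)" and n: "n \<ge> 1"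
  shows "icong I (t1 n) (\<Sum>k<n. zx k)"
    "icong I (t2 n) ((\<Sum>k<n. zy k) * (\<Sum>k<n. zy k) + zx (n - 1) * (\<Sum>k<n - 1. zx k))"
    "icong I (t3 n) (e2 n zy)"
proof -
  show "icong I (t1 n) (\<Sum>k<n. zx k)" unfolding t1_def by (rule icong_sum[OF I]) (use x in auto)
  have Y: "icong I (\<Sum>i<n. pvar (n + i)) (\<Sum>k<n. zy k)" by (rule icong_sum[OF I]) (use y in auto)
  have X: "icong I (\<Sum>i<n - 1. pvar i) (\<Sum>k<n - 1. zx k)" by (rule icong_sum[OF I]) (use x in auto)
  show "icong I (t2 n) ((\<Sum>k<n. zy k) * (\<Sum>k<n. zy k) + zx (n - 1) * (\<Sum>k<n - 1. zx k))"
    unfolding t2_def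
    by (rule icong_add[OF I icong_mult[OF I Y Y] icong_mult[OF I x X]]) (use n zx zy in \<open>auto intro!: polyring_sum\<close>)
  show "icong I (t3 n) (e2 n zy)" unfolding t3_def e2_def
    by (rule icong_sum[OF I], rule icong_sum[OF I], rule icong_mult[OF I y y]) (use zy in auto)
qed

lemma sum_two:
  fixes f :: "nat \<Rightarrow> 'a::comm_monoid_add"
  assumes "i \<noteq> j" "i < n" "j < n"
  shows "(\<Sum>k<n. if k = i \<or> k = j then f k else 0) = f i + f j"
proof -
  have "(\<Sum>k<n. if k = i \<or> k = j then f k else 0) = (\<Sum>k\<in>{i, j}. if k = i \<or> k = j then f k else 0)"
    by (rule sum.mono_neutral_right) (use assms in auto)
  then show ?thesis using assms by simp
qed

lemma sum_one:
  fixes f :: "nat \<Rightarrow> 'a::comm_monoid_add"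
  assumes "\<not> (i < n \<and> j < n)" "i < n"
  shows "(\<Sum>k<n. if k = i \<or> k = j then f k else 0) = f i"
proof -
  have "(\<Sum>k<n. if k = i \<or> k = j then f k else 0) = (\<Sum>k\<in>{i}. if k = i \<or> k = j then f k else 0)"
    by (rule sum.mono_neutral_right) (use assms in auto)
  then show ?thesis by simp
qed

lemma e2_two:
  fixes f :: "nat \<Rightarrow> 'a::comm_ring_1"
  assumes "i < j" "j < n"
  shows "e2 n (\<lambda>k. if k = i \<or> k = j then f k else 0) = f i * f j"
proof -
  let ?z = "\<lambda>k. if k = i \<or> k = j then f k else 0"
  have "e2 n ?z = (\<Sum>l<n. (\<Sum>k<l. ?z k) * ?z l)" by (simp only: e2_def sum_distrib_right)
  also have "\<dots> = (\<Sum>l\<in>{i, j}. (\<Sum>k<l. ?z k) * ?z l)"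
    by (rule sum.mono_neutral_right) (use assms in auto)
  also have "\<dots> = (\<Sum>k<i. ?z k) * f i + (\<Sum>k<j. ?z k) * f j" using assms by simp
  also have "(\<Sum>k<i. ?z k) = 0" using assms by (intro sum.neutral) auto
  also have "(\<Sum>k<j. ?z k) = f i" using assms by (intro sum_one) auto
  finally show ?thesis by simp
qed

text \<open>The third element is not a leading monomial modulo the first two, but one of its multiples is
  congruent to \<open>y_j\<^sup>3\<close>.\<close>

lemma rreg_PP:
  fixes i j n :: nat
  assumes ij: "i < j" "j < n"
  shows "rreg [t1 n, t2 n, t3 n] (polyring (2 * n)) (PP n i j :: 'k::field mpoly set)"
proof -
  have ne [simp]: "n + i \<noteq> j" "n + j \<noteq> i" "j \<noteq> n + i" "i \<noteq> n + j" "i \<noteq> j" "j \<noteq> i" and n0 [simp]: "0 < n" "n \<noteq> 0" using ij by auto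
  let ?R = "polyring (2 * n) :: 'k mpoly set"
  let ?V = "others_sys n {i, j} :: (_ \<times> 'k mpoly) set"
  let ?x = "pvar :: nat \<Rightarrow> 'k mpoly" and ?y = "\<lambda>k. pvar (n + k) :: 'k mpoly"
  \<comment> \<open>Under \<open>w1\<close>, \<open>y_i y_j\<close> leads in \<open>qq\<close> and
    \<open>x_i\<close> in \<open>t1'\<close>. Under \<open>w2\<close>, the leading monomials of
    \<open>t1'\<close>, \<open>q'\<close> and \<open>t2'\<close> are \<open>x_i\<close>,
    \<open>x_j^2\<close> and \<open>y_i^2\<close>. Two weights are needed because eliminating
    \<open>x_i\<close> changes the quadric.\<close>
  define w1 where "w1 = (\<lambda>t. if t = j then 0 else (1::nat))"
  define w2 where "w2 = (\<lambda>t. if t = i then 10 else if t = j then 5 else if t = n + i then 2 else (1::nat))"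
  define t1' where "t1' = ?x i + ?x j"
  define q' where "q' = - (?x j * ?x j) - ?y i * ?y j"
  \<comment> \<open>The square contributes 2; for \<open>j = n - 1\<close> the second summand of
    \<open>t2\<close> is \<open>x_i x_j\<close>, which equals \<open>y_i y_j\<close> modulo the
    quadric and contributes 1 more.\<close>
  define a :: "'k mpoly" where "a = (if j = n - 1 then 3 else 2)"
  define t2' where "t2' = ?y i * ?y i + (a * (?y i * ?y j) + ?y j * ?y j)"
  define P0 where "P0 = insert (vmon (n + i) + vmon (n + j), qq n i j) ?V"
  define P1 where "P1 = insert (vmon j + vmon j, q') (insert (vmon i, t1') ?V)"
  define P2 where "P2 = insert (vmon (n + i) + vmon (n + i), t2') P1"
  have R: "?x i \<in> ?R" "?x j \<in> ?R" "?y i \<in> ?R" "?y j \<in> ?R" using ij by auto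
  have num: "2 \<in> ?R" "3 \<in> ?R"
    using polyring_add[OF polyring_1 polyring_1, of "2 * n"] polyring_add[OF polyring_add[OF polyring_1 polyring_1] polyring_1, of "2 * n"]
    by (simp_all add: numeral_eq_Suc)
  then have aR: "a \<in> ?R" by (simp add: a_def)
  have R': "t1' \<in> ?R" "q' \<in> ?R" "t2' \<in> ?R"
    unfolding t1'_def q'_def t2'_def using R aR by (intro polyring_add polyring_diff polyring_mult; simp)+
  have disj: "mons l \<inter> mons (fst x) = {}" if "mons l \<subseteq> {i, j, n + i, n + j}" "x \<in> ?V" for l x
    using that ij by (auto simp: others_def)
  have L0: "lsys (2 * n) w1 P0" unfolding P0_def
    by (rule lsys_PP) (use ij in \<open>auto intro!: lead_qq_y simp: w1_def mons_add_nat others_def\<close>)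
  have cong0: "icong J (pvar k) (if k = i \<or> k = j then pvar k else 0)" "icong J (pvar (n + k)) (if k = i \<or> k = j then pvar (n + k) else 0)"
    if "k < n" "pvar ` others n {i, j} \<subseteq> J" "rideal (2 * n) J" for J :: "'k mpoly set" and k
    using that by (auto simp: icong_def rideal_0 others_def)
  note cong = icong_t[where zx = "\<lambda>k. if k = i \<or> k = j then ?x k else 0" and zy = "\<lambda>k. if k = i \<or> k = j then ?y k else 0" and n = n]
  have sumx: "(\<Sum>k<n. if k = i \<or> k = j then ?x k else 0) = ?x i + ?x j"
    and sumy: "(\<Sum>k<n. if k = i \<or> k = j then ?y k else 0) = ?y i + ?y j"
    using ij by (auto intro!: sum_two)
  have "(if n - 1 = i \<or> n - 1 = j then ?x (n - 1) else 0) * (\<Sum>k<n - 1. if k = i \<or> k = j then ?x k else 0)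
      = (if j = n - 1 then ?x j * ?x i else 0)"
  proof (cases "j = n - 1")
    case True
    then have "(\<Sum>k<n - 1. if k = i \<or> k = j then ?x k else 0) = ?x i" using ij by (intro sum_one) auto
    then show ?thesis using True by simp
  qed (use ij in auto)
  note sumx' = this
  have V_snd: "snd ` ?V = pvar ` others n {i, j}" by (simp add: image_image)
  have I0: "rideal (2 * n) (ideal_gen (2 * n) (snd ` P0))" by (intro rideal_ideal_gen lsys_polyring[OF L0])
  have V0: "pvar ` others n {i, j} \<subseteq> ideal_gen (2 * n) (snd ` P0)"
    unfolding P0_def using V_snd by (auto intro: ideal_gen_superset)
  have c1: "icong (ideal_gen (2 * n) (snd ` P0)) (t1 n) t1'"
    using cong(1)[OF I0 cong0(1,2)[OF _ V0 I0]] ij by (simp add: t1'_def sumx)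
  have L1': "lsys (2 * n) w2 (insert (vmon i, t1') ?V)"
  proof (rule lsys_insert[OF lsys_others])
    show "lead w2 (vmon i) t1'" unfolding t1'_def
      by (rule lead_add[OF lead_pvar wle_pvar[OF order.refl]]) (simp add: w2_def)
    show "mons (vmon i) \<inter> mons (fst x) = {}" if "x \<in> ?V" for x by (rule disj) (use that in auto)
  qed (use R' in auto)
  have L1: "lsys (2 * n) w2 P1" unfolding P1_def
  proof (rule lsys_insert[OF L1'])
    show "lead w2 (vmon j + vmon j) q'" unfolding q'_def
      by (rule lead_diff[OF _ wle_mult[OF wle_pvar[OF order.refl] wle_pvar[OF order.refl]]])
         (use lead_pvar_mult in \<open>auto simp: w2_def\<close>)
    show "mons (vmon j + vmon j) \<inter> mons (fst x) = {}" if "x \<in> insert (vmon i, t1') ?V" for x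
      using that disj[of "vmon j + vmon j" x] by (auto simp: mons_add_nat)
  qed (use R' in auto)
  have I1: "rideal (2 * n) (ideal_gen (2 * n) (snd ` P1))" by (intro rideal_ideal_gen lsys_polyring[OF L1])
  \<comment> \<open>Modulo \<open>x_i + x_j\<close> the quadric becomes \<open>q'\<close>, which has
    a leading monomial coprime to \<open>x_i\<close> under \<open>w2\<close>; the ideal stays the
    same.\<close>
  have eq1: "ideal_gen (2 * n) (snd ` insert (vmon i, t1') P0) = ideal_gen (2 * n) (snd ` P1)"
  proof -
    let ?G = "insert t1' (snd ` ?V)"
    have G: "?G \<subseteq> ?R" using R' V_snd others_polyring[of n "{i, j}"] by auto
    have "qq n i j - q' = t1' * ?x j" by (simp add: qq_def q'_def t1'_def algebra_simps)
    also have "\<dots> \<in> ideal_gen (2 * n) ?G"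
      by (rule rideal_mult_right[OF rideal_ideal_gen[OF G] R(2) ideal_gen_superset]) simp
    finally have "ideal_gen (2 * n) (insert (qq n i j) ?G) = ideal_gen (2 * n) (insert q' ?G)"
      using ij R' by (intro ideal_gen_insert_cong[OF G]) (auto intro: qq_polyring)
    moreover have "snd ` insert (vmon i, t1') P0 = insert (qq n i j) ?G" by (auto simp: P0_def)
    moreover have "snd ` P1 = insert q' ?G" by (simp add: P1_def)
    ultimately show ?thesis by simp
  qed
  have V1: "pvar ` others n {i, j} \<subseteq> ideal_gen (2 * n) (snd ` P1)"
    unfolding P1_def using V_snd by (auto intro: ideal_gen_superset)
  have "qq n i j \<in> ideal_gen (2 * n) (snd ` P1)"
    unfolding eq1[symmetric] by (rule ideal_gen_superset) (simp add: P0_def)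
  then have "(?y i + ?y j) * (?y i + ?y j) + (if j = n - 1 then ?x j * ?x i else 0) - t2' \<in> ideal_gen (2 * n) (snd ` P1)"
    using rideal_0[OF I1] by (auto simp: t2'_def a_def qq_def algebra_simps)
  then have "icong (ideal_gen (2 * n) (snd ` P1))
      ((?y i + ?y j) * (?y i + ?y j) + (if j = n - 1 then ?x j * ?x i else 0)) t2'" by (simp only: icong_def)
  moreover have "icong (ideal_gen (2 * n) (snd ` P1)) (t2 n)
      ((\<Sum>k<n. if k = i \<or> k = j then ?y k else 0) * (\<Sum>k<n. if k = i \<or> k = j then ?y k else 0) +
       (if n - 1 = i \<or> n - 1 = j then ?x (n - 1) else 0) * (\<Sum>k<n - 1. if k = i \<or> k = j then ?x k else 0))"
    by (rule cong(2)[OF I1 cong0(1,2)[OF _ V1 I1]]) (use ij in auto)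
  ultimately have c2: "icong (ideal_gen (2 * n) (snd ` P1)) (t2 n) t2'"
    unfolding sumy sumx' using icong_trans[OF I1] by blast
  have lt2: "lead w2 (vmon (n + i) + vmon (n + i)) t2'" unfolding t2'_def
  proof (rule lead_add[OF lead_pvar_mult wle_add])
    have "wle w2 0 a" by (simp add: a_def wle_numeral)
    then have "wle w2 (0 + (w2 (n + i) + w2 (n + j))) (a * (?y i * ?y j))"
      by (intro wle_mult wle_pvar) auto
    then show "wle w2 3 (a * (?y i * ?y j))" by (rule wle_mono) (simp add: w2_def)
    show "wle w2 3 (?y j * ?y j)" by (rule wle_mono[OF wle_mult[OF wle_pvar[OF order.refl] wle_pvar[OF order.refl]]]) (simp add: w2_def)
  qed (simp add: w2_def)
  have dt2: "mons (vmon (n + i) + vmon (n + i)) \<inter> mons (fst x) = {}" if "x \<in> P1" for x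
    using that disj[of "vmon (n + i) + vmon (n + i)" x] by (auto simp: mons_add_nat P1_def)
  have L2: "lsys (2 * n) w2 P2" unfolding P2_def by (rule lsys_insert[OF L1 R'(3) lt2 dt2])
  have I2: "rideal (2 * n) (ideal_gen (2 * n) (snd ` P2))" by (intro rideal_ideal_gen lsys_polyring[OF L2])
  have V2: "pvar ` others n {i, j} \<subseteq> ideal_gen (2 * n) (snd ` P2)"
    unfolding P2_def P1_def using V_snd by (auto intro: ideal_gen_superset)
  have c3: "icong (ideal_gen (2 * n) (snd ` P2)) (t3 n) (?y i * ?y j)"
    using cong(3)[OF I2 cong0(1,2)[OF _ V2 I2]] ij by (simp add: e2_two)
  have nzy: "p \<in> ideal_gen (2 * n) (snd ` P2)" if "p \<in> ?R" "?y j * p \<in> ideal_gen (2 * n) (snd ` P2)" for p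
  proof (rule lsys_nzd[OF L2 R(4) lead_pvar _ that])
    show "mons (vmon (n + j)) \<inter> mons (fst x) = {}" if "x \<in> P2" for x
      using that disj[of "vmon (n + j)" x] by (auto simp: mons_add_nat P1_def P2_def)
  qed
  have nz3: "p \<in> ideal_gen (2 * n) (snd ` P2)" if p: "p \<in> ?R" "t3 n * p \<in> ideal_gen (2 * n) (snd ` P2)" for p
  proof -
    let ?J = "ideal_gen (2 * n) (snd ` P2)"
    have "(t3 n - ?y i * ?y j) * p \<in> ?J" using c3 p(1) by (intro rideal_mult_right[OF I2]) (auto simp: icong_def)
    from rideal_diff[OF I2 p(2) this] have yy: "?y i * ?y j * p \<in> ?J" by (simp add: algebra_simps)
    have ra: "?y i + a * ?y j \<in> ?R" using R aR by (intro polyring_add polyring_mult)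
    \<comment> \<open>From \<open>t2' * y_j - (y_i + a * y_j) * (y_i * y_j) = y_j^3\<close> it
      follows that \<open>y_j^3 * p\<close> lies in the ideal, and \<open>y_j\<close> can be
      cancelled three times.\<close>
    have "(?y i + a * ?y j) * (?y i * ?y j * p) \<in> ?J" by (rule rideal_mult[OF I2 ra yy])
    moreover have "t2' * (?y j * p) \<in> ?J"
      by (rule rideal_mult_right[OF I2 _ ideal_gen_superset]) (use R p in \<open>auto simp: P2_def\<close>)
    ultimately have "t2' * (?y j * p) - (?y i + a * ?y j) * (?y i * ?y j * p) \<in> ?J"
      by (rule_tac rideal_diff[OF I2])
    moreover have "t2' * (?y j * p) - (?y i + a * ?y j) * (?y i * ?y j * p) = ?y j * (?y j * (?y j * p))"
      by (simp add: t2'_def algebra_simps)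
    ultimately have "?y j * (?y j * (?y j * p)) \<in> ?J" by simp
    from nzy[OF _ this] have "?y j * (?y j * p) \<in> ?J" using polyring_mult[OF R(4) polyring_mult[OF R(4) p(1)]] by blast
    from nzy[OF _ this] have "?y j * p \<in> ?J" using polyring_mult[OF R(4) p(1)] by blast
    from nzy[OF p(1) this] show ?thesis .
  qed
  have "rreg [t3 n] ?R (ideal_gen (2 * n) (snd ` P2))" using nz3 by simp
  then have "rreg [t2 n, t3 n] ?R (ideal_gen (2 * n) (snd ` P1))"
    by (intro rreg_lsys_Cons[OF L1 t2_polyring R'(3) c2 lt2 dt2]) (simp_all add: P2_def)
  then have r2: "rreg [t2 n, t3 n] ?R (ideal_gen (2 * n) (snd ` insert (vmon i, t1') P0))" by (simp only: eq1)
  have "rreg [t1 n, t2 n, t3 n] ?R (ideal_gen (2 * n) (snd ` P0))"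
  proof (rule rreg_lsys_Cons[OF L0 t1_polyring R'(1) c1 _ _ r2])
    show "lead w1 (vmon i) t1'" unfolding t1'_def
      by (rule lead_add[OF lead_pvar wle_pvar[OF order.refl]]) (simp add: w1_def)
    show "mons (vmon i) \<inter> mons (fst x) = {}" if "x \<in> P0" for x
      using that disj[of "vmon i" x] by (auto simp: mons_add_nat P0_def)
  qed
  moreover have "PP n i j = ideal_gen (2 * n) (snd ` P0)" by (simp add: PP_def P0_def image_image)
  ultimately show ?thesis by simp
qed

section \<open>Quotients by linear forms\<close>

definition tt :: "nat \<Rightarrow> 'k::comm_ring_1 mpoly \<Rightarrow> 'k mpoly set" where
  "tt n \<sigma> = ideal_gen (2 * n) ((\<lambda>i. pvar i - \<sigma> * pvar (n + i)) ` {..<n})"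

text \<open>Generators of the sum of \<open>PP n (n - 2) (n - 1)\<close> and
  \<open>tt n \<sigma>\<close>; the quadric and the remaining linear forms follow from
  these.\<close>

definition QQ :: "nat \<Rightarrow> 'k::comm_ring_1 mpoly \<Rightarrow> 'k mpoly set" where
  "QQ n \<sigma> = ideal_gen (2 * n) (insert (pvar (n - 2) - \<sigma> * pvar (n + (n - 2)))
     (insert (pvar (n - 1) - \<sigma> * pvar (n + (n - 1))) (pvar ` others n {n - 2, n - 1})))"

text \<open>The quadric of \<open>PP n v (n - 1)\<close> is not listed, as each of its terms
  contains \<open>x_(n-1)\<close> or \<open>y_v\<close>.\<close>

definition PV :: "nat \<Rightarrow> nat \<Rightarrow> 'k::comm_ring_1 mpoly set" where
  "PV n v = ideal_gen (2 * n) (insert (pvar (n - 1)) (insert (pvar (n + v)) (pvar ` others n {v, n - 1})))"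

text \<open>The Hilbert series of the quotient by \<open>c\<close> independent linear forms.\<close>

definition hL :: "nat \<Rightarrow> nat \<Rightarrow> rat fps" where
  "hL n c = (1 - fps_X) ^ c * inverse ((1 - fps_X) ^ (2 * n))"

text \<open>The sign is a constant polynomial, so that it can stand in front of a variable. In
  characteristic 2 the two cases agree.\<close>

context
  fixes \<sigma> :: "'k::field mpoly"
  assumes \<sigma>: "\<sigma> = 1 \<or> \<sigma> = - 1"
begin

lemma sigma_simps [simp]: "lead w l (\<sigma> * f) \<longleftrightarrow> lead w l f" "wle w c (\<sigma> * f) \<longleftrightarrow> wle w c f"
  "\<sigma> * \<sigma> = 1" "\<sigma> * (\<sigma> * f) = f" "\<sigma> * f \<in> polyring N \<longleftrightarrow> f \<in> polyring N" "\<sigma> * f \<in> homog N e \<longleftrightarrow> f \<in> homog N e"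
  "\<sigma> \<in> polyring N"
  using \<sigma> by auto

lemma lead_tt: "w (n + i) < w i \<Longrightarrow> lead w (vmon i) (pvar i - \<sigma> * pvar (n + i))"
  by (rule lead_diff[OF lead_pvar, of _ "w (n + i)"]) (auto intro: wle_pvar)

abbreviation tt_sys :: "nat \<Rightarrow> ((nat \<Rightarrow>\<^sub>0 nat) \<times> 'k mpoly) set" where
  "tt_sys n \<equiv> (\<lambda>i. (vmon i, pvar i - \<sigma> * pvar (n + i))) ` {..<n}"

lemma tt_eq_sys: "tt n \<sigma> = ideal_gen (2 * n) (snd ` tt_sys n)"
  by (simp add: tt_def image_image)

lemma lsys_tt: "(\<And>i. i < n \<Longrightarrow> w (n + i) < w i) \<Longrightarrow> lsys (2 * n) w (tt_sys n)"
  unfolding lsys_def by (auto intro!: lead_tt polyring_diff)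

lemma gideal_tt: "gideal (2 * n) (tt n \<sigma>)"
  unfolding tt_def
proof (rule gideal_ideal_gen)
  fix g assume "g \<in> (\<lambda>i. pvar i - \<sigma> * pvar (n + i)) ` {..<n}"
  then show "\<exists>e. g \<in> homog (2 * n) e" by (auto intro!: exI[of _ 1] homog_diff)
qed

text \<open>With \<open>x_k = \<sigma> y_k\<close>, \<open>t1\<close> becomes the sum
  \<open>E\<close> of the y-variables up to sign, \<open>t2\<close> becomes
  \<open>- y_(n-1)^2\<close> modulo \<open>E\<close>, and \<open>t3\<close> becomes a form led by
  \<open>y_1^2\<close> once \<open>E\<close> eliminates \<open>y_0\<close>. As
  \<open>n \<ge> 3\<close>, the indices 0, 1 and \<open>n - 1\<close> are distinct.\<close>

lemma rreg_tt:
  assumes n: "n \<ge> 3"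
  shows "rreg [t1 n, t2 n, t3 n] (polyring (2 * n)) (tt n \<sigma>)"
proof -
  let ?R = "polyring (2 * n) :: 'k mpoly set"
  define m where "m = n - 2"
  then have m: "n = Suc (Suc m)" "m \<ge> 1" using n by auto
  define f where "f i = (pvar (n + i) :: 'k mpoly)" for i
  define U where "U = (\<Sum>j<m. f (Suc (Suc j)))"
  define W where "W = e2 m (\<lambda>i. f (Suc (Suc i)))"
  define E where "E = (\<Sum>i<n. f i)"
  \<comment> \<open>The x-variables outrank \<open>y_0\<close>, then comes \<open>y_1\<close>, then
    the rest: \<open>y_0\<close> leads in \<open>E\<close> and \<open>y_1^2\<close> in
    \<open>q3\<close>.\<close>
  define w where "w t = (if t < n then 4 else if t = n then 3 else if t = Suc n then 2 else (1::nat))" for t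
  have fR: "f i \<in> ?R" if "i < n" for i using that by (simp add: f_def)
  have E_eq: "E = f 0 + (f 1 + U)"
    unfolding E_def U_def m(1) by (simp add: sum.lessThan_Suc_shift del: sum.lessThan_Suc)
  have t3_eq: "t3 n = f 0 * (f 1 + U) + (f 1 * U + W)"
  proof -
    have "t3 n = e2 n f" by (simp add: t3_def f_def[abs_def])
    also have "\<dots> = e2 (Suc (Suc m)) f" by (simp only: m(1))
    also have "\<dots> = f 0 * (f 1 + U) + (f 1 * U + W)"
      by (simp add: e2_Suc U_def W_def sum.lessThan_Suc_shift del: sum.lessThan_Suc)
    finally show ?thesis .
  qed
  define q2 where "q2 = - (f (n - 1) * f (n - 1))"
  \<comment> \<open>The value of \<open>t3\<close> after the substitution
    \<open>y_0 = - (y_1 + U)\<close>.\<close>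
  define q3 where "q3 = - (f 1 * f 1) - (f 1 * U + U * U - W)"
  have UR: "U \<in> ?R" and WR: "W \<in> ?R" unfolding U_def W_def e2_def
    using fR m(1) by (auto intro!: polyring_sum polyring_mult)
  have ER: "\<sigma> * E \<in> ?R" "q2 \<in> ?R" "q3 \<in> ?R"
    unfolding E_def q2_def q3_def using fR UR WR n by (auto intro!: polyring_sum polyring_mult polyring_diff polyring_add)
  define P1 where "P1 = insert (vmon n, \<sigma> * E) (tt_sys n)"
  define P2 where "P2 = insert (vmon (n + (n - 1)) + vmon (n + (n - 1)), q2) P1"
  have wf: "wle w 1 (f i)" if "i \<ge> 2" for i using that unfolding f_def by (intro wle_pvar) (auto simp: w_def)
  have wU: "wle w 1 U" unfolding U_def by (intro wle_sum wf) auto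
  have wf1: "wle w 2 (f 1)" unfolding f_def by (intro wle_pvar) (auto simp: w_def)
  have L0: "lsys (2 * n) w (tt_sys n)" by (rule lsys_tt) (auto simp: w_def)
  have lE: "lead w (vmon n) (\<sigma> * E)"
  proof -
    have "lead w (vmon n) (f 0 + (f 1 + U))"
      by (rule lead_add[OF _ wle_add[OF wf1 wle_mono[OF wU]]]) (auto simp: f_def w_def lead_pvar)
    then show ?thesis by (simp add: E_eq)
  qed
  have dE: "mons (vmon n) \<inter> mons (fst x) = {}" if "x \<in> tt_sys n" for x using that by auto
  have L1: "lsys (2 * n) w P1" unfolding P1_def by (rule lsys_insert[OF L0 ER(1) lE dE])
  have l2: "lead w (vmon (n + (n - 1)) + vmon (n + (n - 1))) q2"
    unfolding q2_def f_def by (simp only: lead_uminus lead_pvar_mult)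
  have d2: "mons (vmon (n + (n - 1)) + vmon (n + (n - 1))) \<inter> mons (fst x) = {}" if "x \<in> P1" for x
    using that n by (auto simp: P1_def mons_add_nat)
  have L2: "lsys (2 * n) w P2" unfolding P2_def by (rule lsys_insert[OF L1 ER(2) l2 d2])
  have l3: "lead w (vmon (Suc n) + vmon (Suc n)) q3"
    unfolding q3_def
  proof (rule lead_diff[where c = 3])
    show "lead w (vmon (Suc n) + vmon (Suc n)) (- (f 1 * f 1))"
      using lead_pvar_mult[of w "Suc n" "Suc n"] by (simp add: f_def)
    have "wle w 3 (f 1 * U)" by (rule wle_mono[OF wle_mult[OF wf1 wU]]) simp
    moreover have "wle w 3 (U * U)" by (rule wle_mono[OF wle_mult[OF wU wU]]) simp
    moreover have "wle w 3 W" unfolding W_def e2_def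
      by (intro wle_sum wle_mono[OF wle_mult[OF wf wf]]) auto
    ultimately show "wle w 3 (f 1 * U + U * U - W)" by (intro wle_add wle_diff)
  qed (simp add: w_def)
  have d3: "mons (vmon (Suc n) + vmon (Suc n)) \<inter> mons (fst x) = {}" if "x \<in> P2" for x
    using that n by (auto simp: P1_def P2_def mons_add_nat)
  let ?I0 = "ideal_gen (2 * n) (snd ` tt_sys n)" and ?I1 = "ideal_gen (2 * n) (snd ` P1)" and ?I2 = "ideal_gen (2 * n) (snd ` P2)"
  have I0: "rideal (2 * n) ?I0" and I1: "rideal (2 * n) ?I1" and I2: "rideal (2 * n) ?I2"
    by (rule rideal_ideal_gen, rule lsys_polyring, rule L0 L1 L2)+
  have sub: "?I0 \<subseteq> ?I1" "?I1 \<subseteq> ?I2" unfolding P1_def P2_def by (intro ideal_gen_mono image_mono; blast)+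
  have x: "icong ?I0 (pvar k) (\<sigma> * f k)" if "k < n" for k
    unfolding icong_def f_def by (rule ideal_gen_superset) (use that in \<open>auto simp: image_image\<close>)
  have y: "icong ?I0 (pvar (n + k)) (f k)" for k unfolding f_def by (rule icong_refl[OF I0])
  have n1: "n \<ge> 1" using n by simp
  have zR: "\<sigma> * f k \<in> ?R" if "k < n" for k using fR[OF that] by simp
  note c = icong_t[OF I0 x y zR fR n1]
  have E1: "E \<in> ?I1"
  proof -
    have "\<sigma> * (\<sigma> * E) \<in> ?I1" by (intro rideal_mult[OF I1] ideal_gen_superset) (auto simp: P1_def)
    then show ?thesis by simp
  qed
  have c1: "icong ?I0 (t1 n) (\<sigma> * E)"
    using c(1) by (simp add: E_def sum_distrib_left)
  have "icong ?I1 (t2 n) q2"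
  proof (rule icong_trans[OF I1 icong_mono[OF c(2) sub(1)]])
    have "E = (\<Sum>k<n - 1. f k) + f (n - 1)" using n1 sum.lessThan_Suc[of f "n - 1"] by (simp add: E_def)
    then have "(\<Sum>k<n. f k) * (\<Sum>k<n. f k) + \<sigma> * f (n - 1) * (\<Sum>k<n - 1. \<sigma> * f k) = E * E + (\<sigma> * \<sigma>) * (f (n - 1) * (E - f (n - 1)))"
      by (simp add: E_def sum_distrib_left[symmetric] algebra_simps del: sigma_simps)
    then have "(\<Sum>k<n. f k) * (\<Sum>k<n. f k) + \<sigma> * f (n - 1) * (\<Sum>k<n - 1. \<sigma> * f k) - q2 = (E + f (n - 1)) * E"
      by (simp add: q2_def algebra_simps)
    moreover have "(E + f (n - 1)) * E \<in> ?I1"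
      by (rule rideal_mult[OF I1 _ E1]) (use ER(1) fR n in auto)
    ultimately show "icong ?I1 ((\<Sum>k<n. f k) * (\<Sum>k<n. f k) + \<sigma> * f (n - 1) * (\<Sum>k<n - 1. \<sigma> * f k)) q2"
      by (simp add: icong_def)
  qed
  note c2 = this
  have c3: "icong ?I2 (t3 n) q3"
  proof -
    have "t3 n - q3 = (f 1 + U) * E" by (simp add: t3_eq q3_def E_eq algebra_simps)
    moreover have "(f 1 + U) * E \<in> ?I1" by (rule rideal_mult[OF I1 _ E1]) (use fR UR n in auto)
    ultimately show ?thesis using sub(2) by (auto simp: icong_def)
  qed
  have "rreg [t3 n] ?R ?I2" by (rule rreg_lsys_Cons[OF L2 t3_polyring ER(3) c3 l3 d3]) simp_all
  then have "rreg [t2 n, t3 n] ?R ?I1"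
    unfolding P2_def by - (rule rreg_lsys_Cons[OF L1 t2_polyring ER(2) c2 l2 d2], assumption+)
  then have "rreg [t1 n, t2 n, t3 n] ?R ?I0"
    unfolding P1_def by - (rule rreg_lsys_Cons[OF L0 t1_polyring ER(1) c1 lE dE], assumption+)
  then show ?thesis by (simp only: tt_eq_sys)
qed

lemma good_tt:
  assumes n: "n \<ge> 3"
  shows "good (2 * n) [t1 n, t2 n, t3 n] (hL n n) 0 (polyring (2 * n)) (tt n \<sigma>)"
proof -
  have L: "lsys (2 * n) (\<lambda>t. if t < n then 1 else 0) (tt_sys n)" by (rule lsys_tt) auto
  have "card (tt_sys n) = n" by (subst card_image) (auto simp: inj_on_def)
  moreover have "snd x \<in> homog (2 * n) 1" if "x \<in> tt_sys n" for x using that by (auto intro!: homog_diff)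
  ultimately have "good (2 * n) [] (hL n n) 0 (polyring (2 * n)) (tt n \<sigma>)"
    using good_linear[OF L] by (simp only: hL_def tt_eq_sys)
  then show ?thesis using rreg_tt[OF n] by (simp add: good_def del: rreg.simps(2))
qed

text \<open>The quotient is a polynomial ring in \<open>y_(n-2)\<close> and \<open>y_(n-1)\<close>,
  so two elements are the most that can be regular: \<open>t1\<close> becomes their sum up to sign,
  and \<open>t2\<close> becomes \<open>- y_(n-1)^2\<close> modulo it.\<close>

lemma good_QQ:
  assumes n: "n \<ge> 3"
  shows "good (2 * n) [t1 n, t2 n] (hL n (2 * n - 2)) 0 (polyring (2 * n)) (QQ n \<sigma>)"
proof -
  let ?R = "polyring (2 * n) :: 'k mpoly set"
  define a s where "a = n - 2" and "s = n - 1"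
  have as: "a < s" "s < n" "s = Suc a" "n = Suc s" using n by (auto simp: a_def s_def)
  have ne [simp]: "a \<noteq> s" "s \<noteq> a" "a < n" "s < n" "n + a \<noteq> s" "n + s \<noteq> a" "s \<noteq> n + a" "a \<noteq> n + s" "0 < n" "n \<noteq> 0" "a < 2 * n" "s < 2 * n" using as by auto
  let ?V = "others_sys n {a, s} :: (_ \<times> 'k mpoly) set"
  let ?y = "\<lambda>k. pvar (n + k) :: 'k mpoly"
  define w where "w t = (if t < n then 4 else if t = n + a then 2 else (1::nat))" for t
  define P0 where "P0 = insert (vmon a, pvar a - \<sigma> * ?y a) (insert (vmon s, pvar s - \<sigma> * ?y s) ?V)"
  define Y where "Y = ?y a + ?y s"
  define q2 where "q2 = - (?y s * ?y s)"
  define P1 where "P1 = insert (vmon (n + a), \<sigma> * Y) P0"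
  have Q: "QQ n \<sigma> = ideal_gen (2 * n) (snd ` P0)"
    by (simp add: QQ_def P0_def image_image a_def s_def)
  have disj: "mons l \<inter> mons (fst x) = {}" if "mons l \<subseteq> {a, s, n + a, n + s}" "x \<in> ?V" for l x
    using that as by (auto simp: others_def)
  have R: "Y \<in> ?R" "\<sigma> * Y \<in> ?R" "q2 \<in> ?R" by (auto simp: Y_def q2_def intro!: polyring_add polyring_mult)
  have Ls: "lsys (2 * n) w (insert (vmon s, pvar s - \<sigma> * ?y s) ?V)"
    by (rule lsys_insert[OF lsys_others _ lead_tt disj]) (auto simp: w_def intro!: polyring_diff)
  have L0: "lsys (2 * n) w P0" unfolding P0_def
  proof (rule lsys_insert[OF Ls _ lead_tt])
    show "mons (vmon a) \<inter> mons (fst x) = {}" if "x \<in> insert (vmon s, pvar s - \<sigma> * ?y s) ?V" for x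
      using that disj[of "vmon a" x] by auto
  qed (auto simp: w_def intro!: polyring_diff)
  have l1: "lead w (vmon (n + a)) (\<sigma> * Y)"
  proof -
    have "lead w (vmon (n + a)) Y" unfolding Y_def
      by (rule lead_add[OF lead_pvar wle_pvar[OF order.refl]]) (simp add: w_def)
    then show ?thesis by simp
  qed
  have d1: "mons (vmon (n + a)) \<inter> mons (fst x) = {}" if "x \<in> P0" for x
    using that disj[of "vmon (n + a)" x] by (auto simp: P0_def)
  have L1: "lsys (2 * n) w P1" unfolding P1_def by (rule lsys_insert[OF L0 R(2) l1 d1])
  have l2: "lead w (vmon (n + s) + vmon (n + s)) q2" unfolding q2_def by (simp only: lead_uminus lead_pvar_mult)
  have d2: "mons (vmon (n + s) + vmon (n + s)) \<inter> mons (fst x) = {}" if "x \<in> P1" for x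
    using that disj[of "vmon (n + s) + vmon (n + s)" x] by (auto simp: P0_def P1_def mons_add_nat)
  let ?I0 = "ideal_gen (2 * n) (snd ` P0)" and ?I1 = "ideal_gen (2 * n) (snd ` P1)"
  have I0: "rideal (2 * n) ?I0" and I1: "rideal (2 * n) ?I1"
    by (rule rideal_ideal_gen, rule lsys_polyring, rule L0 L1)+
  have sub: "?I0 \<subseteq> ?I1" unfolding P1_def by (intro ideal_gen_mono image_mono) blast
  have gens: "pvar ` others n {a, s} \<subseteq> ?I0" "pvar a - \<sigma> * ?y a \<in> ?I0" "pvar s - \<sigma> * ?y s \<in> ?I0"
    by (auto simp: P0_def image_image intro!: ideal_gen_superset)
  have x: "icong ?I0 (pvar k) (if k = a \<or> k = s then \<sigma> * ?y k else 0)"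
    and y: "icong ?I0 (?y k) (if k = a \<or> k = s then ?y k else 0)" if "k < n" for k
    using that gens by (auto simp: icong_def rideal_0[OF I0] others_def)
  have "icong ?I0 (t1 n) (\<Sum>k<n. if k = a \<or> k = s then \<sigma> * ?y k else 0)"
    by (rule icong_t(1)[OF I0 x y]) (use n in auto)
  then have c1: "icong ?I0 (t1 n) (\<sigma> * Y)"
    by (simp add: sum_two Y_def distrib_left)
  have c2: "icong ?I1 (t2 n) q2"
  proof (rule icong_trans[OF I1 icong_mono[OF icong_t(2)[OF I0 x y] sub]])
    let ?e = "(\<Sum>k<n. if k = a \<or> k = s then ?y k else 0) * (\<Sum>k<n. if k = a \<or> k = s then ?y k else 0) +
      (if n - 1 = a \<or> n - 1 = s then \<sigma> * ?y (n - 1) else 0) * (\<Sum>k<n - 1. if k = a \<or> k = s then \<sigma> * ?y k else 0)"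
    have "(\<Sum>k<n - 1. if k = a \<or> k = s then \<sigma> * ?y k else 0) = \<sigma> * ?y a"
      using as by (intro sum_one) auto
    then have "?e = Y * Y + (\<sigma> * \<sigma>) * (?y s * ?y a)"
      using as by (simp add: sum_two Y_def s_def[symmetric] del: sigma_simps)
    then have "?e - q2 = (Y + ?y s) * Y" by (simp add: q2_def Y_def algebra_simps)
    moreover have "Y \<in> ?I1"
    proof -
      have "\<sigma> * (\<sigma> * Y) \<in> ?I1" by (intro rideal_mult[OF I1] ideal_gen_superset) (auto simp: P1_def)
      then show ?thesis by simp
    qed
    then have "(Y + ?y s) * Y \<in> ?I1" using R by (intro rideal_mult[OF I1]) auto
    ultimately show "icong ?I1 ?e q2" by (simp only: icong_def)
  qed (use n in auto)
  have "rreg [t2 n] ?R ?I1" by (rule rreg_lsys_Cons[OF L1 t2_polyring R(3) c2 l2 d2]) simp_all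
  then have r: "rreg [t1 n, t2 n] ?R ?I0"
    unfolding P1_def by - (rule rreg_lsys_Cons[OF L0 t1_polyring R(2) c1 l1 d1], assumption+)
  have "card P0 = 2 * n - 2"
  proof -
    have "card ?V = 2 * n - 4" by (subst card_image) (auto simp: inj_on_def card_others)
    moreover have "(vmon s, pvar s - \<sigma> * ?y s) \<notin> ?V" "(vmon a, pvar a - \<sigma> * ?y a) \<notin> insert (vmon s, pvar s - \<sigma> * ?y s) ?V"
      using as by (auto simp: others_def)
    ultimately show ?thesis using n by (simp add: P0_def)
  qed
  moreover have "snd x \<in> homog (2 * n) 1" if "x \<in> P0" for x
    using that others_subset[of n "{a, s}"] by (auto simp: P0_def intro!: homog_diff homog_pvar)
  ultimately have "good (2 * n) [] (hL n (2 * n - 2)) 0 ?R ?I0"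
    using good_linear[OF L0] by (simp only: hL_def)
  then show ?thesis using r by (simp add: good_def Q del: rreg.simps(2))
qed

end

text \<open>The quotient is a polynomial ring in \<open>x_v\<close> and \<open>y_(n-1)\<close>,
  where \<open>t1\<close> becomes \<open>x_v\<close> and \<open>t2\<close> becomes
  \<open>y_(n-1)^2\<close>, since \<open>x_(n-1)\<close> is 0. All forms involved are single
  monomials, so the zero weight suffices.\<close>

lemma good_PV:
  assumes n: "n \<ge> 3" and v: "v < n - 1"
  shows "good (2 * n) [t1 n, t2 n] (hL n (2 * n - 2)) 0 (polyring (2 * n)) (PV n v :: 'k::field mpoly set)"
proof -
  let ?R = "polyring (2 * n) :: 'k mpoly set"
  define s where "s = n - 1"
  have [simp]: "v \<noteq> s" "s \<noteq> v" "v < n" "s < n" "n + v \<noteq> s" "n + s \<noteq> v" "s \<noteq> n + v" "v \<noteq> n + s" "0 < n" "n \<noteq> 0" "v < 2 * n" "s < 2 * n" using n v by (auto simp: s_def)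
  let ?V = "others_sys n {v, s} :: (_ \<times> 'k mpoly) set"
  let ?y = "\<lambda>k. pvar (n + k) :: 'k mpoly" and ?w = "\<lambda>_. 0 :: nat"
  define P0 where "P0 = insert (vmon s, pvar s) (insert (vmon (n + v), ?y v) ?V)"
  define P1 where "P1 = insert (vmon v, pvar v) P0"
  have Q: "PV n v = ideal_gen (2 * n) (snd ` P0)" by (simp add: PV_def P0_def image_image s_def)
  have disj: "mons l \<inter> mons (fst x) = {}" if "mons l \<subseteq> {v, s, n + v, n + s}" "x \<in> ?V" for l x
    using that v n by (auto simp: others_def s_def)
  have Ls: "lsys (2 * n) ?w (insert (vmon (n + v), ?y v) ?V)"
    by (rule lsys_insert[OF lsys_others _ lead_pvar disj]) auto
  have L0: "lsys (2 * n) ?w P0" unfolding P0_def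
  proof (rule lsys_insert[OF Ls _ lead_pvar])
    show "mons (vmon s) \<inter> mons (fst x) = {}" if "x \<in> insert (vmon (n + v), ?y v) ?V" for x
      using that disj[of "vmon s" x] by auto
  qed auto
  have d1: "mons (vmon v) \<inter> mons (fst x) = {}" if "x \<in> P0" for x
    using that disj[of "vmon v" x] by (auto simp: P0_def)
  have L1: "lsys (2 * n) ?w P1" unfolding P1_def by (rule lsys_insert[OF L0 _ lead_pvar d1]) auto
  have d2: "mons (vmon (n + s) + vmon (n + s)) \<inter> mons (fst x) = {}" if "x \<in> P1" for x
    using that disj[of "vmon (n + s) + vmon (n + s)" x] by (auto simp: P0_def P1_def mons_add_nat)
  let ?I0 = "ideal_gen (2 * n) (snd ` P0)" and ?I1 = "ideal_gen (2 * n) (snd ` P1)"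
  have I0: "rideal (2 * n) ?I0" by (intro rideal_ideal_gen lsys_polyring[OF L0])
  have sub: "?I0 \<subseteq> ?I1" unfolding P1_def by (intro ideal_gen_mono image_mono) blast
  have gens: "pvar ` others n {v, s} \<subseteq> ?I0" "pvar s \<in> ?I0" "?y v \<in> ?I0"
    by (auto simp: P0_def image_image intro!: ideal_gen_superset)
  have x: "icong ?I0 (pvar k) (if k = v then pvar v else 0)"
    and y: "icong ?I0 (?y k) (if k = s then ?y s else 0)" if "k < n" for k
    using that gens by (cases "k = v \<or> k = s"; auto simp: icong_def rideal_0[OF I0] others_def)+
  have "icong ?I0 (t1 n) (\<Sum>k<n. if k = v then pvar v else 0)"
    by (rule icong_t(1)[OF I0 x y]) (use n in auto)
  then have c1: "icong ?I0 (t1 n) (pvar v)" by simp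
  have "icong ?I0 (t2 n) ((\<Sum>k<n. if k = s then ?y s else 0) * (\<Sum>k<n. if k = s then ?y s else 0) +
      (if n - 1 = v then pvar v else 0) * (\<Sum>k<n - 1. if k = v then pvar v else 0))"
    by (rule icong_t(2)[OF I0 x y]) (use n in auto)
  then have "icong ?I0 (t2 n) (?y s * ?y s)" using v by simp
  then have c2: "icong ?I1 (t2 n) (?y s * ?y s)" by (rule icong_mono[OF _ sub])
  have "rreg [t2 n] ?R ?I1"
    by (rule rreg_lsys_Cons[OF L1 t2_polyring _ c2 lead_pvar_mult d2]) auto
  then have r: "rreg [t1 n, t2 n] ?R ?I0"
    unfolding P1_def by - (rule rreg_lsys_Cons[OF L0 t1_polyring _ c1 lead_pvar d1], simp, assumption+)
  have "card P0 = 2 * n - 2"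
  proof -
    have "card ?V = 2 * n - 4" by (subst card_image) (auto simp: inj_on_def card_others)
    moreover have "(vmon (n + v), ?y v) \<notin> ?V" "(vmon s, pvar s) \<notin> insert (vmon (n + v), ?y v) ?V"
      using n v by (auto simp: others_def s_def)
    ultimately show ?thesis using n by (simp add: P0_def)
  qed
  moreover have "snd x \<in> homog (2 * n) 1" if "x \<in> P0" for x
    using that others_subset[of n "{v, s}"] by (auto simp: P0_def intro!: homog_pvar)
  ultimately have "good (2 * n) [] (hL n (2 * n - 2)) 0 ?R ?I0"
    using good_linear[OF L0] by (simp only: hL_def)
  then show ?thesis using r by (simp add: good_def Q del: rreg.simps(2))
qed

lemma good_PP:
  assumes "i < j" "j < n"
  shows "good (2 * n) [t1 n, t2 n, t3 n] (hA n) 1 (polyring (2 * n)) (PP n i j :: 'k::field mpoly set)"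
  using good_PP_Nil[OF assms, where 'k = 'k] rreg_PP[OF assms, where 'k = 'k] by (simp add: good_def del: rreg.simps(2))

subsection \<open>Linear functionals on coefficients\<close>

text \<open>Functionals given by their values on monomials describe ideals by tests on coefficients,
  without a quotient ring or a substitution map.\<close>

definition lf :: "((nat \<Rightarrow>\<^sub>0 nat) \<Rightarrow> 'k) \<Rightarrow> 'k::comm_ring_1 mpoly \<Rightarrow> 'k" where
  "lf f p = (\<Sum>m\<in>mons p. coef p m * f m)"

lemma lf_superset: "finite M \<Longrightarrow> mons p \<subseteq> M \<Longrightarrow> lf f p = (\<Sum>m\<in>M. coef p m * f m)"
  unfolding lf_def by (rule sum.mono_neutral_left) (auto simp: in_keys_iff)

lemma lf_0 [simp]: "lf f 0 = 0"
  by (simp add: lf_def)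

lemma lf_add: "lf f (p + q) = lf f p + lf f q"
proof -
  let ?M = "mons p \<union> mons q"
  have "lf f (p + q) = (\<Sum>m\<in>?M. coef (p + q) m * f m)" using keys_add[of p q] by (intro lf_superset) auto
  then show ?thesis by (simp add: lf_superset[of ?M] lookup_add distrib_right sum.distrib)
qed

lemma lf_mterm [simp]: "lf f (mterm m c) = c * f m"
  by (simp add: lf_def)

lemma lf_pvar [simp]: "lf f (pvar t) = f (vmon t)"
  by (simp add: pvar_def vmon_def del: One_nat_def)

lemma lf_uminus: "lf f (- p) = - lf f p"
  by (simp add: lf_def sum_negf)

lemma lf_diff: "lf f (p - q) = lf f p - lf f q"
  using lf_add[of f p "- q"] by (simp add: lf_uminus)

lemma lf_sum: "lf f (sum g I) = (\<Sum>i\<in>I. lf f (g i))"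
  by (induction I rule: infinite_finite_induct) (auto simp: lf_add)

lemma lf_diff_fun: "lf (\<lambda>m. f m - g m) p = lf f p - lf g p"
  by (simp add: lf_def right_diff_distrib sum_subtractf)

lemma lf_cong: "(\<And>m. m \<in> mons p \<Longrightarrow> f m = g m) \<Longrightarrow> lf f p = lf g p"
  by (simp add: lf_def)

lemma lf_mterm_mult: "lf f (mterm m c * p) = c * lf (\<lambda>k. f (m + k)) p"
  by (induction p rule: poly_induct) (auto simp: mult_single lf_add distrib_left)

lemma lf_pvar_mult: "lf f (pvar t * p) = lf (\<lambda>k. f (vmon t + k)) p"
  by (simp add: pvar_def vmon_def lf_mterm_mult)

lemma lf_mult: "lf f (r * p) = (\<Sum>m\<in>mons r. coef r m * lf (\<lambda>k. f (m + k)) p)"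
proof -
  have "lf f ((\<Sum>m\<in>mons r. mterm m (coef r m)) * p) = (\<Sum>m\<in>mons r. coef r m * lf (\<lambda>k. f (m + k)) p)"
    by (simp add: sum_distrib_right lf_sum lf_mterm_mult)
  then show ?thesis by (simp flip: poly_eq_sum_terms)
qed

lemma coef_eq_lf: "coef p m = lf (\<lambda>k. if k = m then 1 else 0) p"
proof -
  have "lf (\<lambda>k. if k = m then 1 else 0) p = (\<Sum>k\<in>mons p. if k = m then coef p m else 0)"
    unfolding lf_def by (rule sum.cong) auto
  then show ?thesis by (auto simp: in_keys_iff)
qed

text \<open>Multiplying a polynomial by a monomial translates the functional, so a family closed
  under translation cuts out an ideal.\<close>

lemma rideal_lf:
  assumes "\<And>f m. f \<in> \<Phi> \<Longrightarrow> mons m \<subseteq> {..<N} \<Longrightarrow> (\<lambda>k. f (m + k)) \<in> \<Phi>"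
  shows "rideal N {p \<in> polyring N. \<forall>f\<in>\<Phi>. lf f p = 0}"
  unfolding rideal_def using assms
  by (auto simp: lf_add lf_mult dest: polyring_termD intro!: sum.neutral)

text \<open>Rewriting of monomials into normal forms with a scalar. A congruence on monomials
  extends to polynomials, and each coefficient of the result is a functional of
  \<open>p\<close>.\<close>

definition lmap :: "((nat \<Rightarrow>\<^sub>0 nat) \<Rightarrow> (nat \<Rightarrow>\<^sub>0 nat)) \<Rightarrow> ((nat \<Rightarrow>\<^sub>0 nat) \<Rightarrow> 'k) \<Rightarrow> 'k::comm_ring_1 mpoly \<Rightarrow> 'k mpoly" where
  "lmap \<rho> s p = (\<Sum>m\<in>mons p. mterm (\<rho> m) (coef p m * s m))"

lemma lf_lmap: "lf f (lmap \<rho> s p) = lf (\<lambda>m. s m * f (\<rho> m)) p"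
  unfolding lmap_def lf_sum lf_mterm by (simp add: lf_def mult.assoc)

lemma lmap_cong_mod:
  assumes I: "rideal N I" and "\<And>m. m \<in> mons p \<Longrightarrow> mterm m 1 - mterm (\<rho> m) (s m) \<in> I"
  shows "p - lmap \<rho> s p \<in> I"
proof -
  have "mterm m (coef p m) - mterm (\<rho> m) (coef p m * s m) \<in> I" if "m \<in> mons p" for m
  proof -
    have "mterm 0 (coef p m) * (mterm m 1 - mterm (\<rho> m) (s m)) \<in> I"
      by (rule rideal_mult[OF I polyring_term assms(2)[OF that]]) simp
    then show ?thesis by (simp add: right_diff_distrib mult_single)
  qed
  then have "(\<Sum>m\<in>mons p. mterm m (coef p m) - mterm (\<rho> m) (coef p m * s m)) \<in> I"
    by (rule rideal_sum[OF I])
  then show ?thesis by (simp add: sum_subtractf lmap_def flip: poly_eq_sum_terms)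
qed

lemma pvars_ideal_mons:
  assumes "V \<subseteq> {..<N}" "p \<in> ideal_gen N (pvar ` V)" "m \<in> mons p"
  shows "mons m \<inter> V \<noteq> {}"
proof -
  define T where "T = {p \<in> polyring N :: 'a mpoly set. \<forall>m\<in>mons p. mons m \<inter> V \<noteq> {}}"
  have "rideal N T"
    unfolding rideal_def
  proof (intro conjI ballI)
    show "T \<subseteq> polyring N" "0 \<in> T" by (auto simp: T_def)
    show "a + b \<in> T" if "a \<in> T" "b \<in> T" for a b
      using that keys_add[of a b] by (auto simp: T_def)
    show "r * a \<in> T" if "r \<in> polyring N" "a \<in> T" for r a
    proof -
      have "mons m \<inter> V \<noteq> {}" if m: "m \<in> mons (r * a)" for m
      proof -
        obtain k l where "l \<in> mons a" "m = k + l" using keys_mult[of r a] m by blast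
        then show ?thesis using \<open>a \<in> T\<close> by (auto simp: T_def mons_add_nat)
      qed
      then show ?thesis using that by (auto simp: T_def)
    qed
  qed
  then have "p \<in> T" using assms(2)
    by (rule ideal_gen_leastI) (use assms(1) in \<open>auto simp: T_def\<close>)
  then show ?thesis using assms(3) by (auto simp: T_def)
qed

lemma pvars_ideal_memI:
  assumes "V \<subseteq> {..<N}" "p \<in> polyring N" "\<And>m. m \<in> mons p \<Longrightarrow> mons m \<inter> V \<noteq> {}"
  shows "p \<in> ideal_gen N (pvar ` V)"
proof -
  have I: "rideal N (ideal_gen N (pvar ` V) :: 'a mpoly set)" using assms(1) by (intro rideal_ideal_gen) auto
  have "mterm m (coef p m) \<in> ideal_gen N (pvar ` V)" if m: "m \<in> mons p" for m
  proof -
    obtain t where t: "t \<in> mons m" "t \<in> V" using assms(3)[OF m] by blast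
    obtain m' where m': "m = mterm t 1 + m'" using monomial_splitE[OF t(1)] by metis
    then have "mterm m (coef p m) = pvar t * mterm m' (coef p m)" using term_add_eq_pvar_mult by blast
    moreover have "mterm m' (coef p m) \<in> polyring N"
      using polyring_termD[OF assms(2) m] m' by (intro polyring_term) (auto simp: mons_add_nat)
    moreover have "pvar t \<in> ideal_gen N (pvar ` V)" using t by (intro ideal_gen_superset) auto
    ultimately show ?thesis using rideal_mult_right[OF I] by metis
  qed
  then have "(\<Sum>m\<in>mons p. mterm m (coef p m)) \<in> ideal_gen N (pvar ` V)" by (rule rideal_sum[OF I])
  then show ?thesis by (simp flip: poly_eq_sum_terms)
qed

subsection \<open>Multidegree and parity\<close>

text \<open>The fine grading that gives \<open>x_i\<close> and \<open>y_i\<close> the same degree,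
  the i-th unit vector. The binomials \<open>qq\<close>, \<open>gg\<close> and \<open>hh\<close> are
  homogeneous for it and also for the parity of the y-degree.\<close>

definition dv :: "nat \<Rightarrow> (nat \<Rightarrow>\<^sub>0 nat) \<Rightarrow> nat \<Rightarrow> nat" where
  "dv n m = (\<lambda>i. if i < n then coef m i + coef m (n + i) else 0)"

definition par :: "nat \<Rightarrow> (nat \<Rightarrow>\<^sub>0 nat) \<Rightarrow> bool" where
  "par n m \<longleftrightarrow> odd (\<Sum>i<n. coef m (n + i))"

text \<open>The x-monomial of multidegree \<open>d\<close>, a representative of even parity.\<close>

definition nx :: "nat \<Rightarrow> (nat \<Rightarrow> nat) \<Rightarrow> (nat \<Rightarrow>\<^sub>0 nat)" where
  "nx n d = (\<Sum>i<n. mterm i (d i))"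

definition inc :: "nat \<Rightarrow> (nat \<Rightarrow> nat) \<Rightarrow> nat \<Rightarrow> nat" where
  "inc k d = d(k := Suc (d k))"

lemma dv_add: "dv n (m + m') = (\<lambda>i. dv n m i + dv n m' i)"
  by (auto simp: dv_def lookup_add)

lemma par_add: "par n (m + m') \<longleftrightarrow> par n m \<noteq> par n m'"
  by (simp add: par_def lookup_add sum.distrib)

lemma coef_vmon: "coef (vmon t) i = (if i = t then 1 else 0)"
  by (simp add: vmon_def lookup_single when_def)

lemma dv_vmon_x: "k < n \<Longrightarrow> dv n (vmon k + m) = inc k (dv n m)"
  by (auto simp: dv_def lookup_add coef_vmon inc_def)

lemma dv_vmon_y: "k < n \<Longrightarrow> dv n (vmon (n + k) + m) = inc k (dv n m)"
  by (auto simp: dv_def lookup_add coef_vmon inc_def)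

lemma par_vmon_x: "k < n \<Longrightarrow> par n (vmon k + m) = par n m"
  by (simp add: par_add) (simp add: par_def coef_vmon)

lemma par_vmon_y: "k < n \<Longrightarrow> par n (vmon (n + k) + m) = (\<not> par n m)"
  by (simp add: par_add) (simp add: par_def coef_vmon)

lemma dv_par_0 [simp]: "dv n 0 = (\<lambda>_. 0)" "par n 0 = False"
  by (auto simp: dv_def par_def)

lemma coef_nx: "coef (nx n d) t = (if t < n then d t else 0)"
  by (simp add: nx_def lookup_sum lookup_single when_def)

lemma nx_inc: "k < n \<Longrightarrow> nx n (inc k d) = vmon k + nx n d"
  by (rule poly_mapping_eqI) (auto simp: coef_nx lookup_add coef_vmon inc_def)

lemma nx_0 [simp]: "nx n (\<lambda>_. 0) = 0"
  by (simp add: nx_def)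

lemma dv_nx [simp]: "dv n (nx n (dv n m)) = dv n m" and par_nx [simp]: "par n (nx n d) = False"
  by (auto simp: dv_def par_def coef_nx)

lemma mons_nx: "mons (nx n d) \<subseteq> {..<n}"
  by (auto simp: in_keys_iff coef_nx split: if_splits)

lemma mdeg_dv: 
  assumes "mons m \<subseteq> {..<2 * n}"
  shows "mdeg m = (\<Sum>i<n. dv n m i)"
proof -
  have "mdeg m = (\<Sum>i<n + n. coef m i)"
    using wt_superset[of "{..<n + n}" m "\<lambda>_. 1"] assms by (simp add: mdeg_eq_wt mult_2)
  also have "\<dots> = (\<Sum>i<n. coef m i) + (\<Sum>i<n. coef m (n + i))"
  proof -
    have "(\<Sum>i<n + k. f i) = (\<Sum>i<n. f i) + (\<Sum>i<k. f (n + i))" for f :: "nat \<Rightarrow> nat" and k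
      by (induction k) auto
    then show ?thesis .
  qed
  finally show ?thesis by (simp add: dv_def sum.distrib)
qed

lemma monomial_induct_vmon [consumes 1, case_names zero x y]:
  assumes "mons m \<subseteq> {..<2 * n}" "P 0"
    "\<And>k m. k < n \<Longrightarrow> mons m \<subseteq> {..<2 * n} \<Longrightarrow> P m \<Longrightarrow> P (vmon k + m)"
    "\<And>k m. k < n \<Longrightarrow> mons m \<subseteq> {..<2 * n} \<Longrightarrow> P m \<Longrightarrow> P (vmon (n + k) + m)"
  shows "P m"
  using assms(1)
proof (induction m rule: monomial_induct)
  case (add t m)
  have t: "t < 2 * n" and m: "mons m \<subseteq> {..<2 * n}" using add.prems by (auto simp: mons_add_nat)
  then show ?case using add.IH[OF m] assms(3)[of t m] assms(4)[of "t - n" m]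
    by (cases "t < n") (auto simp: vmon_def)
qed (use assms in simp)

lemma mterm_vmon: "mterm (vmon k + m) c = pvar k * mterm m c"
  unfolding vmon_def by (rule term_add_eq_pvar_mult)

subsection \<open>The image in the two linear components\<close>

text \<open>In characteristic other than 2 this is the intersection of \<open>tt n 1\<close> and \<open>tt n (- 1)\<close>;
  grading by parity in the \<open>y\<close>-variables replaces it in a way that also works in characteristic 2.\<close>

definition tt0 :: "nat \<Rightarrow> 'k::comm_ring_1 mpoly set" where
  "tt0 n = {p \<in> polyring (2 * n). \<forall>\<phi>. lf (\<lambda>m. \<phi> (dv n m) (par n m)) p = 0}"

lemma rideal_tt0: "rideal (2 * n) (tt0 n :: 'k::comm_ring_1 mpoly set)"
proof -
  let ?\<Phi> = "range (\<lambda>\<phi> m. \<phi> (dv n m) (par n m)) :: ((nat \<Rightarrow>\<^sub>0 nat) \<Rightarrow> 'k) set"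
  have "rideal (2 * n) {p \<in> polyring (2 * n). \<forall>f\<in>?\<Phi>. lf f p = 0}"
  proof (rule rideal_lf)
    fix f :: "_ \<Rightarrow> 'k" and m assume "f \<in> ?\<Phi>"
    then obtain \<phi> where "f = (\<lambda>m. \<phi> (dv n m) (par n m))" by blast
    then show "(\<lambda>k. f (m + k)) \<in> ?\<Phi>"
      by (intro image_eqI[of _ _ "\<lambda>d b. \<phi> (\<lambda>i. dv n m i + d i) (par n m \<noteq> b)"]) (auto simp: dv_add par_add)
  qed
  then show ?thesis by (simp add: tt0_def)
qed

lemma tt0D: "p \<in> tt0 n \<Longrightarrow> lf (\<lambda>m. \<phi> (dv n m) (par n m)) p = 0"
  by (simp add: tt0_def)

lemma gideal_tt0: "gideal (2 * n) (tt0 n :: 'k::comm_ring_1 mpoly set)"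
  unfolding gideal_def
proof (intro conjI rideal_tt0 ballI allI)
  fix p :: "'k mpoly" and e assume p: "p \<in> tt0 n"
  then have pR: "p \<in> polyring (2 * n)" by (simp add: tt0_def)
  have "lf (\<lambda>m. \<phi> (dv n m) (par n m)) (hcomp e p) = 0" for \<phi>
  proof -
    have "lf f (hcomp e p) = lf (\<lambda>m. if int (mdeg m) = e then f m else 0) p" for f
    proof -
      have "lf f (hcomp e p) = (\<Sum>m\<in>mons p. coef (hcomp e p) m * f m)"
        by (rule lf_superset) (auto simp: hcomp_def)
      then show ?thesis by (auto simp: lf_def hcomp_def intro!: sum.cong)
    qed
    \<comment> \<open>The total degree is determined by the multidegree, so a functional cut off at
      degree \<open>e\<close> is again one of the test functionals.\<close>
    then have "lf (\<lambda>m. \<phi> (dv n m) (par n m)) (hcomp e p) =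
        lf (\<lambda>m. (\<lambda>d b. if int (\<Sum>i<n. d i) = e then \<phi> d b else 0) (dv n m) (par n m)) p"
      by (auto intro!: lf_cong simp: mdeg_dv[OF polyring_termD[OF pR]])
    also have "\<dots> = 0" by (rule tt0D[OF p, of "\<lambda>d b. if int (\<Sum>i<n. d i) = e then \<phi> d b else 0"])
    finally show ?thesis .
  qed
  then show "hcomp e p \<in> tt0 n" using hcomp_polyring[OF pR] by (simp add: tt0_def)
qed

lemma tt0_binomials:
  assumes "i < n" "j < n"
  shows "qq n i j \<in> tt0 n" "gg n i j \<in> tt0 n" "hh n i \<in> tt0 n"
  using assms qq_polyring gg_polyring hh_polyring
  by (auto simp: tt0_def qq_def gg_def hh_def lf_diff lf_pvar_mult dv_vmon_x dv_vmon_y par_vmon_x par_vmon_y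
      dv_vmon_x[of _ _ 0, simplified] dv_vmon_y[of _ _ 0, simplified] par_vmon_x[of _ _ 0, simplified]
      par_vmon_y[of _ _ 0, simplified] inc_def fun_upd_twist intro!: polyring_diff polyring_mult)

definition psg :: "'k::comm_ring_1 \<Rightarrow> bool \<Rightarrow> 'k" where
  "psg s b = (if b then s else 1)"

text \<open>Modulo \<open>tt n (\<plusminus>1)\<close> a monomial depends only on its multidegree, up to the sign \<open>psg\<close>.\<close>

lemma tt_iff:
  fixes s :: "'k::field"
  assumes s: "s = 1 \<or> s = - 1"
  shows "tt n (mterm 0 s) = {p \<in> polyring (2 * n). \<forall>\<chi>. lf (\<lambda>m. psg s (par n m) * \<chi> (dv n m)) p = 0}"
    (is "?L = ?M")
proof
  have ss: "s * s = 1" using s by auto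
  let ?\<sigma> = "mterm 0 s :: 'k mpoly"
  have \<sigma>: "?\<sigma> = 1 \<or> ?\<sigma> = - 1" using s by (auto simp: single_uminus)
  have psg_xor: "psg s (b = (\<not> c)) = psg s c * psg s b" for b c using ss by (auto simp: psg_def)
  have I: "rideal (2 * n) ?L" by (rule gideal_rideal[OF gideal_tt[OF \<sigma>]])
  show "?L \<subseteq> ?M" unfolding tt_def
  proof (rule ideal_gen_least)
    let ?\<Phi> = "range (\<lambda>\<chi> m. psg s (par n m) * \<chi> (dv n m)) :: ((nat \<Rightarrow>\<^sub>0 nat) \<Rightarrow> 'k) set"
    have "rideal (2 * n) {p \<in> polyring (2 * n). \<forall>f\<in>?\<Phi>. lf f p = 0}"
    proof (rule rideal_lf)
      fix f :: "_ \<Rightarrow> 'k" and m assume "f \<in> ?\<Phi>"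
      then obtain \<chi> where "f = (\<lambda>m. psg s (par n m) * \<chi> (dv n m))" by blast
      then show "(\<lambda>k. f (m + k)) \<in> ?\<Phi>"
        by (intro image_eqI[of _ _ "\<lambda>d. psg s (par n m) * \<chi> (\<lambda>i. dv n m i + d i)"]) (auto simp: dv_add par_add psg_xor mult.assoc)
    qed
    then show "rideal (2 * n) ?M" by simp
    show "(\<lambda>i. pvar i - ?\<sigma> * pvar (n + i)) ` {..<n} \<subseteq> ?M"
    proof clarify
      fix i assume i: "i < n"
      have "lf f (?\<sigma> * pvar (n + i)) = s * f (vmon (n + i))" for f by (simp add: lf_mterm_mult)
      then show "pvar i - ?\<sigma> * pvar (n + i) \<in> polyring (2 * n) \<and>
          (\<forall>\<chi>. lf (\<lambda>m. psg s (par n m) * \<chi> (dv n m)) (pvar i - ?\<sigma> * pvar (n + i)) = 0)"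
        using i ss dv_vmon_x[OF i, of 0] dv_vmon_y[OF i, of 0] par_vmon_x[OF i, of 0] par_vmon_y[OF i, of 0]
        by (auto simp: lf_diff psg_def intro!: polyring_diff polyring_mult polyring_term simp flip: mult.assoc)
    qed
  qed
  show "?M \<subseteq> ?L"
  proof
    fix p assume p: "p \<in> ?M"
    have gen: "pvar i - ?\<sigma> * pvar (n + i) \<in> ?L" if "i < n" for i
      unfolding tt_def using that by (intro ideal_gen_superset) auto
    \<comment> \<open>Since \<open>s * s = 1\<close>, each \<open>y_i\<close> may be exchanged for
      \<open>s\<close> times \<open>x_i\<close>; only the parity of the number of exchanges is left
      in the sign.\<close>
    have mon: "mterm m 1 - mterm (nx n (dv n m)) (psg s (par n m)) \<in> ?L" if "mons m \<subseteq> {..<2 * n}" for m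
      using that
    proof (induction m rule: monomial_induct_vmon)
      case zero
      then show ?case by (simp add: psg_def rideal_0[OF I])
    next
      case (x k m)
      have "pvar k * (mterm m 1 - mterm (nx n (dv n m)) (psg s (par n m))) \<in> ?L"
        by (rule rideal_mult[OF I _ x(3)]) (use x in simp)
      then show ?case using x by (simp add: right_diff_distrib dv_vmon_x par_vmon_x nx_inc mterm_vmon)
    next
      case (y k m)
      let ?m = "mterm (nx n (dv n m)) (psg s (par n m)) :: 'k mpoly"
      have mR: "?\<sigma> * ?m \<in> polyring (2 * n)"
        using mons_nx[of n "dv n m"] by (intro polyring_mult polyring_term) auto
      have 1: "pvar (n + k) * (mterm m 1 - ?m) \<in> ?L"
        by (rule rideal_mult[OF I _ y(3)]) (use y in simp)
      have 2: "(?\<sigma> * ?m) * (pvar k - ?\<sigma> * pvar (n + k)) \<in> ?L"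
        by (rule rideal_mult[OF I mR gen[OF y(1)]])
      have "(S * M) * (X - S * Y) = X * (S * M) - (S * S) * (Y * M)" for S M X Y :: "'k mpoly"
        by (simp add: algebra_simps)
      moreover have "?\<sigma> * ?\<sigma> = 1" using ss by (simp add: mult_single)
      ultimately have 3: "(?\<sigma> * ?m) * (pvar k - ?\<sigma> * pvar (n + k)) = pvar k * (?\<sigma> * ?m) - pvar (n + k) * ?m"
        by (simp only: mult_1)
      have "pvar (n + k) * (mterm m 1 - ?m) - (pvar k * (?\<sigma> * ?m) - pvar (n + k) * ?m)
          = pvar (n + k) * mterm m 1 - pvar k * (?\<sigma> * ?m)" by (simp add: right_diff_distrib)
      with rideal_diff[OF I 1 2] have "pvar (n + k) * mterm m 1 - pvar k * (?\<sigma> * ?m) \<in> ?L"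
        by (simp only: 3)
      moreover have "?\<sigma> * ?m = mterm (nx n (dv n m)) (psg s (\<not> par n m))"
        using ss by (simp add: mult_single psg_def)
      ultimately show ?case using y by (simp add: dv_vmon_y par_vmon_y nx_inc mterm_vmon)
    qed
    have pR: "p \<in> polyring (2 * n)" using p by simp
    have "p - lmap (\<lambda>m. nx n (dv n m)) (\<lambda>m. psg s (par n m)) p \<in> ?L"
      by (rule lmap_cong_mod[OF I mon]) (rule polyring_termD[OF pR])
    moreover have "lmap (\<lambda>m. nx n (dv n m)) (\<lambda>m. psg s (par n m)) p = 0"
    proof (rule poly_mapping_eqI)
      fix m0
      have "\<forall>\<chi>. lf (\<lambda>m. psg s (par n m) * \<chi> (dv n m)) p = 0" using p by simp
      \<comment> \<open>With this indicator as \<open>\<chi>\<close> the functional is the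
        coefficient of \<open>m0\<close> in the normal form.\<close>
      from spec[OF this, of "\<lambda>d. if nx n d = m0 then 1 else 0"]
      have "lf (\<lambda>m. psg s (par n m) * (if nx n (dv n m) = m0 then 1 else 0)) p = 0" .
      then show "coef (lmap (\<lambda>m. nx n (dv n m)) (\<lambda>m. psg s (par n m)) p) m0 = coef 0 m0"
        by (simp add: coef_eq_lf[of "lmap _ _ _"] lf_lmap)
    qed
    ultimately show "p \<in> ?L" by simp
  qed
qed

subsection \<open>Adjoining binomials\<close>

abbreviation ts :: "nat \<Rightarrow> 'k::comm_ring_1 mpoly list" where
  "ts n \<equiv> [t1 n, t2 n, t3 n]"

lemma ts_polyring: "set (ts n) \<subseteq> polyring (2 * n)"
  by simp

lemma qq_commute: "qq n i j = qq n j i"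
  by (simp add: qq_def mult.commute)

lemma gg_swap: "gg n i j = - gg n j i"
  by (simp add: gg_def mult.commute)

lemma binomials_in_PP:
  fixes a b :: nat
  assumes ij: "i < n" "j < n" and ab: "a < n" "b < n"
  shows "i \<notin> {a, b} \<Longrightarrow> qq n i j \<in> PP n a b" "i \<notin> {a, b} \<Longrightarrow> gg n i j \<in> PP n a b" "i \<notin> {a, b} \<Longrightarrow> hh n i \<in> PP n a b"
proof -
  note I = rideal_PP[OF ab]
  have *: "pvar i \<in> PP n a b" "pvar (n + i) \<in> PP n a b" if "i \<notin> {a, b}"
    using that ij by (auto intro!: pvar_in_PP simp: others_def)
  have R: "pvar i \<in> polyring (2 * n)" "pvar j \<in> polyring (2 * n)" "pvar (n + i) \<in> polyring (2 * n)" "pvar (n + j) \<in> polyring (2 * n)"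
    using ij by auto
  show "i \<notin> {a, b} \<Longrightarrow> qq n i j \<in> PP n a b"
    unfolding qq_def using * R by (intro rideal_diff[OF I] rideal_mult_right[OF I]) auto
  show "i \<notin> {a, b} \<Longrightarrow> gg n i j \<in> PP n a b"
    unfolding gg_def using rideal_diff[OF I rideal_mult_right[OF I R(4) *(1)] rideal_mult[OF I R(2) *(2)]] by blast
  show "i \<notin> {a, b} \<Longrightarrow> hh n i \<in> PP n a b"
    unfolding hh_def using * R by (intro rideal_diff[OF I] rideal_mult_right[OF I]) auto
qed

locale adjoin =
  fixes n :: nat and J :: "'k::field mpoly set"
  assumes n3: "n \<ge> 3"
    and J_homog: "\<And>g. g \<in> J \<Longrightarrow> g \<in> homog (2 * n) 2"
    and J_qq: "\<And>i j. i < j \<Longrightarrow> j < n \<Longrightarrow> qq n i j \<in> J"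
begin

abbreviation R :: "'k mpoly set" where "R \<equiv> polyring (2 * n)"
abbreviation B :: "'k mpoly set" where "B \<equiv> ideal_gen (2 * n) J"

lemma J_R: "J \<subseteq> R"
  using J_homog homog_polyring by blast

lemma gB: "gideal (2 * n) B"
  using J_homog by (intro gideal_ideal_gen) blast

lemmas rB = gideal_rideal[OF gB]

lemma qqB: "i < n \<Longrightarrow> j < n \<Longrightarrow> i \<noteq> j \<Longrightarrow> qq n i j \<in> B"
  using J_qq[of i j] J_qq[of j i] qq_commute[of n i j, where 'a = 'k]
  by (cases "i < j") (auto intro: ideal_gen_superset)

text \<open>For a third vertex \<open>k\<close>, the quadrics \<open>qq n k i\<close> and
  \<open>qq n k j\<close> are linear in \<open>x_k\<close> and \<open>y_k\<close> with determinant
  \<open>gg n i j\<close> up to sign; Cramer's rule gives the multiples by \<open>x_k\<close> and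
  \<open>y_k\<close>.\<close>

lemma others_gg:
  assumes "i < n" "j < n" "i \<noteq> j" "t \<in> others n {i, j}"
  shows "pvar t * gg n i j \<in> B"
proof -
  obtain k where k: "k < n" "k \<noteq> i" "k \<noteq> j" "t = k \<or> t = n + k" using assms(4) by (auto simp: others_def)
  have "pvar k * gg n i j = (pvar (n + j) * qq n k i - pvar (n + i) * qq n k j :: 'k mpoly)"
    "pvar (n + k) * gg n i j = (pvar j * qq n k i - pvar i * qq n k j :: 'k mpoly)"
    by (simp_all add: gg_def qq_def algebra_simps)
  moreover have "(pvar (n + j) * qq n k i - pvar (n + i) * qq n k j :: 'k mpoly) \<in> B" "pvar j * qq n k i - pvar i * qq n k j \<in> B"
    using assms k by (auto intro!: rideal_diff[OF rB] rideal_mult[OF rB] qqB)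
  ultimately show ?thesis using k(4) by auto
qed

text \<open>Cramer's rule again, for \<open>qq n k v\<close> and \<open>gg n v k\<close>, whose
  determinant in \<open>x_k\<close> and \<open>y_k\<close> is \<open>hh n v\<close>. This is why the
  \<open>gg n v k\<close> have to be present before \<open>hh n v\<close> is adjoined.\<close>

lemma others_hh:
  assumes "v < n" "s < n" "t \<in> others n {v, s}" "\<And>k. k < n \<Longrightarrow> k \<noteq> v \<Longrightarrow> k \<noteq> s \<Longrightarrow> gg n v k \<in> B"
  shows "pvar t * hh n v \<in> B"
proof -
  obtain k where k: "k < n" "k \<noteq> v" "k \<noteq> s" "t = k \<or> t = n + k" using assms(3) by (auto simp: others_def)
  have "pvar k * hh n v = (pvar v * qq n k v + pvar (n + v) * gg n v k :: 'k mpoly)"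
    "pvar (n + k) * hh n v = (pvar v * gg n v k + pvar (n + v) * qq n k v :: 'k mpoly)"
    by (simp_all add: hh_def gg_def qq_def algebra_simps)
  moreover have "pvar v * qq n k v + pvar (n + v) * gg n v k \<in> B" "pvar v * gg n v k + pvar (n + v) * qq n k v \<in> B"
    using assms k by (auto intro!: rideal_add[OF rB] rideal_mult[OF rB] qqB)
  ultimately show ?thesis using k(4) by auto
qed

text \<open>The colon ideal of \<open>B\<close> by \<open>gg n i j\<close> is
  \<open>PP n i j\<close>: the generators of \<open>PP n i j\<close> multiply
  \<open>gg n i j\<close> into \<open>B\<close>, and conversely \<open>B\<close> lies in
  \<open>PP n i j\<close>, modulo which \<open>gg n i j\<close> is regular. The new quotient is thus
  \<open>R / PP n i j\<close> shifted by 2.\<close>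

lemma good_add_gg:
  assumes ij: "i < j" "j < n" and J: "J \<subseteq> PP n i j"
  shows "good (2 * n) (ts n) (fps_X ^ 2 * hA n) 3 (ideal_gen (2 * n) (insert (gg n i j) J)) B"
proof -
  let ?g = "gg n i j :: 'k mpoly" and ?P = "PP n i j :: 'k mpoly set"
  let ?A = "ideal_gen (2 * n) (insert ?g J)"
  have g: "?g \<in> homog (2 * n) (int 2)" "?g \<in> R" using gg_homog[of i n j] gg_polyring[of i n j] ij by auto
  have gP: "gideal (2 * n) ?P" using ij by (intro gideal_PP) auto
  have gA: "gideal (2 * n) ?A" using J_homog g by (intro gideal_ideal_gen) auto
  have BP: "B \<subseteq> ?P" using ideal_gen_least[OF gideal_rideal[OF gP] J] .
  have "good (2 * n) (ts n) (hA n) 1 R ?P \<longleftrightarrow> good (2 * n) (ts n) (fps_X ^ 2 * hA n) (1 + int 2) ?A B"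
  proof (rule good_iso[OF gideal_ring gP gA gB _ ts_polyring g(1)])
    show "?P \<subseteq> R" using rideal_polyring[OF gideal_rideal[OF gP]] by blast
    show "?A = iplus (imul ?g R) B" by (rule ideal_gen_insert[OF J_R g(2)])
    fix a assume a: "a \<in> R"
    show "?g * a \<in> B \<longleftrightarrow> a \<in> ?P"
    proof
      assume "?g * a \<in> B"
      then have "?g * a \<in> ?P" using BP by blast
      moreover have "i < n" "i \<noteq> j" using ij by auto
      ultimately show "a \<in> ?P" using PP_nzd_gg[of i n j a] ij(2) a by blast
    next
      assume "a \<in> ?P"
      then have "a \<in> {f \<in> R. f * ?g \<in> B}"
        unfolding PP_def
      proof (rule ideal_gen_leastI[OF rideal_colon[OF rB g(2)]])
        fix f assume "f \<in> insert (qq n i j) (pvar ` others n {i, j} :: 'k mpoly set)"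
        then consider "f = qq n i j" | t where "f = pvar t" "t \<in> others n {i, j}" by auto
        then show "f \<in> {f \<in> R. f * ?g \<in> B}"
        proof cases
          case 1
          then show ?thesis using ij qqB[of i j] qq_polyring[of i n j] rideal_mult_right[OF rB g(2)] by auto
        next
          case 2
          then show ?thesis using ij others_gg[of i j t] others_subset[of n "{i, j}"] by auto
        qed
      qed
      then show "?g * a \<in> B" by (simp add: mult.commute)
    qed
  qed
  then show ?thesis using good_PP[OF ij, where 'k = 'k] by simp
qed

text \<open>Here the quotient is not cyclic. It is compared with \<open>PV n v / PP n v (n - 1)\<close>: multiplication by
  \<open>gg n v (n - 1)\<close> on the latter and by \<open>pvar (n - 1)\<close> on the former have the same image in \<open>R / PP n v (n - 1)\<close>.\<close>

lemma good_add_gh: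
  assumes v: "v < n - 2" and J: "J \<subseteq> PP n v (n - 1)" and J_gg: "\<And>k. k < n - 1 \<Longrightarrow> k \<noteq> v \<Longrightarrow> gg n v k \<in> B"
  shows "good (2 * n) (ts n) (fps_X * (hA n - hL n (2 * n - 2))) 3
    (ideal_gen (2 * n) (insert (hh n v) (insert (gg n v (n - 1)) J))) B"
proof -
  define s where "s = n - 1"
  have s: "v < s" "s < n" "v < n" "v \<noteq> s" and v1: "v < n - 1" using v by (auto simp: s_def)
  let ?g = "gg n v s :: 'k mpoly" and ?h = "hh n v :: 'k mpoly" and ?q = "qq n v s :: 'k mpoly"
  let ?P = "PP n v s :: 'k mpoly set" and ?P' = "PV n v :: 'k mpoly set"
  let ?F = "pvar ` others n {v, s} :: 'k mpoly set"
  let ?O = "ideal_gen (2 * n) ?F"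
  let ?A = "ideal_gen (2 * n) (insert ?h (insert ?g J))"
  let ?xs = "pvar s :: 'k mpoly" and ?xv = "pvar v :: 'k mpoly" and ?ys = "pvar (n + s) :: 'k mpoly" and ?yv = "pvar (n + v) :: 'k mpoly"
  have vR: "?xs \<in> R" "?xv \<in> R" "?ys \<in> R" "?yv \<in> R" using s by auto
  have g: "?g \<in> homog (2 * n) (int 2)" "?g \<in> R" and h: "?h \<in> homog (2 * n) 2" "?h \<in> R"
    using gg_homog[of v n s] gg_polyring[of v n s] hh_homog[of v n] hh_polyring[of v n] s by auto
  have qB: "?q \<in> B" using qqB s by simp
  have gP: "gideal (2 * n) ?P" using s by (intro gideal_PP) auto
  note rP = gideal_rideal[OF gP]
  have gA: "gideal (2 * n) ?A" using J_homog g h by (intro gideal_ideal_gen) auto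
  note rA = gideal_rideal[OF gA]
  have PVgens: "insert ?xs (insert ?yv ?F) \<subseteq> R" using vR others_polyring by auto
  have gP': "gideal (2 * n) ?P'" unfolding PV_def s_def[symmetric]
    using s others_subset[of n "{v, s}"] by (intro gideal_ideal_gen) (auto intro!: exI[of _ 1] homog_pvar)
  note rP' = gideal_rideal[OF gP']
  have BP: "B \<subseteq> ?P" using ideal_gen_least[OF rP] J by (simp add: s_def)
  have BA: "B \<subseteq> ?A" by (rule ideal_gen_mono) auto
  have gA': "?g \<in> ?A" "?h \<in> ?A" by (auto intro: ideal_gen_superset)
  have rO: "rideal (2 * n) ?O" by (rule rideal_ideal_gen[OF others_polyring])
  have P'_mem: "?xs \<in> ?P'" "?yv \<in> ?P'" "?O \<subseteq> ?P'"
  proof -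
    show "?xs \<in> ?P'" "?yv \<in> ?P'" unfolding PV_def s_def[symmetric] by (rule ideal_gen_superset; simp)+
    show "?O \<subseteq> ?P'" unfolding PV_def s_def[symmetric] by (rule ideal_gen_mono) blast
  qed
  have PP': "?P \<subseteq> ?P'" unfolding PP_def
  proof (rule ideal_gen_least[OF rP'])
    have "?q \<in> ?P'" unfolding qq_def
      by (rule rideal_diff[OF rP' rideal_mult[OF rP' vR(2) P'_mem(1)] rideal_mult_right[OF rP' vR(3) P'_mem(2)]])
    then show "insert ?q ?F \<subseteq> ?P'" using P'_mem(3) by (auto intro: ideal_gen_superset)
  qed
  have ker: "good (2 * n) (ts n) (hA n - hL n (2 * n - 2)) 1 ?P' ?P"
  proof (rule good_ker[OF gideal_ring gP' gP PP' _ ts_polyring])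
    show "?P' \<subseteq> R" using rideal_polyring[OF rP'] by blast
    show "good (2 * n) (ts n) (hA n) 1 R ?P" using good_PP[OF s(1,2)] .
    show "good (2 * n) (butlast (ts n)) (hL n (2 * n - 2)) 0 R ?P'" using good_PV[OF n3 v1] by simp
  qed simp
  define A2 where "A2 = iplus (imul ?g ?P') ?P"
  have gA2: "gideal (2 * n) A2" unfolding A2_def by (intro gideal_iplus gideal_imul[OF gP' g(1)] gP)
  note rA2 = gideal_rideal[OF gA2]
  \<comment> \<open>Modulo \<open>q\<close>, multiplication by \<open>x_s\<close> sends
    \<open>h\<close> to \<open>y_v g\<close> and \<open>g\<close> to \<open>x_s g\<close>: the
    generators of the new quotient match the generators \<open>y_v\<close> and \<open>x_s\<close> of
    \<open>PV\<close> over \<open>PP\<close>.\<close>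
  have rel: "?xs * ?h = ?yv * ?g + ?xv * ?q" "?ys * ?h = ?xv * ?g + ?yv * ?q"
    by (simp_all add: hh_def gg_def qq_def algebra_simps)
  have A_E: "\<exists>\<alpha> \<beta> b. \<alpha> \<in> R \<and> \<beta> \<in> R \<and> b \<in> B \<and> a = ?h * \<beta> + ?g * \<alpha> + b" if aA: "a \<in> ?A" for a
  proof -
    have gJ: "insert ?g J \<subseteq> R" using g J_R by auto
    obtain \<beta> c where 1: "\<beta> \<in> R" "c \<in> ideal_gen (2 * n) (insert ?g J)" "a = ?h * \<beta> + c"
      using ideal_gen_insert_memE[OF aA gJ h(2)] by metis
    obtain \<alpha> b where "\<alpha> \<in> R" "b \<in> B" "c = ?g * \<alpha> + b"
      using ideal_gen_insert_memE[OF 1(2) J_R g(2)] by metis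
    then show ?thesis using 1 by (auto simp: add.assoc)
  qed
  have xs_a: "?xs * (?h * \<beta> + ?g * \<alpha> + b) = ?g * (?yv * \<beta> + ?xs * \<alpha>) + (?xv * \<beta> * ?q + ?xs * b)" for \<alpha> \<beta> b
  proof -
    have "?xs * (?h * \<beta> + ?g * \<alpha> + b) = (?xs * ?h) * \<beta> + ?xs * ?g * \<alpha> + ?xs * b" by (simp add: algebra_simps)
    then show ?thesis unfolding rel by (simp add: algebra_simps)
  qed
  have junk: "?xv * \<beta> * ?q + ?xs * b \<in> B" if "\<beta> \<in> R" "b \<in> B" for \<beta> b
    using rideal_add[OF rB rideal_mult[OF rB polyring_mult[OF vR(2) that(1)] qB] rideal_mult[OF rB vR(1) that(2)]] .
  have Og: "f * ?g \<in> B" if "f \<in> ?O" for f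
  proof -
    have "f \<in> {f \<in> R. f * ?g \<in> B}"
      using that s others_gg[of v s] others_subset[of n "{v, s}"]
      by (rule_tac ideal_gen_leastI[OF rideal_colon[OF rB g(2)]]) auto
    then show ?thesis by simp
  qed
  have Oh: "f * ?h \<in> B" if "f \<in> ?O" for f
  proof -
    have "gg n v k \<in> B" if "k < n" "k \<noteq> v" "k \<noteq> s" for k using J_gg[of k] that by (auto simp: s_def)
    then have "f \<in> {f \<in> R. f * ?h \<in> B}"
      using that s others_hh[of v s] others_subset[of n "{v, s}"]
      by (rule_tac ideal_gen_leastI[OF rideal_colon[OF rB h(2)]]) auto
    then show ?thesis by simp
  qed
  have inj: "?xs * a \<in> ?P \<longleftrightarrow> a \<in> B" if aA: "a \<in> ?A" for a
  proof
    assume "a \<in> B"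
    then show "?xs * a \<in> ?P" using BP rideal_mult[OF rP vR(1)] by blast
  next
    assume xa: "?xs * a \<in> ?P"
    obtain \<alpha> \<beta> b where a: "\<alpha> \<in> R" "\<beta> \<in> R" "b \<in> B" "a = ?h * \<beta> + ?g * \<alpha> + b" using A_E[OF aA] by blast
    have lin: "?yv * \<beta> + ?xs * \<alpha> \<in> R" using a vR by (intro polyring_add polyring_mult)
    have "?xv * \<beta> * ?q + ?xs * b \<in> ?P" using junk[OF a(2,3)] BP by blast
    from rideal_diff[OF rP xa this] have "?g * (?yv * \<beta> + ?xs * \<alpha>) \<in> ?P" unfolding a(4) xs_a by simp
    then have "?yv * \<beta> + ?xs * \<alpha> \<in> ?P" by (rule PP_nzd_gg[OF s(3,2,4) lin])
    then obtain \<gamma> d where \<gamma>: "\<gamma> \<in> R" "d \<in> ?O" "?yv * \<beta> + ?xs * \<alpha> = ?q * \<gamma> + d"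
      unfolding PP_def using ideal_gen_insert_memE[OF _ others_polyring qq_polyring[OF s(3,2)]] by metis
    \<comment> \<open>As \<open>q = x_v x_s - y_v y_s\<close>, the part \<open>q * \<gamma>\<close>
      can be absorbed into the coefficients. What is left is a relation between \<open>y_v\<close>
      and \<open>x_s\<close> modulo the other variables, hence a Koszul relation with some factor
      \<open>\<delta>\<close>.\<close>
    define \<alpha>' \<beta>' where "\<alpha>' = \<alpha> - \<gamma> * ?xv" and "\<beta>' = \<beta> + \<gamma> * ?ys"
    have R': "\<alpha>' \<in> R" "\<beta>' \<in> R" unfolding \<alpha>'_def \<beta>'_def using a \<gamma> vR by (auto intro!: polyring_diff polyring_add polyring_mult)
    have "?yv * \<beta>' + ?xs * \<alpha>' = (?yv * \<beta> + ?xs * \<alpha>) - ?q * \<gamma>" by (simp add: \<alpha>'_def \<beta>'_def qq_def algebra_simps)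
    then have d: "?yv * \<beta>' + ?xs * \<alpha>' = d" unfolding \<gamma>(3) by simp
    let ?V = "insert s (others n {v, s})"
    have V: "?V \<subseteq> {..<2 * n}" using others_subset[of n "{v, s}"] s by auto
    have FR: "pvar ` ?V \<subseteq> R" using vR others_polyring by auto
    note rV = rideal_ideal_gen[OF FR]
    have "?yv * \<beta>' = d - ?xs * \<alpha>'" using d by (simp add: algebra_simps)
    moreover have "d \<in> ideal_gen (2 * n) (pvar ` ?V)" using \<gamma>(2) ideal_gen_mono[of ?F "pvar ` ?V"] by auto
    moreover have "?xs * \<alpha>' \<in> ideal_gen (2 * n) (pvar ` ?V)"
      by (rule rideal_mult_right[OF rV R'(1) ideal_gen_superset]) simp
    ultimately have "?yv * \<beta>' \<in> ideal_gen (2 * n) (pvar ` ?V)" using rideal_diff[OF rV] by simp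
    then have "\<beta>' \<in> ideal_gen (2 * n) (pvar ` ?V)"
      using R'(2) s by (rule_tac pvar_nzd[OF V, of "n + v"]) (auto simp: others_def)
    then have \<beta>'_mem: "\<beta>' \<in> ideal_gen (2 * n) (insert ?xs ?F)" by simp
    obtain \<delta> f2 where \<delta>: "\<delta> \<in> R" "f2 \<in> ?O" "\<beta>' = ?xs * \<delta> + f2"
      using ideal_gen_insert_memE[OF \<beta>'_mem others_polyring vR(1)] by metis
    define f1 where "f1 = \<alpha>' + \<delta> * ?yv"
    have f1R: "f1 \<in> R" unfolding f1_def using R' \<delta> vR by (intro polyring_add polyring_mult)
    have "?xs * f1 = d - ?yv * f2" unfolding d[symmetric] \<delta>(3) f1_def by (simp add: algebra_simps)
    also have "\<dots> \<in> ?O" by (intro rideal_diff[OF rO] \<gamma> rideal_mult[OF rO] \<delta> vR)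
    finally have f1: "f1 \<in> ?O"
      using f1R s by (rule_tac pvar_nzd[OF others_subset, of s]) (auto simp: others_def)
    have \<alpha>: "\<alpha> = \<gamma> * ?xv - \<delta> * ?yv + f1" by (simp add: f1_def \<alpha>'_def)
    have \<beta>: "\<beta> = - \<gamma> * ?ys + ?xs * \<delta> + f2" using \<delta>(3) by (simp add: \<beta>'_def algebra_simps)
    \<comment> \<open>The two brackets are the relations \<open>rel\<close>, each a multiple of
      \<open>q\<close>; the remaining terms come from the other variables.\<close>
    have "?h * \<beta> + ?g * \<alpha> = \<gamma> * (?xv * ?g - ?ys * ?h) + \<delta> * (?xs * ?h - ?yv * ?g) + (f1 * ?g + f2 * ?h)"
      unfolding \<alpha> \<beta> by (simp add: algebra_simps)
    also have "\<dots> = \<delta> * ?xv * ?q - \<gamma> * ?yv * ?q + (f1 * ?g + f2 * ?h)"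
      unfolding rel by (simp add: algebra_simps)
    also have "\<dots> \<in> B"
      using rideal_mult[OF rB polyring_mult[OF \<delta>(1) vR(2)] qB] rideal_mult[OF rB polyring_mult[OF \<gamma>(1) vR(4)] qB]
        Og[OF f1] Oh[OF \<delta>(2)]
      by (auto intro!: rideal_add[OF rB] rideal_diff[OF rB])
    finally show "a \<in> B" unfolding a(4) using rideal_add[OF rB] a(3) by blast
  qed
  have A2_eq: "A2 = iplus (imul ?xs ?A) ?P"
  proof
    have rA3: "rideal (2 * n) (iplus (imul ?xs ?A) ?P)" by (intro rideal_iplus rideal_imul rA rP vR)
    have sub: "?P \<subseteq> iplus (imul ?xs ?A) ?P" by (rule iplus_sup2[OF rideal_imul[OF rA vR(1)]])
    have P'g: "f * ?g \<in> iplus (imul ?xs ?A) ?P" if "f \<in> ?P'" for f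
    proof -
      have "f \<in> {f \<in> R. f * ?g \<in> iplus (imul ?xs ?A) ?P}"
        using that unfolding PV_def s_def[symmetric]
      proof (rule ideal_gen_leastI[OF rideal_colon[OF rA3 g(2)]])
        fix f assume "f \<in> insert ?xs (insert ?yv ?F)"
        then consider "f = ?xs" | "f = ?yv" | "f \<in> ?F" by blast
        then show "f \<in> {f \<in> R. f * ?g \<in> iplus (imul ?xs ?A) ?P}"
        proof cases
          case 1
          then show ?thesis using vR mult_mem_iplus_imul[OF rP gA'(1), of ?xs] by simp
        next
          case 2
          have "?yv * ?g = ?xs * ?h - ?xv * ?q" unfolding rel by simp
          moreover have "?xv * ?q \<in> ?P" using qB BP rideal_mult[OF rP vR(2)] by blast
          ultimately have "?yv * ?g \<in> iplus (imul ?xs ?A) ?P"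
            using rideal_diff[OF rA3 mult_mem_iplus_imul[OF rP gA'(2)]] sub by auto
          then show ?thesis using 2 vR by simp
        next
          case 3
          then have "f \<in> ?P" "f \<in> R" using others_polyring by (auto intro: pvar_in_PP)
          then show ?thesis using rideal_mult_right[OF rP g(2)] sub by blast
        qed
      qed
      then show ?thesis by simp
    qed
    show "A2 \<subseteq> iplus (imul ?xs ?A) ?P" unfolding A2_def
    proof (rule iplus_least[OF rA3 _ sub])
      show "imul ?g ?P' \<subseteq> iplus (imul ?xs ?A) ?P" using P'g by (auto simp: imul_def mult.commute)
    qed
    show "iplus (imul ?xs ?A) ?P \<subseteq> A2"
    proof (rule iplus_least[OF rA2])
      have PA2: "?P \<subseteq> A2" unfolding A2_def by (rule iplus_sup2[OF rideal_imul[OF rP' g(2)]])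
      then show "?P \<subseteq> A2" .
      show "imul ?xs ?A \<subseteq> A2"
      proof
        fix z assume "z \<in> imul ?xs ?A"
        then obtain a where a: "a \<in> ?A" "z = ?xs * a" by (auto simp: imul_def)
        obtain \<alpha> \<beta> b where ab: "\<alpha> \<in> R" "\<beta> \<in> R" "b \<in> B" "a = ?h * \<beta> + ?g * \<alpha> + b" using A_E[OF a(1)] by blast
        have "?yv * \<beta> + ?xs * \<alpha> \<in> ?P'"
          by (intro rideal_add[OF rP'] rideal_mult_right[OF rP'] P'_mem ab)
        then have "?g * (?yv * \<beta> + ?xs * \<alpha>) \<in> A2" unfolding A2_def by (rule mult_mem_iplus_imul[OF rP])
        moreover have "?xv * \<beta> * ?q + ?xs * b \<in> A2" using junk[OF ab(2,3)] BP PA2 by blast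
        ultimately show "z \<in> A2" unfolding a(2) ab(4) xs_a by (rule rideal_add[OF rA2])
      qed
    qed
  qed
  have "good (2 * n) (ts n) (hA n - hL n (2 * n - 2)) 1 ?P' ?P \<longleftrightarrow>
      good (2 * n) (ts n) (fps_X ^ 2 * (hA n - hL n (2 * n - 2))) (1 + int 2) A2 ?P"
  proof (rule good_iso[OF gP' gP gA2 gP PP' ts_polyring g(1) A2_def])
    fix a assume "a \<in> ?P'"
    then have "a \<in> R" by (rule rideal_polyring[OF rP'])
    then show "?g * a \<in> ?P \<longleftrightarrow> a \<in> ?P" using PP_nzd_gg[OF s(3,2,4)] rideal_mult[OF rP g(2)] by blast
  qed
  \<comment> \<open>The common image is shifted by 2 against \<open>PV / PP\<close> and by 1 against
    the new quotient, so the net shift is 1.\<close>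
  with ker have A2: "good (2 * n) (ts n) (fps_X ^ 1 * (fps_X * (hA n - hL n (2 * n - 2)))) (2 + int 1) A2 ?P"
    by (simp add: power2_eq_square mult.assoc)
  have xsh: "?xs \<in> homog (2 * n) (int 1)" using s homog_pvar[of s "2 * n"] by simp
  have "good (2 * n) (ts n) (fps_X * (hA n - hL n (2 * n - 2))) 2 ?A B"
    using good_iso[OF gA gB gA2 gP BA ts_polyring xsh A2_eq inj] A2 by blast
  then have "good (2 * n) (ts n) (fps_X * (hA n - hL n (2 * n - 2))) 3 ?A B" by (rule good_mono) simp
  then show ?thesis by (simp add: s_def)
qed

end

subsection \<open>The two linear components\<close>

context
  fixes n :: nat and \<sigma> :: "'k::field mpoly"
  assumes n3: "n \<ge> 3" and \<sigma>: "\<sigma> = 1 \<or> \<sigma> = - 1"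
begin

lemma gideal_QQ: "gideal (2 * n) (QQ n \<sigma>)"
  unfolding QQ_def
proof (rule gideal_ideal_gen)
  fix g assume g: "g \<in> insert (pvar (n - 2) - \<sigma> * pvar (n + (n - 2)))
     (insert (pvar (n - 1) - \<sigma> * pvar (n + (n - 1))) (pvar ` others n {n - 2, n - 1}))"
  have L: "pvar k - \<sigma> * pvar (n + k) \<in> homog (2 * n) 1" if "k < n" for k
    using that by (intro homog_diff) (auto simp: sigma_simps[OF \<sigma>] homog_pvar)
  have "n - 2 < n" "n - 1 < n" using n3 by auto
  then have "g \<in> homog (2 * n) 1" using g L[of "n - 2"] L[of "n - 1"] others_subset[of n "{n - 2, n - 1}"] by (auto simp: homog_pvar)
  then show "\<exists>e. g \<in> homog (2 * n) e" by blast
qed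

lemma lin_in_tt: "k < n \<Longrightarrow> pvar k - \<sigma> * pvar (n + k) \<in> tt n \<sigma>"
  unfolding tt_def by (rule ideal_gen_superset) simp

lemma QQ_gens: "pvar (n - 2) - \<sigma> * pvar (n + (n - 2)) \<in> QQ n \<sigma>" "pvar (n - 1) - \<sigma> * pvar (n + (n - 1)) \<in> QQ n \<sigma>"
  "t \<in> others n {n - 2, n - 1} \<Longrightarrow> pvar t \<in> QQ n \<sigma>"
  unfolding QQ_def by (rule ideal_gen_superset; simp)+

lemma tt_subset_QQ: "tt n \<sigma> \<subseteq> QQ n \<sigma>"
proof -
  note rQ = gideal_rideal[OF gideal_QQ]
  have "pvar k - \<sigma> * pvar (n + k) \<in> QQ n \<sigma>" if k: "k < n" for k
  proof (cases "k = n - 2 \<or> k = n - 1")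
    case True
    then show ?thesis using QQ_gens(1,2) by blast
  next
    case False
    then have "pvar k \<in> QQ n \<sigma>" "pvar (n + k) \<in> QQ n \<sigma>"
      by (rule_tac QQ_gens(3), use k in \<open>simp add: others_iff\<close>)+
    then show ?thesis by (intro rideal_diff[OF rQ] rideal_mult[OF rQ]) (auto simp: sigma_simps[OF \<sigma>])
  qed
  then show ?thesis unfolding tt_def by (intro ideal_gen_least[OF rQ]) auto
qed

lemma good_QQ_tt: "good (2 * n) (ts n) (hL n n - hL n (2 * n - 2)) 1 (QQ n \<sigma>) (tt n \<sigma>)"
proof (rule good_ker[OF gideal_ring gideal_QQ gideal_tt[OF \<sigma>] tt_subset_QQ _ ts_polyring])
  show "QQ n \<sigma> \<subseteq> polyring (2 * n)" using rideal_polyring[OF gideal_rideal[OF gideal_QQ]] by blast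
  show "good (2 * n) (ts n) (hL n n) 1 (polyring (2 * n)) (tt n \<sigma>)"
    using good_tt[OF \<sigma> n3] by (rule good_mono) simp
  show "good (2 * n) (butlast (ts n)) (hL n (2 * n - 2)) 0 (polyring (2 * n)) (QQ n \<sigma>)"
    using good_QQ[OF \<sigma> n3] by simp
qed simp

text \<open>The quadric \<open>x_a x_s - y_a y_s\<close> lies in the ideal of the linear forms at
  \<open>a\<close> and \<open>s\<close>, because \<open>\<sigma> * \<sigma> = 1\<close>; the linear
  forms at other vertices lie in the ideal of the other variables.\<close>

lemma PP_plus_tt: "QQ n \<sigma> = iplus (PP n (n - 2) (n - 1)) (tt n \<sigma>)"
proof
  define a s where "a = n - 2" and "s = n - 1"
  have as: "a < n" "s < n" using n3 by (auto simp: a_def s_def)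
  note rQ = gideal_rideal[OF gideal_QQ]
  have rP: "rideal (2 * n) (PP n (n - 2) (n - 1) :: 'k mpoly set)" and rT: "rideal (2 * n) (tt n \<sigma>)"
    using n3 gideal_rideal[OF gideal_tt[OF \<sigma>]] by (auto intro: rideal_PP)
  note rI = rideal_iplus[OF rP rT]
  show "QQ n \<sigma> \<subseteq> iplus (PP n (n - 2) (n - 1)) (tt n \<sigma>)"
    unfolding QQ_def
  proof (rule ideal_gen_least[OF rI])
    have "n - 2 < n" "n - 1 < n" using n3 by auto
    note lin = this[THEN lin_in_tt]
    have "pvar ` others n {n - 2, n - 1} \<subseteq> PP n (n - 2) (n - 1)" by (auto intro: pvar_in_PP)
    then show "insert (pvar (n - 2) - \<sigma> * pvar (n + (n - 2))) (insert (pvar (n - 1) - \<sigma> * pvar (n + (n - 1)))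
        (pvar ` others n {n - 2, n - 1})) \<subseteq> iplus (PP n (n - 2) (n - 1)) (tt n \<sigma>)"
      using lin iplus_sup1[OF rT, of "PP n (n - 2) (n - 1)"] iplus_sup2[OF rP, of "tt n \<sigma>"] by blast
  qed
  show "iplus (PP n (n - 2) (n - 1)) (tt n \<sigma>) \<subseteq> QQ n \<sigma>"
  proof (rule iplus_least[OF rQ _ tt_subset_QQ])
    have "(pvar a - \<sigma> * pvar (n + a)) * pvar s + \<sigma> * pvar (n + a) * (pvar s - \<sigma> * pvar (n + s))
        = pvar a * pvar s - (\<sigma> * \<sigma>) * (pvar (n + a) * pvar (n + s))" by (simp add: algebra_simps del: sigma_simps)
    then have "qq n a s = (pvar a - \<sigma> * pvar (n + a)) * pvar s + \<sigma> * pvar (n + a) * (pvar s - \<sigma> * pvar (n + s))"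
      by (simp only: sigma_simps[OF \<sigma>] qq_def mult_1)
    also have "\<dots> \<in> QQ n \<sigma>"
      using as QQ_gens(1,2) unfolding a_def[symmetric] s_def[symmetric]
      by (intro rideal_add[OF rQ] rideal_mult[OF rQ] rideal_mult_right[OF rQ]) (auto simp: sigma_simps[OF \<sigma>] mult.assoc)
    finally show "PP n (n - 2) (n - 1) \<subseteq> QQ n \<sigma>"
      unfolding PP_def a_def s_def using QQ_gens(3) by (intro ideal_gen_least[OF rQ]) auto
  qed
qed

end

text \<open>A functional of multidegree and parity kills every multiple of \<open>qq\<close>, whose
  two terms agree in both. Vanishing on multidegrees that touch another vertex, it also kills the
  multiples of the other variables.\<close>

lemma PP_lf_0:
  fixes p :: "'k::field mpoly"
  assumes as: "a < n" "s < n" and p: "p \<in> PP n a s"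
    and \<phi>: "\<And>d b k. k < n \<Longrightarrow> k \<notin> {a, s} \<Longrightarrow> d k \<noteq> 0 \<Longrightarrow> \<phi> d b = 0"
  shows "lf (\<lambda>m. \<phi> (dv n m) (par n m)) p = 0"
proof -
  define \<Phi> where "\<Phi> = {\<lambda>m. \<phi> (dv n m) (par n m) | \<phi> :: _ \<Rightarrow> _ \<Rightarrow> 'k.
    \<forall>d b k. k < n \<longrightarrow> k \<notin> {a, s} \<longrightarrow> d k \<noteq> 0 \<longrightarrow> \<phi> d b = 0}"
  have "rideal (2 * n) {p \<in> polyring (2 * n). \<forall>f\<in>\<Phi>. lf f p = 0}"
  proof (rule rideal_lf)
    fix f :: "_ \<Rightarrow> 'k" and m assume "f \<in> \<Phi>"
    then obtain \<psi> where \<psi>: "f = (\<lambda>m. \<psi> (dv n m) (par n m))"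
      "\<And>d b k. k < n \<Longrightarrow> k \<notin> {a, s} \<Longrightarrow> d k \<noteq> 0 \<Longrightarrow> \<psi> d b = 0" by (auto simp: \<Phi>_def)
    define \<psi>' where "\<psi>' d b = \<psi> (\<lambda>i. dv n m i + d i) (par n m \<noteq> b)" for d b
    have "(\<lambda>k. f (m + k)) = (\<lambda>k. \<psi>' (dv n k) (par n k))"
      by (auto simp: \<psi>(1) \<psi>'_def dv_add par_add)
    moreover have "\<psi>' d b = 0" if "k < n" "k \<notin> {a, s}" "d k \<noteq> 0" for d b k
      using \<psi>(2)[OF that(1,2), of "\<lambda>i. dv n m i + d i"] that(3) by (simp add: \<psi>'_def)
    ultimately show "(\<lambda>k. f (m + k)) \<in> \<Phi>" unfolding \<Phi>_def by blast
  qed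
  then have "p \<in> {p \<in> polyring (2 * n). \<forall>f\<in>\<Phi>. lf f p = 0}"
    using p[unfolded PP_def]
  proof (rule ideal_gen_leastI)
    fix g :: "'k mpoly" assume "g \<in> insert (qq n a s) (pvar ` others n {a, s})"
    then consider "g = qq n a s" | t where "g = pvar t" "t \<in> others n {a, s}" by auto
    then show "g \<in> {p \<in> polyring (2 * n). \<forall>f\<in>\<Phi>. lf f p = 0}"
    proof cases
      case 1
      then show ?thesis using tt0_binomials(1)[OF as, where 'a = 'k] as qq_polyring[of a n s, where 'a = 'k] by (auto simp: \<Phi>_def tt0_def)
    next
      case 2
      then obtain k where k: "k < n" "k \<notin> {a, s}" "t = k \<or> t = n + k" by (auto simp: others_def)
      have "dv n (vmon t) k \<noteq> 0" using k dv_vmon_x[of k n 0] dv_vmon_y[of k n 0] by (auto simp: inc_def)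
      then have "lf f g = 0" if "f \<in> \<Phi>" for f using that k(1,2) unfolding \<Phi>_def 2(1) lf_pvar by blast
      moreover have "g \<in> polyring (2 * n)" using 2 others_subset[of n "{a, s}"] by auto
      ultimately show ?thesis by blast
    qed
  qed
  moreover have "(\<lambda>m. \<phi> (dv n m) (par n m)) \<in> \<Phi>" using \<phi> unfolding \<Phi>_def by blast
  ultimately show ?thesis by blast
qed

lemma inc_pred [simp]: "(inc k d)(k := inc k d k - Suc 0) = d"
  by (auto simp: inc_def)

lemma tt0_subset_tt:
  fixes s :: "'k::field"
  assumes "s = 1 \<or> s = - 1"
  shows "tt0 n \<subseteq> tt n (mterm 0 s)"
proof
  fix p :: "'k mpoly" assume p: "p \<in> tt0 n"
  then have "lf (\<lambda>m. psg s (par n m) * \<chi> (dv n m)) p = 0" for \<chi>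
    using tt0D[OF p, of "\<lambda>d b. psg s b * \<chi> d"] by simp
  then show "p \<in> tt n (mterm 0 s)" using p unfolding tt_iff[OF assms] by (simp add: tt0_def)
qed

text \<open>Multiplication by \<open>x_k\<close> shifts the multidegree injectively and keeps the
  parity, so every test functional on \<open>p\<close> comes from one on the product.\<close>

lemma tt0_pvar_mult:
  fixes p :: "'k::field mpoly"
  assumes k: "k < n" and p: "p \<in> polyring (2 * n)"
  shows "pvar k * p \<in> tt0 n \<longleftrightarrow> p \<in> tt0 n"
proof
  assume "p \<in> tt0 n"
  then show "pvar k * p \<in> tt0 n" using k by (rule_tac rideal_mult[OF rideal_tt0]) auto
next
  assume *: "pvar k * p \<in> tt0 n"
  have "lf (\<lambda>m. \<phi> (dv n m) (par n m)) p = 0" for \<phi>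
    using tt0D[OF *, of "\<lambda>d. \<phi> (d(k := d k - 1))"] k by (simp add: lf_pvar_mult dv_vmon_x par_vmon_x)
  then show "p \<in> tt0 n" using p by (simp add: tt0_def)
qed

lemma lf_diff_pvar_mult:
  "k < n \<Longrightarrow> lf (\<lambda>m. \<phi> (dv n m) (par n m)) ((pvar k - pvar (n + k)) * p) =
    lf (\<lambda>m. \<phi> (inc k (dv n m)) (par n m) - \<phi> (inc k (dv n m)) (\<not> par n m)) p"
  by (simp add: left_diff_distrib lf_diff lf_pvar_mult lf_diff_fun dv_vmon_x dv_vmon_y par_vmon_x par_vmon_y)

text \<open>On a multiple of \<open>x_k - y_k\<close> a functional sees only the difference of its
  values at the two parities, which is the pairing with sign -1. Conversely, each such pairing
  arises from a functional supported on even parity.\<close>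

lemma tt0_diff_pvar_mult:
  fixes p :: "'k::field mpoly"
  assumes k: "k < n" and p: "p \<in> polyring (2 * n)"
  shows "(pvar k - pvar (n + k)) * p \<in> tt0 n \<longleftrightarrow> p \<in> tt n (mterm 0 (- 1))"
proof
  let ?c = "pvar k - pvar (n + k) :: 'k mpoly"
  have c: "?c \<in> polyring (2 * n)" using k by (auto intro: polyring_diff)
  {
    assume "p \<in> tt n (mterm 0 (- 1))"
    then have *: "lf (\<lambda>m. psg (- 1) (par n m) * \<chi> (dv n m)) p = 0" for \<chi> by (simp add: tt_iff)
    have "lf (\<lambda>m. \<phi> (dv n m) (par n m)) (?c * p) = 0" for \<phi>
    proof -
      have "lf (\<lambda>m. \<phi> (dv n m) (par n m)) (?c * p)
          = lf (\<lambda>m. psg (- 1) (par n m) * (\<phi> (inc k (dv n m)) False - \<phi> (inc k (dv n m)) True)) p"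
        unfolding lf_diff_pvar_mult[OF k] by (rule lf_cong) (auto simp: psg_def)
      then show ?thesis using *[of "\<lambda>d. \<phi> (inc k d) False - \<phi> (inc k d) True"] by simp
    qed
    then show "?c * p \<in> tt0 n" using polyring_mult[OF c p] by (simp add: tt0_def)
  next
    assume *: "?c * p \<in> tt0 n"
    have "lf (\<lambda>m. psg (- 1) (par n m) * \<chi> (dv n m)) p = 0" for \<chi>
    proof -
      have "lf (\<lambda>m. psg (- 1) (par n m) * \<chi> (dv n m)) p
          = lf (\<lambda>m. (\<lambda>d b. if b then 0 else \<chi> (d(k := d k - 1))) (dv n m) (par n m)) (?c * p)"
        by (subst lf_diff_pvar_mult[OF k]) (rule lf_cong, simp add: psg_def)
      then show ?thesis using tt0D[OF *, of "\<lambda>d b. if b then 0 else \<chi> (d(k := d k - 1))"] by simp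
    qed
    then show "p \<in> tt n (mterm 0 (- 1))" using p by (simp add: tt_iff)
  }
qed

context
  fixes n :: nat
  assumes n3: "n \<ge> 3"
begin

abbreviation P0 :: "'k::field mpoly set" where "P0 \<equiv> PP n (n - 2) (n - 1)"
abbreviation W1 :: "'k::field mpoly set" where "W1 \<equiv> P0 \<inter> tt n 1"
abbreviation W2 :: "'k::field mpoly set" where "W2 \<equiv> P0 \<inter> tt0 n"

lemma gideal_P0: "gideal (2 * n) (P0 :: 'k::field mpoly set)"
  using n3 by (intro gideal_PP) auto

lemma gideal_W: "gideal (2 * n) (W1 :: 'k::field mpoly set)" "gideal (2 * n) (W2 :: 'k::field mpoly set)"
  using gideal_P0 gideal_tt[of "1 :: 'k mpoly" n] gideal_tt0 by (auto intro: gideal_Int)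

lemma W2_W1: "(W2 :: 'k::field mpoly set) \<subseteq> W1"
  using tt0_subset_tt[of "1 :: 'k" n] by auto

text \<open>Second isomorphism theorem: \<open>P / (P \<inter> L)\<close> is
  \<open>(P + L) / L\<close>, expressed with multiplier 1 and shift 0.\<close>

lemma good_P0_W1: "good (2 * n) (ts n) (hL n n - hL n (2 * n - 2)) 1 P0 (W1 :: 'k::field mpoly set)"
proof -
  have 1: "(1 :: 'k mpoly) = 1 \<or> (1 :: 'k mpoly) = - 1" by simp
  have "good (2 * n) (ts n) (hL n n - hL n (2 * n - 2)) 1 P0 (W1 :: 'k mpoly set) \<longleftrightarrow>
    good (2 * n) (ts n) (fps_X ^ 0 * (hL n n - hL n (2 * n - 2))) (1 + int 0) (QQ n 1) (tt n (1 :: 'k mpoly))"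
  proof (rule good_iso[OF gideal_P0 gideal_W(1) gideal_QQ[OF n3 1] gideal_tt[OF 1] _ ts_polyring, where c = 1])
    show "QQ n 1 = iplus (imul 1 P0) (tt n (1 :: 'k mpoly))" unfolding PP_plus_tt[OF n3 1] by (simp add: imul_def)
  qed auto
  then show ?thesis using good_QQ_tt[OF n3 1] by simp
qed

text \<open>For \<open>u\<close> in \<open>tt n 1\<close> the odd part cancels the even part in each
  multidegree. With \<open>r\<close> the even part moved to x-monomials, \<open>x_0 u\<close> and
  \<open>(x_0 - y_0) r\<close> therefore have the same values under all functionals of multidegree
  and parity.\<close>

lemma W1_decomp:
  fixes u :: "'k::field mpoly"
  assumes u: "u \<in> W1"
  shows "\<exists>r\<in>P0. pvar 0 * u - (pvar 0 - pvar n) * r \<in> tt0 n"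
proof -
  define a s where "a = n - 2" and "s = n - 1"
  have as: "a < n" "s < n" "0 < n" using n3 by (auto simp: a_def s_def)
  have uP: "u \<in> PP n a s" using u by (simp add: a_def s_def)
  have uR: "u \<in> polyring (2 * n)" using rideal_polyring[OF rideal_PP[OF as(1,2)] uP] .
  have "(mterm 0 1 :: 'k mpoly) = 1" by simp
  then have "u \<in> tt n (mterm 0 1)" using u by simp
  then have u1: "lf (\<lambda>m. psg 1 (par n m) * \<chi> (dv n m)) u = 0" for \<chi> using tt_iff[of "1 :: 'k" n] by simp
  define r where "r = lmap (\<lambda>m. nx n (dv n m)) (\<lambda>m. if par n m then 0 else 1) u"
  have rR: "r \<in> polyring (2 * n)"
    unfolding r_def lmap_def by (intro polyring_sum polyring_term) (use mons_nx[of n] in fastforce)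
  \<comment> \<open>At a monomial free of other vertices, the coefficient of \<open>r\<close> is a
    functional of \<open>u\<close> that vanishes on \<open>PP\<close>; only monomials containing
    another vertex remain.\<close>
  have "r \<in> ideal_gen (2 * n) (pvar ` others n {a, s})"
  proof (rule pvars_ideal_memI[OF others_subset rR], rule ccontr)
    fix m assume m: "m \<in> mons r" and "\<not> mons m \<inter> others n {a, s} \<noteq> {}"
    then have m0: "coef m k = 0" if "k < n" "k \<notin> {a, s}" for k
      using that by (auto simp: others_def in_keys_iff)
    have "coef r m = lf (\<lambda>k. (\<lambda>d b. if \<not> b \<and> nx n d = m then 1 else 0) (dv n k) (par n k)) u"
      unfolding coef_eq_lf r_def lf_lmap by (rule lf_cong) simp
    also have "\<dots> = 0"
      using m0 by (intro PP_lf_0[OF as(1,2) uP]) (auto simp: coef_nx)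
    finally show False using m by (simp add: in_keys_iff)
  qed
  then have "r \<in> P0" unfolding PP_def a_def s_def using ideal_gen_mono subset_insertI by blast
  moreover have "lf (\<lambda>m. \<phi> (dv n m) (par n m)) (pvar 0 * u - (pvar 0 - pvar n) * r) = 0" for \<phi>
  proof -
    have "lf (\<lambda>m. \<phi> (dv n m) (par n m)) ((pvar 0 - pvar n) * r)
        = lf (\<lambda>m. (if par n m then 0 else 1) * (\<phi> (inc 0 (dv n m)) False - \<phi> (inc 0 (dv n m)) True)) u"
      using lf_diff_pvar_mult[OF as(3), of \<phi> r] unfolding r_def lf_lmap by simp
    then have "lf (\<lambda>m. \<phi> (dv n m) (par n m)) (pvar 0 * u - (pvar 0 - pvar n) * r)
        = lf (\<lambda>m. \<phi> (inc 0 (dv n m)) (par n m)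
            - (if par n m then 0 else 1) * (\<phi> (inc 0 (dv n m)) False - \<phi> (inc 0 (dv n m)) True)) u"
      using as(3) by (simp add: lf_diff lf_pvar_mult dv_vmon_x par_vmon_x lf_diff_fun)
    also have "\<dots> = lf (\<lambda>m. psg 1 (par n m) * \<phi> (inc 0 (dv n m)) True) u"
      by (rule lf_cong) (auto simp: psg_def)
    also have "\<dots> = 0" using u1[of "\<lambda>d. \<phi> (inc 0 d) True"] .
    finally show ?thesis .
  qed
  moreover have "pvar 0 * u - (pvar 0 - pvar n) * r \<in> polyring (2 * n)"
    using uR rR as by (intro polyring_diff polyring_mult) auto
  ultimately show ?thesis by (auto simp: tt0_def)
qed

text \<open>Multiplication by \<open>x\<^sub>0\<close> embeds \<open>W1 / W2\<close>, and multiplication by \<open>x\<^sub>0 - y\<^sub>0\<close> embeds \<open>QQ n (- 1) / tt n (- 1)\<close>,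
  into \<open>R / tt0 n\<close>, with the same image.\<close>

lemma W1_W2_link:
  "iplus (imul (pvar 0) W1) (tt0 n) = iplus (imul (pvar 0 - pvar n) (QQ n (- 1))) (tt0 n :: 'k::field mpoly set)"
proof
  let ?x = "pvar 0 :: 'k mpoly" and ?c = "pvar 0 - pvar n :: 'k mpoly"
  have \<sigma>: "(- 1 :: 'k mpoly) = 1 \<or> (- 1 :: 'k mpoly) = - 1" by simp
  have 0: "0 < n" using n3 by simp
  have xR: "?x \<in> polyring (2 * n)" and cR: "?c \<in> polyring (2 * n)" using 0 by (auto intro: polyring_diff)
  note rQ = gideal_rideal[OF gideal_QQ[OF n3 \<sigma>]] and r0 = rideal_tt0[of n, where 'k = 'k]
  have rW: "rideal (2 * n) (W1 :: 'k mpoly set)" by (rule gideal_rideal[OF gideal_W(1)])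
  let ?E = "iplus (imul ?x W1) (tt0 n)" and ?F = "iplus (imul ?c (QQ n (- 1))) (tt0 n)"
  have rE: "rideal (2 * n) ?E" and rF: "rideal (2 * n) ?F"
    using xR cR rQ rW r0 by (auto intro!: rideal_iplus rideal_imul)
  have E0: "tt0 n \<subseteq> ?E" and F0: "tt0 n \<subseteq> ?F" using xR cR rQ rW by (auto intro!: iplus_sup2 rideal_imul)
  have PQ: "P0 \<subseteq> QQ n (- 1 :: 'k mpoly)"
    unfolding PP_plus_tt[OF n3 \<sigma>] by (rule iplus_sup1[OF gideal_rideal[OF gideal_tt[OF \<sigma>]]])
  show "?E \<subseteq> ?F"
  proof (rule iplus_least[OF rF _ F0])
    show "imul ?x W1 \<subseteq> ?F"
    proof
      fix z assume "z \<in> imul ?x W1"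
      then obtain u where u: "u \<in> W1" "z = ?x * u" by (auto simp: imul_def)
      obtain r where r: "r \<in> P0" "?x * u - ?c * r \<in> tt0 n" using W1_decomp[OF u(1)] by blast
      have "?c * r \<in> ?F" using r(1) PQ mult_mem_iplus_imul[OF r0] by blast
      then have "?c * r + (?x * u - ?c * r) \<in> ?F" using r(2) F0 rideal_add[OF rF] by blast
      then show "z \<in> ?F" by (simp add: u)
    qed
  qed
  have mem: "?c * t \<in> tt0 n" if "t \<in> tt n (- 1)" for t
  proof -
    have "t \<in> polyring (2 * n)" using that rideal_polyring[OF gideal_rideal[OF gideal_tt[OF \<sigma>]]] by blast
    moreover have "(mterm 0 (- 1) :: 'k mpoly) = - 1" by (simp add: single_uminus)
    ultimately show ?thesis using tt0_diff_pvar_mult[OF 0, of t] that by simp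
  qed
  show "?F \<subseteq> ?E"
  proof (rule iplus_least[OF rE _ E0])
    \<comment> \<open>The binomials \<open>g_0v\<close> and \<open>q_0v\<close> lie in
      \<open>tt0\<close> and rewrite \<open>(x_0 - y_0) x_v\<close> and
      \<open>(x_0 - y_0) y_v\<close> as \<open>x_0 (x_v - y_v)\<close> up to sign, where
      \<open>x_v - y_v\<close> is in \<open>W1\<close>.\<close>
    have var: "?c * pvar v \<in> ?E" "?c * pvar (n + v) \<in> ?E" if v: "v < n" "v \<notin> {n - 2, n - 1}" for v
    proof -
      let ?d = "pvar v - pvar (n + v) :: 'k mpoly"
      have "?d \<in> tt n 1" using lin_in_tt[OF n3 _ v(1), of 1] by simp
      moreover have "pvar v \<in> P0" "pvar (n + v) \<in> P0" using v by (auto intro!: pvar_in_PP simp: others_iff)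
      then have "?d \<in> P0" by (rule rideal_diff[OF gideal_rideal[OF gideal_P0]])
      ultimately have d: "?x * ?d \<in> ?E" using mult_mem_iplus_imul[OF r0] by blast
      have "gg n 0 v \<in> ?E" "qq n 0 v \<in> ?E" using tt0_binomials[OF 0 v(1)] E0 by auto
      then have "?x * ?d + gg n 0 v \<in> ?E" "qq n 0 v - ?x * ?d \<in> ?E"
        using d rideal_add[OF rE] rideal_diff[OF rE] by auto
      moreover have "?c * pvar v = ?x * ?d + gg n 0 v" "?c * pvar (n + v) = qq n 0 v - ?x * ?d"
        by (simp_all add: gg_def qq_def algebra_simps)
      ultimately show "?c * pvar v \<in> ?E" "?c * pvar (n + v) \<in> ?E" by simp_all
    qed
    have lin: "?c * (pvar k - - 1 * pvar (n + k)) \<in> ?E" if "k < n" for k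
      using mem[OF lin_in_tt[OF n3 \<sigma> that]] E0 by blast
    show "imul ?c (QQ n (- 1)) \<subseteq> ?E"
    proof
      fix z assume "z \<in> imul ?c (QQ n (- 1))"
      then obtain r where r: "r \<in> QQ n (- 1)" "z = ?c * r" by (auto simp: imul_def)
      have "r \<in> {f \<in> polyring (2 * n). f * ?c \<in> ?E}"
        using r(1) unfolding QQ_def
      proof (rule ideal_gen_leastI[OF rideal_colon[OF rE cR]])
        fix g assume "g \<in> insert (pvar (n - 2) - - 1 * pvar (n + (n - 2)))
          (insert (pvar (n - 1) - - 1 * pvar (n + (n - 1))) (pvar ` others n {n - 2, n - 1}) :: 'k mpoly set)"
        moreover have n12: "n - 2 < n" "n - 1 < n" using n3 by auto
        ultimately consider k where "k < n" "g = pvar k - - 1 * pvar (n + k)" | t where "g = pvar t" "t \<in> others n {n - 2, n - 1}"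
          using n12 by blast
        then show "g \<in> {f \<in> polyring (2 * n). f * ?c \<in> ?E}"
        proof cases
          case 1
          then show ?thesis using lin[of k] by (auto simp: mult.commute[of _ ?c] intro!: polyring_add)
        next
          case 2
          then obtain k where k: "k < n" "k \<notin> {n - 2, n - 1}" "t = k \<or> t = n + k" by (auto simp: others_def)
          then have "?c * g \<in> ?E" using var[OF k(1,2)] 2(1) by blast
          then show ?thesis using 2(1) k by (auto simp: mult.commute[of _ ?c])
        qed
      qed
      then show "z \<in> ?E" by (simp add: r(2) mult.commute)
    qed
  qed
qed

lemma good_W1_W2: "good (2 * n) (ts n) (hL n n - hL n (2 * n - 2)) 1 W1 (W2 :: 'k::field mpoly set)"
proof -
  let ?x = "pvar 0 :: 'k mpoly" and ?c = "pvar 0 - pvar n :: 'k mpoly" and ?h = "hL n n - hL n (2 * n - 2)"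
  let ?A = "iplus (imul ?x W1) (tt0 n)"
  have \<sigma>: "(- 1 :: 'k mpoly) = 1 \<or> (- 1 :: 'k mpoly) = - 1" by simp
  have 0: "0 < n" using n3 by simp
  have xH: "?x \<in> homog (2 * n) (int 1)" and cH: "?c \<in> homog (2 * n) (int 1)"
    using 0 by (auto intro!: homog_diff homog_pvar)
  have gA: "gideal (2 * n) ?A" by (intro gideal_iplus gideal_imul[OF gideal_W(1) xH] gideal_tt0)
  have "good (2 * n) (ts n) ?h 1 (QQ n (- 1)) (tt n (- 1 :: 'k mpoly)) \<longleftrightarrow>
      good (2 * n) (ts n) (fps_X ^ 1 * ?h) (1 + int 1) ?A (tt0 n)"
  proof (rule good_iso[OF gideal_QQ[OF n3 \<sigma>] gideal_tt[OF \<sigma>] gA gideal_tt0 tt_subset_QQ[OF n3 \<sigma>] ts_polyring cH W1_W2_link])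
    fix r :: "'k mpoly" assume "r \<in> QQ n (- 1)"
    then have "r \<in> polyring (2 * n)" using rideal_polyring[OF gideal_rideal[OF gideal_QQ[OF n3 \<sigma>]]] by blast
    moreover have "(mterm 0 (- 1) :: 'k mpoly) = - 1" by (simp add: single_uminus)
    ultimately show "?c * r \<in> tt0 n \<longleftrightarrow> r \<in> tt n (- 1)" using tt0_diff_pvar_mult[OF 0, of r] by simp
  qed
  moreover have "good (2 * n) (ts n) ?h 1 W1 (W2 :: 'k mpoly set) \<longleftrightarrow>
      good (2 * n) (ts n) (fps_X ^ 1 * ?h) (1 + int 1) ?A (tt0 n)"
  proof (rule good_iso[OF gideal_W gA gideal_tt0 W2_W1 ts_polyring xH refl])
    fix u :: "'k mpoly" assume u: "u \<in> W1"
    then have "u \<in> polyring (2 * n)" using rideal_polyring[OF gideal_rideal[OF gideal_P0]] by blast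
    then show "?x * u \<in> tt0 n \<longleftrightarrow> u \<in> W2" using tt0_pvar_mult[OF 0, of u] u by auto
  qed
  ultimately show ?thesis using good_QQ_tt[OF n3 \<sigma>] by blast
qed

end

subsection \<open>The filtration\<close>

text \<open>Indices start at 0, so the last vertex is \<open>n - 1\<close>; its binomials with the
  vertices below \<open>n - 2\<close> enter in the vertex steps.\<close>

definition EE :: "nat \<Rightarrow> (nat \<times> nat) set" where
  "EE n = {(i, j). i < j \<and> j < n - 1}"

lemma finite_EE: "finite (EE n)"
  by (rule finite_subset[of _ "{..<n} \<times> {..<n}"]) (auto simp: EE_def)

lemma card_EE: "2 * card (EE n) = (n - 1) * (n - 2)"
proof -
  have "EE n = prod.swap ` (SIGMA j:{..<n - 1}. {..<j})" by (force simp: EE_def)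
  then have "card (EE n) = (\<Sum>j<n - 1. j)" by (simp add: card_image card_SigmaI)
  moreover have "2 * (\<Sum>j<m. j) = m * (m - 1)" for m :: nat
    by (induction m) (auto simp: algebra_simps split: nat_diff_split)
  ultimately show ?thesis using diff_diff_left[of n 1 1] by (metis one_add_one)
qed

definition JG :: "nat \<Rightarrow> (nat \<times> nat) set \<Rightarrow> nat set \<Rightarrow> 'k::comm_ring_1 mpoly set" where
  "JG n E V = parity_KN n \<union> (\<lambda>(i, j). gg n i j) ` E \<union> (\<lambda>v. gg n v (n - 1)) ` V \<union> hh n ` V"

lemma parity_KN_eq: "parity_KN n = {qq n i j | i j. i < j \<and> j < n}"
  by (simp add: parity_KN_def qq_def)

lemma JG_empty: "JG n {} {} = parity_KN n"
  by (simp add: JG_def)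

lemma JG_insert:
  "JG n (insert (i, j) E) V = insert (gg n i j) (JG n E V)"
  "JG n E (insert v V) = insert (hh n v) (insert (gg n v (n - 1)) (JG n E V))"
  by (auto simp: JG_def)

lemma JG_cases:
  assumes "g \<in> JG n E V"
  obtains i j where "i < j" "j < n" "g = qq n i j" | i j where "(i, j) \<in> E" "g = gg n i j"
    | v where "v \<in> V" "g = gg n v (n - 1)" | v where "v \<in> V" "g = hh n v"
  using assms by (auto simp: JG_def parity_KN_eq)

lemma adjoin_JG:
  assumes "n \<ge> 3" "E \<subseteq> EE n" "V \<subseteq> {..<n - 2}"
  shows "adjoin n (JG n E V :: 'k::field mpoly set)"
proof
  fix g :: "'k mpoly" assume "g \<in> JG n E V"
  then show "g \<in> homog (2 * n) 2"
  proof (cases rule: JG_cases)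
    case (1 i j)
    then show ?thesis using qq_homog[of i n j] by simp
  next
    case (2 i j)
    then have "i < n" "j < n" using assms by (auto simp: EE_def)
    then show ?thesis using 2 gg_homog[of i n j] by simp
  next
    case (3 v)
    then have "v < n" "n - 1 < n" using assms by auto
    then show ?thesis using 3 gg_homog[of v n "n - 1"] by simp
  next
    case (4 v)
    then have "v < n" using assms by auto
    then show ?thesis using 4 hh_homog[of v n] by simp
  qed
qed (use assms in \<open>auto simp: JG_def parity_KN_eq\<close>)

lemma binomials_in_PP':
  assumes "i < n" "j < n" "a < n" "b < n" "\<not> {i, j} \<subseteq> {a, b}"
  shows "qq n i j \<in> PP n a b" "gg n i j \<in> PP n a b"
proof -
  have "qq n i j \<in> PP n a b \<and> gg n i j \<in> PP n a b"
  proof (cases "i \<in> {a, b}")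
    case False
    then show ?thesis using assms binomials_in_PP[of i n j a b] by blast
  next
    case True
    then have "j \<notin> {a, b}" using assms by blast
    then have "qq n j i \<in> PP n a b" "gg n j i \<in> PP n a b" using assms binomials_in_PP[of j n i a b] by blast+
    then show ?thesis using rideal_uminus[OF rideal_PP[OF assms(3,4)]] gg_swap[of n i j] qq_commute[of n i j] by metis
  qed
  then show "qq n i j \<in> PP n a b" "gg n i j \<in> PP n a b" by auto
qed

lemma qq_in_PP': "i < j \<Longrightarrow> a < b \<Longrightarrow> j < n \<Longrightarrow> b < n \<Longrightarrow> qq n i j \<in> PP n a b"
proof (cases "i = a \<and> j = b")
  case False
  assume *: "i < j" "a < b" "j < n" "b < n"
  then have "\<not> {i, j} \<subseteq> {a, b}" using False by auto
  then show ?thesis using * by (intro binomials_in_PP'(1)) auto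
qed (use qq_in_PP in auto)

context
  fixes n :: nat
  assumes n3: "n \<ge> 3"
begin

abbreviation II :: "(nat \<times> nat) set \<Rightarrow> nat set \<Rightarrow> 'k::field mpoly set" where
  "II E V \<equiv> ideal_gen (2 * n) (JG n E V)"

lemma gideal_II: "E \<subseteq> EE n \<Longrightarrow> V \<subseteq> {..<n - 2} \<Longrightarrow> gideal (2 * n) (II E V :: 'k::field mpoly set)"
  using adjoin.gB[OF adjoin_JG[OF n3]] .

text \<open>The induction descends the chain below a fixed \<open>A\<close>: \<open>h\<close> is the
  series of \<open>A\<close> over the ideal reached so far, and each pair taken away adds one more
  quotient underneath.\<close>

lemma good_adjoin_pairs:
  fixes A :: "'k::field mpoly set"
  assumes "finite E" "E \<subseteq> EE n" "gideal (2 * n) A" "II E {} \<subseteq> A" "good (2 * n) (ts n) h 3 A (II E {})"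
  shows "good (2 * n) (ts n) (h + of_nat (card E) * (fps_X ^ 2 * hA n)) 3 A (II {} {})"
  using assms
proof (induction E arbitrary: h rule: finite_induct)
  case (insert e E)
  obtain i j where e: "e = (i, j)" "i < j" "j < n - 1" using insert.prems(1) by (auto simp: EE_def)
  have E: "E \<subseteq> EE n" using insert.prems(1) by blast
  interpret adjoin n "JG n E {} :: 'k mpoly set" by (rule adjoin_JG[OF n3 E]) simp
  have "JG n E {} \<subseteq> (PP n i j :: 'k mpoly set)"
  proof
    fix g :: "'k mpoly" assume "g \<in> JG n E {}"
    then show "g \<in> PP n i j"
    proof (cases rule: JG_cases)
      case (1 i' j')
      then show ?thesis using e by (auto intro: qq_in_PP')
    next
      case (2 i' j')
      then have "i' < j'" "j' < n - 1" "(i', j') \<noteq> (i, j)" using E insert.hyps e(1) by (auto simp: EE_def)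
      then show ?thesis unfolding 2(2) using e by (intro binomials_in_PP'(2)) auto
    qed auto
  qed
  then have "good (2 * n) (ts n) (fps_X ^ 2 * hA n) 3 (II (insert e E) {}) (II E {} :: 'k mpoly set)"
    unfolding e(1) JG_insert using e by (intro good_add_gg) auto
  moreover have sub: "II E {} \<subseteq> (II (insert e E) {} :: 'k mpoly set)" by (rule ideal_gen_mono) (auto simp: JG_def)
  ultimately have "good (2 * n) (ts n) (h + fps_X ^ 2 * hA n) 3 A (II E {})"
    using insert.prems E by (intro good_ext[OF insert.prems(2) gideal_II gideal_II sub insert.prems(3) ts_polyring insert.prems(4)]) auto
  then have "good (2 * n) (ts n) (h + fps_X ^ 2 * hA n + of_nat (card E) * (fps_X ^ 2 * hA n)) 3 A (II {} {})"
    using insert.IH[OF E insert.prems(2)] sub insert.prems(3) by blast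
  then show ?case using insert.hyps by (simp add: algebra_simps)
qed simp

text \<open>All pairs of \<open>EE n\<close> stay present here, which supplies the
  \<open>gg n v k\<close> that each vertex step requires.\<close>

lemma good_adjoin_vertices:
  fixes A :: "'k::field mpoly set"
  assumes "finite V" "V \<subseteq> {..<n - 2}" "gideal (2 * n) A" "II (EE n) V \<subseteq> A" "good (2 * n) (ts n) h 3 A (II (EE n) V)"
  shows "good (2 * n) (ts n) (h + of_nat (card V) * (fps_X * (hA n - hL n (2 * n - 2)))) 3 A (II (EE n) {})"
  using assms
proof (induction V arbitrary: h rule: finite_induct)
  case (insert v V)
  let ?d = "fps_X * (hA n - hL n (2 * n - 2))"
  have v: "v < n - 2" and V: "V \<subseteq> {..<n - 2}" using insert.prems(1) by auto
  interpret adjoin n "JG n (EE n) V :: 'k mpoly set" by (rule adjoin_JG[OF n3 order.refl V])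
  have "JG n (EE n) V \<subseteq> (PP n v (n - 1) :: 'k mpoly set)"
  proof
    fix g :: "'k mpoly" assume "g \<in> JG n (EE n) V"
    then show "g \<in> PP n v (n - 1)"
    proof (cases rule: JG_cases)
      case (1 i' j')
      then show ?thesis using v by (auto intro!: qq_in_PP')
    next
      case (2 i' j')
      then have "i' < j'" "j' < n - 1" by (auto simp: EE_def)
      then show ?thesis unfolding 2(2) using v by (intro binomials_in_PP'(2)) auto
    next
      case (3 v')
      then have "v' < n - 2" "v' \<noteq> v" using V insert.hyps by auto
      then show ?thesis unfolding 3(2) using v by (intro binomials_in_PP'(2)) auto
    next
      case (4 v')
      then have "v' < n - 2" "v' \<noteq> v" using V insert.hyps by auto
      then show ?thesis unfolding 4(2) using v by (intro binomials_in_PP(3)[of v' n v']) auto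
    qed
  qed
  moreover have "gg n v k \<in> (II (EE n) V :: 'k mpoly set)" if k: "k < n - 1" "k \<noteq> v" for k
  proof (cases "v < k")
    case True
    then show ?thesis using k by (intro ideal_gen_superset) (auto simp: JG_def EE_def)
  next
    case False
    then have "gg n k v \<in> (II (EE n) V :: 'k mpoly set)"
      using k v by (intro ideal_gen_superset) (auto simp: JG_def EE_def)
    then show ?thesis using rideal_uminus[OF rB] gg_swap[of n v k, where 'a = 'k] by metis
  qed
  ultimately have "good (2 * n) (ts n) ?d 3 (II (EE n) (insert v V)) (II (EE n) V :: 'k mpoly set)"
    unfolding JG_insert by (rule good_add_gh[OF v])
  moreover have sub: "II (EE n) V \<subseteq> (II (EE n) (insert v V) :: 'k mpoly set)" by (rule ideal_gen_mono) (auto simp: JG_def)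
  ultimately have "good (2 * n) (ts n) (h + ?d) 3 A (II (EE n) V)"
    using insert.prems V by (intro good_ext[OF insert.prems(2) gideal_II gideal_II sub insert.prems(3) ts_polyring insert.prems(4)]) auto
  then have "good (2 * n) (ts n) (h + ?d + of_nat (card V) * ?d) 3 A (II (EE n) {})"
    using insert.IH[OF V insert.prems(2)] sub insert.prems(3) by blast
  then show ?case using insert.hyps by (simp add: algebra_simps)
qed simp

lemma II_subset_W2: "II (EE n) {..<n - 2} \<subseteq> (W2 n :: 'k::field mpoly set)"
proof (rule ideal_gen_least[OF gideal_rideal[OF gideal_W(2)[OF n3]]], rule subsetI)
  fix g :: "'k mpoly" assume "g \<in> JG n (EE n) {..<n - 2}"
  then show "g \<in> W2 n"
  proof (cases rule: JG_cases)
    case (1 i j)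
    then show ?thesis using n3 tt0_binomials(1)[of i n j] by (auto intro!: qq_in_PP')
  next
    case (2 i j)
    then have "i < j" "j < n - 1" "i < n" "j < n" by (auto simp: EE_def)
    then show ?thesis unfolding 2(2) using tt0_binomials(2)[of i n j] by (auto intro!: binomials_in_PP(2))
  next
    case (3 v)
    then have "v < n - 2" "v < n" by auto
    then show ?thesis unfolding 3(2) using tt0_binomials(2)[of v n "n - 1"] by (auto intro!: binomials_in_PP(2))
  next
    case (4 v)
    then have "v < n - 2" "v < n" by auto
    then show ?thesis unfolding 4(2) using tt0_binomials(3)[of v n] by (auto intro!: binomials_in_PP(3)[of v n v])
  qed
qed

text \<open>Up to a multiple of \<open>qq n (n - 2) (n - 1)\<close>, an element of \<open>PP\<close>
  consists of monomials that involve a vertex below \<open>n - 2\<close>. Modulo the generated ideal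
  such monomials depend only on multidegree and parity, and membership in \<open>tt0\<close> says
  that the coefficients in each class sum to 0.\<close>

lemma W2_subset_II: "(W2 n :: 'k::field mpoly set) \<subseteq> II (EE n) {..<n - 2}"
proof
  define a s where "a = n - 2" and "s = n - 1"
  have as: "a < n" "s < n" "a \<noteq> s" using n3 by (auto simp: a_def s_def)
  interpret adjoin n "JG n (EE n) {..<n - 2} :: 'k mpoly set" by (rule adjoin_JG[OF n3]) auto
  have hhB: "hh n k \<in> B" if "k < n - 2" for k using that by (intro ideal_gen_superset) (auto simp: JG_def)
  have ggB: "gg n k i \<in> B" if "k < n - 2" "i < n" "i \<noteq> k" for k i
  proof -
    consider "i = n - 1" | "k < i" "i < n - 1" | "i < k" using \<open>i < n\<close> \<open>i \<noteq> k\<close> by linarith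
    then show ?thesis
    proof cases
      case 1
      then show ?thesis using that by (intro ideal_gen_superset) (auto simp: JG_def)
    next
      case 2
      then show ?thesis by (intro ideal_gen_superset) (auto simp: JG_def EE_def)
    next
      case 3
      then have "gg n i k \<in> B" using that by (intro ideal_gen_superset) (auto simp: JG_def EE_def)
      then show ?thesis using rideal_uminus[OF rB] gg_swap[of n k i, where 'a = 'k] by metis
    qed
  qed
  define zz where "zz k b = (if b then n + k else k)" for k b
  \<comment> \<open>A y at vertex \<open>i\<close> is traded for an x by switching the letter at
    vertex \<open>k\<close>; the cases are \<open>qq\<close>, \<open>gg\<close> and, for
    \<open>i = k\<close>, \<open>hh\<close>.\<close>
  have swap: "pvar (n + i) * pvar (zz k b) - pvar i * pvar (zz k (\<not> b)) \<in> B" if k: "k < n - 2" and i: "i < n" for i k b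
  proof (cases "i = k")
    case True
    then show ?thesis using rideal_uminus[OF rB hhB[OF k]] rideal_0[OF rB]
      by (cases b) (auto simp: zz_def hh_def mult.commute)
  next
    case False
    have "- qq n i k \<in> B" using rideal_uminus[OF rB qqB] k i False by auto
    then show ?thesis using ggB[OF k i False]
      by (cases b) (auto simp: zz_def gg_def qq_def mult.commute)
  qed
  \<comment> \<open>All letters y are pushed onto the chosen variable of vertex \<open>k\<close>,
    where only their parity remains.\<close>
  have norm: "mterm (vmon (zz k b) + m) 1 - mterm (vmon (zz k (b \<noteq> par n m)) + nx n (dv n m)) 1 \<in> B"
    if k: "k < n - 2" and m: "mons m \<subseteq> {..<2 * n}" for k b m
    using m
  proof (induction m rule: monomial_induct_vmon)
    case zero
    then show ?case by (simp add: rideal_0[OF rB])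
  next
    case (x i m)
    have "pvar i * (mterm (vmon (zz k b) + m) 1 - mterm (vmon (zz k (b \<noteq> par n m)) + nx n (dv n m)) 1) \<in> B"
      by (rule rideal_mult[OF rB _ x(3)]) (use x in simp)
    then show ?case using x by (simp add: right_diff_distrib dv_vmon_x par_vmon_x nx_inc mterm_vmon mult.left_commute)
  next
    case (y i m)
    let ?c = "b \<noteq> par n m" and ?N = "mterm (nx n (dv n m)) 1 :: 'k mpoly" and ?M = "mterm m 1 :: 'k mpoly"
    have NR: "?N \<in> R" by (intro polyring_term) (use mons_nx[of n "dv n m"] in auto)
    have 1: "pvar (n + i) * (pvar (zz k b) * ?M - pvar (zz k ?c) * ?N) \<in> B"
      using rideal_mult[OF rB _ y(3), of "pvar (n + i)"] y(1) by (simp add: mterm_vmon)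
    have 2: "(pvar (n + i) * pvar (zz k ?c) - pvar i * pvar (zz k (\<not> ?c))) * ?N \<in> B"
      by (rule rideal_mult_right[OF rB NR swap[OF k y(1)]])
    have "pvar (zz k b) * (pvar (n + i) * ?M) - pvar (zz k (\<not> ?c)) * (pvar i * ?N)
      = pvar (n + i) * (pvar (zz k b) * ?M - pvar (zz k ?c) * ?N) + (pvar (n + i) * pvar (zz k ?c) - pvar i * pvar (zz k (\<not> ?c))) * ?N"
      by (simp add: algebra_simps)
    also have "\<dots> \<in> B" by (rule rideal_add[OF rB 1 2])
    finally have "pvar (zz k b) * (pvar (n + i) * ?M) - pvar (zz k (\<not> ?c)) * (pvar i * ?N) \<in> B" .
    moreover have "mterm (vmon (zz k b) + (vmon (n + i) + m)) 1 = pvar (zz k b) * (pvar (n + i) * ?M)"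
      by (simp only: mterm_vmon)
    moreover have "mterm (vmon (zz k (\<not> ?c)) + nx n (dv n (vmon (n + i) + m))) 1 = pvar (zz k (\<not> ?c)) * (pvar i * ?N)"
      by (simp only: mterm_vmon dv_vmon_y[OF y(1)] nx_inc[OF y(1)])
    moreover have "(b \<noteq> par n (vmon (n + i) + m)) = (\<not> ?c)" by (auto simp: par_vmon_y[OF y(1)])
    ultimately show ?case by (simp only:)
  qed
  \<comment> \<open>The normal form uses the least vertex that occurs, a choice depending on the
    multidegree alone; for the monomials of \<open>p1\<close> it lies below
    \<open>n - 2\<close>.\<close>
  define \<rho> where "\<rho> d b = (let k = LEAST k. 0 < d k in vmon (zz k b) + nx n (d(k := d k - 1)))" for d :: "nat \<Rightarrow> nat" and b
  fix p :: "'k mpoly" assume p: "p \<in> W2 n"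
  have "p \<in> ideal_gen (2 * n) (insert (qq n a s) (pvar ` others n {a, s}))" using p by (simp add: PP_def a_def s_def)
  then obtain r p1 where r: "r \<in> R" "p1 \<in> ideal_gen (2 * n) (pvar ` others n {a, s})" "p = qq n a s * r + p1"
    using ideal_gen_insert_memE[OF _ others_polyring qq_polyring[OF as(1,2)]] by metis
  have qr: "qq n a s * r \<in> B" by (rule rideal_mult_right[OF rB r(1) qqB[OF as]])
  then have "p - qq n a s * r \<in> tt0 n" using II_subset_W2 p by (intro rideal_diff[OF rideal_tt0]) auto
  then have p0: "p1 \<in> tt0 n" by (simp add: r(3))
  then have p1R: "p1 \<in> R" by (simp add: tt0_def)
  have "p1 - lmap (\<lambda>m. \<rho> (dv n m) (par n m)) (\<lambda>_. 1) p1 \<in> B"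
  proof (rule lmap_cong_mod[OF rB])
    fix m assume m: "m \<in> mons p1"
    have mR: "mons m \<subseteq> {..<2 * n}" by (rule polyring_termD[OF p1R m])
    define k where "k = (LEAST k. 0 < dv n m k)"
    obtain t where t: "t \<in> mons m" "t \<in> others n {a, s}" using pvars_ideal_mons[OF others_subset r(2) m] by blast
    then obtain k0 where k0: "k0 < n" "k0 \<notin> {a, s}" "t = k0 \<or> t = n + k0" by (auto simp: others_def)
    then have "0 < dv n m k0" using t(1) by (auto simp: dv_def in_keys_iff)
    then have "0 < dv n m k" "k \<le> k0" unfolding k_def by (rule LeastI, rule Least_le)
    moreover have "k0 < n - 2" using k0 by (auto simp: a_def s_def)
    ultimately have k: "k < n - 2" "k < n" "coef m k + coef m (n + k) > 0" by (auto simp: dv_def split: if_splits)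
    then have "coef m (zz k False) \<noteq> 0 \<or> coef m (zz k True) \<noteq> 0" by (auto simp: zz_def)
    then obtain c where "zz k c \<in> mons m" by (auto simp: in_keys_iff)
    then obtain m' where m': "m = vmon (zz k c) + m'" using monomial_splitE unfolding vmon_def by metis
    have "dv n m = inc k (dv n m')" "par n m = (c \<noteq> par n m')"
      using k by (cases c; simp add: m' zz_def dv_vmon_x dv_vmon_y par_vmon_x par_vmon_y)+
    then have "\<rho> (dv n m) (par n m) = vmon (zz k (c \<noteq> par n m')) + nx n (dv n m')"
      unfolding \<rho>_def k_def[symmetric] Let_def by simp
    moreover have "mons m' \<subseteq> {..<2 * n}" using mR by (simp add: m' mons_add_nat)
    ultimately show "mterm m 1 - mterm (\<rho> (dv n m) (par n m)) 1 \<in> B" using norm[OF k(1), of m' c] by (simp add: m')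
  qed
  moreover have "lmap (\<lambda>m. \<rho> (dv n m) (par n m)) (\<lambda>_. 1) p1 = 0"
  proof (rule poly_mapping_eqI)
    fix m0
    show "coef (lmap (\<lambda>m. \<rho> (dv n m) (par n m)) (\<lambda>_. 1) p1) m0 = coef 0 m0"
      using tt0D[OF p0, of "\<lambda>d b. if \<rho> d b = m0 then 1 else 0"] by (simp add: coef_eq_lf[of "lmap _ _ _"] lf_lmap)
  qed
  ultimately have "p1 \<in> B" by simp
  then show "p \<in> B" unfolding r(3) by (rule rideal_add[OF rB qr])
qed

text \<open>The summands follow the chain from the top: the quotient \<open>R / P\<close>, the two
  linear components, the \<open>n - 2\<close> vertex steps, and the pair steps.\<close>

theorem good_parity_KN:
  "good (2 * n) (ts n) (hA n + (hL n n - hL n (2 * n - 2)) + (hL n n - hL n (2 * n - 2))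
     + of_nat (n - 2) * (fps_X * (hA n - hL n (2 * n - 2))) + of_nat (card (EE n)) * (fps_X ^ 2 * hA n)) 3
    (polyring (2 * n)) (ideal_gen (2 * n) (parity_KN n) :: 'k::field mpoly set)"
proof -
  let ?R = "polyring (2 * n) :: 'k mpoly set"
  have PR: "P0 n \<subseteq> ?R" using rideal_polyring[OF gideal_rideal[OF gideal_P0[OF n3]]] by blast
  have "good (2 * n) (ts n) (hA n) 1 ?R (P0 n)" using n3 by (intro good_PP) auto
  then have "good (2 * n) (ts n) (hA n + (hL n n - hL n (2 * n - 2))) 1 ?R (W1 n)"
    by (rule good_ext[OF gideal_ring gideal_P0[OF n3] gideal_W(1)[OF n3] Int_lower1 PR ts_polyring _ good_P0_W1[OF n3]])
  then have "good (2 * n) (ts n) (hA n + (hL n n - hL n (2 * n - 2)) + (hL n n - hL n (2 * n - 2))) 1 ?R (W2 n)"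
    using PR by (intro good_ext[OF gideal_ring gideal_W[OF n3] W2_W1[OF n3] _ ts_polyring _ good_W1_W2[OF n3]]) auto
  moreover have W: "W2 n = (II (EE n) {..<n - 2} :: 'k mpoly set)" using II_subset_W2 W2_subset_II by blast
  ultimately have 1: "good (2 * n) (ts n) (hA n + (hL n n - hL n (2 * n - 2)) + (hL n n - hL n (2 * n - 2))) 3 ?R (II (EE n) {..<n - 2})"
    by (auto intro: good_mono)
  have "II (EE n) {..<n - 2} \<subseteq> ?R" "II (EE n) {} \<subseteq> ?R"
    using rideal_polyring[OF gideal_rideal[OF gideal_II]] by blast+
  then show ?thesis
    using good_adjoin_pairs[OF finite_EE order.refl gideal_ring _ good_adjoin_vertices[OF _ order.refl gideal_ring _ 1]]
    by (simp add: JG_empty)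
qed

end

subsection \<open>Hilbert series, depth and regularity\<close>

lemma iplus_commute: "iplus A B = iplus B A"
  by (auto simp: iplus_def) (metis add.commute)+

lemma rreg_nth:
  assumes "G \<subseteq> polyring N" "set fs \<subseteq> polyring N" "rreg fs (polyring N) (ideal_gen N G)" "i < length fs"
    "g \<in> polyring N" "fs ! i * g \<in> ideal_gen N (G \<union> set (take i fs))"
  shows "g \<in> ideal_gen N (G \<union> set (take i fs))"
  using assms
proof (induction fs arbitrary: G i)
  case (Cons t fs)
  show ?case
  proof (cases i)
    case 0
    then show ?thesis using Cons.prems by simp
  next
    case (Suc k)
    have "ideal_gen N (insert t G) = iplus (ideal_gen N G) (imul t (polyring N))"
      using Cons.prems by (subst iplus_commute) (intro ideal_gen_insert, auto)
    then have r: "rreg fs (polyring N) (ideal_gen N (insert t G))" using Cons.prems(3) by simp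
    have *: "G \<union> set (take i (t # fs)) = insert t G \<union> set (take k fs)" using Suc by auto
    have "insert t G \<subseteq> polyring N" "set fs \<subseteq> polyring N" "k < length fs" "fs ! k * g \<in> ideal_gen N (insert t G \<union> set (take k fs))"
      using Cons.prems Suc unfolding * by auto
    from Cons.IH[OF this(1,2) r this(3) Cons.prems(5) this(4)] show ?thesis unfolding * .
  qed
qed simp

lemma regular_seqI:
  assumes "G \<subseteq> maxideal N" "set fs \<subseteq> maxideal N" "rreg fs (polyring N) (ideal_gen N G)"
  shows "regular_seq N G fs"
proof -
  have R: "maxideal N \<subseteq> (polyring N :: 'a mpoly set)" by (auto simp: maxideal_def)
  have "ideal_gen N (G \<union> set fs) \<subseteq> maxideal N" using assms by (intro ideal_gen_least[OF rideal_maxideal]) auto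
  moreover have "1 \<notin> (maxideal N :: 'a mpoly set)" by (simp add: maxideal_def)
  ultimately have "1 \<notin> ideal_gen N (G \<union> set fs)" by blast
  moreover have "fs ! i \<in> maxideal N" if "i < length fs" for i using assms(2) that by auto
  ultimately show ?thesis
    unfolding regular_seq_def using rreg_nth[OF _ _ assms(3)] assms(1,2) R by blast
qed

lemma ts_maxideal:
  assumes n: "n \<ge> 1"
  shows "set (ts n) \<subseteq> (maxideal (2 * n) :: 'k::comm_ring_1 mpoly set)"
proof -
  let ?M = "maxideal (2 * n) :: 'k mpoly set"
  have I: "rideal (2 * n) ?M" by (rule rideal_maxideal)
  have v: "pvar i \<in> ?M" if "i < 2 * n" for i
    using that by (intro homog_pos_maxideal[of _ _ 1] homog_pvar) auto
  have "t1 n \<in> ?M" unfolding t1_def by (intro rideal_sum[OF I] v) auto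
  moreover have "t2 n \<in> ?M" unfolding t2_def using n
    by (intro rideal_add[OF I] rideal_mult_right[OF I] rideal_sum[OF I] v polyring_sum polyring_pvar) auto
  moreover have "t3 n \<in> ?M" unfolding t3_def e2_def
    by (intro rideal_mult_right[OF I] rideal_sum[OF I] v polyring_pvar) auto
  ultimately show ?thesis by simp
qed

lemma vdim_mono:
  fixes A B :: "'k::field mpoly set"
  assumes "A \<subseteq> B" "B \<subseteq> homog N (int d)"
  shows "vdim A \<le> vdim B"
proof -
  obtain T where T: "finite T" "homog N (int d) \<subseteq> pv.span (T :: 'k mpoly set)" by (rule homog_span)
  obtain C where C: "C \<subseteq> A" "pv.independent C" "A \<subseteq> pv.span C" "card C = pv.dim A" by (rule pv.basis_exists)
  obtain D where D: "D \<subseteq> B" "pv.independent D" "B \<subseteq> pv.span D" "card D = pv.dim B" by (rule pv.basis_exists)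
  have "finite D" using pv.independent_span_bound[OF T(1) D(2)] D(1) assms T(2) by blast
  then have "card C \<le> card D" using pv.independent_span_bound[OF _ C(2), of D] C(1) assms(1) D(3) by blast
  then show ?thesis by (simp add: vdim_def C(4) D(4))
qed

text \<open>\<open>hilbert_fun\<close> subtracts natural numbers; the degree part of the ideal never
  exceeds that of the ring in dimension, so the truncation has no effect.\<close>

lemma hilbert_series_eq_hilb:
  fixes G :: "'k::field mpoly set"
  shows "hilbert_series N G = hilb N (polyring N) (ideal_gen N G)"
proof (rule fps_ext)
  fix d
  have "polyring N \<inter> homog N (int d) = (homog N (int d) :: 'k mpoly set)" by (auto simp: homog_def)
  moreover have "vdim (ideal_gen N G \<inter> homog N (int d)) \<le> vdim (homog N (int d) :: 'k mpoly set)"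
    by (rule vdim_mono) auto
  ultimately show "fps_nth (hilbert_series N G) d = fps_nth (hilb N (polyring N) (ideal_gen N G)) d"
    by (simp add: hilbert_series_def hilb_def hilbert_fun_def of_nat_diff)
qed

lemma hilbert_numerator:
  assumes n: "n \<ge> 3"
  shows "hA n + (hL n n - hL n (2 * n - 2)) + (hL n n - hL n (2 * n - 2))
      + of_nat (n - 2) * (fps_X * (hA n - hL n (2 * n - 2))) + of_nat (card (EE n)) * (fps_X ^ 2 * hA n)
    = (2 * (1 - fps_X) ^ n
              + (- 1 + 3 * fps_X
                 + fps_const ((of_nat n ^ 2 + of_nat n - 6) / 2) * fps_X ^ 2
                 + fps_const ((of_nat n ^ 2 - 3 * of_nat n + 2) / 2) * fps_X ^ 3)
                * (1 - fps_X) ^ (2 * n - 3))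
             / (1 - fps_X) ^ (2 * n)"
    (is "?L = (2 * ?U + ?p * _) / ?D")
proof -
  let ?X = "fps_X :: rat fps"
  define e where "e = (1 - ?X) ^ (2 * n - 4)"
  \<comment> \<open>\<open>c\<close> counts the pairs and equals \<open>n - 1\<close> choose 2,
    while \<open>k\<close> counts the vertex steps; the coefficients in the claim turn out to be
    \<open>c + 2 * k\<close> and \<open>c\<close>.\<close>
  define k c where "k = (of_nat (n - 2) :: rat fps)" and "c = (of_nat (card (EE n)) :: rat fps)"
  have "of_nat (2 * card (EE n)) = (of_nat ((n - 1) * (n - 2)) :: rat)" by (simp only: card_EE)
  then have card: "2 * of_nat (card (EE n)) = ((of_nat n - 1) * (of_nat n - 2) :: rat)"
    using n by (simp add: of_nat_diff)
  have "(of_nat n ^ 2 - 3 * of_nat n + 2) / 2 = (of_nat (card (EE n)) :: rat)"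
    using card by (simp add: power2_eq_square algebra_simps)
  then have c: "fps_const ((of_nat n ^ 2 - 3 * of_nat n + 2) / 2) = c" by (simp add: c_def fps_of_nat)
  have "(of_nat n ^ 2 + of_nat n - 6) / 2 = (of_nat (card (EE n) + 2 * (n - 2)) :: rat)"
    using card n by (simp add: of_nat_diff power2_eq_square field_simps)
  then have "fps_const ((of_nat n ^ 2 + of_nat n - 6) / 2 :: rat) = of_nat (card (EE n) + 2 * (n - 2))" by (simp only: fps_of_nat)
  then have k: "fps_const ((of_nat n ^ 2 + of_nat n - 6) / 2) = c + 2 * k" by (simp add: c_def k_def)
  have "2 * n - 3 = Suc (2 * n - 4)" "2 * n - 2 = Suc (Suc (2 * n - 4))" using n by auto
  then have e: "(1 - ?X) ^ (2 * n - 3) = (1 - ?X) * e" "(1 - ?X) ^ (2 * n - 2) = (1 - ?X) * (1 - ?X) * e"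
    by (simp_all add: e_def mult.assoc)
  have "?L = (2 * ?U + ((1 - ?X ^ 2) - 2 * ((1 - ?X) * (1 - ?X)) + k * (?X * ((1 - ?X ^ 2) - (1 - ?X) * (1 - ?X)))
      + c * (?X ^ 2 * (1 - ?X ^ 2))) * e) * inverse ?D"
    unfolding hA_def hL_def e_def[symmetric] e k_def[symmetric] c_def[symmetric] by (simp add: algebra_simps)
  \<comment> \<open>Every contribution contains a factor \<open>1 - t\<close>, which raises the
    common exponent from \<open>2 * n - 4\<close> to \<open>2 * n - 3\<close>.\<close>
  also have "(1 - ?X ^ 2) - 2 * ((1 - ?X) * (1 - ?X)) + k * (?X * ((1 - ?X ^ 2) - (1 - ?X) * (1 - ?X))) + c * (?X ^ 2 * (1 - ?X ^ 2))
      = (- 1 + 3 * ?X + (c + 2 * k) * ?X ^ 2 + c * ?X ^ 3) * (1 - ?X)"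
    by (simp add: algebra_simps power2_eq_square power3_eq_cube)
  also have "(2 * ?U + (- 1 + 3 * ?X + (c + 2 * k) * ?X ^ 2 + c * ?X ^ 3) * (1 - ?X) * e) * inverse ?D
      = (2 * ?U + ?p * (1 - ?X) ^ (2 * n - 3)) / ?D"
    unfolding c k e by (subst fps_divide_unit) (simp_all add: mult.assoc)
  finally show ?thesis .
qed

theorem theorem3p6:
  fixes n :: nat
  assumes "n \<ge> 3"
  shows "hilbert_series (2 * n) (parity_KN n :: 'k::field mpoly set)
           = (2 * (1 - fps_X) ^ n
              + (- 1 + 3 * fps_X
                 + fps_const ((of_nat n ^ 2 + of_nat n - 6) / 2) * fps_X ^ 2
                 + fps_const ((of_nat n ^ 2 - 3 * of_nat n + 2) / 2) * fps_X ^ 3)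
                * (1 - fps_X) ^ (2 * n - 3))
             / (1 - fps_X) ^ (2 * n)
       \<and> depth (2 * n) (parity_KN n :: 'k mpoly set) \<ge> 3
       \<and> cm_reg (2 * n) (parity_KN n :: 'k mpoly set) \<le> 3"
proof (intro conjI)
  let ?G = "parity_KN n :: 'k mpoly set"
  let ?I = "ideal_gen (2 * n) ?G"
  have good: "hilb (2 * n) (polyring (2 * n)) ?I = hA n + (hL n n - hL n (2 * n - 2)) + (hL n n - hL n (2 * n - 2))
      + of_nat (n - 2) * (fps_X * (hA n - hL n (2 * n - 2))) + of_nat (card (EE n)) * (fps_X ^ 2 * hA n)"
    "pkreg (2 * n) 3 (polyring (2 * n)) ?I" "rreg (ts n) (polyring (2 * n)) ?I"
    using good_parity_KN[OF assms, where 'k = 'k] unfolding good_def by blast+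
  have gI: "gideal (2 * n) ?I" using gideal_II[OF assms, of "{}" "{}", where 'k = 'k] by (simp add: JG_empty)
  have "g \<in> maxideal (2 * n)" if "g \<in> ?G" for g
    using adjoin.J_homog[OF adjoin_JG[OF assms], of "{}" "{}" g] that
    by (auto simp: JG_empty intro: homog_pos_maxideal)
  then have G: "?G \<subseteq> maxideal (2 * n)" by blast
  show "hilbert_series (2 * n) ?G = (2 * (1 - fps_X) ^ n
              + (- 1 + 3 * fps_X
                 + fps_const ((of_nat n ^ 2 + of_nat n - 6) / 2) * fps_X ^ 2
                 + fps_const ((of_nat n ^ 2 - 3 * of_nat n + 2) / 2) * fps_X ^ 3)
                * (1 - fps_X) ^ (2 * n - 3))
             / (1 - fps_X) ^ (2 * n)"
    unfolding hilbert_series_eq_hilb good(1) by (rule hilbert_numerator[OF assms])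
  have "regular_seq (2 * n) ?G (ts n)"
    using assms by (intro regular_seqI[OF G ts_maxideal good(3)]) simp
  then have "enat (length (ts n :: 'k mpoly list)) \<le> depth (2 * n) ?G" unfolding depth_def by (intro Sup_upper) blast
  then show "depth (2 * n) ?G \<ge> 3" by (simp add: numeral_eq_enat numeral_3_eq_3)
  have "cm_reg (2 * n) ?G \<le> ereal (of_int 3)"
    by (rule cm_reg_le[OF gI good(2) ideal_gen_least[OF rideal_maxideal G]])
  then show "cm_reg (2 * n) ?G \<le> 3" by simp
qed

end
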